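(* Let $X$ be an irreducible smooth projective variety of dimension $n$ over $\mathbb{C}$ with canonical divisor $K_X$, and let $D$ be an ample divisor on $X$. There exists an integer $m(D)$, depending only on $D$, such that $m(D)\cdot D-K_X$ is ample and the following holds for every $k\in\mathbb{N}$. If for some positive integer $m$ there exists a real number $\varepsilon>0$ such that $$\Delta^{-1}_{n+k+\varepsilon}\subseteq\Delta_{\tilde{Y}_\bullet,j}(m\pi^*(D))$$ for all distinct points $p_1,\ldots,p_{k+1}\in X$, all $j=1,\ldots,k+1$, and every tuple of infinitesimal flags $\tilde{Y}_\bullet=(\tilde{Y}^{(1)}_\bullet,\ldots,\tilde{Y}^{(k+1)}_\bullet)$ with $\tilde{Y}^{(i)}_\bullet$ over $p_i$, where $\pi$ denotes the blow-up of $X$ along $\{p_1,\ldots,p_{k+1}\}$, then $(m+m(D))\cdot D$ is $k$-jet ample.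
   Context: $\mathbb{N}$ includes $0$. Inverted standard simplex: for a real number $\xi\ge 0$, $\Delta^{-1}_\xi\subseteq\mathbb{R}^n$ is the convex hull of $\{0,\ \xi e_1,\ \xi(e_1+e_2),\ \ldots,\ \xi(e_1+\cdots+e_n)\}$, where $e_1,\dots,e_n$ is the standard basis. Infinitesimal flags: let $Z=\{p_1,\dots,p_N\}$ be a set of distinct points of $X$ and let $E_j=\mathbb{P}(T_{p_j}X)$ (one-dimensional subspaces) be the exceptional divisor of $\pi:\overline X=\mathrm{Bl}_Z(X)\to X$ over $p_j$. A complete flag of linear subspaces $T_{p_j}X=V^{(j)}_0\supseteq V^{(j)}_1\supseteq\cdots\supseteq V^{(j)}_{n-1}\supseteq\{0\}$ with $\dim V^{(j)}_i=n-i$ gives the flag $\tilde Y^{(j)}_\bullet:\ \overline X=\tilde Y^{(j)}_0\supseteq\tilde Y^{(j)}_1\supseteq\cdots\supseteq\tilde Y^{(j)}_n$ with $\tilde Y^{(j)}_{i+1}=\mathbb{P}(V^{(j)}_i)$; in particular $\tilde Y^{(j)}_1=E_j$ and $\tilde Y^{(j)}_n$ is a point. Such flags are the infinitesimal flags over $p_j$. Flag valuation: given a flag $Y_0\supseteq Y_1\supseteq\cdots\supseteq Y_n=\{pt\}$ of irreducible subvarieties of $Y_0$ with $\operatorname{codim} Y_i=i$ and each $Y_i$ smooth at the point $Y_n$, and a nonzero section $s$ of a line bundle on $Y_0$, set $\nu_{Y_\bullet}(s)=(\nu_1(s),\dots,\nu_n(s))\in\mathbb{Z}^n$, where $\nu_1(s)=\operatorname{ord}_{Y_1}(s)$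 and, inductively, $\nu_i(s)$ is the order of vanishing along $Y_i$ of the section of a line bundle on $Y_{i-1}$ obtained by dividing the section from the previous step by the $\nu_{i-1}(s)$-th power of a local equation of $Y_{i-1}$ and restricting to $Y_{i-1}$. For a section $s$ of a line bundle on $X$ put $\nu_{\tilde Y^{(j)}_\bullet}(s):=\nu_{\tilde Y^{(j)}_\bullet}(\pi^*s)$. Multipoint infinitesimal Newton-Okounkov body: let $G$ be a big divisor on $X$ and $\tilde Y_\bullet=(\tilde Y^{(1)}_\bullet,\ldots,\tilde Y^{(N)}_\bullet)$ a tuple of infinitesimal flags, $\tilde Y^{(i)}_\bullet$ over $p_i$. For $q\ge 1$ let $$V_{q,j}=\{s\in H^0(X,qG)\setminus\{0\}:\ \nu_{\tilde Y^{(j)}_\bullet}(s)<\nu_{\tilde Y^{(i)}_\bullet}(s)\ \text{for all } i\ne j\},$$ where $<$ is the lexicographic order on $\mathbb{Z}^n$. Then $$\Delta_{\tilde Y_\bullet,j}(G)=\Delta_{\tilde Y_\bullet,j}(\pi^*(G))=\overline{\bigcup_{q\ge1}\frac{\nu_{\tilde Y^{(j)}_\bullet}(V_{q,j})}{q}}\subset\mathbb{R}^n$$ (the two notations agree since $H^0(X,qG)=H^0(\overline X,q\pi^*G)$). $k$-jet ampleness: a divisor $G$ on $X$, with $L=\mathcal{O}_X(G)$, is $k$-jet ample if, for any positive integers $k_1,\ldots,k_N$ with $\sum_{i=1}^N k_i=k+1$ and any $N$ distinct points $x_1,\ldots,x_N\in X$, the evaluation map $H^0(X,L)\to H^0\bigl(X,L\otimes\mathcal{O}_X/(\mathfrak{m}_{x_1}^{k_1}\otimes\cdots\otimes\mathfrak{m}_{x_N}^{k_N})\bigr)$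 is surjective, where $\mathfrak{m}_{x_i}$ is the maximal ideal (sheaf) at $x_i$ (equivalently the product ideal $\mathfrak{m}_{x_1}^{k_1}\cdots\mathfrak{m}_{x_N}^{k_N}$ is used). *)

theory Defs
  imports
    "HOL-Analysis.Analysis"
    "HOL-Combinatorics.Permutations"
    "HOL-Library.Poly_Mapping"
    "HOL-Library.Function_Algebras"
begin

section \<open>Projective varieties over the complex numbers\<close>

text \<open>
  Polynomials in the variables \<open>x\<^sub>0, x\<^sub>1, \<dots>\<close>. The points of projective \<open>r\<close>-space are the punctured
  lines through nonzero vectors supported in \<open>{0..r}\<close>; the variables beyond \<open>x\<^sub>r\<close> vanish there.
\<close>

type_synonym mpoly = "(nat \<Rightarrow>\<^sub>0 nat) \<Rightarrow>\<^sub>0 complex"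
type_synonym point = "(nat \<Rightarrow> complex) set"

definition peval :: "(complex \<Rightarrow> 'a) \<Rightarrow> (nat \<Rightarrow> 'a) \<Rightarrow> mpoly \<Rightarrow> 'a::comm_ring_1" where
  "peval c x F = (\<Sum>\<mu>\<in>Poly_Mapping.keys F. c (Poly_Mapping.lookup F \<mu>) *
     (\<Prod>i\<in>Poly_Mapping.keys \<mu>. x i ^ Poly_Mapping.lookup \<mu> i))"

definition homogeneous :: "nat \<Rightarrow> mpoly \<Rightarrow> bool" where
  "homogeneous d F \<longleftrightarrow> (\<forall>\<mu>\<in>Poly_Mapping.keys F.
     (\<Sum>i\<in>Poly_Mapping.keys \<mu>. Poly_Mapping.lookup \<mu> i) = d)"

definition proj_point :: "(nat \<Rightarrow> complex) \<Rightarrow> point" where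
  "proj_point a = {(\<lambda>i. c * a i) | c. c \<noteq> 0}"

definition proj_space :: "nat \<Rightarrow> point set" where
  "proj_space r = {proj_point a | a. (\<exists>i. a i \<noteq> 0) \<and> (\<forall>i>r. a i = 0)}"

definition vanishes_at :: "mpoly \<Rightarrow> point \<Rightarrow> bool" where
  "vanishes_at F p \<longleftrightarrow> (\<forall>a\<in>p. peval (\<lambda>c. c) a F = 0)"

definition zariski_closed :: "nat \<Rightarrow> point set \<Rightarrow> bool" where
  "zariski_closed r Z \<longleftrightarrow>
     (\<exists>S. (\<forall>F\<in>S. \<exists>d. homogeneous d F) \<and> Z = {p \<in> proj_space r. \<forall>F\<in>S. vanishes_at F p})"

definition irreducible_closed :: "nat \<Rightarrow> point set \<Rightarrow> bool" where
  "irreducible_closed r Z \<longleftrightarrow> zariski_closed r Z \<and> Z \<noteq> {} \<and>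
     (\<forall>A B. zariski_closed r A \<and> zariski_closed r B \<and> Z = A \<union> B \<longrightarrow> Z = A \<or> Z = B)"

definition irreducible_chain :: "nat \<Rightarrow> point set \<Rightarrow> nat \<Rightarrow> bool" where
  "irreducible_chain r X n \<longleftrightarrow>
     (\<exists>Z. (\<forall>i\<le>n. irreducible_closed r (Z i) \<and> Z i \<subseteq> X) \<and> (\<forall>i<n. Z i \<subset> Z (Suc i)))"

definition has_dimension :: "nat \<Rightarrow> point set \<Rightarrow> nat \<Rightarrow> bool" where
  "has_dimension r X n \<longleftrightarrow> irreducible_chain r X n \<and> \<not> irreducible_chain r X (Suc n)"

text \<open>
  An irreducible projective variety together with a field \<open>'k\<close> serving as its field of rational
  functions. The component \<open>coord\<close> lists homogeneous coordinates of the generic point, for instance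
  the rational functions \<open>x\<^sub>i/x\<^sub>j\<close> for a fixed \<open>j\<close> such that \<open>x\<^sub>j\<close> does not vanish identically on the
  variety. For \<open>F\<close>, \<open>G\<close> homogeneous of the same degree, the rational function \<open>F/G\<close> is
  \<open>peval scalar coord F / peval scalar coord G\<close>, which does not depend on \<open>j\<close>.
\<close>

record 'k projvar =
  ambient :: nat
  points :: "point set"
  scalar :: "complex \<Rightarrow> 'k"
  coord :: "nat \<Rightarrow> 'k"

definition projective_variety :: "'k::field projvar \<Rightarrow> bool" where
  "projective_variety X \<longleftrightarrow>
     irreducible_closed (ambient X) (points X) \<and>
     scalar X 1 = 1 \<and>
     (\<forall>a b. scalar X (a + b) = scalar X a + scalar X b) \<and>
     (\<forall>a b. scalar X (a * b) = scalar X a * scalar X b) \<and>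
     (\<forall>d F. homogeneous d F \<longrightarrow>
        (peval (scalar X) (coord X) F = 0 \<longleftrightarrow> (\<forall>p\<in>points X. vanishes_at F p))) \<and>
     (\<forall>f. \<exists>d F G. homogeneous d F \<and> homogeneous d G \<and> peval (scalar X) (coord X) G \<noteq> 0 \<and>
        f = peval (scalar X) (coord X) F / peval (scalar X) (coord X) G)"

text \<open>The germs at \<open>p\<close> on projective space, pulled back along the homogeneous coordinates \<open>x\<close>.\<close>

definition germs_along :: "(complex \<Rightarrow> 'k) \<Rightarrow> (nat \<Rightarrow> 'k) \<Rightarrow> point \<Rightarrow> 'k::field set" where
  "germs_along c x p =
     {peval c x F / peval c x G | F G.
        (\<exists>d. homogeneous d F \<and> homogeneous d G) \<and> \<not> vanishes_at G p}"

definition local_ring :: "'k::field projvar \<Rightarrow> point \<Rightarrow> 'k set" where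
  "local_ring X p = germs_along (scalar X) (coord X) p"

text \<open>The nonunits of a subring of \<open>'k\<close>.\<close>

definition max_ideal :: "'k::field set \<Rightarrow> 'k set" where
  "max_ideal R = {f \<in> R. f = 0 \<or> inverse f \<notin> R}"

definition value_at :: "'k::field projvar \<Rightarrow> point \<Rightarrow> 'k \<Rightarrow> complex" where
  "value_at X p f = (THE c. f - scalar X c \<in> max_ideal (local_ring X p))"

definition open_nbhd :: "'k projvar \<Rightarrow> point \<Rightarrow> point set \<Rightarrow> bool" where
  "open_nbhd X p U \<longleftrightarrow> p \<in> U \<and> (\<exists>Z. zariski_closed (ambient X) Z \<and> U = points X - Z)"

definition ideal_prod :: "'k::field set \<Rightarrow> 'k set \<Rightarrow> 'k set" where
  "ideal_prod I J = {(\<Sum>i<l. a i * b i) | (l::nat) a b. \<forall>i<l. a i \<in> I \<and> b i \<in> J}"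

primrec ideal_pow :: "'k::field set \<Rightarrow> 'k set \<Rightarrow> nat \<Rightarrow> 'k set" where
  "ideal_pow R I 0 = R"
| "ideal_pow R I (Suc d) = ideal_prod I (ideal_pow R I d)"


section \<open>Tangent spaces and smoothness\<close>

interpretation cfun: vector_space "\<lambda>(c::complex) (v::'a \<Rightarrow> complex) x. c * v x"
  by unfold_locales (simp_all add: fun_eq_iff algebra_simps)

text \<open>Point derivations of the local ring, extended by zero to all of \<open>'k\<close>.\<close>

definition tangent_space :: "'k::field projvar \<Rightarrow> point \<Rightarrow> ('k \<Rightarrow> complex) set" where
  "tangent_space X p = {v.
     (\<forall>f. f \<notin> local_ring X p \<longrightarrow> v f = 0) \<and>
     (\<forall>c. v (scalar X c) = 0) \<and>
     (\<forall>f\<in>local_ring X p. \<forall>g\<in>local_ring X p.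
        v (f + g) = v f + v g \<and> v (f * g) = value_at X p f * v g + value_at X p g * v f)}"

definition smooth_projective_variety :: "nat \<Rightarrow> 'k::field projvar \<Rightarrow> bool" where
  "smooth_projective_variety n X \<longleftrightarrow>
     projective_variety X \<and> has_dimension (ambient X) (points X) n \<and>
     (\<forall>p\<in>points X. cfun.dim (tangent_space X p) = n)"


section \<open>Divisors, sections, ampleness\<close>

text \<open>
  A Cartier divisor \<open>D\<close> is given by local equations: \<open>D p\<close> is a local equation at \<open>p\<close>, and up to units
  it is also a local equation at all points near \<open>p\<close>. Addition of divisors is multiplication of local
  equations. The stalk of the associated sheaf at \<open>p\<close> is generated by \<open>1 / D p\<close>.
\<close>

type_synonym 'k divisor = "point \<Rightarrow> 'k"

definition cartier_divisor :: "'k::field projvar \<Rightarrow> 'k divisor \<Rightarrow> bool" where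
  "cartier_divisor X D \<longleftrightarrow> (\<forall>p\<in>points X. D p \<noteq> 0 \<and>
     (\<exists>U. open_nbhd X p U \<and>
        (\<forall>q\<in>U. D p / D q \<in> local_ring X q \<and> D q / D p \<in> local_ring X q)))"

definition div_scale :: "int \<Rightarrow> 'k::field divisor \<Rightarrow> 'k divisor" where
  "div_scale m D = (\<lambda>p. D p powi m)"

definition div_minus :: "'k::field divisor \<Rightarrow> 'k divisor \<Rightarrow> 'k divisor" where
  "div_minus D E = (\<lambda>p. D p / E p)"

definition sections :: "'k::field projvar \<Rightarrow> 'k divisor \<Rightarrow> 'k set" where
  "sections X D = {s. \<forall>p\<in>points X. s * D p \<in> local_ring X p}"

text \<open>
  The morphism to projective \<open>M\<close>-space defined by sections \<open>s\<^sub>0, \<dots>, s\<^sub>M\<close> without common zeros; it pulls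
  the hyperplane bundle back to the sheaf of \<open>D\<close>.
\<close>

definition section_map :: "'k::field projvar \<Rightarrow> 'k divisor \<Rightarrow> (nat \<Rightarrow> 'k) \<Rightarrow> point \<Rightarrow> point" where
  "section_map X D s p = proj_point (\<lambda>i. value_at X p (s i * D p))"

text \<open>
  The last three lines say that \<open>section_map\<close> is a closed immersion: a homeomorphism onto a closed
  subset, with surjective maps on stalks.
\<close>

definition very_ample :: "'k::field projvar \<Rightarrow> 'k divisor \<Rightarrow> bool" where
  "very_ample X D \<longleftrightarrow> cartier_divisor X D \<and>
     (\<exists>M s. (\<forall>i\<le>M. s i \<in> sections X D) \<and> (\<forall>i>M. s i = 0) \<and>
        (\<forall>p\<in>points X. \<exists>i\<le>M. s i * D p \<notin> max_ideal (local_ring X p)) \<and>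
        inj_on (section_map X D s) (points X) \<and>
        (\<forall>Z\<subseteq>points X. zariski_closed (ambient X) Z \<longleftrightarrow> zariski_closed M (section_map X D s ` Z)) \<and>
        (\<forall>p\<in>points X. germs_along (scalar X) s (section_map X D s p) = local_ring X p))"

definition ample :: "'k::field projvar \<Rightarrow> 'k divisor \<Rightarrow> bool" where
  "ample X D \<longleftrightarrow> cartier_divisor X D \<and> (\<exists>m>0. very_ample X (div_scale m D))"

text \<open>
  Rational \<open>n\<close>-forms are regarded as alternating forms on the derivations of \<open>'k\<close> over the complex
  numbers; \<open>wedge_d n x\<close> is \<open>dx\<^sub>0 \<and> \<dots> \<and> dx\<^sub>n\<^sub>-\<^sub>1\<close>.
\<close>

definition derivations :: "'k::field projvar \<Rightarrow> ('k \<Rightarrow> 'k) set" where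
  "derivations X = {\<delta>. (\<forall>c. \<delta> (scalar X c) = 0) \<and>
     (\<forall>f g. \<delta> (f + g) = \<delta> f + \<delta> g \<and> \<delta> (f * g) = f * \<delta> g + g * \<delta> f)}"

definition wedge_d :: "nat \<Rightarrow> (nat \<Rightarrow> 'k) \<Rightarrow> (nat \<Rightarrow> 'k \<Rightarrow> 'k) \<Rightarrow> 'k::field" where
  "wedge_d n x \<delta> =
     (\<Sum>\<sigma> | \<sigma> permutes {..<n}. of_int (sign \<sigma>) * (\<Prod>i<n. \<delta> i (x (\<sigma> i))))"

definition local_parameters :: "nat \<Rightarrow> 'k::field projvar \<Rightarrow> point \<Rightarrow> (nat \<Rightarrow> 'k) \<Rightarrow> bool" where
  "local_parameters n X p t \<longleftrightarrow>
     max_ideal (local_ring X p) = {(\<Sum>i<n. a i * t i) | a. \<forall>i<n. a i \<in> local_ring X p}"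

text \<open>
  \<open>K\<close> is the divisor of a nonzero rational \<open>n\<close>-form \<open>f dx\<^sub>0 \<and> \<dots> \<and> dx\<^sub>n\<^sub>-\<^sub>1\<close>: near \<open>p\<close> the form is a unit
  \<open>u\<close> times \<open>K p dt\<^sub>0 \<and> \<dots> \<and> dt\<^sub>n\<^sub>-\<^sub>1\<close> for local parameters \<open>t\<close>.
\<close>

definition canonical_divisor :: "nat \<Rightarrow> 'k::field projvar \<Rightarrow> 'k divisor \<Rightarrow> bool" where
  "canonical_divisor n X K \<longleftrightarrow> cartier_divisor X K \<and>
     (\<exists>f x. (\<exists>\<delta>. (\<forall>i<n. \<delta> i \<in> derivations X) \<and> f * wedge_d n x \<delta> \<noteq> 0) \<and>
        (\<forall>p\<in>points X. \<exists>t u. local_parameters n X p t \<and>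
           u \<in> local_ring X p - max_ideal (local_ring X p) \<and>
           (\<forall>\<delta>. (\<forall>i<n. \<delta> i \<in> derivations X) \<longrightarrow>
              f * wedge_d n x \<delta> = u * K p * wedge_d n t \<delta>)))"


section \<open>Jet ampleness\<close>

text \<open>The stalk at \<open>q\<close> of the product of the \<open>k\<^sub>i\<close>-th powers of the ideal sheaves of the \<open>x\<^sub>i\<close>.\<close>

definition jet_ideal :: "'k::field projvar \<Rightarrow> point list \<Rightarrow> nat list \<Rightarrow> point \<Rightarrow> 'k set" where
  "jet_ideal X xs ks q = foldr ideal_prod
     (map2 (\<lambda>x e. ideal_pow (local_ring X q)
        (if q = x then max_ideal (local_ring X q) else local_ring X q) e) xs ks)
     (local_ring X q)"

text \<open>
  A global section of the quotient sheaf of the sheaf of \<open>D\<close> by its product with \<open>J\<close> is a family of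
  germs that locally comes from sections; only the class of \<open>g q\<close> modulo the stalk at \<open>q\<close> of that
  product matters.
\<close>

definition quotient_section ::
  "'k::field projvar \<Rightarrow> 'k divisor \<Rightarrow> (point \<Rightarrow> 'k set) \<Rightarrow> (point \<Rightarrow> 'k) \<Rightarrow> bool" where
  "quotient_section X D J g \<longleftrightarrow>
     (\<forall>p\<in>points X. \<exists>U h. open_nbhd X p U \<and>
        (\<forall>q\<in>U. h * D q \<in> local_ring X q \<and> (h - g q) * D q \<in> J q))"

definition jet_ample :: "'k::field projvar \<Rightarrow> nat \<Rightarrow> 'k divisor \<Rightarrow> bool" where
  "jet_ample X k D \<longleftrightarrow>
     (\<forall>xs ks. distinct xs \<and> set xs \<subseteq> points X \<and> length ks = length xs \<and>
        (\<forall>e\<in>set ks. e \<ge> 1) \<and> sum_list ks = k + 1 \<longrightarrow>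
        (\<forall>g. quotient_section X D (jet_ideal X xs ks) g \<longrightarrow>
           (\<exists>s\<in>sections X D. \<forall>q\<in>points X. (s - g q) * D q \<in> jet_ideal X xs ks q)))"


section \<open>Blow-ups of points\<close>

text \<open>
  Points of the blow-up of \<open>X\<close> along a finite set: points of \<open>X\<close> outside the centre, and one-dimensional
  subspaces of the tangent spaces at the points of the centre.
\<close>

datatype 'k blowup_point = Outside point | Direction point "('k \<Rightarrow> complex) set"

definition directions :: "('k \<Rightarrow> complex) set \<Rightarrow> ('k \<Rightarrow> complex) set set" where
  "directions V = {l. cfun.subspace l \<and> l \<subseteq> V \<and> cfun.dim l = 1}"

text \<open>\<open>proj_tangent p V\<close> is the projectivization of \<open>V\<close> inside the exceptional divisor over \<open>p\<close>.\<close>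

definition proj_tangent :: "point \<Rightarrow> ('k \<Rightarrow> complex) set \<Rightarrow> 'k blowup_point set" where
  "proj_tangent p V = Direction p ` directions V"

definition blowup_points :: "'k::field projvar \<Rightarrow> point set \<Rightarrow> 'k blowup_point set" where
  "blowup_points X Z = Outside ` (points X - Z) \<union> (\<Union>p\<in>Z. proj_tangent p (tangent_space X p))"

text \<open>
  For \<open>t\<close> in the maximal ideal \<open>\<mm>\<close> of the local ring \<open>R\<close> at \<open>p\<close>, the coordinate ring \<open>R[\<mm>/t]\<close> of a
  chart of the blow-up over \<open>p\<close>. The point of this chart given by a tangent vector \<open>v\<close> with \<open>v t \<noteq> 0\<close> is
  the homomorphism extending evaluation at \<open>p\<close> and mapping \<open>u/t\<close> to \<open>v u / v t\<close> for \<open>u\<close> in \<open>\<mm>\<close>.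
\<close>

definition blowup_chart :: "'k::field projvar \<Rightarrow> point \<Rightarrow> 'k \<Rightarrow> 'k set" where
  "blowup_chart X p t = {a / t ^ d | a d.
     a \<in> ideal_pow (local_ring X p) (max_ideal (local_ring X p)) d}"

definition chart_point ::
  "'k::field projvar \<Rightarrow> point \<Rightarrow> 'k \<Rightarrow> ('k \<Rightarrow> complex) \<Rightarrow> ('k \<Rightarrow> complex) \<Rightarrow> bool" where
  "chart_point X p t v \<phi> \<longleftrightarrow>
     (\<forall>f\<in>blowup_chart X p t. \<forall>g\<in>blowup_chart X p t.
        \<phi> (f + g) = \<phi> f + \<phi> g \<and> \<phi> (f * g) = \<phi> f * \<phi> g) \<and>
     (\<forall>f\<in>local_ring X p. \<phi> f = value_at X p f) \<and>
     (\<forall>u\<in>max_ideal (local_ring X p). \<phi> (u / t) = v u / v t)"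

text \<open>
  The blow-up has the same field of rational functions as \<open>X\<close>, pulling back being the identity of \<open>'k\<close>.
\<close>

fun blowup_ring :: "'k::field projvar \<Rightarrow> 'k blowup_point \<Rightarrow> 'k set" where
  "blowup_ring X (Outside p) = local_ring X p"
| "blowup_ring X (Direction p l) =
     {f. \<exists>t\<in>max_ideal (local_ring X p). \<exists>v\<in>l. v t \<noteq> 0 \<and>
        (\<exists>\<phi>. chart_point X p t v \<phi> \<and>
           (\<exists>a\<in>blowup_chart X p t. \<exists>b\<in>blowup_chart X p t. \<phi> b \<noteq> 0 \<and> f = a / b))}"


section \<open>Flag valuations\<close>

text \<open>
  The stalk at \<open>y\<close> of the ideal sheaf of an irreducible subvariety \<open>Y\<close> through \<open>y\<close>, where \<open>R x\<close> is the
  local ring at \<open>x\<close>: the germs vanishing at those points of \<open>Y\<close> at which they are regular.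
\<close>

definition stalk_ideal :: "('p \<Rightarrow> 'k::field set) \<Rightarrow> 'p set \<Rightarrow> 'p \<Rightarrow> 'k set" where
  "stalk_ideal R Y y = {h \<in> R y. \<forall>x\<in>Y. h \<in> R x \<longrightarrow> h \<in> max_ideal (R x)}"

definition local_equation :: "('p \<Rightarrow> 'k::field set) \<Rightarrow> 'p \<Rightarrow> 'p set \<Rightarrow> 'p set \<Rightarrow> 'k \<Rightarrow> bool" where
  "local_equation R y Y Y' t \<longleftrightarrow>
     stalk_ideal R Y' y = {h + t * a | h a. h \<in> stalk_ideal R Y y \<and> a \<in> R y}"

text \<open>
  The position of \<open>i\<close> in the linearly ordered index type, counted from \<open>0\<close>; it identifies \<open>'n\<close> with
  \<open>{0..<CARD('n)}\<close>.
\<close>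

definition pos :: "'n::{finite,linorder} \<Rightarrow> nat" where
  "pos i = card {..<i}"

text \<open>
  Here \<open>f\<close> is the germ at the point \<open>y\<close> of a nonzero section in a local trivialization, and \<open>g i\<close>
  represents on \<open>Y i\<close> the section obtained after \<open>i\<close> steps. It equals the \<open>\<nu>\<close>-th power of a local
  equation \<open>t i\<close> of \<open>Y (Suc i)\<close> in \<open>Y i\<close> times the quotient \<open>g (Suc i)\<close>, and the latter does not vanish
  identically on \<open>Y (Suc i)\<close>, so that \<open>\<nu>\<close> is the order of vanishing of \<open>g i\<close> along \<open>Y (Suc i)\<close>.
\<close>

definition is_flag_valuation ::
  "('p \<Rightarrow> 'k::field set) \<Rightarrow> (nat \<Rightarrow> 'p set) \<Rightarrow> 'p \<Rightarrow> 'k \<Rightarrow> (nat, 'n::{finite,linorder}) vec \<Rightarrow> bool" where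
  "is_flag_valuation R Y y f \<nu> \<longleftrightarrow>
     (\<exists>t g. g 0 = f \<and> f \<in> R y \<and>
        (\<forall>j::'n. let i = pos j in
           local_equation R y (Y i) (Y (Suc i)) (t i) \<and> g (Suc i) \<in> R y \<and>
           g i - t i ^ (\<nu> $ j) * g (Suc i) \<in> stalk_ideal R (Y i) y \<and>
           g (Suc i) \<notin> stalk_ideal R (Y (Suc i)) y))"

definition flag_valuation ::
  "('p \<Rightarrow> 'k::field set) \<Rightarrow> (nat \<Rightarrow> 'p set) \<Rightarrow> 'p \<Rightarrow> 'k \<Rightarrow> (nat, 'n::{finite,linorder}) vec" where
  "flag_valuation R Y y f = (THE \<nu>. is_flag_valuation R Y y f \<nu>)"

definition lex_less :: "(nat, 'n::{finite,linorder}) vec \<Rightarrow> (nat, 'n) vec \<Rightarrow> bool" where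
  "lex_less a b \<longleftrightarrow> (\<exists>i. a $ i < b $ i \<and> (\<forall>j<i. a $ j = b $ j))"

definition infinitesimal_flag ::
  "nat \<Rightarrow> 'k::field projvar \<Rightarrow> point set \<Rightarrow> point \<Rightarrow> (nat \<Rightarrow> 'k blowup_point set) \<Rightarrow> bool" where
  "infinitesimal_flag n X Z p Y \<longleftrightarrow>
     (\<exists>V. V 0 = tangent_space X p \<and>
        (\<forall>i<n. cfun.subspace (V i) \<and> cfun.dim (V i) = n - i) \<and>
        (\<forall>i. Suc i < n \<longrightarrow> V (Suc i) \<subseteq> V i) \<and>
        Y 0 = blowup_points X Z \<and>
        (\<forall>i<n. Y (Suc i) = proj_tangent p (V i)))"


section \<open>Multipoint infinitesimal Newton--Okounkov bodies\<close>

text \<open>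
  The valuation of the pullback of a section \<open>s\<close> of the sheaf of \<open>G\<close>; near the exceptional divisor over
  \<open>p\<close> the pulled back sheaf is trivialized by \<open>1 / G p\<close>.
\<close>

definition section_valuation ::
  "'k::field projvar \<Rightarrow> 'k divisor \<Rightarrow> point \<Rightarrow> (nat \<Rightarrow> 'k blowup_point set) \<Rightarrow> 'k \<Rightarrow>
     (nat, 'n::{finite,linorder}) vec" where
  "section_valuation X G p Y s =
     flag_valuation (blowup_ring X) Y (the_elem (Y CARD('n))) (s * G p)"

text \<open>The \<open>N\<close> points and flags are indexed by \<open>{0..<N}\<close>.\<close>

definition minimal_sections ::
  "'n::{finite,linorder} itself \<Rightarrow> 'k::field projvar \<Rightarrow> nat \<Rightarrow> (nat \<Rightarrow> point) \<Rightarrow>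
     (nat \<Rightarrow> nat \<Rightarrow> 'k blowup_point set) \<Rightarrow> 'k divisor \<Rightarrow> nat \<Rightarrow> 'k set" where
  "minimal_sections _ X N p Y G j = {s \<in> sections X G - {0}. \<forall>i<N. i \<noteq> j \<longrightarrow>
     lex_less (section_valuation X G (p j) (Y j) s :: (nat, 'n) vec)
              (section_valuation X G (p i) (Y i) s)}"

definition newton_okounkov_body ::
  "'k::field projvar \<Rightarrow> nat \<Rightarrow> (nat \<Rightarrow> point) \<Rightarrow> (nat \<Rightarrow> nat \<Rightarrow> 'k blowup_point set) \<Rightarrow>
     'k divisor \<Rightarrow> nat \<Rightarrow> (real, 'n::{finite,linorder}) vec set" where
  "newton_okounkov_body X N p Y G j = closure (\<Union>q\<in>{1::nat..}.
     (\<lambda>s. \<chi> i. real ((section_valuation X (div_scale (int q) G) (p j) (Y j) s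
        :: (nat, 'n) vec) $ i) / real q)
       ` minimal_sections TYPE('n) X N p Y (div_scale (int q) G) j)"

definition inverted_simplex :: "real \<Rightarrow> (real, 'n::{finite,linorder}) vec set" where
  "inverted_simplex \<xi> = convex hull (insert 0 (range (\<lambda>i. \<xi> *\<^sub>R (\<Sum>j\<le>i. axis j 1))))"

end

theory Submission
  imports Defs
    "HOL-Computational_Algebra.Fundamental_Theorem_Algebra"
begin

text \<open>
  Let \<open>m\<^sub>0 D\<close> be very ample. Products of hyperplane sections separate jets, so \<open>t D\<close> is \<open>k\<close>-jet ample for
  \<open>t \<ge> m\<^sub>0 k + c\<close>, where \<open>c\<close> does not depend on \<open>k\<close>. Hence it suffices that the hypothesis forces \<open>m > m\<^sub>0 (n + k)\<close>
  for all large \<open>k\<close>: the finitely many other \<open>k\<close> are absorbed by \<open>m(D)\<close>.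

  The hypothesis provides \<open>q\<close> and a section of \<open>q m D\<close> of multiplicity greater than \<open>q (n + k)\<close> at \<open>k + 1\<close>
  prescribed points. Let \<open>f\<close> be its \<open>m\<^sub>0\<close>-th power, on an affine chart, and \<open>x\<^sub>1, \<dots>, x\<^sub>n\<close> a transcendence basis among the coordinates.
  Counting dimensions there is a relation \<open>\<Sum>i\<le>r. c\<^sub>i f\<^sup>i\<^sup>l = 0\<close> with polynomials \<open>c\<^sub>i\<close> in the \<open>x\<^sub>j\<close> of degree at
  most \<open>r l q m\<close> in each variable, where \<open>r\<close> depends only on the embedding. The first nonzero coefficient is
  divisible by \<open>f\<^sup>l\<close>, so it vanishes at the points to an order greater than \<open>l m\<^sub>0 q (n + k)\<close>. If their
  coordinates contain a grid of \<open>(n r)\<^sup>n\<close> points, the Schwartz-Zippel lemma with multiplicities gives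
  \<open>m\<^sub>0 (n + k) < m\<close>.
\<close>

section \<open>Evaluation of polynomials\<close>

text \<open>\<open>m(D)\<close> is fixed before the canonical divisor and before \<open>k\<close>.
  Ampleness of \<open>m(D) D - K\<close> is therefore shown for one \<open>K\<close>, by the Segre
  embedding of a very ample plus a globally generated divisor, and carried to the others by linear
  equivalence. The bound on \<open>m\<close> needs a grid that is known before the section is: the
  degree \<open>r\<close> of the relation depends on the embedding alone, and the grid is completed
  by more good points to \<open>k + 1\<close> points. At a good point the transcendence basis,
  shifted by its values, is a system of local parameters; it relates multiplicities to Taylor
  coefficients in these variables and provides an explicit flag of tangent subspaces. The obstacle
  is that \<open>flag_valuation\<close> is a definite description. Uniqueness is proved, from the
  local rings of the blow-up along that flag; existence is avoided. A section without valuation is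
  assigned one constant vector, and for \<open>q\<close> above its first entry that entry cannot
  exceed \<open>q (n + k)\<close>. Large \<open>q\<close> are enforced by aiming at a first
  coordinate slightly above \<open>n + k\<close>, where no fraction of small denominator is
  close.\<close>

definition rhom :: "('a::comm_ring_1 \<Rightarrow> 'b::comm_ring_1) \<Rightarrow> bool" where
 "rhom h \<longleftrightarrow> h 1 = 1 \<and> (\<forall>x y. h (x + y) = h x + h y) \<and> (\<forall>x y. h (x * y) = h x * h y)"

lemma rhomD:
 assumes "rhom h"
 shows "h 0 = 0" "h 1 = 1" "h (x + y) = h x + h y" "h (x * y) = h x * h y"
  "h (- x) = - h x" "h (x - y) = h x - h y" "h (x ^ m) = h x ^ m"
  "h (sum f S) = (\<Sum>i\<in>S. h (f i))" "h (prod f S) = (\<Prod>i\<in>S. h (f i))" "h (of_nat m) = of_nat m"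
proof -
 show 1: "h 1 = 1" and a: "h (x + y) = h x + h y" and m: "h (x * y) = h x * h y" for x y
  using assms by (auto simp: rhom_def)
 show z: "h 0 = 0" using a[of 0 0] by simp
 show u: "h (- x) = - h x" for x using a[of x "- x"] z by (simp add: eq_neg_iff_add_eq_0 add.commute)
 show "h (x - y) = h x - h y" using a[of x "- y"] u by simp
 show "h (x ^ m) = h x ^ m" by (induction m) (auto simp: 1 m)
 show "h (sum f S) = (\<Sum>i\<in>S. h (f i))" by (induction S rule: infinite_finite_induct) (auto simp: z a)
 show "h (prod f S) = (\<Prod>i\<in>S. h (f i))" by (induction S rule: infinite_finite_induct) (auto simp: 1 m)
 show "h (of_nat m) = of_nat m" by (induction m) (auto simp: z a 1)
qed

lemma rhom_id [simp]: "rhom (\<lambda>c. c)"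
 by (simp add: rhom_def)

lemma rhom_comp: "rhom g ==> rhom h ==> rhom (\<lambda>x. g (h x))"
 by (simp add: rhom_def)

definition mon :: "(nat \<Rightarrow> 'a) \<Rightarrow> (nat \<Rightarrow>\<^sub>0 nat) \<Rightarrow> 'a::comm_ring_1" where
 "mon x \<mu> = (\<Prod>i\<in>Poly_Mapping.keys \<mu>. x i ^ Poly_Mapping.lookup \<mu> i)"

definition Const :: "complex \<Rightarrow> mpoly" where "Const a = Poly_Mapping.single 0 a"

definition Var :: "nat \<Rightarrow> mpoly" where "Var i = Poly_Mapping.single (Poly_Mapping.single i 1) 1"

lemma rhom_Const: "rhom Const"
 by (simp add: rhom_def Const_def single_add mult_single)

lemma mon_superset:
 assumes "finite S" "Poly_Mapping.keys \<mu> \<subseteq> S"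
 shows "mon x \<mu> = (\<Prod>i\<in>S. x i ^ Poly_Mapping.lookup \<mu> i)"
 unfolding mon_def using assms by (intro prod.mono_neutral_left) (auto simp: in_keys_iff)

lemma mon_add: "mon x (\<mu> + \<nu>) = mon x \<mu> * mon x \<nu>"
proof -
 let ?S = "Poly_Mapping.keys \<mu> \<union> Poly_Mapping.keys \<nu>"
 have "mon x (\<mu> + \<nu>) = (\<Prod>i\<in>?S. x i ^ Poly_Mapping.lookup (\<mu> + \<nu>) i)"
  using keys_add[of \<mu> \<nu>] by (intro mon_superset) auto
 also have "\<dots> = (\<Prod>i\<in>?S. x i ^ Poly_Mapping.lookup \<mu> i) * (\<Prod>i\<in>?S. x i ^ Poly_Mapping.lookup \<nu> i)"
  by (simp add: lookup_add power_add prod.distrib)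
 finally show ?thesis by (simp add: mon_superset[of ?S])
qed

lemma peval_superset:
 assumes "rhom c" "finite S" "Poly_Mapping.keys F \<subseteq> S"
 shows "peval c x F = (\<Sum>\<mu>\<in>S. c (Poly_Mapping.lookup F \<mu>) * mon x \<mu>)"
 unfolding peval_def mon_def[symmetric] using assms
 by (intro sum.mono_neutral_left) (auto simp: in_keys_iff rhomD)

lemma peval_zero [simp]: "peval c x 0 = 0"
 by (simp add: peval_def)

lemma peval_add:
 assumes "rhom c"
 shows "peval c x (F + G) = peval c x F + peval c x G"
proof -
 let ?S = "Poly_Mapping.keys F \<union> Poly_Mapping.keys G"
 show ?thesis
  using keys_add[of F G]
  by (simp add: peval_superset[OF assms, of ?S] lookup_add rhomD[OF assms] algebra_simps sum.distrib)
qed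

lemma peval_sum:
 assumes "rhom c"
 shows "peval c x (sum f S) = (\<Sum>i\<in>S. peval c x (f i))"
 by (induction S rule: infinite_finite_induct) (auto simp: peval_add[OF assms])

lemma peval_single:
 assumes "rhom c"
 shows "peval c x (Poly_Mapping.single \<mu> a) = c a * mon x \<mu>"
 using peval_superset[OF assms, of "{\<mu>}" "Poly_Mapping.single \<mu> a"] by simp

lemma mpoly_sum_single:
 fixes F :: mpoly
 shows "F = (\<Sum>\<mu>\<in>Poly_Mapping.keys F. Poly_Mapping.single \<mu> (Poly_Mapping.lookup F \<mu>))"
proof (rule poly_mapping_eqI)
 fix k
 show "Poly_Mapping.lookup F k =
  Poly_Mapping.lookup (\<Sum>\<mu>\<in>Poly_Mapping.keys F. Poly_Mapping.single \<mu> (Poly_Mapping.lookup F \<mu>)) k"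
  by (cases "k \<in> Poly_Mapping.keys F")
   (auto simp: lookup_sum lookup_single when_def in_keys_iff)
qed

lemma peval_mult:
 assumes "rhom c"
 shows "peval c x (F * G) = peval c x F * peval c x G"
proof -
 have "F * G = (\<Sum>\<mu>\<in>Poly_Mapping.keys F. \<Sum>\<nu>\<in>Poly_Mapping.keys G.
   Poly_Mapping.single (\<mu> + \<nu>) (Poly_Mapping.lookup F \<mu> * Poly_Mapping.lookup G \<nu>))"
  by (subst mpoly_sum_single[of F], subst mpoly_sum_single[of G])
   (simp add: sum_product mult_single)
 then have "peval c x (F * G) = (\<Sum>\<mu>\<in>Poly_Mapping.keys F. \<Sum>\<nu>\<in>Poly_Mapping.keys G.
   (c (Poly_Mapping.lookup F \<mu>) * mon x \<mu>) * (c (Poly_Mapping.lookup G \<nu>) * mon x \<nu>))"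
  by (simp add: peval_sum[OF assms] peval_single[OF assms] mon_add rhomD[OF assms] ac_simps)
 then show ?thesis
  by (simp add: sum_product[symmetric] peval_def mon_def)
qed

lemma peval_Const [simp]: "rhom c ==> peval c x (Const a) = c a"
 by (simp add: Const_def peval_single mon_def)

lemma peval_Var [simp]: "rhom c ==> peval c x (Var i) = x i"
 by (simp add: Var_def peval_single mon_def rhomD)

lemma peval_one [simp]: "rhom c ==> peval c x 1 = 1"
 using peval_Const[of c x 1] by (simp add: rhomD[OF rhom_Const] rhomD)

lemma rhom_peval: "rhom c ==> rhom (peval c x)"
 by (simp add: rhom_def[of "peval c x"] peval_add peval_mult)

lemmas peval_simps = rhomD[OF rhom_peval]

lemma single_eq_mon: "Poly_Mapping.single \<mu> a = Const a * mon Var \<mu>"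
proof -
 have *: "Poly_Mapping.single (Poly_Mapping.single i 1) (1::complex) ^ n
   = Poly_Mapping.single (Poly_Mapping.single i n) 1" for i n :: nat
  by (induction n) (auto simp: mult_single single_add[symmetric])
 have **: "(\<Prod>i\<in>S. Poly_Mapping.single (Poly_Mapping.single i (g i)) (1::complex))
   = Poly_Mapping.single (\<Sum>i\<in>S. Poly_Mapping.single i (g i)) 1" if "finite S" for S and g :: "nat \<Rightarrow> nat"
  using that by induction (simp_all add: mult_single)
 have "(\<Sum>i\<in>Poly_Mapping.keys \<mu>. Poly_Mapping.single i (Poly_Mapping.lookup \<mu> i)) = \<mu>"
 proof (rule poly_mapping_eqI)
  fix k
  show "Poly_Mapping.lookup (\<Sum>i\<in>Poly_Mapping.keys \<mu>. Poly_Mapping.single i (Poly_Mapping.lookup \<mu> i)) k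
    = Poly_Mapping.lookup \<mu> k"
   by (cases "k \<in> Poly_Mapping.keys \<mu>") (auto simp: lookup_sum lookup_single when_def in_keys_iff)
 qed
 then show ?thesis
  by (simp add: mon_def Var_def * ** Const_def mult_single del: One_nat_def)
qed

lemma mpoly_induct [case_names Const Var add mult]:
 fixes F :: mpoly
 assumes c: "\<And>a. P (Const a)" and v: "\<And>i. P (Var i)"
  and a: "\<And>F G. P F ==> P G ==> P (F + G)" and m: "\<And>F G. P F ==> P G ==> P (F * G)"
 shows "P F"
proof -
 have 0: "P 0" and 1: "P 1" using c[of 0] c[of 1] by (auto simp: rhomD[OF rhom_Const])
 have pw: "P (F ^ n)" if "P F" for F n by (induction n) (auto simp: 1 m that)
 have pr: "P (prod f S)" if "\<And>i. P (f i)" for f and S :: "nat set"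
  by (induction S rule: infinite_finite_induct) (auto simp: 1 m that)
 have sm: "P (sum f S)" if "\<And>i. P (f i)" for f and S :: "(nat \<Rightarrow>\<^sub>0 nat) set"
  by (induction S rule: infinite_finite_induct) (auto simp: 0 a that)
 show ?thesis
  by (subst mpoly_sum_single) (intro sm, simp add: single_eq_mon mon_def, intro m c pr pw v)
qed

lemma rhom_peval_comp:
 assumes "rhom c" "rhom h"
 shows "h (peval c x F) = peval (\<lambda>a. h (c a)) (\<lambda>i. h (x i)) F"
 by (induction F rule: mpoly_induct)
  (simp_all add: rhom_comp[OF assms(2,1)] peval_simps assms rhomD(3,4)[OF assms(2)])

definition psubst :: "(nat \<Rightarrow> mpoly) \<Rightarrow> mpoly \<Rightarrow> mpoly" where
 "psubst = peval Const"

lemma peval_psubst: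
 assumes "rhom c"
 shows "peval c x (psubst G F) = peval c (\<lambda>i. peval c x (G i)) F"
 unfolding psubst_def
 by (subst rhom_peval_comp[OF rhom_Const rhom_peval[OF assms]]) (simp add: assms)

subsection \<open>Homogeneous polynomials\<close>

definition mdeg :: "(nat \<Rightarrow>\<^sub>0 nat) \<Rightarrow> nat" where
 "mdeg \<mu> = (\<Sum>i\<in>Poly_Mapping.keys \<mu>. Poly_Mapping.lookup \<mu> i)"

lemma mdeg_add: "mdeg (\<mu> + \<nu>) = mdeg \<mu> + mdeg \<nu>"
proof -
 let ?S = "Poly_Mapping.keys \<mu> \<union> Poly_Mapping.keys \<nu>"
 have *: "mdeg \<rho> = (\<Sum>i\<in>?S. Poly_Mapping.lookup \<rho> i)" if "Poly_Mapping.keys \<rho> \<subseteq> ?S" for \<rho>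
  unfolding mdeg_def using that by (intro sum.mono_neutral_left) (auto simp: in_keys_iff)
 show ?thesis using keys_add[of \<mu> \<nu>] by (subst (1 2 3) *) (auto simp: lookup_add sum.distrib)
qed

lemma homogeneous_iff: "homogeneous d F \<longleftrightarrow> (\<forall>\<mu>. Poly_Mapping.lookup F \<mu> \<noteq> 0 \<longrightarrow> mdeg \<mu> = d)"
 unfolding homogeneous_def mdeg_def Ball_def in_keys_iff by simp

lemma homogeneous_add: "homogeneous d F ==> homogeneous d G ==> homogeneous d (F + G)"
 unfolding homogeneous_iff lookup_add by (metis add.right_neutral)

lemma homogeneous_0 [simp]: "homogeneous d 0"
 by (simp add: homogeneous_def)

lemma homogeneous_sum: "(\<And>i. i \<in> S ==> homogeneous d (f i)) ==> homogeneous d (sum f S)"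
 by (induction S rule: infinite_finite_induct) (auto simp: homogeneous_add)

lemma homogeneous_mult: "homogeneous d F ==> homogeneous e G ==> homogeneous (d + e) (F * G)"
 unfolding homogeneous_def mdeg_def[symmetric]
 using keys_mult[of F G] by (fastforce simp: mdeg_add)

lemma homogeneous_Const [simp]: "homogeneous 0 (Const a)"
 by (simp add: homogeneous_iff Const_def lookup_single when_def mdeg_def)

lemma homogeneous_1 [simp]: "homogeneous 0 1"
 using homogeneous_Const[of 1] by (simp add: rhomD[OF rhom_Const])

lemma homogeneous_Var [simp]: "homogeneous 1 (Var i)" "homogeneous (Suc 0) (Var i)"
 by (simp_all add: homogeneous_iff Var_def lookup_single when_def mdeg_def)

lemma homogeneous_power: "homogeneous d F ==> homogeneous (n * d) (F ^ n)"
 by (induction n) (auto simp: homogeneous_mult)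

lemma homogeneous_prod:
 "(\<And>i. i \<in> S ==> homogeneous (d i) (f i)) ==> homogeneous (sum d S) (prod f S)"
 by (induction S rule: infinite_finite_induct) (auto simp: homogeneous_mult)

lemma homogeneous_smult: "homogeneous d F ==> homogeneous d (Const a * F)"
 using homogeneous_mult[OF homogeneous_Const, of d F a] by simp

lemma homogeneous_uminus: "homogeneous d F ==> homogeneous d (- F)"
 by (simp add: homogeneous_iff)

lemma homogeneous_diff: "homogeneous d F ==> homogeneous d G ==> homogeneous d (F - G)"
 using homogeneous_add[of d F "- G"] by (simp add: homogeneous_uminus)

lemma homogeneous_psubst:
 assumes "homogeneous d F" "\<And>i. homogeneous e (G i)"
 shows "homogeneous (d * e) (psubst G F)"
 unfolding psubst_def peval_def
proof (intro homogeneous_sum homogeneous_smult)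
 fix \<mu> assume "\<mu> \<in> Poly_Mapping.keys F"
 then have d: "d = mdeg \<mu>" using assms(1) by (simp add: homogeneous_def mdeg_def)
 show "homogeneous (d * e) (\<Prod>i\<in>Poly_Mapping.keys \<mu>. G i ^ Poly_Mapping.lookup \<mu> i)"
  unfolding d mdeg_def sum_distrib_right
  by (intro homogeneous_prod homogeneous_power assms)
qed

lemma peval_scale:
 assumes "rhom c" "homogeneous d F"
 shows "peval c (\<lambda>i. t * x i) F = t ^ d * peval c x F"
proof -
 have "mon (\<lambda>i. t * x i) \<mu> = t ^ mdeg \<mu> * mon x \<mu>" for \<mu>
  by (simp add: mon_def mdeg_def power_mult_distrib prod.distrib power_sum)
 then show ?thesis
  using assms(2) unfolding peval_def mon_def[symmetric] sum_distrib_left homogeneous_def mdeg_def[symmetric]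
  by (intro sum.cong) (auto simp: ac_simps)
qed

abbreviation ceval :: "(nat \<Rightarrow> complex) \<Rightarrow> mpoly \<Rightarrow> complex" where
 "ceval \<equiv> peval (\<lambda>c. c)"

section \<open>Linear algebra over a subfield\<close>

definition subfield :: "'a::field set \<Rightarrow> bool" where
 "subfield L \<longleftrightarrow> 1 \<in> L \<and> (\<forall>x\<in>L. \<forall>y\<in>L. x - y \<in> L \<and> x * y \<in> L) \<and> (\<forall>x\<in>L. inverse x \<in> L)"

definition subring1 :: "'a::comm_ring_1 set \<Rightarrow> bool" where
 "subring1 L \<longleftrightarrow> 1 \<in> L \<and> (\<forall>x\<in>L. \<forall>y\<in>L. x - y \<in> L \<and> x * y \<in> L)"

lemma subring1D:
 assumes "subring1 L"
 shows "0 \<in> L" "1 \<in> L" "x \<in> L ==> - x \<in> L" "x \<in> L ==> y \<in> L ==> x + y \<in> L"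
  "x \<in> L ==> y \<in> L ==> x - y \<in> L" "x \<in> L ==> y \<in> L ==> x * y \<in> L"
  "x \<in> L ==> x ^ n \<in> L"
  "(\<And>i. i \<in> S ==> f i \<in> L) ==> sum f S \<in> L"
  "(\<And>i. i \<in> S ==> f i \<in> L) ==> prod f S \<in> L"
  "of_nat n \<in> L"
proof -
 show 1: "1 \<in> L" and d: "x \<in> L ==> y \<in> L ==> x - y \<in> L"
  and m: "x \<in> L ==> y \<in> L ==> x * y \<in> L" for x y
  using assms by (auto simp: subring1_def)
 show z: "0 \<in> L" using d[OF 1 1] by simp
 show u: "x \<in> L ==> - x \<in> L" for x using d[OF z, of x] by simp
 show a: "x \<in> L ==> y \<in> L ==> x + y \<in> L" for x y using d[OF _ u, of x y] by simp
 show "x \<in> L ==> x ^ n \<in> L" by (induction n) (auto simp: 1 m)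
 show "(\<And>i. i \<in> S ==> f i \<in> L) ==> sum f S \<in> L"
  by (induction S rule: infinite_finite_induct) (auto simp: z a)
 show "(\<And>i. i \<in> S ==> f i \<in> L) ==> prod f S \<in> L"
  by (induction S rule: infinite_finite_induct) (auto simp: 1 m)
 show "of_nat n \<in> L" by (induction n) (auto simp: z 1 a)
qed

lemma subfield_subring1: "subfield L ==> subring1 L"
 by (simp add: subfield_def subring1_def)

lemma subfield_divide: "subfield L ==> x \<in> L ==> y \<in> L ==> x / y \<in> L"
 by (simp add: subfield_def divide_inverse)

lemma subfield_UNIV [simp]: "subfield UNIV"
 by (simp add: subfield_def)

lemma subfield_range: 
 fixes sc :: "'b::field \<Rightarrow> 'a::field"
 assumes "rhom sc" shows "subfield (range sc)"
proof -
 have "inverse (sc x) \<in> range sc" for x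
 proof (cases "x = 0")
  case False
  then have "sc x * sc (inverse x) = 1" using assms by (metis rhomD(2,4) right_inverse)
  then have "inverse (sc x) = sc (inverse x)" by (simp add: inverse_unique)
  then show ?thesis by simp
 qed (simp add: rhomD[OF assms] image_iff, metis rhomD(1)[OF assms])
 then show ?thesis unfolding subfield_def
  using rhomD(2)[OF assms, symmetric] rhomD(6)[OF assms, symmetric] rhomD(4)[OF assms, symmetric] by auto
qed

text \<open>Gaussian elimination on the last equation: either it is void, or an unknown
  \<open>i0\<close> occurring in it is eliminated, and the remaining unknowns satisfy
  \<open>d\<close> equations whose coefficients \<open>B\<close> stay in \<open>L\<close>.\<close>

lemma nontrivial_solution:
 fixes A :: "'i \<Rightarrow> nat \<Rightarrow> 'a::field"
 assumes L: "subfield L"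
 shows "finite I ==> d < card I ==> (\<And>i k. i \<in> I ==> k < d ==> A i k \<in> L) ==>
  \<exists>c. (\<forall>i. c i \<in> L) \<and> (\<exists>i\<in>I. c i \<noteq> 0) \<and> (\<forall>k<d. (\<Sum>i\<in>I. c i * A i k) = 0)"
proof (induction d arbitrary: I A)
 note R = subring1D[OF subfield_subring1[OF L]]
 case 0
 then have "I \<noteq> {}" by auto
 then show ?case using R(2) by (intro exI[of _ "\<lambda>_. 1"]) auto
next
 case (Suc d)
 note R = subring1D[OF subfield_subring1[OF L]]
 show ?case
 proof (cases "\<forall>i\<in>I. A i d = 0")
  case True
  obtain c where "\<forall>i. c i \<in> L" "\<exists>i\<in>I. c i \<noteq> 0" "\<forall>k<d. (\<Sum>i\<in>I. c i * A i k) = 0"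
   using Suc.IH[of I A] Suc.prems by auto
  then show ?thesis using True by (intro exI[of _ c]) (auto simp: less_Suc_eq)
 next
  case False
  then obtain i0 where i0: "i0 \<in> I" "A i0 d \<noteq> 0" by auto
  define B where "B i k = A i k - A i d / A i0 d * A i0 k" for i k
  have "d < card (I - {i0})" using Suc.prems(1,2) i0 by simp
  moreover have "B i k \<in> L" if "i \<in> I - {i0}" "k < d" for i k
   unfolding B_def using that i0 Suc.prems(3) by (intro R(5,6) subfield_divide[OF L]) auto
  ultimately obtain c where c: "\<forall>i. c i \<in> L" "\<exists>i\<in>I - {i0}. c i \<noteq> 0"
   "\<forall>k<d. (\<Sum>i\<in>I - {i0}. c i * B i k) = 0"
   using Suc.IH[of "I - {i0}" B] Suc.prems(1) by auto
  \<comment> \<open>The value of the eliminated unknown, solved from equation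
    \<open>d\<close>.\<close>
  define e where "e = - (\<Sum>i\<in>I - {i0}. c i * A i d) / A i0 d"
  define c' where "c' = (\<lambda>i. if i = i0 then e else c i)"
  have e: "e \<in> L" unfolding e_def
   using c(1) i0 Suc.prems(3) by (intro subfield_divide[OF L] R(3,6,8)) auto
  have split: "(\<Sum>i\<in>I. c' i * A i k) = e * A i0 k + (\<Sum>i\<in>I - {i0}. c i * A i k)" for k
   by (subst sum.remove[OF Suc.prems(1) i0(1)]) (simp add: c'_def)
  have "(\<Sum>i\<in>I. c' i * A i k) = 0" if k: "k < Suc d" for k
  proof (cases "k = d")
   case True
   then show ?thesis using i0 by (simp add: split e_def)
  next
   case False
   with k have "(\<Sum>i\<in>I - {i0}. c i * B i k) = 0" using c(3) by simp
   moreover have "(\<Sum>i\<in>I - {i0}. c i * B i k) =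
     (\<Sum>i\<in>I - {i0}. c i * A i k) - (\<Sum>i\<in>I - {i0}. c i * A i d) / A i0 d * A i0 k"
    by (simp add: B_def algebra_simps sum_subtractf sum_distrib_left sum_distrib_right sum_divide_distrib)
   ultimately show ?thesis by (simp add: split e_def algebra_simps)
  qed
  moreover have "\<forall>i. c' i \<in> L" using c(1) e by (simp add: c'_def)
  moreover have "\<exists>i\<in>I. c' i \<noteq> 0" using c(2) by (auto simp: c'_def)
  ultimately show ?thesis by blast
 qed
qed

section \<open>The Nullstellensatz\<close>

definition is_ideal :: "'a::comm_ring_1 set \<Rightarrow> bool" where
 "is_ideal J \<longleftrightarrow> 0 \<in> J \<and> (\<forall>x\<in>J. \<forall>y\<in>J. x + y \<in> J) \<and> (\<forall>x\<in>J. \<forall>r. r * x \<in> J)"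

lemma is_idealD:
 assumes "is_ideal J"
 shows "0 \<in> J" "x \<in> J ==> y \<in> J ==> x + y \<in> J" "x \<in> J ==> r * x \<in> J" "x \<in> J ==> x * r \<in> J"
  "x \<in> J ==> - x \<in> J" "x \<in> J ==> y \<in> J ==> x - y \<in> J"
  "(\<And>i. i \<in> S ==> f i \<in> J) ==> sum f S \<in> J"
proof -
 show 0: "0 \<in> J" and a: "x \<in> J ==> y \<in> J ==> x + y \<in> J" and m: "x \<in> J ==> r * x \<in> J" for x y r
  using assms by (auto simp: is_ideal_def)
 show "x \<in> J ==> x * r \<in> J" using m[of x r] by (simp add: mult.commute)
 show u: "x \<in> J ==> - x \<in> J" for x using m[of x "- 1"] by simp
 show "x \<in> J ==> y \<in> J ==> x - y \<in> J" using a[OF _ u, of x y] by simp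
 show "(\<And>i. i \<in> S ==> f i \<in> J) ==> sum f S \<in> J"
  by (induction S rule: infinite_finite_induct) (auto simp: 0 a)
qed

text \<open>Zorn's lemma. The last property says that the quotient by \<open>m\<close> is a field:
  \<open>m\<close> and \<open>x\<close> generate an ideal that is too large to avoid 1.\<close>

lemma maximal_ideal_exists:
 fixes J :: "'a::comm_ring_1 set"
 assumes "is_ideal J" "1 \<notin> J"
 obtains m where "is_ideal m" "J \<subseteq> m" "1 \<notin> m" "\<And>x. x \<notin> m ==> \<exists>y. 1 - x * y \<in> m"
proof -
 let ?I = "{I. is_ideal I \<and> J \<subseteq> I \<and> 1 \<notin> I}"
 have "\<exists>m\<in>?I. \<forall>X\<in>?I. m \<subseteq> X \<longrightarrow> X = m"
 proof (rule subset_Zorn_nonempty)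
  show "?I \<noteq> {}" using assms by auto
  fix C assume C: "C \<noteq> {}" "subset.chain ?I C"
  have C1: "is_ideal I" "J \<subseteq> I" "1 \<notin> I" if "I \<in> C" for I
   using that C(2) unfolding subset_chain_def by auto
  have C2: "I \<subseteq> I' \<or> I' \<subseteq> I" if "I \<in> C" "I' \<in> C" for I I'
   using that C(2) unfolding subset_chain_def by blast
  have "is_ideal (\<Union>C)"
   unfolding is_ideal_def
  proof (intro conjI ballI allI)
   show "0 \<in> \<Union>C" using C(1) is_idealD(1)[OF C1(1)] by blast
   fix x assume "x \<in> \<Union>C"
   then obtain I1 where 1: "x \<in> I1" "I1 \<in> C" by blast
   show "r * x \<in> \<Union>C" for r using is_idealD(3)[OF C1(1)[OF 1(2)] 1(1)] 1(2) by blast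
   fix y assume "y \<in> \<Union>C"
   then obtain I2 where 2: "y \<in> I2" "I2 \<in> C" by blast
   consider "x \<in> I2" | "y \<in> I1" using C2[OF 1(2) 2(2)] 1(1) 2(1) by blast
   then show "x + y \<in> \<Union>C"
    by cases (use is_idealD(2)[OF C1(1)[OF 1(2)]] is_idealD(2)[OF C1(1)[OF 2(2)]] 1 2 in blast)+
  qed
  moreover have "J \<subseteq> \<Union>C" "1 \<notin> \<Union>C" using C(1) C1(2,3) by blast+
  ultimately show "\<Union>C \<in> ?I" by simp
 qed
 then obtain m where mI: "m \<in> ?I" and mX: "\<forall>X\<in>?I. m \<subseteq> X \<longrightarrow> X = m" by (rule bexE)
 have m: "is_ideal m" "J \<subseteq> m" "1 \<notin> m" using mI by auto
 have max: "X = m" if "is_ideal X" "J \<subseteq> X" "1 \<notin> X" "m \<subseteq> X" for X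
  using bspec[OF mX, of X] that by simp
 have "\<exists>y. 1 - x * y \<in> m" if x: "x \<notin> m" for x
 proof -
  let ?X = "{u + x * y | u y. u \<in> m}"
  have X1: "is_ideal ?X"
   unfolding is_ideal_def
  proof (intro conjI ballI allI)
   have "0 = 0 + x * 0" by simp
   then show "0 \<in> ?X" using is_idealD(1)[OF m(1)] by blast
   fix p assume "p \<in> ?X"
   then obtain u y where p: "p = u + x * y" "u \<in> m" by auto
   have "r * p = r * u + x * (r * y)" for r using p by (simp add: algebra_simps)
   then show "r * p \<in> ?X" for r using is_idealD(3)[OF m(1) p(2), of r] by blast
   fix q assume "q \<in> ?X"
   then obtain v z where q: "q = v + x * z" "v \<in> m" by auto
   have "p + q = (u + v) + x * (y + z)" using p q by (simp add: algebra_simps)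
   then show "p + q \<in> ?X" using is_idealD(2)[OF m(1) p(2) q(2)] by blast
  qed
  have X2: "m \<subseteq> ?X"
  proof
   fix u assume "u \<in> m"
   moreover have "u = u + x * 0" by simp
   ultimately show "u \<in> ?X" by blast
  qed
  have X3: "x \<in> ?X"
  proof -
   have "x = 0 + x * 1" by simp
   then show ?thesis using is_idealD(1)[OF m(1)] by blast
  qed
  have "1 \<in> ?X"
  proof (rule ccontr)
   assume "1 \<notin> ?X"
   with X1 X2 m(2) have "?X = m" by (intro max) (blast intro: subset_trans)+
   with X3 x show False by metis
  qed
  then obtain u y where u: "1 = u + x * y" "u \<in> m" by auto
  have "1 - x * y = u" by (subst u(1)) simp
  then show ?thesis using u(2) by metis
 qed
 then show thesis using that m by blast
qed

text \<open>An exponent is determined by the finite list of its values below its degree, and lists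
  of naturals are countable. This is the countable dimension of the polynomial ring.\<close>

lemma exponents_countable: "\<exists>e :: nat \<Rightarrow> (nat \<Rightarrow>\<^sub>0 nat). surj e"
proof -
 have "\<mu> = Poly_Mapping.nth (map (Poly_Mapping.lookup \<mu>) [0..<Poly_Mapping.degree \<mu>])" for \<mu> :: "nat \<Rightarrow>\<^sub>0 nat"
  by (rule poly_mapping_eqI) (auto simp: nth_default_def beyond_degree_lookup_zero)
 then have "surj (Poly_Mapping.nth :: nat list \<Rightarrow> nat \<Rightarrow>\<^sub>0 nat)" by (rule surjI[OF sym])
 then have "surj (\<lambda>n. Poly_Mapping.nth (from_nat n :: nat list) :: nat \<Rightarrow>\<^sub>0 nat)"
  using comp_surj[OF surj_from_nat] by (auto simp: comp_def)
 then show ?thesis by blast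
qed

text \<open>The polynomial ring has countable dimension, whereas the inverses of \<open>z - c\<close> modulo a maximal
 ideal would form an uncountable linearly independent family if \<open>z\<close> were not constant.\<close>

lemma maximal_ideal_residue:
 fixes m :: "mpoly set"
 assumes m: "is_ideal m" "1 \<notin> m" and inv: "\<And>x. x \<notin> m ==> \<exists>y. 1 - x * y \<in> m"
 shows "\<exists>c. z - Const c \<in> m"
proof (rule ccontr)
 assume no: "\<nexists>c. z - Const c \<in> m"
 note C = rhomD[OF rhom_Const]
 have prime: "x * y \<notin> m" if nx: "x \<notin> m" and ny: "y \<notin> m" for x y
 proof
  assume xy: "x * y \<in> m"
  obtain u where u: "1 - x * u \<in> m" using inv[OF nx] by blast
  have "y = y * (1 - x * u) + u * (x * y)" by (simp add: algebra_simps)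
  then have "y \<in> m" using is_idealD(2,3)[OF m(1)] u xy by metis
  with ny show False by simp
 qed
 define ev where "ev h = poly (map_poly Const h) z" for h
 have ev_pCons: "ev (pCons b h) = Const b + z * ev h" for b h
  by (simp add: ev_def map_poly_pCons C)
 have ev0: "ev 0 = 0" by (simp add: ev_def)
 have ev_add: "ev (g + h) = ev g + ev h" for g h
 proof (induction g arbitrary: h)
  case 0 then show ?case by (simp add: ev0)
 next
  case (pCons b g)
  then show ?case by (cases h) (simp add: ev_pCons C algebra_simps)
 qed
 have ev_smult: "ev (smult b h) = Const b * ev h" for b h
  by (induction h) (simp_all add: ev0 ev_pCons C algebra_simps)
 have ev_mult: "ev (g * h) = ev g * ev h" for g h
  by (induction g) (simp_all add: ev0 ev_pCons ev_add ev_smult C algebra_simps)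
 have ev_lin: "ev [:- b, 1:] = z - Const b" for b
  by (simp add: ev_pCons ev0 C)
 \<comment> \<open>Over the complex numbers \<open>h\<close> splits into linear factors, whose
   images \<open>z - Const b\<close> avoid the prime ideal \<open>m\<close> by assumption. So
   \<open>z\<close> is transcendental modulo \<open>m\<close>.\<close>
 have nz: "h \<noteq> 0 ==> ev h \<notin> m" for h
 proof (induction "degree h" arbitrary: h)
  case 0
  then obtain b where b: "h = [:b:]" "b \<noteq> 0" by (metis degree_eq_zeroE pCons_0_0)
  have "Const (inverse b) * Const b = 1" using b by (simp add: C(4)[symmetric] C(2))
  then show ?case using is_idealD(3)[OF m(1), of "Const b" "Const (inverse b)"] m(2) b
   by (auto simp: ev_pCons ev0)
 next
  case (Suc n)
  then have "\<not> constant (poly h)" by (simp add: constant_degree)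
  then obtain b where "poly h b = 0" using fundamental_theorem_of_algebra by blast
  then obtain g where g: "h = [:- b, 1:] * g" by (metis poly_eq_0_iff_dvd dvdE)
  with Suc have "g \<noteq> 0" by auto
  then have "degree h = Suc (degree g)" using g by (simp add: degree_mult_eq del: mult_pCons_left)
  with Suc \<open>g \<noteq> 0\<close> have "ev g \<notin> m" by simp
  then show ?case unfolding g ev_mult ev_lin using prime no by blast
 qed
 have "\<forall>c. \<exists>w. 1 - (z - Const c) * w \<in> m" using inv no by blast
 then obtain w where w: "\<And>c. 1 - (z - Const c) * w c \<in> m" by metis
 obtain e :: "nat \<Rightarrow> (nat \<Rightarrow>\<^sub>0 nat)" where e: "surj e" using exponents_countable by blast
 have "\<exists>n. Poly_Mapping.keys (w c) \<subseteq> e ` {..<n}" for c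
 proof -
  obtain I where I: "finite I" "Poly_Mapping.keys (w c) = e ` I"
   using finite_subset_image[of "Poly_Mapping.keys (w c)" e UNIV] e by auto
  then obtain n where "I \<subseteq> {..<n}" using finite_nat_iff_bounded by blast
  then show ?thesis using I by blast
 qed
 then obtain n where n: "\<And>c. Poly_Mapping.keys (w c) \<subseteq> e ` {..<n c}" by metis
 \<comment> \<open>Each of the uncountably many inverses \<open>w c\<close> is supported on an
   initial segment of the monomials \<open>e\<close>. One length \<open>N\<close> occurs infinitely
   often, and \<open>N + 1\<close> of the corresponding inverses are linearly dependent.\<close>
 have "uncountable (UNIV :: complex set)"
  using uncountable_UNIV_real countable_image_inj_on[of complex_of_real UNIV]
  by (metis countable_image_inj_eq countable_subset inj_of_real subset_UNIV)
 moreover have "(UNIV :: complex set) = (\<Union>N. {c. n c = N})" by auto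
 ultimately obtain N where "\<not> countable {c. n c = N}"
  using countable_UN[of UNIV "\<lambda>N. {c. n c = N}"] by auto
 then have "infinite {c. n c = N}" using countable_finite by blast
 then obtain I where I: "finite I" "card I = Suc N" "I \<subseteq> {c. n c = N}"
  using infinite_arbitrarily_large by blast
 obtain l where l: "\<exists>c\<in>I. l c \<noteq> 0" "\<forall>k<N. (\<Sum>c\<in>I. l c * Poly_Mapping.lookup (w c) (e k)) = 0"
  using nontrivial_solution[OF subfield_UNIV I(1), of N "\<lambda>c k. Poly_Mapping.lookup (w c) (e k)"] I(2) by auto
 have lk: "Poly_Mapping.lookup (Const b * F) \<mu> = b * Poly_Mapping.lookup F \<mu>" for b F \<mu>
  by (simp add: Const_def mult_map_scale_conv_mult[symmetric] map.rep_eq when_def)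
 have "(\<Sum>c\<in>I. Const (l c) * w c) = 0"
 proof (rule poly_mapping_eqI)
  fix \<mu>
  show "Poly_Mapping.lookup (\<Sum>c\<in>I. Const (l c) * w c) \<mu> = Poly_Mapping.lookup 0 \<mu>"
  proof (cases "\<mu> \<in> e ` {..<N}")
   case True
   then show ?thesis using l(2) by (auto simp: lookup_sum lk)
  next
   case False
   then have "Poly_Mapping.lookup (w c) \<mu> = 0" if "c \<in> I" for c
   proof -
    have "n c = N" using I(3) that by auto
    then have "\<mu> \<notin> Poly_Mapping.keys (w c)" using n[of c] False by auto
    then show ?thesis by (simp add: in_keys_iff)
   qed
   then show ?thesis by (simp add: lookup_sum lk)
  qed
 qed
 \<comment> \<open>The dependence with the denominators \<open>z - c\<close> cleared. At
   \<open>c0\<close> every summand but one vanishes, so \<open>h\<close> is nonzero although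
   \<open>ev h\<close> lies in \<open>m\<close>.\<close>
 define h where "h = (\<Sum>c\<in>I. smult (l c) (\<Prod>d\<in>I - {c}. [:- d, 1:]))"
 have ev_sum: "ev (sum f S) = (\<Sum>i\<in>S. ev (f i))" for f and S :: "complex set"
  by (induction S rule: infinite_finite_induct) (auto simp: ev0 ev_add)
 have ev_prod: "ev (prod f S) = (\<Prod>i\<in>S. ev (f i))" for f and S :: "complex set"
  by (induction S rule: infinite_finite_induct) (auto simp: ev_mult ev_pCons ev0 C one_pCons)
 have "(\<Prod>d\<in>I. z - Const d) * (\<Sum>c\<in>I. Const (l c) * w c) = 
   (\<Sum>c\<in>I. Const (l c) * (\<Prod>d\<in>I - {c}. z - Const d) * ((z - Const c) * w c))"
  unfolding sum_distrib_left
  by (intro sum.cong refl, subst prod.remove[OF I(1)]) (auto simp: ac_simps)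
 then have "(\<Sum>c\<in>I. Const (l c) * (\<Prod>d\<in>I - {c}. z - Const d) * ((z - Const c) * w c)) = 0"
  using \<open>(\<Sum>c\<in>I. Const (l c) * w c) = 0\<close> by simp
 moreover have "ev h = (\<Sum>c\<in>I. Const (l c) * (\<Prod>d\<in>I - {c}. z - Const d))"
  by (simp add: h_def ev_sum ev_smult ev_prod ev_lin)
 ultimately have *: "ev h = (\<Sum>c\<in>I. Const (l c) * (\<Prod>d\<in>I - {c}. z - Const d) * (1 - (z - Const c) * w c))"
  unfolding right_diff_distrib sum_subtractf by simp
 have "ev h \<in> m"
  unfolding * by (intro is_idealD(7)[OF m(1)] is_idealD(3)[OF m(1)] w)
 moreover obtain c0 where c0: "c0 \<in> I" "l c0 \<noteq> 0" using l by blast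
 have "poly h c0 = (\<Sum>c\<in>I. if c = c0 then l c0 * (\<Prod>d\<in>I - {c0}. c0 - d) else 0)"
  unfolding h_def poly_sum
  by (intro sum.cong refl) (auto simp: poly_prod I c0 intro!: prod_zero)
 then have "poly h c0 \<noteq> 0" using c0 I by auto
 then have "h \<noteq> 0" by auto
 ultimately show False using nz by blast
qed

text \<open>Modulo a maximal ideal containing \<open>J\<close> every variable is congruent to a
  constant, and these constants form the common zero. The variables are infinite in number, which
  the cardinality argument tolerates.\<close>

theorem nullstellensatz:
 fixes J :: "mpoly set"
 assumes "is_ideal J" "1 \<notin> J"
 shows "\<exists>y. \<forall>F\<in>J. ceval y F = 0"
proof -
 obtain m where m: "is_ideal m" "J \<subseteq> m" "1 \<notin> m" and inv: "\<And>x. x \<notin> m ==> \<exists>y. 1 - x * y \<in> m"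
  using maximal_ideal_exists[OF assms] by blast
 have "\<exists>c. Var i - Const c \<in> m" for i
  by (rule maximal_ideal_residue[OF m(1,3)]) (rule inv)
 then obtain y where y: "\<And>i. Var i - Const (y i) \<in> m" by metis
 note C = rhomD[OF rhom_Const]
 have *: "F - Const (ceval y F) \<in> m" for F
 proof (induction F rule: mpoly_induct)
  case (add F G)
  have *: "F + G - Const (ceval y (F + G)) = (F - Const (ceval y F)) + (G - Const (ceval y G))"
   by (simp add: peval_simps C)
  show ?case unfolding * by (rule is_idealD(2)[OF m(1) add])
 next
  case (mult F G)
  have *: "F * G - Const (ceval y (F * G)) = G * (F - Const (ceval y F)) + Const (ceval y F) * (G - Const (ceval y G))"
   by (simp add: peval_simps C algebra_simps)
  show ?case unfolding * by (intro is_idealD(2)[OF m(1)] is_idealD(3)[OF m(1)] mult)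
 qed (use y is_idealD(1)[OF m(1)] in auto)
 have "ceval y F = 0" if "F \<in> J" for F
 proof (rule ccontr)
  assume nz: "ceval y F \<noteq> 0"
  have "F \<in> m" using that m by auto
  have "Const (ceval y F) = F - (F - Const (ceval y F))" by simp
  then have "Const (ceval y F) \<in> m" using is_idealD(6)[OF m(1) \<open>F \<in> m\<close> *] by metis
  then have "Const (inverse (ceval y F)) * Const (ceval y F) \<in> m" using is_idealD(3)[OF m(1)] by blast
  then show False using m nz by (simp add: C(4)[symmetric] C(2))
 qed
 then show ?thesis by blast
qed

section \<open>Embedded varieties\<close>

text \<open>An irreducible projective variety, given by the values \<open>s i\<close> of the homogeneous coordinates at the
 generic point and by coordinate vectors \<open>a p\<close> of its closed points. The points are only labels, so
 that one variety can be studied in several embeddings.\<close>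

locale model =
 fixes sc :: "complex \<Rightarrow> 'k::field" and s :: "nat \<Rightarrow> 'k" and M :: nat
  and Pts :: "point set" and a :: "point \<Rightarrow> nat \<Rightarrow> complex" and Ov :: "point \<Rightarrow> 'k set"
 assumes sc: "rhom sc"
  and s_supp: "i > M ==> s i = 0"
  and a_supp: "p \<in> Pts ==> i > M ==> a p i = 0"
  and a_ne: "p \<in> Pts ==> \<exists>i. a p i \<noteq> 0"
  and Ov: "p \<in> Pts ==> Ov p = {peval sc s F / peval sc s G | F G.
        (\<exists>d. homogeneous d F \<and> homogeneous d G) \<and> ceval (a p) G \<noteq> 0}"
  and vanish: "homogeneous d F ==> peval sc s F = 0 \<longleftrightarrow> (\<forall>p\<in>Pts. ceval (a p) F = 0)"
  and closed: "[|\<exists>i. b i \<noteq> 0; \<And>i. i > M ==> b i = 0;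
        \<And>d F. homogeneous d F ==> peval sc s F = 0 ==> ceval b F = 0|]
        ==> \<exists>p\<in>Pts. \<exists>c. c \<noteq> 0 \<and> b = (\<lambda>i. c * a p i)"
  and inj: "[|p \<in> Pts; q \<in> Pts; c \<noteq> 0; a p = (\<lambda>i. c * a q i)|] ==> p = q"
  and frac: "\<exists>d F G. homogeneous d F \<and> homogeneous d G \<and> peval sc s G \<noteq> 0 \<and>
        f = peval sc s F / peval sc s G"
  and ne: "Pts \<noteq> {}"
begin

abbreviation E :: "mpoly \<Rightarrow> 'k" where "E \<equiv> peval sc s"

lemmas E_simps = peval_simps[OF sc]
lemmas ce_simps = peval_simps[OF rhom_id]
lemmas sc_simps = rhomD[OF sc]

lemma sc_inj: "sc x = sc y \<longleftrightarrow> x = y"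
proof
 assume "sc x = sc y"
 then have "sc (x - y) = 0" by (simp add: sc_simps)
 then have "sc (x - y) * sc (inverse (x - y)) = 0" by simp
 then have "sc ((x - y) * inverse (x - y)) = 0" by (simp only: sc_simps)
 then show "x = y" by (cases "x = y") (auto simp: sc_simps)
qed simp

lemma sc_0_iff [simp]: "sc x = 0 \<longleftrightarrow> x = 0"
 using sc_inj[of x 0] by (simp add: sc_simps)

lemma E_nz: "p \<in> Pts ==> homogeneous d G ==> ceval (a p) G \<noteq> 0 ==> E G \<noteq> 0"
 using vanish by blast

lemma Ov_I: "p \<in> Pts ==> homogeneous d F ==> homogeneous d G ==> ceval (a p) G \<noteq> 0 ==> E F / E G \<in> Ov p"
 using Ov by blast

lemma Ov_E:
 assumes "p \<in> Pts" "f \<in> Ov p"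
 obtains d F G where "homogeneous d F" "homogeneous d G" "ceval (a p) G \<noteq> 0" "f = E F / E G" "E G \<noteq> 0"
 using assms Ov E_nz by blast

lemma sc_in_Ov: "p \<in> Pts ==> sc c \<in> Ov p"
 using Ov_I[of p 0 "Const c" 1] by (simp add: sc E_simps ce_simps)

lemma Ov_ring: assumes p: "p \<in> Pts" shows "subring1 (Ov p)"
 unfolding subring1_def
proof (intro conjI ballI)
 show "1 \<in> Ov p" using sc_in_Ov[OF p, of 1] by (simp add: sc_simps)
 fix x y assume "x \<in> Ov p" "y \<in> Ov p"
 then obtain d F G d' F' G' where 1: "homogeneous d F" "homogeneous d G" "ceval (a p) G \<noteq> 0" "x = E F / E G" "E G \<noteq> 0"
  and 2: "homogeneous d' F'" "homogeneous d' G'" "ceval (a p) G' \<noteq> 0" "y = E F' / E G'" "E G' \<noteq> 0"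
  by (metis Ov_E[OF p])
 have h: "homogeneous (d + d') (G * G')" "homogeneous (d + d') (F * F')" "homogeneous (d + d') (F * G' - F' * G)"
  using homogeneous_mult[OF 1(2) 2(2)] homogeneous_mult[OF 1(1) 2(1)]
   homogeneous_diff[OF homogeneous_mult[OF 1(1) 2(2)], of "F' * G"] homogeneous_mult[OF 2(1) 1(2)]
  by (auto simp: add.commute)
 have c: "ceval (a p) (G * G') \<noteq> 0" using 1 2 by (simp add: ce_simps)
 have "x - y = E (F * G' - F' * G) / E (G * G')" "x * y = E (F * F') / E (G * G')"
  unfolding 1(4) 2(4) using 1(5) 2(5) by (simp_all add: E_simps field_simps)
 then show "x - y \<in> Ov p" "x * y \<in> Ov p" using Ov_I[OF p h(3) h(1) c] Ov_I[OF p h(2) h(1) c] by simp_all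
qed

lemmas Ov_simps = subring1D[OF Ov_ring]

definition val :: "point \<Rightarrow> 'k \<Rightarrow> complex" where
 "val p f = (THE c. f - sc c \<in> max_ideal (Ov p))"

text \<open>If \<open>F\<close> vanishes at \<open>p\<close> and the inverse were
  \<open>E F' / E G'\<close>, then \<open>G * G' - F * F'\<close> would vanish on the whole variety
  but not at \<open>p\<close>.\<close>

lemma max_ideal_frac:
 assumes p: "p \<in> Pts" and F: "homogeneous d F" "homogeneous d G" "ceval (a p) G \<noteq> 0"
 shows "E F / E G \<in> max_ideal (Ov p) \<longleftrightarrow> ceval (a p) F = 0"
proof -
 have G: "E G \<noteq> 0" using E_nz[OF p F(2,3)] .
 have "inverse (E F / E G) \<notin> Ov p" if z: "ceval (a p) F = 0" and nz: "E F \<noteq> 0"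
 proof
  assume "inverse (E F / E G) \<in> Ov p"
  then have "E G / E F \<in> Ov p" by simp
  then obtain d' F' G' where 2: "homogeneous d' F'" "homogeneous d' G'" "ceval (a p) G' \<noteq> 0"
   "E G / E F = E F' / E G'" "E G' \<noteq> 0" by (metis Ov_E[OF p])
  then have "E (G * G' - F * F') = 0" using nz by (simp add: E_simps field_simps)
  moreover have "homogeneous (d + d') (G * G' - F * F')"
   by (intro homogeneous_diff homogeneous_mult F 2)
  ultimately have "ceval (a p) (G * G' - F * F') = 0" using vanish p by blast
  then show False using z 2 F by (simp add: ce_simps)
 qed
 moreover have "inverse (E F / E G) \<in> Ov p" if "ceval (a p) F \<noteq> 0"
  using Ov_I[OF p F(2,1) that] by simp
 moreover have "ceval (a p) F = 0" if "E F = 0" using vanish[OF F(1)] p that by blast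
 moreover have "E F / E G \<in> Ov p" using Ov_I[OF p F] .
 ultimately show ?thesis unfolding max_ideal_def using G by auto
qed

text \<open>Makes the definite description in \<open>val\<close> meaningful: the residue field
  consists of the constants.\<close>

lemma val_frac:
 assumes p: "p \<in> Pts" and F: "homogeneous d F" "homogeneous d G" "ceval (a p) G \<noteq> 0"
 shows "val p (E F / E G) = ceval (a p) F / ceval (a p) G"
proof -
 have "E F / E G - sc c \<in> max_ideal (Ov p) \<longleftrightarrow> c = ceval (a p) F / ceval (a p) G" for c
 proof -
  have "E F / E G - sc c = E (F - Const c * G) / E G"
   using E_nz[OF p F(2,3)] by (simp add: E_simps sc field_simps)
  moreover have "homogeneous d (F - Const c * G)" by (intro homogeneous_diff homogeneous_smult F)
  ultimately have "E F / E G - sc c \<in> max_ideal (Ov p) \<longleftrightarrow> ceval (a p) (F - Const c * G) = 0"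
   using max_ideal_frac[OF p _ F(2,3)] by metis
  then show ?thesis using F(3) by (auto simp: ce_simps field_simps)
 qed
 then show ?thesis unfolding val_def by auto
qed

lemma val_ops:
 assumes p: "p \<in> Pts" and x: "x \<in> Ov p" and y: "y \<in> Ov p"
 shows "val p (x + y) = val p x + val p y" "val p (x * y) = val p x * val p y"
proof -
 obtain d F G d' F' G' where 1: "homogeneous d F" "homogeneous d G" "ceval (a p) G \<noteq> 0" "x = E F / E G" "E G \<noteq> 0"
  and 2: "homogeneous d' F'" "homogeneous d' G'" "ceval (a p) G' \<noteq> 0" "y = E F' / E G'" "E G' \<noteq> 0"
  using x y by (metis Ov_E[OF p])
 have h: "homogeneous (d + d') (G * G')" "homogeneous (d + d') (F * F')" "homogeneous (d + d') (F * G' + F' * G)"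
  using homogeneous_mult[OF 1(2) 2(2)] homogeneous_mult[OF 1(1) 2(1)]
   homogeneous_add[OF homogeneous_mult[OF 1(1) 2(2)], of "F' * G"] homogeneous_mult[OF 2(1) 1(2)]
  by (auto simp: add.commute)
 have c: "ceval (a p) (G * G') \<noteq> 0" using 1 2 by (simp add: ce_simps)
 have e: "x + y = E (F * G' + F' * G) / E (G * G')" "x * y = E (F * F') / E (G * G')"
  unfolding 1(4) 2(4) using 1(5) 2(5) by (simp_all add: E_simps field_simps)
 have v: "val p x = ceval (a p) F / ceval (a p) G" "val p y = ceval (a p) F' / ceval (a p) G'"
  unfolding 1(4) 2(4) using val_frac[OF p 1(1-3)] val_frac[OF p 2(1-3)] by simp_all
 show "val p (x + y) = val p x + val p y"
  unfolding e(1) val_frac[OF p h(3,1) c] v using 1(3) 2(3) by (simp add: ce_simps field_simps)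
 show "val p (x * y) = val p x * val p y"
  unfolding e(2) val_frac[OF p h(2,1) c] v using 1(3) 2(3) by (simp add: ce_simps field_simps)
qed

lemma val_sc [simp]: "p \<in> Pts ==> val p (sc c) = c"
 using val_frac[of p 0 "Const c" 1] by (simp add: sc E_simps ce_simps)

lemma val_0 [simp]: "p \<in> Pts ==> val p 0 = 0" and val_1 [simp]: "p \<in> Pts ==> val p 1 = 1"
 using val_sc[of p 0] val_sc[of p 1] by (simp_all add: sc_simps)

lemma val_uminus: "p \<in> Pts ==> x \<in> Ov p ==> val p (- x) = - val p x"
 using val_ops(1)[of p x "- x"] by (simp add: Ov_simps eq_neg_iff_add_eq_0 add.commute)

lemma val_diff: "p \<in> Pts ==> x \<in> Ov p ==> y \<in> Ov p ==> val p (x - y) = val p x - val p y"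
 using val_ops(1)[of p x "- y"] by (simp add: Ov_simps val_uminus)

lemma val_sum: "p \<in> Pts ==> (\<And>i. i \<in> S ==> f i \<in> Ov p) ==> val p (sum f S) = (\<Sum>i\<in>S. val p (f i))"
 by (induction S rule: infinite_finite_induct) (auto simp: val_ops Ov_simps)

lemma val_power: "p \<in> Pts ==> x \<in> Ov p ==> val p (x ^ n) = val p x ^ n"
 by (induction n) (auto simp: val_ops Ov_simps)

lemma max_ideal_iff: 
 assumes p: "p \<in> Pts" shows "f \<in> max_ideal (Ov p) \<longleftrightarrow> f \<in> Ov p \<and> val p f = 0"
proof (cases "f \<in> Ov p")
 case True
 then obtain d F G where 1: "homogeneous d F" "homogeneous d G" "ceval (a p) G \<noteq> 0" "f = E F / E G" "E G \<noteq> 0"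
  by (metis Ov_E[OF p])
 then show ?thesis using max_ideal_frac[OF p 1(1-3)] val_frac[OF p 1(1-3)] True by simp
qed (simp add: max_ideal_def)

text \<open>The units of the local ring at \<open>p\<close>; \<open>isu_iff\<close> gives the usual
  form.\<close>

definition isu :: "point \<Rightarrow> 'k \<Rightarrow> bool" where
 "isu p f \<longleftrightarrow> f \<in> Ov p \<and> val p f \<noteq> 0"

lemma isu_nz: "p \<in> Pts ==> isu p f ==> f \<noteq> 0"
 by (auto simp: isu_def)

lemma isu_inverse: assumes p: "p \<in> Pts" "isu p f" shows "isu p (inverse f)" "val p (inverse f) = inverse (val p f)"
proof -
 have f: "f \<in> Ov p" "val p f \<noteq> 0" using p by (auto simp: isu_def)
 then have "f \<noteq> 0" using p by auto
 have "inverse f \<in> Ov p" using f max_ideal_iff[OF p(1), of f] unfolding max_ideal_def by auto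
 moreover have "val p f * val p (inverse f) = 1"
  using val_ops(2)[OF p(1) f(1) calculation] \<open>f \<noteq> 0\<close> p(1) by simp
 ultimately show "isu p (inverse f)" "val p (inverse f) = inverse (val p f)"
  by (auto simp: isu_def inverse_unique)
qed

lemma isu_iff: "p \<in> Pts ==> isu p f \<longleftrightarrow> f \<noteq> 0 \<and> f \<in> Ov p \<and> inverse f \<in> Ov p"
 using isu_inverse[of p f] isu_nz[of p f] val_ops(2)[of p f "inverse f"] by (auto simp: isu_def)

lemma isu_mult: "p \<in> Pts ==> isu p f ==> isu p g ==> isu p (f * g)"
 by (auto simp: isu_def Ov_simps val_ops)

lemma isu_divide: "p \<in> Pts ==> isu p f ==> isu p g ==> isu p (f / g)"
 by (simp add: divide_inverse isu_mult isu_inverse)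

lemma isu_1: "p \<in> Pts ==> isu p 1"
 by (simp add: isu_def Ov_simps)

lemma isu_power: "p \<in> Pts ==> isu p f ==> isu p (f ^ n)"
 by (induction n) (auto simp: isu_mult isu_1)

lemma isu_powi: "p \<in> Pts ==> isu p f ==> isu p (f powi n)"
 by (simp add: power_int_def isu_power isu_inverse)

lemma isu_divide_commute: "p \<in> Pts ==> isu p (f / g) ==> isu p (g / f)"
 using isu_inverse(1)[of p "f / g"] by simp

lemma val_peval:
 assumes p: "p \<in> Pts" and g: "\<And>i. g i \<in> Ov p"
 shows "peval sc g P \<in> Ov p" "val p (peval sc g P) = ceval (\<lambda>i. val p (g i)) P"
proof -
 have "peval sc g P \<in> Ov p \<and> val p (peval sc g P) = ceval (\<lambda>i. val p (g i)) P"
  by (induction P rule: mpoly_induct) (auto simp: sc E_simps ce_simps val_ops p g Ov_simps sc_in_Ov)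
 then show "peval sc g P \<in> Ov p" "val p (peval sc g P) = ceval (\<lambda>i. val p (g i)) P" by auto
qed

lemma s_ne: "p \<in> Pts ==> a p j \<noteq> 0 ==> s j \<noteq> 0"
 using E_nz[of p 1 "Var j"] by (simp add: sc)

lemma a_le: "p \<in> Pts ==> a p j \<noteq> 0 ==> j \<le> M"
 using a_supp not_less by blast

lemma val_ratio: assumes "p \<in> Pts" "a p j \<noteq> 0" shows "s i / s j \<in> Ov p" "val p (s i / s j) = a p i / a p j"
 using assms Ov_I[of p 1 "Var i" "Var j"] val_frac[of p 1 "Var i" "Var j"] by (auto simp: sc)

lemma E_dehom: "s j \<noteq> 0 ==> homogeneous d G ==> E G = s j ^ d * peval sc (\<lambda>i. s i / s j) G"
 using peval_scale[OF sc, of d G "s j" "\<lambda>i. s i / s j"] by simp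

text \<open>A homomorphism from the algebra generated by the \<open>g i\<close> to the complex numbers is the evaluation
 at a vector \<open>y\<close> satisfying all polynomial relations between the \<open>g i\<close>.\<close>

lemma affine_point:
 assumes j: "s j \<noteq> 0" and T: "\<And>i. peval sc g (T i) = s i / s j"
  and y: "\<And>P. peval sc g P = 0 ==> ceval y P = 0"
 obtains p where "p \<in> Pts" "a p j \<noteq> 0"
  "\<And>d G. homogeneous d G ==> ceval (a p) G = a p j ^ d * ceval y (psubst T G)"
  "\<And>d G. homogeneous d G ==> E G = s j ^ d * peval sc g (psubst T G)"
proof -
 define b where "b i = ceval y (T i)" for i
 have bG: "ceval b G = ceval y (psubst T G)" for G
  by (simp add: peval_psubst b_def[abs_def])
 have EG: "E G = s j ^ d * peval sc g (psubst T G)" if "homogeneous d G" for d G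
  using E_dehom[OF j that] by (simp add: peval_psubst sc T)
 have "peval sc g (T j - 1) = 0" using T[of j] j by (simp add: E_simps)
 then have bj: "b j = 1" using y[of "T j - 1"] by (simp add: b_def ce_simps)
 have "b i = 0" if "i > M" for i using y[of "T i"] T[of i] s_supp[OF that] by (simp add: b_def)
 moreover have "ceval b F = 0" if "homogeneous d F" "E F = 0" for d F
  unfolding bG using EG[OF that(1)] that(2) j by (intro y) simp
 ultimately obtain p c where p: "p \<in> Pts" "c \<noteq> 0" "b = (\<lambda>i. c * a p i)"
  using closed[of b] bj by (metis zero_neq_one)
 have cj: "c * a p j = 1" using p(3) bj by metis
 have pG: "ceval (a p) G = a p j ^ d * ceval y (psubst T G)" if "homogeneous d G" for d G
  unfolding bG[symmetric] p(3) peval_scale[OF rhom_id that]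
  using cj by (simp add: mult.assoc[symmetric] power_mult_distrib[symmetric] mult.commute)
 have "a p j \<noteq> 0" using cj by auto
 then show thesis by (rule that[OF p(1) _ pG EG])
qed

text \<open>The denominators of \<open>f\<close>, taken in the coordinate ring of the affine set
  where \<open>F\<close> is nonzero, form an ideal without zeros, so 1 is a denominator. The factor
  \<open>Var j\<close> of \<open>F\<close> places this open set inside one standard chart.\<close>

lemma regular_on_basic_open:
 assumes F': "homogeneous d' F'" and F: "F = Var j * F'" "E F \<noteq> 0"
  and f: "\<And>q. q \<in> Pts ==> ceval (a q) F \<noteq> 0 ==> f \<in> Ov q"
 obtains N G where "homogeneous (N * Suc d') G" "f = E G / E F ^ N"
proof -
 have hF: "homogeneous (Suc d') F" using homogeneous_mult[OF homogeneous_Var(1)[of j] F'] F by simp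
 have j: "s j \<noteq> 0" "E F' \<noteq> 0" using F by (auto simp: E_simps sc)
 \<comment> \<open>Rabinowitsch's device: the additional variable \<open>Suc M\<close> stands for
   the inverse of the dehomogenized \<open>F\<close>, so that every zero found later is a point with
   \<open>F\<close> nonzero.\<close>
 define g where "g i = (if i = Suc M then s j ^ Suc d' / E F else s i / s j)" for i
 define T where "T i = (if i \<le> M then Var i else 0)" for i
 have T: "peval sc g (T i) = s i / s j" for i
  by (auto simp: T_def g_def sc s_supp)
 have gA: "\<exists>N G. homogeneous (N * Suc d') G \<and> peval sc g Q = E G / E F ^ N" for Q
 proof (induction Q rule: mpoly_induct)
  case (Const c)
  show ?case by (rule exI[of _ 0], rule exI[of _ "Const c"]) (simp add: sc)
 next
  case (Var i)
  consider "i \<le> M" | "i = Suc M" | "i > Suc M" by linarith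
  then show ?case
  proof cases
   case 1
   have "homogeneous (1 * Suc d') (Var i * F')" using homogeneous_mult[OF homogeneous_Var(1)[of i] F'] by simp
   moreover have "peval sc g (Var i) = E (Var i * F') / E F ^ 1"
    using 1 j by (simp add: sc g_def F E_simps)
   ultimately show ?thesis by blast
  next
   case 2
   have "homogeneous (1 * Suc d') (Var j ^ Suc d')"
    using homogeneous_power[OF homogeneous_Var(1)[of j], of "Suc d'"] by simp
   moreover have "peval sc g (Var i) = E (Var j ^ Suc d') / E F ^ 1"
    using 2 by (simp add: sc g_def E_simps)
   ultimately show ?thesis by blast
  next
   case 3
   then show ?thesis by (intro exI[of _ 0]) (auto simp: sc g_def s_supp intro!: exI[of _ 0])
  qed
 next
  case (add P Q)
  then obtain N1 G1 N2 G2 where 1: "homogeneous (N1 * Suc d') G1" "peval sc g P = E G1 / E F ^ N1"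
   and 2: "homogeneous (N2 * Suc d') G2" "peval sc g Q = E G2 / E F ^ N2" by blast
  have "homogeneous ((N1 + N2) * Suc d') (G1 * F ^ N2 + G2 * F ^ N1)"
   using homogeneous_mult[OF 1(1) homogeneous_power[OF hF, of N2]]
    homogeneous_mult[OF 2(1) homogeneous_power[OF hF, of N1]]
   by (intro homogeneous_add) (simp_all add: algebra_simps)
  moreover have "peval sc g (P + Q) = E (G1 * F ^ N2 + G2 * F ^ N1) / E F ^ (N1 + N2)"
   using 1 2 F(2) by (simp add: E_simps add_frac_eq power_add)
  ultimately show ?case by blast
 next
  case (mult P Q)
  then obtain N1 G1 N2 G2 where 1: "homogeneous (N1 * Suc d') G1" "peval sc g P = E G1 / E F ^ N1"
   and 2: "homogeneous (N2 * Suc d') G2" "peval sc g Q = E G2 / E F ^ N2" by blast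
  have "homogeneous ((N1 + N2) * Suc d') (G1 * G2)"
   using homogeneous_mult[OF 1(1) 2(1)] by (simp add: algebra_simps)
  moreover have "peval sc g (P * Q) = E (G1 * G2) / E F ^ (N1 + N2)"
   using 1 2 by (simp add: E_simps power_add)
  ultimately show ?case by blast
 qed
 \<comment> \<open>The ideal of denominators of \<open>f\<close>; it contains all polynomial
   relations between the \<open>g i\<close>.\<close>
 define J where "J = {P. \<exists>Q. peval sc g P * f = peval sc g Q}"
 have "1 \<in> J"
 proof (rule ccontr)
  assume n1: "1 \<notin> J"
  have "is_ideal J"
   unfolding is_ideal_def
  proof (intro conjI ballI allI)
   show "0 \<in> J" unfolding J_def by (auto intro!: exI[of _ 0])
   fix P assume "P \<in> J"
   then obtain P' where P: "peval sc g P * f = peval sc g P'" by (auto simp: J_def)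
   have "peval sc g (r * P) * f = peval sc g (r * P')" for r by (simp add: E_simps P mult.assoc)
   then show "r * P \<in> J" for r unfolding J_def by blast
   fix Q assume "Q \<in> J"
   then obtain Q' where Q: "peval sc g Q * f = peval sc g Q'" by (auto simp: J_def)
   have "peval sc g (P + Q) * f = peval sc g (P' + Q')" by (simp add: E_simps P Q distrib_right)
   then show "P + Q \<in> J" unfolding J_def by blast
  qed
  then obtain y where y: "\<And>P. P \<in> J ==> ceval y P = 0" using nullstellensatz n1 by blast
  have y0: "ceval y P = 0" if "peval sc g P = 0" for P
  proof (rule y)
   have "peval sc g P * f = peval sc g 0" using that by simp
   then show "P \<in> J" unfolding J_def by blast
  qed
  obtain p where p: "p \<in> Pts" "a p j \<noteq> 0"
   and pG: "\<And>d G. homogeneous d G ==> ceval (a p) G = a p j ^ d * ceval y (psubst T G)"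
   and EG: "\<And>d G. homogeneous d G ==> E G = s j ^ d * peval sc g (psubst T G)"
   using affine_point[OF j(1) T y0] by blast
  have "peval sc g (Var (Suc M) * psubst T F - 1) = 0"
   using EG[OF hF] F j by (simp add: E_simps sc g_def field_simps)
  then have "ceval y (Var (Suc M)) * ceval y (psubst T F) = 1" using y0 by (fastforce simp: ce_simps)
  then have "ceval (a p) F \<noteq> 0" using pG[OF hF] p(2) by auto
  then have "f \<in> Ov p" using f p by blast
  then obtain d A B where AB: "homogeneous d A" "homogeneous d B" "ceval (a p) B \<noteq> 0" "f = E A / E B" "E B \<noteq> 0"
   by (metis Ov_E[OF p(1)])
  have "peval sc g (psubst T B) * f = peval sc g (psubst T A)"
   using AB(5) j unfolding AB(4) EG[OF AB(1)] EG[OF AB(2)] by (simp add: field_simps)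
  then have "ceval y (psubst T B) = 0" by (intro y) (auto simp: J_def)
  then show False using AB(3) pG[OF AB(2)] by simp
 qed
 then obtain Q where "f = peval sc g Q" by (auto simp: J_def sc)
 then show thesis using gA[of Q] that by blast
qed

text \<open>In a chart where no finite set sufficed, the forms \<open>H p\<close> together with the
  relations would generate a proper ideal. Its zero is a point \<open>p\<close> of the variety at
  which its own form \<open>H p\<close> vanishes.\<close>

lemma quasi_compact:
 assumes H: "\<And>p. p \<in> Pts ==> homogeneous (dd p) (H p) \<and> ceval (a p) (H p) \<noteq> 0"
 obtains Q where "finite Q" "Q \<subseteq> Pts" "\<And>q. q \<in> Pts ==> \<exists>p\<in>Q. ceval (a q) (H p) \<noteq> 0"
proof -
 have "\<exists>Q. finite Q \<and> Q \<subseteq> Pts \<and> (\<forall>q\<in>Pts. a q j \<noteq> 0 \<longrightarrow> (\<exists>p\<in>Q. ceval (a q) (H p) \<noteq> 0))" for j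
 proof (cases "s j = 0")
  case True
  then show ?thesis using s_ne by (intro exI[of _ "{}"]) auto
 next
  case j: False
  define g where "g i = s i / s j" for i
  define J where "J = {P. \<exists>Q R. finite Q \<and> Q \<subseteq> Pts \<and> peval sc g P = peval sc g (\<Sum>p\<in>Q. R p * H p)}"
  have HJ: "R * H p \<in> J" if "p \<in> Pts" for p R
   unfolding J_def using that by (auto intro!: exI[of _ "{p}"] exI[of _ "\<lambda>_. R"])
  have "is_ideal J"
   unfolding is_ideal_def
  proof (intro conjI ballI allI)
   show "0 \<in> J" unfolding J_def by (auto intro!: exI[of _ "{}"])
   fix P assume "P \<in> J"
   then obtain Q R where P: "finite Q" "Q \<subseteq> Pts" "peval sc g P = peval sc g (\<Sum>p\<in>Q. R p * H p)" by (auto simp: J_def)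
   have "peval sc g (r * P) = peval sc g (\<Sum>p\<in>Q. (r * R p) * H p)" for r
    by (simp add: peval_mult[OF sc] P peval_sum[OF sc] sum_distrib_left mult.assoc)
   then show "r * P \<in> J" for r unfolding J_def using P(1,2) by (intro CollectI exI[of _ Q] exI[of _ "\<lambda>p. r * R p"]) blast
   fix P' assume "P' \<in> J"
   then obtain Q' R' where P': "finite Q'" "Q' \<subseteq> Pts" "peval sc g P' = peval sc g (\<Sum>p\<in>Q'. R' p * H p)" by (auto simp: J_def)
   define R1 where "R1 p = (if p \<in> Q then R p else 0)" for p
   define R2 where "R2 p = (if p \<in> Q' then R' p else 0)" for p
   have "(\<Sum>p\<in>Q. R p * H p) = (\<Sum>p\<in>Q \<union> Q'. R1 p * H p)"
    "(\<Sum>p\<in>Q'. R' p * H p) = (\<Sum>p\<in>Q \<union> Q'. R2 p * H p)"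
    using P(1) P'(1) by (auto intro!: sum.mono_neutral_cong_left simp: R1_def R2_def)
   then have "peval sc g (P + P') = peval sc g (\<Sum>p\<in>Q \<union> Q'. (R1 p + R2 p) * H p)"
    by (simp add: peval_add[OF sc] P(3) P'(3) distrib_right sum.distrib)
   then show "P + P' \<in> J" unfolding J_def using P(1,2) P'(1,2)
    by (intro CollectI exI[of _ "Q \<union> Q'"] exI[of _ "\<lambda>p. R1 p + R2 p"]) blast
  qed
  have "1 \<in> J"
  proof (rule ccontr)
   assume "1 \<notin> J"
   then obtain y where y: "\<And>P. P \<in> J ==> ceval y P = 0" using nullstellensatz \<open>is_ideal J\<close> by blast
   have y0: "ceval y P = 0" if "peval sc g P = 0" for P
    by (rule y) (use that in \<open>auto simp: J_def intro!: exI[of _ "{}"]\<close>)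
   have gV: "peval sc g (Var i) = s i / s j" for i by (simp add: sc g_def)
   obtain p where p: "p \<in> Pts" "a p j \<noteq> 0"
    and pG: "\<And>d G. homogeneous d G ==> ceval (a p) G = a p j ^ d * ceval y (psubst Var G)"
    using affine_point[OF j gV y0] by metis
   have "ceval y (H p) = 0" using y HJ[OF p(1), of 1] by simp
   then have "ceval (a p) (H p) = 0" using pG[of "dd p" "H p"] H[OF p(1)] by (simp add: peval_psubst)
   then show False using H p by blast
  qed
  then obtain Q R where Q: "finite Q" "Q \<subseteq> Pts" "1 = peval sc g (\<Sum>p\<in>Q. R p * H p)" by (auto simp: J_def sc)
  have "\<exists>p\<in>Q. ceval (a q) (H p) \<noteq> 0" if q: "q \<in> Pts" "a q j \<noteq> 0" for q
  proof (rule ccontr)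
   assume "\<not> ?thesis"
   then have z: "ceval (a q) (H p) = 0" if "p \<in> Q" for p using that by blast
   have gi: "g i \<in> Ov q" "val q (g i) = a q i / a q j" for i using val_ratio[OF q] by (auto simp: g_def)
   have "ceval (\<lambda>i. a q i / a q j) (H p) = 0" if "p \<in> Q" for p
   proof -
    have "homogeneous (dd p) (H p)" using H that Q by blast
    from peval_scale[OF rhom_id this, of "inverse (a q j)" "a q"] show ?thesis
     using z[OF that] by (simp add: divide_inverse mult.commute)
   qed
   then have "ceval (\<lambda>i. a q i / a q j) (\<Sum>p\<in>Q. R p * H p) = 0" by (simp add: ce_simps)
   then have "val q (peval sc g (\<Sum>p\<in>Q. R p * H p)) = 0"
    using val_peval(2)[OF q(1) gi(1)] by (simp add: gi(2))
   then show False unfolding Q(3)[symmetric] using q by simp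
  qed
  then show ?thesis using Q by blast
 qed
 then obtain Q where Q: "\<And>j. finite (Q j)" "\<And>j. Q j \<subseteq> Pts"
  "\<And>j q. q \<in> Pts ==> a q j \<noteq> 0 ==> (\<exists>p\<in>Q j. ceval (a q) (H p) \<noteq> 0)" by metis
 show thesis
 proof (rule that[of "\<Union>j\<le>M. Q j"])
  show "finite (\<Union>j\<le>M. Q j)" using Q by auto
  show "(\<Union>j\<le>M. Q j) \<subseteq> Pts" using Q by auto
  fix q assume q: "q \<in> Pts"
  then obtain j where "a q j \<noteq> 0" "j \<le> M" using a_ne a_le by blast
  then show "\<exists>p\<in>(\<Union>j\<le>M. Q j). ceval (a q) (H p) \<noteq> 0" using Q(3)[OF q] by blast
 qed
qed

end

lemma ideal_prodE:
 assumes "u \<in> ideal_prod I J"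
 obtains l :: nat and x y where "u = (\<Sum>i<l. x i * y i)" "\<forall>i<l. x i \<in> I \<and> y i \<in> J"
 using assms unfolding ideal_prod_def by (elim CollectE exE conjE) (erule that, assumption)

lemma ideal_prod_add:
 assumes "u \<in> ideal_prod I J" "v \<in> ideal_prod I J" shows "u + v \<in> ideal_prod I J"
proof -
 obtain l :: nat and x y where 1: "u = (\<Sum>i<l. x i * y i)" "\<forall>i<l. x i \<in> I \<and> y i \<in> J"
  using assms(1) by (rule ideal_prodE)
 obtain l' :: nat and x' y' where 2: "v = (\<Sum>i<l'. x' i * y' i)" "\<forall>i<l'. x' i \<in> I \<and> y' i \<in> J"
  using assms(2) by (rule ideal_prodE)
 define X where "X i = (if i < l then x i else x' (i - l))" for i
 define Y where "Y i = (if i < l then y i else y' (i - l))" for i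
 have "(\<Sum>i<l + l'. X i * Y i) = (\<Sum>i<l. X i * Y i) + (\<Sum>i=l..<l + l'. X i * Y i)"
  by (metis atLeast0LessThan le_add1 sum.atLeastLessThan_concat zero_le)
 also have "(\<Sum>i=l..<l + l'. X i * Y i) = (\<Sum>i<l'. X (i + l) * Y (i + l))"
  using sum.shift_bounds_nat_ivl[of "\<lambda>i. X i * Y i" 0 l l'] by (simp add: atLeast0LessThan add.commute)
 finally have "u + v = (\<Sum>i<l + l'. X i * Y i)" by (simp add: 1(1) 2(1) X_def Y_def)
 moreover have "\<forall>i<l + l'. X i \<in> I \<and> Y i \<in> J" using 1(2) 2(2) by (auto simp: X_def Y_def)
 ultimately show ?thesis unfolding ideal_prod_def by blast
qed

section \<open>Global generation\<close>

context model begin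

text \<open>Cartier divisors, the neighbourhoods being complements of hypersurfaces, so that only
  coordinate vectors occur.\<close>

definition cart :: "(point \<Rightarrow> 'k) \<Rightarrow> bool" where
 "cart B \<longleftrightarrow> (\<forall>p\<in>Pts. B p \<noteq> 0 \<and> (\<exists>d H. homogeneous d H \<and> ceval (a p) H \<noteq> 0 \<and>
   (\<forall>q\<in>Pts. ceval (a q) H \<noteq> 0 \<longrightarrow> isu q (B p / B q))))"

text \<open>Global generation of the sheaf whose stalk at \<open>p\<close> is generated by
  \<open>1 / B p\<close>.\<close>

definition gg :: "(point \<Rightarrow> 'k) \<Rightarrow> bool" where
 "gg B \<longleftrightarrow> (\<forall>p\<in>Pts. \<exists>\<sigma>. (\<forall>q\<in>Pts. \<sigma> * B q \<in> Ov q) \<and> isu p (\<sigma> * B p))"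

lemma cart_nz: "cart B ==> p \<in> Pts ==> B p \<noteq> 0"
 by (auto simp: cart_def)

lemma isu_open:
 assumes p: "p \<in> Pts" and f: "isu p f"
 obtains d H where "homogeneous d H" "ceval (a p) H \<noteq> 0" "\<And>q. q \<in> Pts ==> ceval (a q) H \<noteq> 0 ==> isu q f"
proof -
 obtain d F G where F: "homogeneous d F" "homogeneous d G" "ceval (a p) G \<noteq> 0" "f = E F / E G"
  using f Ov_E[OF p] by (metis isu_def)
 have nz: "ceval (a p) F \<noteq> 0" using f val_frac[OF p F(1-3)] unfolding isu_def F(4)[symmetric] by auto
 show thesis
 proof (rule that[of "d + d" "F * G"])
  show "homogeneous (d + d) (F * G)" by (intro homogeneous_mult F)
  show "ceval (a p) (F * G) \<noteq> 0" using nz F by (simp add: ce_simps)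
  fix q assume q: "q \<in> Pts" "ceval (a q) (F * G) \<noteq> 0"
  then have "ceval (a q) F \<noteq> 0" "ceval (a q) G \<noteq> 0" by (auto simp: ce_simps)
  then show "isu q f" unfolding isu_def F(4)
   using Ov_I[OF q(1) F(1,2)] val_frac[OF q(1) F(1,2)] by simp
 qed
qed

lemma cart_mult:
 assumes "cart A" "cart B" shows "cart (\<lambda>p. A p * B p)"
 unfolding cart_def
proof (intro ballI conjI)
 fix p assume p: "p \<in> Pts"
 show "A p * B p \<noteq> 0" using cart_nz assms p by simp
 obtain d H where 1: "homogeneous d H" "ceval (a p) H \<noteq> 0"
  "\<And>q. q \<in> Pts ==> ceval (a q) H \<noteq> 0 ==> isu q (A p / A q)" using assms(1) p unfolding cart_def by blast
 obtain d' H' where 2: "homogeneous d' H'" "ceval (a p) H' \<noteq> 0"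
  "\<And>q. q \<in> Pts ==> ceval (a q) H' \<noteq> 0 ==> isu q (B p / B q)" using assms(2) p unfolding cart_def by blast
 have "isu q (A p * B p / (A q * B q))" if "q \<in> Pts" "ceval (a q) (H * H') \<noteq> 0" for q
  using isu_mult[OF that(1) 1(3)[OF that(1)] 2(3)[OF that(1)]] that by (simp add: ce_simps)
 then show "\<exists>d H. homogeneous d H \<and> ceval (a p) H \<noteq> 0 \<and>
   (\<forall>q\<in>Pts. ceval (a q) H \<noteq> 0 \<longrightarrow> isu q (A p * B p / (A q * B q)))"
  using homogeneous_mult[OF 1(1) 2(1)] 1(2) 2(2) by (intro exI[of _ "d + d'"] exI[of _ "H * H'"]) (auto simp: ce_simps)
qed

lemma cart_powi:
 assumes "cart B" shows "cart (\<lambda>p. B p powi n)"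
 unfolding cart_def
proof (intro ballI conjI)
 fix p assume p: "p \<in> Pts"
 show "B p powi n \<noteq> 0" using cart_nz assms p by (simp add: power_int_eq_0_iff)
 obtain d H where 1: "homogeneous d H" "ceval (a p) H \<noteq> 0"
  "\<And>q. q \<in> Pts ==> ceval (a q) H \<noteq> 0 ==> isu q (B p / B q)" using assms(1) p unfolding cart_def by blast
 then show "\<exists>d H. homogeneous d H \<and> ceval (a p) H \<noteq> 0 \<and>
   (\<forall>q\<in>Pts. ceval (a q) H \<noteq> 0 \<longrightarrow> isu q (B p powi n / B q powi n))"
  by (metis isu_powi power_int_divide_distrib)
qed

text \<open>A section generating the stalk at \<open>p\<close> generates the stalks nearby, so by
  quasi-compactness finitely many sections suffice. The family is continued by 0 to all
  indices.\<close>

lemma gg_finite: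
 assumes "cart B" "gg B"
 obtains L :: nat and u where "\<And>l q. q \<in> Pts ==> u l * B q \<in> Ov q" "\<And>l. l \<ge> L ==> u l = 0"
  "\<And>p. p \<in> Pts ==> \<exists>l<L. isu p (u l * B p)"
proof -
 have "\<exists>\<sigma> d H. (\<forall>q\<in>Pts. \<sigma> * B q \<in> Ov q) \<and> homogeneous d H \<and> ceval (a p) H \<noteq> 0 \<and>
   (\<forall>q\<in>Pts. ceval (a q) H \<noteq> 0 \<longrightarrow> isu q (\<sigma> * B q))" if p: "p \<in> Pts" for p
 proof -
  obtain \<sigma> where \<sigma>: "\<And>q. q \<in> Pts ==> \<sigma> * B q \<in> Ov q" "isu p (\<sigma> * B p)" using assms(2) p unfolding gg_def by blast
  obtain d H where 1: "homogeneous d H" "ceval (a p) H \<noteq> 0"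
   "\<And>q. q \<in> Pts ==> ceval (a q) H \<noteq> 0 ==> isu q (\<sigma> * B p)" using isu_open[OF p \<sigma>(2)] by blast
  obtain d' H' where 2: "homogeneous d' H'" "ceval (a p) H' \<noteq> 0"
   "\<And>q. q \<in> Pts ==> ceval (a q) H' \<noteq> 0 ==> isu q (B p / B q)" using assms(1) p unfolding cart_def by blast
  have "isu q (\<sigma> * B q)" if q: "q \<in> Pts" "ceval (a q) (H * H') \<noteq> 0" for q
   using isu_divide[OF q(1) 1(3)[OF q(1)] 2(3)[OF q(1)]] q cart_nz[OF assms(1) p] by (simp add: ce_simps)
  then show ?thesis
   using \<sigma>(1) homogeneous_mult[OF 1(1) 2(1)] 1(2) 2(2)
   by (intro exI[of _ \<sigma>] exI[of _ "d + d'"] exI[of _ "H * H'"]) (auto simp: ce_simps)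
 qed
 then obtain \<sigma> dd H where S: "\<And>p q. p \<in> Pts ==> q \<in> Pts ==> \<sigma> p * B q \<in> Ov q"
  "\<And>p. p \<in> Pts ==> homogeneous (dd p) (H p) \<and> ceval (a p) (H p) \<noteq> 0"
  "\<And>p q. p \<in> Pts ==> q \<in> Pts ==> ceval (a q) (H p) \<noteq> 0 ==> isu q (\<sigma> p * B q)" by metis
 obtain Q where Q: "finite Q" "Q \<subseteq> Pts" "\<And>q. q \<in> Pts ==> \<exists>p\<in>Q. ceval (a q) (H p) \<noteq> 0"
  using quasi_compact[of dd H] S(2) by blast
 obtain f where f: "bij_betw f {..<card Q} Q" using Q(1) ex_bij_betw_nat_finite atLeast0LessThan by metis
 define u where "u l = (if l < card Q then \<sigma> (f l) else 0)" for l
 show thesis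
 proof (rule that[of u "card Q"])
  show "u l * B q \<in> Ov q" if "q \<in> Pts" for l q
   using S(1)[OF _ that, of "f l"] f Q(2) that by (auto simp: u_def Ov_simps bij_betw_def)
  show "u l = 0" if "l \<ge> card Q" for l using that by (simp add: u_def)
  fix p assume p: "p \<in> Pts"
  then obtain r where r: "r \<in> Q" "ceval (a p) (H r) \<noteq> 0" using Q by blast
  then obtain l where "l < card Q" "r = f l" using f by (auto simp: bij_betw_def)
  then show "\<exists>l<card Q. isu p (u l * B p)" using S(3)[OF _ p r(2)] r Q(2) by (intro exI[of _ l]) (auto simp: u_def)
 qed
qed

subsection \<open>Powers of the maximal ideals\<close>

definition mp :: "point \<Rightarrow> nat \<Rightarrow> 'k set" where
 "mp p e = ideal_pow (Ov p) (max_ideal (Ov p)) e"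

lemma mp_0 [simp]: "mp p 0 = Ov p" by (simp add: mp_def)

lemma mp_Suc_prod: "mp p (Suc e) = ideal_prod (max_ideal (Ov p)) (mp p e)"
 by (simp add: mp_def)

lemma mp_Suc: "mp p (Suc e) = {(\<Sum>i<l. x i * y i) | (l::nat) x y. \<forall>i<l. x i \<in> max_ideal (Ov p) \<and> y i \<in> mp p e}"
 by (simp add: mp_def ideal_prod_def)

lemma mp_Suc_I: "x \<in> max_ideal (Ov p) ==> y \<in> mp p e ==> x * y \<in> mp p (Suc e)"
 unfolding mp_Suc by (intro CollectI exI[of _ "1::nat"] exI[of _ "\<lambda>_. x"] exI[of _ "\<lambda>_. y"]) simp

lemma mp_add: assumes p: "p \<in> Pts" shows "u \<in> mp p e ==> v \<in> mp p e ==> u + v \<in> mp p e"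
 using ideal_prod_add by (cases e) (auto simp: mp_def subring1D[OF Ov_ring[OF p]])

lemma mp_zero: assumes p: "p \<in> Pts" shows "0 \<in> mp p e"
proof (cases e)
 case (Suc n)
 show ?thesis unfolding Suc mp_Suc by (intro CollectI exI[of _ "0::nat"]) simp
qed (simp add: Ov_simps p)

lemma mp_sum: "p \<in> Pts ==> (\<And>i. i \<in> S ==> f i \<in> mp p e) ==> sum f S \<in> mp p e"
 by (induction S rule: infinite_finite_induct) (auto simp: mp_add mp_zero)

lemma mp_induct [consumes 2, case_names zero add mult]:
 assumes p: "p \<in> Pts" and f: "f \<in> mp p (Suc e)"
  and "P 0" "\<And>u v. u \<in> mp p (Suc e) ==> v \<in> mp p (Suc e) ==> P u ==> P v ==> P (u + v)"
  "\<And>x y. x \<in> max_ideal (Ov p) ==> y \<in> mp p e ==> P (x * y)"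
 shows "P f"
proof -
 obtain l :: nat and x y where 1: "f = (\<Sum>i<l. x i * y i)" "\<forall>i<l. x i \<in> max_ideal (Ov p) \<and> y i \<in> mp p e"
  using f unfolding mp_Suc_prod by (rule ideal_prodE)
 have "n \<le> l ==> (\<Sum>i<n. x i * y i) \<in> mp p (Suc e) \<and> P (\<Sum>i<n. x i * y i)" for n
 proof (induction n)
  case 0 show ?case using mp_zero[OF p] assms(3) by simp
 next
  case (Suc n)
  then have n: "x n \<in> max_ideal (Ov p)" "y n \<in> mp p e" using 1(2) by auto
  have IH: "(\<Sum>i<n. x i * y i) \<in> mp p (Suc e)" "P (\<Sum>i<n. x i * y i)" using Suc by auto
  show ?case
   using mp_add[OF p IH(1) mp_Suc_I[OF n]] assms(4)[OF IH(1) mp_Suc_I[OF n] IH(2) assms(5)[OF n]] by simp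
 qed
 then show ?thesis using 1 by auto
qed

lemma mp_mult_left: assumes p: "p \<in> Pts" and r: "r \<in> Ov p" shows "f \<in> mp p e ==> r * f \<in> mp p e"
proof (induction e arbitrary: f)
 case 0 then show ?case using r p by (simp add: Ov_simps)
next
 case (Suc e)
 from p Suc.prems show ?case
 proof (induction f rule: mp_induct)
  case zero then show ?case using mp_zero[OF p] by simp
 next
  case (add u v) then show ?case using mp_add[OF p] by (simp add: distrib_left)
 next
  case (mult x y)
  then show ?case using mp_Suc_I[OF mult(1) Suc.IH[OF mult(2)]] by (simp add: ac_simps)
 qed
qed

lemma mp_uminus: "p \<in> Pts ==> f \<in> mp p e ==> - f \<in> mp p e"
 using mp_mult_left[of p "- 1" f e] by (simp add: Ov_simps)

lemma mp_diff: "p \<in> Pts ==> f \<in> mp p e ==> g \<in> mp p e ==> f - g \<in> mp p e"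
 using mp_add[of p f e "- g"] mp_uminus by simp

lemma mp_dec: assumes p: "p \<in> Pts" shows "f \<in> mp p (Suc e) ==> f \<in> mp p e"
proof -
 assume "f \<in> mp p (Suc e)"
 with p show ?thesis
  by (induction f rule: mp_induct) (auto simp: mp_zero mp_add p max_ideal_iff intro!: mp_mult_left)
qed

lemma mp_mono: assumes p: "p \<in> Pts" and "d \<le> e" shows "f \<in> mp p e ==> f \<in> mp p d"
 using assms(2) by (induction rule: inc_induct) (auto intro: mp_dec[OF p])

lemma mp_Ov: "p \<in> Pts ==> f \<in> mp p e ==> f \<in> Ov p"
 using mp_mono[of p 0 e f] by simp

lemma mp_1: assumes p: "p \<in> Pts" shows "mp p (Suc 0) = max_ideal (Ov p)"
proof
 show "max_ideal (Ov p) \<subseteq> mp p (Suc 0)"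
  using mp_Suc_I[of _ p 1 0] p by (auto simp: Ov_simps)
 show "mp p (Suc 0) \<subseteq> max_ideal (Ov p)"
 proof
  fix f assume "f \<in> mp p (Suc 0)"
  with p show "f \<in> max_ideal (Ov p)"
   by (induction f rule: mp_induct) (auto simp: max_ideal_iff Ov_simps val_ops p)
 qed
qed

lemma mp_mult: assumes p: "p \<in> Pts" shows "f \<in> mp p d ==> g \<in> mp p e ==> f * g \<in> mp p (d + e)"
proof (induction d arbitrary: f)
 case 0 then show ?case using mp_mult_left[OF p] by simp
next
 case (Suc d)
 from p Suc.prems(1) show ?case
 proof (induction f rule: mp_induct)
  case zero then show ?case using mp_zero[OF p] by simp
 next
  case (add u v) then show ?case using mp_add[OF p] by (simp add: distrib_right)
 next
  case (mult x y)
  then show ?case using mp_Suc_I[OF mult(1) Suc.IH[OF mult(2) Suc.prems(2)]] by (simp add: ac_simps)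
 qed
qed

lemma mp_power: "p \<in> Pts ==> f \<in> mp p d ==> f ^ n \<in> mp p (n * d)"
 by (induction n) (auto simp: mp_mult Ov_simps)

text \<open>Modulo \<open>I\<close> the \<open>z i\<close> are constants, and so is every polynomial
  in them. The intended \<open>I\<close> is the span of given generators.\<close>

lemma polynomial_expansion:
 assumes p: "p \<in> Pts" and z: "\<And>i. z i \<in> Ov p" 
  and I: "\<And>i. z i - sc (val p (z i)) \<in> I" "0 \<in> I" "\<And>x y. x \<in> I ==> y \<in> I ==> x + y \<in> I"
   "\<And>r x. r \<in> Ov p ==> x \<in> I ==> r * x \<in> I"
 shows "peval sc z P - sc (ceval (\<lambda>i. val p (z i)) P) \<in> I"
proof (induction P rule: mpoly_induct)
 case (Const c) then show ?case using I by (simp add: sc)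
next
 case (Var i) then show ?case using I by (simp add: sc)
next
 case (add F G)
 have "peval sc z (F + G) - sc (ceval (\<lambda>i. val p (z i)) (F + G)) =
  (peval sc z F - sc (ceval (\<lambda>i. val p (z i)) F)) + (peval sc z G - sc (ceval (\<lambda>i. val p (z i)) G))"
  by (simp add: E_simps ce_simps sc_simps)
 then show ?case using I(3)[OF add] by simp
next
 case (mult F G)
 let ?c = "\<lambda>F. sc (ceval (\<lambda>i. val p (z i)) F)"
 have e: "peval sc z (F * G) - ?c (F * G) =
  peval sc z G * (peval sc z F - ?c F) + ?c F * (peval sc z G - ?c G)"
  by (simp add: E_simps ce_simps sc_simps algebra_simps)
 show ?case unfolding e using val_peval(1)[OF p z] mult sc_in_Ov[OF p] by (intro I(3,4)) auto
qed

text \<open>After dehomogenizing, the numerator is a polynomial in the affine coordinates that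
  vanishes at \<open>p\<close>, hence lies in the ideal of their differences from their values; the
  denominator is a unit.\<close>

lemma max_ideal_generators:
 assumes p: "p \<in> Pts" and j: "a p j \<noteq> 0" and f: "f \<in> max_ideal (Ov p)"
 shows "\<exists>r. (\<forall>i. r i \<in> Ov p) \<and> f = (\<Sum>i\<le>M. r i * (s i / s j - sc (a p i / a p j)))"
proof -
 define z where "z i = s i / s j" for i
 have z: "z i \<in> Ov p" "val p (z i) = a p i / a p j" for i using val_ratio[OF p j] by (auto simp: z_def)
 define I where "I = {(\<Sum>i\<le>M. r i * (z i - sc (val p (z i)))) | r. \<forall>i. r i \<in> Ov p}"
 have I0: "0 \<in> I" unfolding I_def using p by (intro CollectI exI[of _ "\<lambda>_. 0"]) (simp add: Ov_simps)
 have Iadd: "x + y \<in> I" if xy: "x \<in> I" "y \<in> I" for x y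
 proof -
  obtain r where r: "x = (\<Sum>i\<le>M. r i * (z i - sc (val p (z i))))" "\<forall>i. r i \<in> Ov p" using xy unfolding I_def by blast
  obtain t where t: "y = (\<Sum>i\<le>M. t i * (z i - sc (val p (z i))))" "\<forall>i. t i \<in> Ov p" using xy unfolding I_def by blast
  show ?thesis unfolding I_def using r t p
   by (intro CollectI exI[of _ "\<lambda>i. r i + t i"]) (simp add: Ov_simps distrib_right sum.distrib)
 qed
 have Imult: "c * x \<in> I" if cx: "c \<in> Ov p" "x \<in> I" for c x
 proof -
  obtain r where r: "x = (\<Sum>i\<le>M. r i * (z i - sc (val p (z i))))" "\<forall>i. r i \<in> Ov p" using cx unfolding I_def by blast
  show ?thesis unfolding I_def using r cx p
   by (intro CollectI exI[of _ "\<lambda>i. c * r i"]) (simp add: Ov_simps sum_distrib_left mult.assoc)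
 qed
 have Igen: "z i - sc (val p (z i)) \<in> I" for i
 proof (cases "i \<le> M")
  case True
  then show ?thesis unfolding I_def using p
   by (intro CollectI exI[of _ "\<lambda>l. if l = i then 1 else 0"]) (simp add: Ov_simps if_distrib[of "\<lambda>x. x * _"] cong: if_cong)
 next
  case False
  then show ?thesis using I0 s_supp[of i] p by (simp add: z_def sc_simps)
 qed
 obtain d F G where F: "homogeneous d F" "homogeneous d G" "ceval (a p) G \<noteq> 0" "f = E F / E G" "E G \<noteq> 0"
  using f max_ideal_iff[OF p] by (metis Ov_E[OF p])
 have cF: "ceval (a p) F = 0" using f max_ideal_frac[OF p F(1-3)] F(4) by simp
 have sj: "s j \<noteq> 0" using s_ne[OF p j] .
 have cz: "ceval (\<lambda>i. val p (z i)) H = ceval (a p) H / a p j ^ d" if "homogeneous d H" for H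
  using peval_scale[OF rhom_id that, of "inverse (a p j)" "a p"] j
  by (simp add: z(2) divide_inverse mult.commute power_inverse)
 have "peval sc z F - sc (ceval (\<lambda>i. val p (z i)) F) \<in> I"
  by (rule polynomial_expansion[OF p z(1) Igen I0 Iadd Imult])
 then have "peval sc z F \<in> I" using cz[OF F(1)] cF by (simp add: sc_simps)
 moreover have "isu p (peval sc z G)"
  using val_peval[of p z G, OF p z(1)] cz[OF F(2)] F(3) j by (simp add: isu_def)
 then have "inverse (peval sc z G) \<in> Ov p" using isu_inverse[OF p] by (simp add: isu_def)
 moreover have "f = inverse (peval sc z G) * peval sc z F"
  unfolding F(4) E_dehom[OF sj F(1)] E_dehom[OF sj F(2)] z_def[abs_def, symmetric] using sj
  by (simp add: z_def[abs_def] field_simps)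
 ultimately have "f \<in> I" using Imult by simp
 then show ?thesis unfolding I_def z(2) by (auto simp: z_def)
qed

end

text \<open>\<open>D0\<close> is a hyperplane divisor of the embedding: the coordinates are sections
  of its sheaf, and \<open>a p\<close> lists their values in the trivialization by
  \<open>1 / D0 p\<close>.\<close>

locale pmodel = model sc s M Pts a Ov
 for sc :: "complex \<Rightarrow> 'k::field" and s M Pts a Ov +
 fixes D0 :: "point \<Rightarrow> 'k"
 assumes D0_ne: "p \<in> Pts ==> D0 p \<noteq> 0"
  and sD0: "p \<in> Pts ==> s i * D0 p \<in> Ov p"
  and val_sD0: "p \<in> Pts ==> val p (s i * D0 p) = a p i"
begin

lemma E_D0:
 assumes p: "p \<in> Pts" and F: "homogeneous d F"
 shows "E F * D0 p ^ d \<in> Ov p" "val p (E F * D0 p ^ d) = ceval (a p) F"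
proof -
 have "E F * D0 p ^ d = peval sc (\<lambda>i. s i * D0 p) F"
  using peval_scale[OF sc F, of "D0 p" s] by (simp add: mult.commute)
 then show "E F * D0 p ^ d \<in> Ov p" "val p (E F * D0 p ^ d) = ceval (a p) F"
  using val_peval[OF p sD0[OF p]] by (simp_all add: val_sD0 p)
qed

lemma isu_E_D0: "p \<in> Pts ==> homogeneous d F ==> ceval (a p) F \<noteq> 0 ==> isu p (E F * D0 p ^ d)"
 by (simp add: isu_def E_D0)

lemma isu_sD0: "p \<in> Pts ==> a p i \<noteq> 0 ==> isu p (s i * D0 p)"
 by (simp add: isu_def sD0 val_sD0)

lemma cart_D0: "cart D0"
 unfolding cart_def
proof (intro ballI conjI)
 fix p assume p: "p \<in> Pts"
 show "D0 p \<noteq> 0" using D0_ne p .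
 obtain i where i: "a p i \<noteq> 0" using a_ne[OF p] by blast
 obtain d H where H: "homogeneous d H" "ceval (a p) H \<noteq> 0"
  "\<And>q. q \<in> Pts ==> ceval (a q) H \<noteq> 0 ==> isu q (s i * D0 p)"
  using isu_open[OF p isu_sD0[OF p i]] by blast
 have "isu q (D0 p / D0 q)" if q: "q \<in> Pts" "ceval (a q) (H * Var i) \<noteq> 0" for q
  using isu_divide[OF q(1) H(3)[OF q(1)] isu_sD0[OF q(1), of i]] q s_ne[OF p i] by (simp add: ce_simps)
 then show "\<exists>d H. homogeneous d H \<and> ceval (a p) H \<noteq> 0 \<and>
   (\<forall>q\<in>Pts. ceval (a q) H \<noteq> 0 \<longrightarrow> isu q (D0 p / D0 q))"
  using homogeneous_mult[OF H(1) homogeneous_Var(1)[of i]] H(2) i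
  by (intro exI[of _ "d + 1"] exI[of _ "H * Var i"]) (auto simp: ce_simps)
qed

text \<open>Serre's theorem. The local generator \<open>1 / B r\<close> has poles only along
  \<open>H r\<close>, in the sense that each transition function \<open>B t / B r\<close> is a form
  divided by a power of \<open>H r * H t\<close>. A high power of \<open>H r\<close> clears these
  poles, and a power of a coordinate fills up the degree.\<close>

theorem serre_gg:
 assumes B: "cart B"
 shows "\<exists>N0. \<forall>N\<ge>N0. gg (\<lambda>q. D0 q ^ N * B q)"
proof -
 \<comment> \<open>The factor \<open>Var j\<close> gives the form the shape required by
   \<open>regular_on_basic_open\<close>.\<close>
 have "\<exists>j d H. homogeneous d H \<and> ceval (a p) (Var j * H) \<noteq> 0 \<and>
   (\<forall>q\<in>Pts. ceval (a q) (Var j * H) \<noteq> 0 \<longrightarrow> isu q (B p / B q))" if p: "p \<in> Pts" for p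
 proof -
  obtain d H where 1: "homogeneous d H" "ceval (a p) H \<noteq> 0"
   "\<And>q. q \<in> Pts ==> ceval (a q) H \<noteq> 0 ==> isu q (B p / B q)" using B p unfolding cart_def by blast
  obtain i where i: "a p i \<noteq> 0" using a_ne[OF p] by blast
  show ?thesis using 1 i by (intro exI[of _ i] exI[of _ d] exI[of _ H]) (auto simp: ce_simps)
 qed
 then obtain jj d' H' where H': "\<And>p. p \<in> Pts ==> homogeneous (d' p) (H' p)"
  "\<And>p. p \<in> Pts ==> ceval (a p) (Var (jj p) * H' p) \<noteq> 0"
  "\<And>p q. p \<in> Pts ==> q \<in> Pts ==> ceval (a q) (Var (jj p) * H' p) \<noteq> 0 ==> isu q (B p / B q)" by metis
 define H where "H p = Var (jj p) * H' p" for p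
 define dd where "dd p = Suc (d' p)" for p
 have H: "homogeneous (dd p) (H p)" "ceval (a p) (H p) \<noteq> 0" if "p \<in> Pts" for p
  using homogeneous_mult[OF homogeneous_Var(1) H'(1)[OF that], of "jj p"] H'(2)[OF that] by (simp_all add: H_def dd_def)
 have HB: "isu q (B p / B q)" if "p \<in> Pts" "q \<in> Pts" "ceval (a q) (H p) \<noteq> 0" for p q
  using H'(3) that by (simp add: H_def)
 have EH: "E (H p) \<noteq> 0" if "p \<in> Pts" for p using E_nz[OF that H(1)[OF that] H(2)[OF that]] .
 obtain Q where Q: "finite Q" "Q \<subseteq> Pts" "\<And>q. q \<in> Pts ==> \<exists>p\<in>Q. ceval (a q) (H p) \<noteq> 0"
  using quasi_compact[of dd H] H by blast
 have "\<exists>N G. homogeneous (N * (dd r + dd t)) G \<and> B t / B r = E G / E (H r * H t) ^ N" if rt: "r \<in> Pts" "t \<in> Pts" for r t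
 proof -
  have hh: "homogeneous (d' r + dd t) (H' r * H t)" by (intro homogeneous_mult H' H rt)
  have 2: "H r * H t = Var (jj r) * (H' r * H t)" by (simp add: H_def)
  have 3: "E (H r * H t) \<noteq> 0" using EH rt by (simp add: E_simps)
  have 4: "B t / B r \<in> Ov q" if q: "q \<in> Pts" "ceval (a q) (H r * H t) \<noteq> 0" for q
  proof -
   have "isu q ((B t / B q) / (B r / B q))"
    using q rt by (intro isu_divide HB) (auto simp: ce_simps)
   then show ?thesis using cart_nz[OF B q(1)] by (simp add: isu_def)
  qed
  show ?thesis by (rule regular_on_basic_open[OF hh 2 3 4]) (auto simp: dd_def)
 qed
 then obtain n G where G: "\<And>r t. r \<in> Pts ==> t \<in> Pts ==> homogeneous (n r t * (dd r + dd t)) (G r t)"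
  "\<And>r t. r \<in> Pts ==> t \<in> Pts ==> B t / B r = E (G r t) / E (H r * H t) ^ n r t" by metis
 \<comment> \<open>One exponent for all of the finitely many transition functions.\<close>
 define K where "K = (\<Sum>r\<in>Q. \<Sum>t\<in>Q. n r t)"
 have nK: "n r t \<le> K" if "r \<in> Q" "t \<in> Q" for r t
  unfolding K_def using that Q(1) member_le_sum[of t Q "n r"] member_le_sum[of r Q "\<lambda>r. \<Sum>t\<in>Q. n r t"]
  by (meson le_trans zero_le)
 have ddQ: "dd r \<le> sum dd Q" if "r \<in> Q" for r using that Q(1) by (simp add: member_le_sum)
 show ?thesis
 proof (intro exI[of _ "sum dd Q * K"] allI impI)
  fix N assume N: "sum dd Q * K \<le> N"
  show "gg (\<lambda>q. D0 q ^ N * B q)"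
   unfolding gg_def
  proof
   fix p assume p: "p \<in> Pts"
   obtain r where r: "r \<in> Q" "ceval (a p) (H r) \<noteq> 0" using Q(3)[OF p] by blast
   then have rP: "r \<in> Pts" using Q by blast
   obtain i where i: "a p i \<noteq> 0" using a_ne[OF p] by blast
   have le: "dd r * K \<le> N" using ddQ[OF r(1)] N by (meson le_trans mult_le_mono1)
   \<comment> \<open>The numerator has degree \<open>N\<close>: \<open>dd r * K\<close> comes from
     \<open>H r\<close> and the rest from the coordinate \<open>s i\<close>, which is nonzero at
     \<open>p\<close>.\<close>
   define \<sigma> where "\<sigma> = s i ^ (N - dd r * K) * E (H r) ^ K / B r"
   have main: "\<sigma> * (D0 q ^ N * B q) = (s i * D0 q) ^ (N - dd r * K) * (E (H r) ^ K * D0 q ^ (dd r * K) * (B q / B r))" for q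
   proof -
    have "D0 q ^ N = D0 q ^ (N - dd r * K) * D0 q ^ (dd r * K)" using le by (simp add: power_add[symmetric])
    then show ?thesis by (simp add: \<sigma>_def power_mult_distrib)
   qed
   have "\<sigma> * (D0 q ^ N * B q) \<in> Ov q" if q: "q \<in> Pts" for q
   proof -
    obtain t where t: "t \<in> Q" "ceval (a q) (H t) \<noteq> 0" using Q(3)[OF q] by blast
    then have tP: "t \<in> Pts" using Q by blast
    define m where "m = n r t"
    have mK: "m \<le> K" using nK[OF r(1) t(1)] by (simp add: m_def)
    have deg: "homogeneous ((K - m) * dd r + m * (dd r + dd t)) (H r ^ (K - m) * G r t)"
     using G(1)[OF rP tP] H(1)[OF rP] unfolding m_def by (intro homogeneous_mult homogeneous_power)
    have "(K - m) * dd r + m * (dd r + dd t) = dd r * K + m * dd t"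
    proof -
     obtain e where "K = m + e" using mK le_Suc_ex by blast
     then show ?thesis by (simp add: algebra_simps)
    qed
    note deg = deg[unfolded this]
    have u: "isu q ((E (H t) * D0 q ^ dd t) ^ m)" using isu_E_D0[OF q H(1)[OF tP] t(2)] by (intro isu_power q)
    have "E (H r) ^ K * D0 q ^ (dd r * K) * (B t / B r) =
      inverse ((E (H t) * D0 q ^ dd t) ^ m) * (E (H r ^ (K - m) * G r t) * D0 q ^ (dd r * K + m * dd t))"
    proof -
     have "E (H r) ^ K = E (H r) ^ (K - m) * E (H r) ^ m" using mK by (simp add: power_add[symmetric])
     then show ?thesis unfolding G(2)[OF rP tP] m_def[symmetric]
      using EH[OF rP] EH[OF tP] D0_ne[OF q]
      by (simp add: E_simps power_mult_distrib power_add power_mult field_simps) (simp add: power_mult[symmetric] mult.commute)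
    qed
    moreover have "\<dots> \<in> Ov q" using isu_inverse[OF q u] E_D0(1)[OF q deg] q by (simp add: isu_def Ov_simps)
    ultimately have 1: "E (H r) ^ K * D0 q ^ (dd r * K) * (B t / B r) \<in> Ov q" by simp
    have 2: "B q / B t \<in> Ov q" using isu_divide_commute[OF q HB[OF tP q t(2)]] by (simp add: isu_def)
    have "B t \<noteq> 0" using cart_nz[OF B tP] .
    then have "E (H r) ^ K * D0 q ^ (dd r * K) * (B q / B r) =
      (E (H r) ^ K * D0 q ^ (dd r * K) * (B t / B r)) * (B q / B t)" by simp
    then have "E (H r) ^ K * D0 q ^ (dd r * K) * (B q / B r) \<in> Ov q"
     using Ov_simps(6)[OF q 1 2] by simp
    then show ?thesis unfolding main by (rule Ov_simps(6)[OF q Ov_simps(7)[OF q sD0[OF q]]])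
   qed
   moreover have "isu p (\<sigma> * (D0 p ^ N * B p))"
   proof -
    have *: "E (H r) ^ K * D0 p ^ (dd r * K) = (E (H r) * D0 p ^ dd r) ^ K"
     by (simp add: power_mult_distrib power_mult)
    show ?thesis unfolding main *
     by (intro isu_mult isu_power p isu_E_D0 H(1)[OF rP] r(2) isu_sD0 i
       isu_divide_commute[OF p HB[OF rP p r(2)]])
   qed
   ultimately show "\<exists>\<sigma>. (\<forall>q\<in>Pts. \<sigma> * (D0 q ^ N * B q) \<in> Ov q) \<and> isu p (\<sigma> * (D0 p ^ N * B p))" by blast
  qed
 qed
qed

end

section \<open>Separation of jets\<close>

context model begin

text \<open>Otherwise all forms \<open>a q j * x i - a q i * x j\<close> would vanish at
  \<open>p\<close>, which makes the two coordinate vectors proportional.\<close>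

lemma separating_form:
 assumes "p \<in> Pts" "q \<in> Pts" "p \<noteq> q"
 shows "\<exists>L. homogeneous 1 L \<and> ceval (a q) L = 0 \<and> ceval (a p) L \<noteq> 0"
proof (rule ccontr)
 assume no: "\<not> ?thesis"
 obtain j where j: "a q j \<noteq> 0" using a_ne[OF assms(2)] by blast
 have eq: "a q j * a p i = a q i * a p j" for i
 proof -
  have "homogeneous 1 (Const (a q j) * Var i - Const (a q i) * Var j)"
   by (intro homogeneous_diff homogeneous_smult homogeneous_Var)
  moreover have "ceval (a q) (Const (a q j) * Var i - Const (a q i) * Var j) = 0" by (simp add: ce_simps)
  ultimately have "ceval (a p) (Const (a q j) * Var i - Const (a q i) * Var j) = 0" using no by blast
  then show ?thesis by (simp add: ce_simps)
 qed
 have "a p j \<noteq> 0"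
 proof
  assume "a p j = 0"
  then have "a p i = 0" for i using eq[of i] j by simp
  then show False using a_ne[OF assms(1)] by blast
 qed
 moreover have "a p = (\<lambda>i. (a p j / a q j) * a q i)"
  using eq j by (simp add: fun_eq_iff field_simps)
 ultimately show False using inj[OF assms(1,2), of "a p j / a q j"] j assms(3) by simp
qed

end

context pmodel begin

text \<open>In the expression of \<open>x\<close> by \<open>max_ideal_generators\<close> the
  coefficients matter only through their values, modulo the square of the maximal ideal; with
  constant coefficients it is a linear form. Division by \<open>a p j\<close> accounts for the value
  of \<open>s j * D0 p\<close>.\<close>

lemma linear_leading_form:
 assumes p: "p \<in> Pts" and x: "x \<in> max_ideal (Ov p)"
 shows "\<exists>L. homogeneous 1 L \<and> E L * D0 p - x \<in> mp p (Suc (Suc 0))"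
proof -
 obtain j where j: "a p j \<noteq> 0" using a_ne[OF p] by blast
 obtain r where r: "\<And>i. r i \<in> Ov p" "x = (\<Sum>i\<le>M. r i * (s i / s j - sc (a p i / a p j)))"
  using max_ideal_generators[OF p j x] by blast
 have sj: "s j \<noteq> 0" using s_ne[OF p j] .
 define L where "L = (\<Sum>i\<le>M. Const (val p (r i) / a p j) * (Var i - Const (a p i / a p j) * Var j))"
 have z: "s i / s j - sc (a p i / a p j) \<in> max_ideal (Ov p)" for i
  using val_ratio[OF p j, of i] by (simp add: max_ideal_iff p val_diff sc_in_Ov Ov_simps)
 have w: "sc (val p (r i) / a p j) * (s j * D0 p) - r i \<in> max_ideal (Ov p)" for i
  using j sD0[OF p] val_sD0[OF p] r(1)[of i]
  by (simp add: max_ideal_iff p val_diff val_ops sc_in_Ov Ov_simps)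
 have "E L * D0 p - x = (\<Sum>i\<le>M. (s i / s j - sc (a p i / a p j)) * (sc (val p (r i) / a p j) * (s j * D0 p) - r i))"
  unfolding r(2) L_def E_simps(8) sum_distrib_right sum_subtractf[symmetric]
  by (intro sum.cong refl) (simp add: E_simps sc field_simps sj)
 moreover have "\<dots> \<in> mp p (Suc (Suc 0))"
  using z w by (intro mp_sum[OF p] mp_Suc_I) (auto simp: mp_1[OF p])
 moreover have "homogeneous 1 L" unfolding L_def
  by (intro homogeneous_sum homogeneous_smult homogeneous_diff homogeneous_Var)
 ultimately show ?thesis by auto
qed

text \<open>Forms of degree \<open>e\<close> surject onto the \<open>e\<close>-th graded piece of
  the local ring, as products of linear ones.\<close>

lemma leading_form:
 assumes p: "p \<in> Pts"
 shows "r \<in> mp p e ==> \<exists>P. homogeneous e P \<and> E P * D0 p ^ e - r \<in> mp p (Suc e)"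
proof (induction e arbitrary: r)
 case 0
 then have "r \<in> Ov p" by simp
 then have "E (Const (val p r)) * D0 p ^ 0 - r \<in> mp p (Suc 0)"
  by (simp add: sc mp_1 p max_ideal_iff Ov_simps sc_in_Ov val_diff)
 then show ?case using homogeneous_Const by blast
next
 case (Suc e)
 from p Suc.prems show ?case
 proof (induction r rule: mp_induct)
  case zero
  then show ?case using mp_zero[OF p] by (intro exI[of _ 0]) simp
 next
  case (add u v)
  then obtain P Q where P: "homogeneous (Suc e) P" "E P * D0 p ^ Suc e - u \<in> mp p (Suc (Suc e))"
   and Q: "homogeneous (Suc e) Q" "E Q * D0 p ^ Suc e - v \<in> mp p (Suc (Suc e))" by blast
  have *: "E (P + Q) * D0 p ^ Suc e - (u + v) = (E P * D0 p ^ Suc e - u) + (E Q * D0 p ^ Suc e - v)"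
   by (simp add: E_simps algebra_simps)
  show ?case using homogeneous_add[OF P(1) Q(1)] mp_add[OF p P(2) Q(2)] unfolding *[symmetric] by blast
 next
  case (mult x y)
  obtain P where P: "homogeneous e P" "E P * D0 p ^ e - y \<in> mp p (Suc e)" using Suc.IH[OF mult(2)] by blast
  obtain L where L: "homogeneous 1 L" "E L * D0 p - x \<in> mp p (Suc (Suc 0))"
   using linear_leading_form[OF p mult(1)] by blast
  have "E P * D0 p ^ e = (E P * D0 p ^ e - y) + y" by simp
  then have Pe: "E P * D0 p ^ e \<in> mp p e" using mp_add[OF p mp_dec[OF p P(2)] mult(2)] by simp
  have *: "E (L * P) * D0 p ^ Suc e - x * y = (E L * D0 p - x) * (E P * D0 p ^ e) + x * (E P * D0 p ^ e - y)"
   by (simp add: E_simps algebra_simps)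
  have "E (L * P) * D0 p ^ Suc e - x * y \<in> mp p (Suc (Suc e))"
   unfolding * using mp_mult[OF p L(2) Pe] mp_Suc_I[OF mult(1) P(2)] by (intro mp_add[OF p]) simp_all
  moreover have "homogeneous (Suc e) (L * P)" using homogeneous_mult[OF L(1) P(1)] by simp
  ultimately show ?case by blast
 qed
qed

text \<open>Correction order by order. The error of order \<open>e\<close> at the chosen point is
  removed by a form of degree \<open>e\<close> times powers of linear forms through the other
  points; the degree stays at most \<open>k\<close> because \<open>e < ks ! i\<close>.\<close>

lemma jets_at_one_point:
 fixes xs :: "point list" and ks :: "nat list"
 assumes B: "gg B" and xs: "distinct xs" "set xs \<subseteq> Pts" and ks: "length ks = length xs"
  and k: "sum_list ks = Suc k" and i: "i < length xs" and \<gamma>: "\<gamma> \<in> Ov (xs ! i)"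
 shows "e \<le> ks ! i ==> \<exists>T. (\<forall>q\<in>Pts. T * (D0 q ^ k * B q) \<in> Ov q) \<and>
  T * (D0 (xs ! i) ^ k * B (xs ! i)) - \<gamma> \<in> mp (xs ! i) e \<and>
  (\<forall>l<length xs. l \<noteq> i \<longrightarrow> T * (D0 (xs ! l) ^ k * B (xs ! l)) \<in> mp (xs ! l) (ks ! l))"
proof (induction e)
 case 0
 have "xs ! l \<in> Pts" if "l < length xs" for l using xs(2) that by auto
 then show ?case using \<gamma> i by (intro exI[of _ 0]) (auto simp: Ov_simps mp_zero)
next
 case (Suc e)
 define p where "p = xs ! i"
 have xP: "xs ! l \<in> Pts" if "l < length xs" for l using xs(2) that by auto
 have p: "p \<in> Pts" using xP[OF i] by (simp add: p_def)
 let ?I = "{..<length xs} - {i}"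
 have "\<forall>l\<in>?I. \<exists>L. homogeneous 1 L \<and> ceval (a (xs ! l)) L = 0 \<and> ceval (a p) L \<noteq> 0"
  using separating_form[OF p xP] xs(1) i by (auto simp: p_def nth_eq_iff_index_eq)
 then obtain L where L: "\<And>l. l \<in> ?I ==> homogeneous 1 (L l)" "\<And>l. l \<in> ?I ==> ceval (a (xs ! l)) (L l) = 0"
  "\<And>l. l \<in> ?I ==> ceval (a p) (L l) \<noteq> 0" by metis
 define S where "S = (\<Sum>l\<in>?I. ks ! l)"
 define Q where "Q = (\<Prod>l\<in>?I. L l ^ (ks ! l))"
 have "homogeneous (\<Sum>l\<in>?I. ks ! l * 1) Q"
  unfolding Q_def by (intro homogeneous_prod homogeneous_power L)
 then have Q: "homogeneous S Q" by (simp add: S_def)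
 have "Suc k = (\<Sum>l<length xs. ks ! l)" using k ks by (simp add: sum_list_sum_nth atLeast0LessThan)
 then have kS: "Suc k = ks ! i + S" using sum.remove[of "{..<length xs}" i "\<lambda>l. ks ! l"] i by (simp add: S_def)
 obtain j where j: "a p j \<noteq> 0" using a_ne[OF p] by blast
 obtain \<sigma> where \<sigma>: "\<And>q. q \<in> Pts ==> \<sigma> * B q \<in> Ov q" "isu p (\<sigma> * B p)" using B p unfolding gg_def by blast
 have e: "e < ks ! i" using Suc.prems by simp
 then obtain T where T: "\<And>q. q \<in> Pts ==> T * (D0 q ^ k * B q) \<in> Ov q" "T * (D0 p ^ k * B p) - \<gamma> \<in> mp p e"
  "\<And>l. l < length xs ==> l \<noteq> i ==> T * (D0 (xs ! l) ^ k * B (xs ! l)) \<in> mp (xs ! l) (ks ! l)"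
  using Suc.IH unfolding p_def by auto
 \<comment> \<open>The remaining degree, filled by a coordinate not vanishing at \<open>p\<close>.
   The difference is not truncated, since \<open>Suc k = ks ! i + S\<close> and
   \<open>e < ks ! i\<close>.\<close>
 define t where "t = k - e - S"
 have t: "k = e + S + t" using kS e by (simp add: t_def)
 define W where "W q = (E Q * D0 q ^ S) * ((s j * D0 q) ^ t * (\<sigma> * B q))" for q
 have W: "W q \<in> Ov q" if "q \<in> Pts" for q
  unfolding W_def
  by (rule Ov_simps(6)[OF that E_D0(1)[OF that Q] Ov_simps(6)[OF that Ov_simps(7)[OF that sD0[OF that]] \<sigma>(1)[OF that]]])
 have "ceval (a p) Q \<noteq> 0" using L(3) by (simp add: Q_def ce_simps)
 then have Wp: "isu p (W p)"
  unfolding W_def by (intro isu_mult isu_power p isu_E_D0 Q isu_sD0 j \<sigma>)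
 have Wl: "W (xs ! l) \<in> mp (xs ! l) (ks ! l)" if l: "l \<in> ?I" for l
 proof -
  let ?q = "xs ! l"
  have q: "?q \<in> Pts" using l xP by auto
  have "Q = L l ^ (ks ! l) * (\<Prod>l\<in>?I - {l}. L l ^ (ks ! l))"
   unfolding Q_def using l by (intro prod.remove) auto
  moreover define R where "R = (\<Prod>l\<in>?I - {l}. L l ^ (ks ! l))"
  ultimately have QR: "Q = L l ^ (ks ! l) * R" by simp
  have "homogeneous (\<Sum>l\<in>?I - {l}. ks ! l * 1) R"
   unfolding R_def by (intro homogeneous_prod homogeneous_power L) auto
  moreover have SR: "S = ks ! l + (\<Sum>l\<in>?I - {l}. ks ! l)"
   unfolding S_def using l by (intro sum.remove) auto
  ultimately have R: "homogeneous (S - ks ! l) R" by simp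
  have "E (L l) * D0 ?q \<in> mp ?q (Suc 0)"
   using E_D0[OF q L(1)[OF l]] L(2)[OF l] by (simp add: mp_1 q max_ideal_iff)
  from mp_power[OF q this, of "ks ! l"] have "(E (L l) * D0 ?q) ^ (ks ! l) \<in> mp ?q (ks ! l)" by simp
  moreover have "W ?q = ((E R * D0 ?q ^ (S - ks ! l)) * ((s j * D0 ?q) ^ t * (\<sigma> * B ?q))) * (E (L l) * D0 ?q) ^ (ks ! l)"
  proof -
   have "D0 ?q ^ S = D0 ?q ^ (S - ks ! l) * D0 ?q ^ (ks ! l)" using SR by (simp add: power_add[symmetric] add.commute)
   then show ?thesis by (simp add: W_def QR E_simps power_mult_distrib)
  qed
  moreover have "(E R * D0 ?q ^ (S - ks ! l)) * ((s j * D0 ?q) ^ t * (\<sigma> * B ?q)) \<in> Ov ?q"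
   by (rule Ov_simps(6)[OF q E_D0(1)[OF q R] Ov_simps(6)[OF q Ov_simps(7)[OF q sD0[OF q]] \<sigma>(1)[OF q]]])
  ultimately show ?thesis using mp_mult_left[OF q] by simp
 qed
 \<comment> \<open>The form \<open>P\<close> is going to be multiplied by the unit
   \<open>W p\<close>, so the error is divided by it beforehand.\<close>
 define r where "r = inverse (W p) * (\<gamma> - T * (D0 p ^ k * B p))"
 have "r \<in> mp p e"
  unfolding r_def using isu_inverse(1)[OF p Wp] mp_uminus[OF p T(2)]
  by (intro mp_mult_left[OF p]) (auto simp: isu_def)
 then obtain P where P: "homogeneous e P" "E P * D0 p ^ e - r \<in> mp p (Suc e)" using leading_form[OF p] by blast
 define T' where "T' = E P * E Q * s j ^ t * \<sigma>"
 have T'W: "T' * (D0 q ^ k * B q) = (E P * D0 q ^ e) * W q" for q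
  unfolding T'_def W_def t by (simp add: power_add power_mult_distrib)
 have Wr: "W p * r = \<gamma> - T * (D0 p ^ k * B p)" using isu_nz[OF p Wp] by (simp add: r_def)
 show ?case
 proof (intro exI[of _ "T + T'"] conjI ballI allI impI)
  fix q assume q: "q \<in> Pts"
  show "(T + T') * (D0 q ^ k * B q) \<in> Ov q"
   unfolding distrib_right T'W
   by (rule Ov_simps(4)[OF q T(1)[OF q] Ov_simps(6)[OF q E_D0(1)[OF q P(1)] W[OF q]]])
 next
  have "(T + T') * (D0 p ^ k * B p) - \<gamma> = W p * (E P * D0 p ^ e - r)"
   unfolding distrib_right T'W right_diff_distrib Wr by simp
  then show "(T + T') * (D0 (xs ! i) ^ k * B (xs ! i)) - \<gamma> \<in> mp (xs ! i) (Suc e)"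
   using mp_mult_left[OF p W[OF p] P(2)] by (simp add: p_def)
 next
  fix l assume l: "l < length xs" "l \<noteq> i"
  show "(T + T') * (D0 (xs ! l) ^ k * B (xs ! l)) \<in> mp (xs ! l) (ks ! l)"
   unfolding distrib_right T'W
   using T(3)[OF l] mp_mult_left[OF xP[OF l(1)] E_D0(1)[OF xP[OF l(1)] P(1)] Wl[of l]] l
   by (intro mp_add[OF xP[OF l(1)]]) auto
 qed
qed

text \<open>The solutions for the single points can be added, since each vanishes to the required
  order at the other points.\<close>

theorem jets:
 fixes xs :: "point list" and ks :: "nat list"
 assumes B: "gg B" and xs: "distinct xs" "set xs \<subseteq> Pts" and ks: "length ks = length xs"
  and k: "sum_list ks = Suc k" and \<gamma>: "\<And>i. i < length xs ==> \<gamma> i \<in> Ov (xs ! i)"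
 shows "\<exists>T. (\<forall>q\<in>Pts. T * (D0 q ^ k * B q) \<in> Ov q) \<and>
  (\<forall>i<length xs. T * (D0 (xs ! i) ^ k * B (xs ! i)) - \<gamma> i \<in> mp (xs ! i) (ks ! i))"
proof -
 let ?C = "\<lambda>q. D0 q ^ k * B q"
 have xP: "xs ! l \<in> Pts" if "l < length xs" for l using xs(2) that by auto
 have "\<exists>T. (\<forall>q\<in>Pts. T * ?C q \<in> Ov q) \<and> T * ?C (xs ! i) - \<gamma> i \<in> mp (xs ! i) (ks ! i) \<and>
  (\<forall>l<length xs. l \<noteq> i \<longrightarrow> T * ?C (xs ! l) \<in> mp (xs ! l) (ks ! l))" if "i < length xs" for i
  using jets_at_one_point[OF B xs ks k that \<gamma>[OF that] order.refl] .
 then obtain T where T: "\<And>i q. i < length xs ==> q \<in> Pts ==> T i * ?C q \<in> Ov q"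
  "\<And>i. i < length xs ==> T i * ?C (xs ! i) - \<gamma> i \<in> mp (xs ! i) (ks ! i)"
  "\<And>i l. i < length xs ==> l < length xs ==> l \<noteq> i ==> T i * ?C (xs ! l) \<in> mp (xs ! l) (ks ! l)"
  by metis
 show ?thesis
 proof (intro exI[of _ "\<Sum>i<length xs. T i"] conjI ballI allI impI)
  fix q assume q: "q \<in> Pts"
  show "(\<Sum>i<length xs. T i) * ?C q \<in> Ov q"
   unfolding sum_distrib_right using T(1)[OF _ q] by (intro Ov_simps(8)[OF q]) auto
 next
  fix i assume i: "i < length xs"
  have e: "(\<Sum>l<length xs. T l) * ?C (xs ! i) - \<gamma> i =
   (T i * ?C (xs ! i) - \<gamma> i) + (\<Sum>l\<in>{..<length xs} - {i}. T l * ?C (xs ! i))"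
   unfolding sum_distrib_right using i by (subst sum.remove[of _ i]) auto
  have "(\<Sum>l\<in>{..<length xs} - {i}. T l * ?C (xs ! i)) \<in> mp (xs ! i) (ks ! i)"
   using T(3) i by (intro mp_sum[OF xP[OF i]]) auto
  then show "(\<Sum>l<length xs. T l) * ?C (xs ! i) - \<gamma> i \<in> mp (xs ! i) (ks ! i)"
   unfolding e by (rule mp_add[OF xP[OF i] T(2)[OF i]])
 qed
qed

end

section \<open>Projective varieties as embedded varieties\<close>

definition rep :: "point \<Rightarrow> nat \<Rightarrow> complex" where "rep p = (SOME v. v \<in> p)"

lemma vanishes_at_proj_point:
 assumes "homogeneous d F"
 shows "vanishes_at F (proj_point v) \<longleftrightarrow> ceval v F = 0"
proof -
 have e: "ceval (\<lambda>i. c * v i) F = c ^ d * ceval v F" for c using peval_scale[OF rhom_id assms] .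
 have "vanishes_at F (proj_point v) \<longleftrightarrow> (\<forall>c. c \<noteq> 0 \<longrightarrow> ceval (\<lambda>i. c * v i) F = 0)"
  unfolding vanishes_at_def proj_point_def by blast
 also have "\<dots> \<longleftrightarrow> ceval v F = 0" unfolding e by (metis mult_eq_0_iff power_not_zero one_neq_zero)
 finally show ?thesis .
qed

lemma proj_point_scale:
 assumes c: "c \<noteq> 0" shows "proj_point (\<lambda>i. c * v i) = proj_point v"
proof (rule set_eqI)
 fix w
 have 1: "w = (\<lambda>i. t * (c * v i)) \<longleftrightarrow> w = (\<lambda>i. (t * c) * v i)" for t by (simp only: mult.assoc)
 have "(\<exists>t. w = (\<lambda>i. (t * c) * v i) \<and> t \<noteq> 0) \<longleftrightarrow> (\<exists>t. w = (\<lambda>i. t * v i) \<and> t \<noteq> 0)"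
 proof
  assume "\<exists>t. w = (\<lambda>i. (t * c) * v i) \<and> t \<noteq> 0"
  then obtain t where "w = (\<lambda>i. (t * c) * v i)" "t * c \<noteq> 0" using c by auto
  then show "\<exists>t. w = (\<lambda>i. t * v i) \<and> t \<noteq> 0" by (intro exI[of _ "t * c"] conjI)
 next
  assume "\<exists>t. w = (\<lambda>i. t * v i) \<and> t \<noteq> 0"
  then obtain t where "w = (\<lambda>i. t * v i)" "t \<noteq> 0" by blast
  then have "w = (\<lambda>i. (t / c * c) * v i)" "t / c \<noteq> 0" using c by auto
  then show "\<exists>t. w = (\<lambda>i. (t * c) * v i) \<and> t \<noteq> 0" by (intro exI[of _ "t / c"] conjI)
 qed
 then show "w \<in> proj_point (\<lambda>i. c * v i) \<longleftrightarrow> w \<in> proj_point v"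
  unfolding proj_point_def mem_Collect_eq 1 .
qed

lemma proj_point_mem: "v \<in> proj_point v"
 unfolding proj_point_def by (intro CollectI exI[of _ 1]) simp

lemma proj_point_eq_iff: "proj_point v = proj_point w \<longleftrightarrow> (\<exists>c. c \<noteq> 0 \<and> v = (\<lambda>i. c * w i))"
proof
 assume "proj_point v = proj_point w"
 then have "v \<in> proj_point w" using proj_point_mem by blast
 then show "\<exists>c. c \<noteq> 0 \<and> v = (\<lambda>i. c * w i)" unfolding proj_point_def by blast
qed (auto simp: proj_point_scale)

lemma rep_proj_space:
 assumes "p \<in> proj_space r"
 shows "proj_point (rep p) = p" "\<exists>i. rep p i \<noteq> 0" "i > r ==> rep p i = 0"
proof -
 obtain v where v: "p = proj_point v" "\<exists>i. v i \<noteq> 0" "\<forall>i>r. v i = 0"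
  using assms unfolding proj_space_def by blast
 have "rep p \<in> p" unfolding rep_def using v(1) proj_point_mem by (metis someI)
 then obtain c where "c \<noteq> 0" "rep p = (\<lambda>i. c * v i)" using v(1) unfolding proj_point_def by blast
 then show "proj_point (rep p) = p" "\<exists>i. rep p i \<noteq> 0" "i > r ==> rep p i = 0"
  using v by (auto simp: proj_point_scale)
qed

lemma vanishes_at_rep: "p \<in> proj_space r ==> homogeneous d F ==> vanishes_at F p \<longleftrightarrow> ceval (rep p) F = 0"
 using vanishes_at_proj_point[of d F "rep p"] rep_proj_space(1)[of p r] by simp

lemma proj_point_in_proj_space: "\<exists>i. v i \<noteq> 0 ==> (\<And>i. i > r ==> v i = 0) ==> proj_point v \<in> proj_space r"
 unfolding proj_space_def by blast

text \<open>A closed set is cut out by all forms vanishing on it, so one suitable form for each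
  point outside suffices.\<close>

lemma zariski_closed_iff:
 "zariski_closed r Z \<longleftrightarrow> Z \<subseteq> proj_space r \<and>
   (\<forall>p\<in>proj_space r - Z. \<exists>d F. homogeneous d F \<and> \<not> vanishes_at F p \<and> (\<forall>q\<in>Z. vanishes_at F q))"
proof
 assume "zariski_closed r Z"
 then obtain S where S: "\<forall>F\<in>S. \<exists>d. homogeneous d F" "Z = {p \<in> proj_space r. \<forall>F\<in>S. vanishes_at F p}"
  unfolding zariski_closed_def by blast
 then show "Z \<subseteq> proj_space r \<and>
   (\<forall>p\<in>proj_space r - Z. \<exists>d F. homogeneous d F \<and> \<not> vanishes_at F p \<and> (\<forall>q\<in>Z. vanishes_at F q))" by blast
next
 assume Z: "Z \<subseteq> proj_space r \<and>
   (\<forall>p\<in>proj_space r - Z. \<exists>d F. homogeneous d F \<and> \<not> vanishes_at F p \<and> (\<forall>q\<in>Z. vanishes_at F q))"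
 let ?S = "{F. (\<exists>d. homogeneous d F) \<and> (\<forall>q\<in>Z. vanishes_at F q)}"
 have "Z = {p \<in> proj_space r. \<forall>F\<in>?S. vanishes_at F p}" using Z by blast
 then show "zariski_closed r Z" unfolding zariski_closed_def by (intro exI[of _ ?S]) blast
qed

section \<open>Zariski topology and Cartier divisors in terms of coordinate vectors\<close>

context model begin

definition zcl :: "point set \<Rightarrow> bool" where
 "zcl Z \<longleftrightarrow> Z \<subseteq> Pts \<and>
   (\<forall>p\<in>Pts - Z. \<exists>d F. homogeneous d F \<and> ceval (a p) F \<noteq> 0 \<and> (\<forall>q\<in>Z. ceval (a q) F = 0))"

lemma zcl_zeros: "homogeneous d H ==> zcl {q \<in> Pts. ceval (a q) H = 0}"
 unfolding zcl_def by blast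

text \<open>Expresses \<open>cart\<close> through closed sets and local rings, so that it transfers
  between two embeddings in which these agree.\<close>

lemma cart_iff:
 "cart B \<longleftrightarrow> (\<forall>p\<in>Pts. B p \<noteq> 0 \<and> (\<exists>Z. zcl Z \<and> p \<notin> Z \<and> (\<forall>q\<in>Pts - Z. isu q (B p / B q))))"
proof
 assume c: "cart B"
 show "\<forall>p\<in>Pts. B p \<noteq> 0 \<and> (\<exists>Z. zcl Z \<and> p \<notin> Z \<and> (\<forall>q\<in>Pts - Z. isu q (B p / B q)))"
 proof
  fix p assume p: "p \<in> Pts"
  then obtain d H where "homogeneous d H" "ceval (a p) H \<noteq> 0"
   "\<forall>q\<in>Pts. ceval (a q) H \<noteq> 0 \<longrightarrow> isu q (B p / B q)" using c unfolding cart_def by blast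
  then show "B p \<noteq> 0 \<and> (\<exists>Z. zcl Z \<and> p \<notin> Z \<and> (\<forall>q\<in>Pts - Z. isu q (B p / B q)))"
   using cart_nz[OF c p] zcl_zeros[of d H] by (intro conjI exI[of _ "{q \<in> Pts. ceval (a q) H = 0}"]) auto
 qed
next
 assume R: "\<forall>p\<in>Pts. B p \<noteq> 0 \<and> (\<exists>Z. zcl Z \<and> p \<notin> Z \<and> (\<forall>q\<in>Pts - Z. isu q (B p / B q)))"
 show "cart B"
  unfolding cart_def
 proof (intro ballI conjI)
  fix p assume p: "p \<in> Pts"
  then show "B p \<noteq> 0" using R by blast
  obtain Z where Z: "zcl Z" "p \<notin> Z" "\<And>q. q \<in> Pts - Z ==> isu q (B p / B q)" using R p by blast
  obtain d F where "homogeneous d F" "ceval (a p) F \<noteq> 0" "\<forall>q\<in>Z. ceval (a q) F = 0"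
   using Z(1,2) p unfolding zcl_def by blast
  then show "\<exists>d H. homogeneous d H \<and> ceval (a p) H \<noteq> 0 \<and> (\<forall>q\<in>Pts. ceval (a q) H \<noteq> 0 \<longrightarrow> isu q (B p / B q))"
   using Z(3) by (intro exI[of _ d] exI[of _ F]) auto
 qed
qed

lemma nonvanishing_point: "homogeneous d F ==> E F \<noteq> 0 ==> \<exists>q\<in>Pts. ceval (a q) F \<noteq> 0"
 using vanish by blast

end

lemma projective_varietyD:
 assumes "projective_variety X"
 shows "irreducible_closed (ambient X) (points X)" "rhom (scalar X)"
  "homogeneous d F ==> peval (scalar X) (coord X) F = 0 \<longleftrightarrow> (\<forall>p\<in>points X. vanishes_at F p)"
  "\<exists>d F G. homogeneous d F \<and> homogeneous d G \<and> peval (scalar X) (coord X) G \<noteq> 0 \<and>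
    f = peval (scalar X) (coord X) F / peval (scalar X) (coord X) G"
 using assms unfolding projective_variety_def rhom_def by blast+

lemma points_proj_space: "projective_variety X ==> points X \<subseteq> proj_space (ambient X)"
 using projective_varietyD(1)[of X] unfolding irreducible_closed_def zariski_closed_iff by blast

lemma points_equation:
 assumes "projective_variety X" "p \<in> proj_space (ambient X)" "p \<notin> points X"
 obtains d F where "homogeneous d F" "\<not> vanishes_at F p" "\<And>q. q \<in> points X ==> vanishes_at F q"
proof -
 have "zariski_closed (ambient X) (points X)"
  using projective_varietyD(1)[OF assms(1)] unfolding irreducible_closed_def by (rule conjunct1)
 then have "\<exists>d F. homogeneous d F \<and> \<not> vanishes_at F p \<and> (\<forall>q\<in>points X. vanishes_at F q)"
  using assms(2,3) unfolding zariski_closed_iff by blast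
 then show thesis using that by blast
qed

theorem projvar_model:
 assumes X: "projective_variety X"
 shows "model (scalar X) (coord X) (ambient X) (points X) rep (local_ring X)"
proof
 note P = projective_varietyD[OF X]
 have ps: "p \<in> proj_space (ambient X)" if "p \<in> points X" for p using that points_proj_space[OF X] by blast
 note va = vanishes_at_rep[OF ps]
 show sc: "rhom (scalar X)" by fact
 show van: "peval (scalar X) (coord X) F = 0 \<longleftrightarrow> (\<forall>p\<in>points X. ceval (rep p) F = 0)" if "homogeneous d F" for d F
  using P(3)[OF that] va[OF _ that] by blast
 show "coord X i = 0" if "i > ambient X" for i
  using van[OF homogeneous_Var(1)[of i]] rep_proj_space(3)[OF ps that] by (simp add: sc)
 show "rep p i = 0" if "p \<in> points X" "i > ambient X" for p i using rep_proj_space(3)[OF ps] that by blast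
 show "\<exists>i. rep p i \<noteq> 0" if "p \<in> points X" for p using rep_proj_space(2)[OF ps] that by blast
 show "local_ring X p = {peval (scalar X) (coord X) F / peval (scalar X) (coord X) G |F G.
     (\<exists>d. homogeneous d F \<and> homogeneous d G) \<and> ceval (rep p) G \<noteq> 0}" if "p \<in> points X" for p
  unfolding local_ring_def germs_along_def using va[OF that] by blast
 show "\<exists>p\<in>points X. \<exists>c. c \<noteq> 0 \<and> b = (\<lambda>i. c * rep p i)"
  if b: "\<exists>i. b i \<noteq> 0" "\<And>i. i > ambient X ==> b i = 0"
   "\<And>d F. homogeneous d F ==> peval (scalar X) (coord X) F = 0 ==> ceval b F = 0" for b
 proof -
  have bp: "proj_point b \<in> proj_space (ambient X)" by (rule proj_point_in_proj_space[OF b(1,2)])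
  have "proj_point b \<in> points X"
  proof (rule ccontr)
   assume "proj_point b \<notin> points X"
   then obtain d F where F: "homogeneous d F" "\<not> vanishes_at F (proj_point b)" "\<And>q. q \<in> points X ==> vanishes_at F q"
    using points_equation[OF X bp] by metis
   then show False using b(3)[OF F(1)] P(3)[OF F(1)] vanishes_at_proj_point[OF F(1)] by blast
  qed
  moreover have "proj_point b = proj_point (rep (proj_point b))" using rep_proj_space(1)[OF bp] by simp
  ultimately show ?thesis using proj_point_eq_iff by blast
 qed
 show "p = q" if "p \<in> points X" "q \<in> points X" "c \<noteq> 0" "rep p = (\<lambda>i. c * rep q i)" for p q c
  using that rep_proj_space(1)[OF ps] proj_point_scale by metis
 show "\<exists>d F G. homogeneous d F \<and> homogeneous d G \<and> peval (scalar X) (coord X) G \<noteq> 0 \<and>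
   f = peval (scalar X) (coord X) F / peval (scalar X) (coord X) G" for f by (rule P(4))
 show "points X \<noteq> {}" using P(1) unfolding irreducible_closed_def by blast
qed

context
 fixes X :: "'k::field projvar"
 assumes X: "projective_variety X"
begin

interpretation o: model "scalar X" "coord X" "ambient X" "points X" rep "local_ring X"
 by (rule projvar_model[OF X])

lemma val_eq_value_at: "o.val = value_at X"
 by (intro ext) (simp add: o.val_def value_at_def)

lemma zariski_closed_eq_zcl:
 assumes "Z \<subseteq> points X" shows "zariski_closed (ambient X) Z \<longleftrightarrow> o.zcl Z"
proof -
 have ps: "p \<in> proj_space (ambient X)" if "p \<in> points X" for p using that points_proj_space[OF X] by blast
 note va = vanishes_at_rep[OF ps]
 show ?thesis
 proof
  assume "zariski_closed (ambient X) Z"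
  then have Z: "\<And>p. p \<in> proj_space (ambient X) - Z ==> \<exists>d F. homogeneous d F \<and> \<not> vanishes_at F p \<and> (\<forall>q\<in>Z. vanishes_at F q)"
   unfolding zariski_closed_iff by blast
  show "o.zcl Z" unfolding o.zcl_def
  proof (intro conjI ballI assms)
   fix p assume p: "p \<in> points X - Z"
   then obtain d F where F: "homogeneous d F" "\<not> vanishes_at F p" "\<forall>q\<in>Z. vanishes_at F q" using Z ps by blast
   then show "\<exists>d F. homogeneous d F \<and> ceval (rep p) F \<noteq> 0 \<and> (\<forall>q\<in>Z. ceval (rep q) F = 0)"
    using va[OF _ F(1)] p assms by blast
  qed
 next
  assume Z: "o.zcl Z"
  show "zariski_closed (ambient X) Z" unfolding zariski_closed_iff
  proof (intro conjI ballI)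
   show "Z \<subseteq> proj_space (ambient X)" using assms ps by blast
   fix p assume p: "p \<in> proj_space (ambient X) - Z"
   show "\<exists>d F. homogeneous d F \<and> \<not> vanishes_at F p \<and> (\<forall>q\<in>Z. vanishes_at F q)"
   proof (cases "p \<in> points X")
    case True
    then obtain d F where F: "homogeneous d F" "ceval (rep p) F \<noteq> 0" "\<forall>q\<in>Z. ceval (rep q) F = 0"
     using Z p unfolding o.zcl_def by blast
    then show ?thesis using va[OF _ F(1)] True assms by blast
   next
    case False
    then obtain d F where "homogeneous d F" "\<not> vanishes_at F p" "\<And>q. q \<in> points X ==> vanishes_at F q"
     using p points_equation[OF X] by blast
    then show ?thesis using assms by blast
   qed
  qed
 qed
qed

lemma open_nbhd_iff: "p \<in> points X ==> open_nbhd X p U \<longleftrightarrow> (\<exists>Z. o.zcl Z \<and> p \<notin> Z \<and> U = points X - Z)"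
proof -
 assume p: "p \<in> points X"
 show ?thesis
 proof
  assume "open_nbhd X p U"
  then obtain Z where Z: "p \<in> U" "zariski_closed (ambient X) Z" "U = points X - Z" unfolding open_nbhd_def by blast
  have "o.zcl (Z \<inter> points X)"
   unfolding o.zcl_def
  proof (intro conjI ballI)
   fix q assume q: "q \<in> points X - Z \<inter> points X"
   have qs: "q \<in> proj_space (ambient X)" using q points_proj_space[OF X] by blast
   then obtain d F where F: "homogeneous d F" "\<not> vanishes_at F q" "\<forall>q\<in>Z. vanishes_at F q"
    using Z(2) q unfolding zariski_closed_iff by blast
   then show "\<exists>d F. homogeneous d F \<and> ceval (rep q) F \<noteq> 0 \<and> (\<forall>q\<in>Z \<inter> points X. ceval (rep q) F = 0)"
    using vanishes_at_rep[OF _ F(1)] qs points_proj_space[OF X] by blast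
  qed blast
  then show "\<exists>Z. o.zcl Z \<and> p \<notin> Z \<and> U = points X - Z" using Z by (intro exI[of _ "Z \<inter> points X"]) blast
 next
  assume "\<exists>Z. o.zcl Z \<and> p \<notin> Z \<and> U = points X - Z"
  then obtain Z where Z: "o.zcl Z" "p \<notin> Z" "U = points X - Z" by blast
  then have "zariski_closed (ambient X) Z" using zariski_closed_eq_zcl unfolding o.zcl_def by blast
  then show "open_nbhd X p U" unfolding open_nbhd_def using Z p by blast
 qed
qed

lemma cartier_divisor_iff: "cartier_divisor X B \<longleftrightarrow> o.cart B"
proof -
 have *: "(B p / B q \<in> local_ring X q \<and> B q / B p \<in> local_ring X q) \<longleftrightarrow> o.isu q (B p / B q)"
  if "q \<in> points X" "B p \<noteq> 0" "B q \<noteq> 0" for p q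
  using o.isu_iff[OF that(1), of "B p / B q"] that by simp
 show ?thesis
  unfolding cartier_divisor_def o.cart_iff
 proof (intro iffI ballI)
  fix p assume p: "p \<in> points X" and c: "\<forall>p\<in>points X. B p \<noteq> 0 \<and>
   (\<exists>U. open_nbhd X p U \<and> (\<forall>q\<in>U. B p / B q \<in> local_ring X q \<and> B q / B p \<in> local_ring X q))"
  then show "B p \<noteq> 0 \<and> (\<exists>Z. o.zcl Z \<and> p \<notin> Z \<and> (\<forall>q\<in>points X - Z. o.isu q (B p / B q)))"
   using open_nbhd_iff[OF p] * by (metis DiffD1)
 next
  fix p assume p: "p \<in> points X" and c: "\<forall>p\<in>points X. B p \<noteq> 0 \<and>
   (\<exists>Z. o.zcl Z \<and> p \<notin> Z \<and> (\<forall>q\<in>points X - Z. o.isu q (B p / B q)))"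
  then obtain Z where Z: "o.zcl Z" "p \<notin> Z" "\<And>q. q \<in> points X - Z ==> o.isu q (B p / B q)" by blast
  have "open_nbhd X p (points X - Z)" using open_nbhd_iff[OF p] Z by blast
  moreover have "B p / B q \<in> local_ring X q \<and> B q / B p \<in> local_ring X q" if "q \<in> points X - Z" for q
   using *[of q p] Z(3)[OF that] that c p by blast
  ultimately show "B p \<noteq> 0 \<and>
   (\<exists>U. open_nbhd X p U \<and> (\<forall>q\<in>U. B p / B q \<in> local_ring X q \<and> B q / B p \<in> local_ring X q))"
   using c p by blast
 qed
qed

text \<open>A closed immersion re-embeds the variety without changing points, local rings or closed
  sets; only the coordinates and the coordinate vectors are new. The very ample multiple
  \<open>m0 D\<close> is studied in this embedding.\<close>

theorem very_ample_pmodel: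
 assumes D: "very_ample X D0"
 obtains M s a where "pmodel (scalar X) s M (points X) a (local_ring X) D0"
  "\<And>Z. Z \<subseteq> points X ==> model.zcl (points X) a Z \<longleftrightarrow> o.zcl Z"
proof -
 obtain M s where s: "\<And>i. i \<le> M ==> s i \<in> sections X D0" "\<And>i. i > M ==> s i = 0"
  "\<And>p. p \<in> points X ==> \<exists>i\<le>M. s i * D0 p \<notin> max_ideal (local_ring X p)"
  "inj_on (section_map X D0 s) (points X)"
  "\<And>Z. Z \<subseteq> points X ==> zariski_closed (ambient X) Z \<longleftrightarrow> zariski_closed M (section_map X D0 s ` Z)"
  "\<And>p. p \<in> points X ==> germs_along (scalar X) s (section_map X D0 s p) = local_ring X p"
  and cD: "cartier_divisor X D0"
  using D unfolding very_ample_def by metis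
 have cD: "o.cart D0" using cD cartier_divisor_iff by blast
 define a where "a p i = value_at X p (s i * D0 p)" for p i
 have sm: "section_map X D0 s p = proj_point (a p)" for p by (simp add: section_map_def a_def[abs_def])
 have sO: "s i * D0 p \<in> local_ring X p" if "p \<in> points X" for p i
  using s(1)[of i] s(2)[of i] that o.Ov_simps(1)[OF that] by (cases "i \<le> M") (auto simp: sections_def)
 have av: "a p i = o.val p (s i * D0 p)" for p i by (simp add: a_def val_eq_value_at)
 have a0: "a p i = 0" if "p \<in> points X" "i > M" for p i using s(2)[OF that(2)] that(1) by (simp add: av)
 have ane: "\<exists>i. a p i \<noteq> 0" if "p \<in> points X" for p
  using s(3)[OF that] sO[OF that] o.max_ideal_iff[OF that] by (auto simp: av)
 have ED: "peval (scalar X) s F * D0 p ^ d \<in> local_ring X p"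
  "o.val p (peval (scalar X) s F * D0 p ^ d) = ceval (a p) F" if p: "p \<in> points X" and F: "homogeneous d F" for d F p
 proof -
  have "peval (scalar X) s F * D0 p ^ d = peval (scalar X) (\<lambda>i. s i * D0 p) F"
   using peval_scale[OF o.sc F, of "D0 p" s] by (simp add: mult.commute)
  then show "peval (scalar X) s F * D0 p ^ d \<in> local_ring X p"
   "o.val p (peval (scalar X) s F * D0 p ^ d) = ceval (a p) F"
   using o.val_peval[OF p sO[OF p]] by (simp_all add: av[abs_def])
 qed
 have van: "peval (scalar X) s F = 0 \<longleftrightarrow> (\<forall>p\<in>points X. ceval (a p) F = 0)" if F: "homogeneous d F" for d F
 proof
  assume "peval (scalar X) s F = 0"
  then show "\<forall>p\<in>points X. ceval (a p) F = 0" using ED(2)[OF _ F] by auto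
 next
  \<comment> \<open>A nonzero rational function is a unit at some point \<open>q\<close>, and
    \<open>q\<close> can be taken where the trivializations by \<open>D0 p\<close> and
    \<open>D0 q\<close> differ by a unit; there \<open>F\<close> has a nonzero value.\<close>
  assume z: "\<forall>p\<in>points X. ceval (a p) F = 0"
  show "peval (scalar X) s F = 0"
  proof (rule ccontr)
   assume nz: "peval (scalar X) s F \<noteq> 0"
   obtain p where p: "p \<in> points X" using o.ne by blast
   have Dp: "D0 p \<noteq> 0" using o.cart_nz[OF cD p] .
   obtain e H where H: "homogeneous e H" "ceval (rep p) H \<noteq> 0"
    "\<And>q. q \<in> points X ==> ceval (rep q) H \<noteq> 0 ==> o.isu q (D0 p / D0 q)"
    using cD p unfolding o.cart_def by blast
   let ?f = "peval (scalar X) s F * D0 p ^ d"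
   obtain n A B where AB: "homogeneous n A" "homogeneous n B" "ceval (rep p) B \<noteq> 0" "?f = o.E A / o.E B" "o.E B \<noteq> 0"
    by (metis o.Ov_E[OF p ED(1)[OF p F]])
   have "o.E A \<noteq> 0" using AB nz Dp by auto
   moreover have "o.E H \<noteq> 0" using o.E_nz[OF p H(1,2)] .
   ultimately have "o.E (A * B * H) \<noteq> 0" using AB(5) by (simp add: o.E_simps)
   then obtain q where q: "q \<in> points X" "ceval (rep q) (A * B * H) \<noteq> 0"
    using o.nonvanishing_point[OF homogeneous_mult[OF homogeneous_mult[OF AB(1,2)] H(1)]] by blast
   then have q2: "ceval (rep q) A \<noteq> 0" "ceval (rep q) B \<noteq> 0" "ceval (rep q) H \<noteq> 0" by (auto simp: o.ce_simps)
   have "o.isu q ?f" unfolding AB(4) o.isu_def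
    using o.Ov_I[OF q(1) AB(1,2) q2(2)] o.val_frac[OF q(1) AB(1,2) q2(2)] q2 by simp
   then have "o.isu q (?f / (D0 p / D0 q) ^ d)"
    by (intro o.isu_divide o.isu_power q(1) H(3)[OF q(1) q2(3)])
   moreover have "?f / (D0 p / D0 q) ^ d = peval (scalar X) s F * D0 q ^ d"
    using Dp by (simp add: power_divide)
   ultimately show False using ED(2)[OF q(1) F] z q(1) unfolding o.isu_def by simp
  qed
 qed
 have ps: "proj_point (a p) \<in> proj_space M" if "p \<in> points X" for p
  by (rule proj_point_in_proj_space[OF ane[OF that] a0[OF that]])
 have va: "vanishes_at F (section_map X D0 s p) \<longleftrightarrow> ceval (a p) F = 0" if "homogeneous d F" for d F p
  unfolding sm by (rule vanishes_at_proj_point[OF that])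
 have cX: "zariski_closed M (section_map X D0 s ` points X)"
  using s(5)[of "points X"] projective_varietyD(1)[OF X] unfolding irreducible_closed_def by blast
 have pm: "pmodel (scalar X) s M (points X) a (local_ring X) D0"
 proof
  show "rhom (scalar X)" by (rule o.sc)
  show "s i = 0" if "i > M" for i by (rule s(2)[OF that])
  show "a p i = 0" if "p \<in> points X" "i > M" for p i by (rule a0[OF that])
  show "\<exists>i. a p i \<noteq> 0" if "p \<in> points X" for p by (rule ane[OF that])
  show "local_ring X p = {peval (scalar X) s F / peval (scalar X) s G |F G.
     (\<exists>d. homogeneous d F \<and> homogeneous d G) \<and> ceval (a p) G \<noteq> 0}" if "p \<in> points X" for p
   unfolding s(6)[OF that, symmetric] germs_along_def using va by blast
  show "peval (scalar X) s F = 0 \<longleftrightarrow> (\<forall>p\<in>points X. ceval (a p) F = 0)" if "homogeneous d F" for d F by (rule van[OF that])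
  show "\<exists>p\<in>points X. \<exists>c. c \<noteq> 0 \<and> b = (\<lambda>i. c * a p i)"
   if b: "\<exists>i. b i \<noteq> 0" "\<And>i. i > M ==> b i = 0"
    "\<And>d F. homogeneous d F ==> peval (scalar X) s F = 0 ==> ceval b F = 0" for b
  proof -
   have bp: "proj_point b \<in> proj_space M" by (rule proj_point_in_proj_space[OF b(1,2)])
   have "proj_point b \<in> section_map X D0 s ` points X"
   proof (rule ccontr)
    assume "proj_point b \<notin> section_map X D0 s ` points X"
    then obtain d F where F: "homogeneous d F" "\<not> vanishes_at F (proj_point b)"
     "\<forall>q\<in>section_map X D0 s ` points X. vanishes_at F q"
     using cX bp unfolding zariski_closed_iff by blast
    then have "peval (scalar X) s F = 0" using van[OF F(1)] va[OF F(1)] by blast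
    then show False using b(3)[OF F(1)] vanishes_at_proj_point[OF F(1)] F(2) by blast
   qed
   then show ?thesis unfolding sm using proj_point_eq_iff by blast
  qed
  show "p = q" if "p \<in> points X" "q \<in> points X" "c \<noteq> 0" "a p = (\<lambda>i. c * a q i)" for p q c
  proof -
   have "section_map X D0 s p = section_map X D0 s q" unfolding sm using that proj_point_scale by metis
   then show ?thesis using s(4) that unfolding inj_on_def by blast
  qed
  show "\<exists>d F G. homogeneous d F \<and> homogeneous d G \<and> peval (scalar X) s G \<noteq> 0 \<and>
    f = peval (scalar X) s F / peval (scalar X) s G" for f
  proof -
   obtain n A B where AB: "homogeneous n A" "homogeneous n B" "o.E B \<noteq> 0" "f = o.E A / o.E B" using o.frac by blast
   obtain q where q: "q \<in> points X" "ceval (rep q) B \<noteq> 0" using o.nonvanishing_point[OF AB(2,3)] by blast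
   have "f \<in> local_ring X q" using o.Ov_I[OF q(1) AB(1,2) q(2)] AB(4) by simp
   then obtain F G d where F: "homogeneous d F" "homogeneous d G" "ceval (a q) G \<noteq> 0"
    "f = peval (scalar X) s F / peval (scalar X) s G"
    unfolding s(6)[OF q(1), symmetric] germs_along_def using va by blast
   then show ?thesis using van[OF F(2)] q(1) by blast
  qed
  show "points X \<noteq> {}" by (rule o.ne)
  show "D0 p \<noteq> 0" if "p \<in> points X" for p using o.cart_nz[OF cD that] .
  show "s i * D0 p \<in> local_ring X p" if "p \<in> points X" for p i by (rule sO[OF that])
  show "model.val (scalar X) (local_ring X) p (s i * D0 p) = a p i" if "p \<in> points X" for p i
   by (simp add: av)
 qed
 interpret n: pmodel "scalar X" s M "points X" a "local_ring X" D0 by (rule pm)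
 have "n.zcl Z \<longleftrightarrow> o.zcl Z" if Z: "Z \<subseteq> points X" for Z
 proof -
  have "zariski_closed M (section_map X D0 s ` Z) \<longleftrightarrow> n.zcl Z"
  proof
   assume c: "zariski_closed M (section_map X D0 s ` Z)"
   show "n.zcl Z" unfolding n.zcl_def
   proof (intro conjI ballI Z)
    fix p assume p: "p \<in> points X - Z"
    then have "section_map X D0 s p \<notin> section_map X D0 s ` Z" using s(4) Z unfolding inj_on_def by blast
    moreover have "section_map X D0 s p \<in> proj_space M" unfolding sm using ps p by blast
    ultimately obtain d F where F: "homogeneous d F" "\<not> vanishes_at F (section_map X D0 s p)"
     "\<forall>q\<in>section_map X D0 s ` Z. vanishes_at F q" using c unfolding zariski_closed_iff by blast
    then show "\<exists>d F. homogeneous d F \<and> ceval (a p) F \<noteq> 0 \<and> (\<forall>q\<in>Z. ceval (a q) F = 0)"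
     using va[OF F(1)] by blast
   qed
  next
   assume c: "n.zcl Z"
   show "zariski_closed M (section_map X D0 s ` Z)" unfolding zariski_closed_iff
   proof (intro conjI ballI)
    show "section_map X D0 s ` Z \<subseteq> proj_space M" using ps Z unfolding sm by blast
    fix p assume p: "p \<in> proj_space M - section_map X D0 s ` Z"
    show "\<exists>d F. homogeneous d F \<and> \<not> vanishes_at F p \<and> (\<forall>q\<in>section_map X D0 s ` Z. vanishes_at F q)"
    proof (cases "p \<in> section_map X D0 s ` points X")
     case True
     then obtain r where r: "p = section_map X D0 s r" "r \<in> points X - Z" using p by blast
     then obtain d F where F: "homogeneous d F" "ceval (a r) F \<noteq> 0" "\<forall>q\<in>Z. ceval (a q) F = 0"
      using c unfolding n.zcl_def by blast
     then show ?thesis using va[OF F(1)] r by blast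
    next
     case False
     then obtain d F where F: "homogeneous d F" "\<not> vanishes_at F p" "\<forall>q\<in>section_map X D0 s ` points X. vanishes_at F q"
      using p cX unfolding zariski_closed_iff by blast
     then show ?thesis using Z by blast
    qed
   qed
  qed
  then show ?thesis using s(5)[OF Z] zariski_closed_eq_zcl[OF Z] by blast
 qed
 with pm show thesis by (rule that)
qed

end

section \<open>Very ampleness of the sum of a very ample and a globally generated divisor\<close>

context pmodel begin

text \<open>The products \<open>s i * u l\<close> of sections define the Segre embedding of the graph of the morphism
 given by the \<open>u l\<close>; the product with indices \<open>(i, l)\<close> is number \<open>i * L + l\<close>.\<close>

theorem segre:
 assumes cB: "cart B" and gB: "gg B"
 obtains t w M' where
  "\<And>m p. p \<in> Pts ==> t m * (D0 p * B p) \<in> Ov p" "\<And>m p. p \<in> Pts ==> val p (t m * (D0 p * B p)) = w p m"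
  "\<And>m. m > M' ==> t m = 0" "\<And>p. p \<in> Pts ==> \<exists>m\<le>M'. w p m \<noteq> 0"
  "\<And>p q c. p \<in> Pts ==> q \<in> Pts ==> c \<noteq> 0 ==> w p = (\<lambda>m. c * w q m) ==> p = q"
  "\<And>Z v. zcl Z ==> \<exists>m. v m \<noteq> 0 ==> (\<And>m. m > M' ==> v m = 0) ==>
    (\<And>d F. homogeneous d F ==> \<forall>q\<in>Z. ceval (w q) F = 0 ==> ceval v F = 0) ==>
    \<exists>p\<in>Z. \<exists>c. c \<noteq> 0 \<and> v = (\<lambda>m. c * w p m)"
  "\<And>Z p d F. Z \<subseteq> Pts ==> p \<in> Pts ==> homogeneous d F ==> ceval (w p) F \<noteq> 0 ==>
    \<forall>q\<in>Z. ceval (w q) F = 0 ==>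
    \<exists>e H. homogeneous e H \<and> ceval (a p) H \<noteq> 0 \<and> (\<forall>q\<in>Z. ceval (a q) H = 0)"
  "\<And>p. p \<in> Pts ==> Ov p = {peval sc t F / peval sc t G | F G.
    (\<exists>d. homogeneous d F \<and> homogeneous d G) \<and> ceval (w p) G \<noteq> 0}"
proof -
 obtain L :: nat and u where u: "\<And>l q. q \<in> Pts ==> u l * B q \<in> Ov q" "\<And>l. l \<ge> L ==> u l = 0"
  "\<And>p. p \<in> Pts ==> \<exists>l<L. isu p (u l * B p)" using gg_finite[OF cB gB] by metis
 obtain p0 where "p0 \<in> Pts" using ne by blast
 then have L: "L > 0" using u(3)[of p0] by auto
 define b where "b p l = val p (u l * B p)" for p l
 have b0: "b p l = 0" if "p \<in> Pts" "l \<ge> L" for p l using u(2)[OF that(2)] that(1) by (simp add: b_def)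
 have bL: "l < L" if "p \<in> Pts" "b p l \<noteq> 0" for p l using b0 that not_less by blast
 have bex: "\<exists>l. b p l \<noteq> 0" if "p \<in> Pts" for p using u(3)[OF that] by (auto simp: isu_def b_def)
 have bu: "isu p (u l * B p)" if "p \<in> Pts" "b p l \<noteq> 0" for p l
  using that u(1) by (simp add: isu_def b_def)
 define t where "t m = s (m div L) * u (m mod L)" for m
 define w where "w p m = a p (m div L) * b p (m mod L)" for p m
 \<comment> \<open>A bound past which \<open>m div L > M\<close>, so that the products
   vanish.\<close>
 define M' where "M' = M * L + L"
 have tidx: "t (i * L + l) = s i * u l" if "l < L" for i l using that by (simp add: t_def)
 have widx: "w p (i * L + l) = a p i * b p l" if "l < L" for p i l using that by (simp add: w_def)
 have tB: "t m * (D0 p * B p) = (s (m div L) * D0 p) * (u (m mod L) * B p)" for m p by (simp add: t_def)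
 have 1: "t m * (D0 p * B p) \<in> Ov p" "val p (t m * (D0 p * B p)) = w p m" if "p \<in> Pts" for m p
  unfolding tB w_def b_def using sD0[OF that] u(1)[OF that] val_sD0[OF that]
  by (simp_all add: Ov_simps(6)[OF that] val_ops(2)[OF that])
 have big: "m div L > M" if "m > M'" for m
  using that L unfolding M'_def by (metis div_le_mono div_mult_self_is_m less_eq_Suc_le mult_Suc add.commute less_imp_le)
 have 2: "t m = 0" if "m > M'" for m using s_supp[OF big[OF that]] by (simp add: t_def)
 have 3: "\<exists>m\<le>M'. w p m \<noteq> 0" if p: "p \<in> Pts" for p
 proof -
  obtain i l where il: "a p i \<noteq> 0" "b p l \<noteq> 0" using a_ne[OF p] bex[OF p] by blast
  have "i \<le> M" "l < L" using a_le[OF p il(1)] bL[OF p il(2)] by auto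
  then have "i * L + l \<le> M'" unfolding M'_def by (intro add_mono mult_le_mono) auto
  then show ?thesis using widx[OF \<open>l < L\<close>, of p i] il by (intro exI[of _ "i * L + l"]) auto
 qed
 have 4: "p = q" if pq: "p \<in> Pts" "q \<in> Pts" "c \<noteq> 0" "w p = (\<lambda>m. c * w q m)" for p q c
 proof -
  obtain l where l: "b p l \<noteq> 0" using bex[OF pq(1)] by blast
  have lL: "l < L" using bL[OF pq(1) l] .
  have e: "a p i * b p l = c * (a q i * b q l)" for i
   using fun_cong[OF pq(4), of "i * L + l"] widx[OF lL] by simp
  obtain i where "a p i \<noteq> 0" using a_ne[OF pq(1)] by blast
  then have "b q l \<noteq> 0" using e[of i] l by auto
  moreover have "a p = (\<lambda>i. (c * b q l / b p l) * a q i)" using e l by (auto simp: fun_eq_iff field_simps)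
  ultimately show ?thesis using inj[OF pq(1,2), of "c * b q l / b p l"] pq(3) l by simp
 qed
 have ps: "ceval (w q) (psubst (\<lambda>i. Var (i * L + l)) F) = b q l ^ d * ceval (a q) F"
  if "l < L" "homogeneous d F" for q l d F
 proof -
  have "(\<lambda>i. w q (i * L + l)) = (\<lambda>i. b q l * a q i)" using widx[OF that(1)] by (simp add: mult.commute)
  then show ?thesis using peval_scale[OF rhom_id that(2), of "b q l" "a q"] by (simp add: peval_psubst)
 qed
 have hps: "homogeneous d (psubst (\<lambda>i. Var (i * L + l)) F)" if "homogeneous d F" for l d F
  using homogeneous_psubst[OF that homogeneous_Var(1)] by simp
 have 5: "\<exists>p\<in>Z. \<exists>c. c \<noteq> 0 \<and> v = (\<lambda>m. c * w p m)"
  if Z: "zcl Z" and v: "\<exists>m. v m \<noteq> 0" "\<And>m. m > M' ==> v m = 0"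
   and vF: "\<And>d F. homogeneous d F ==> \<forall>q\<in>Z. ceval (w q) F = 0 ==> ceval v F = 0" for Z v
 proof -
  have ZP: "Z \<subseteq> Pts" using Z by (simp add: zcl_def)
  \<comment> \<open>The 2 by 2 minors vanish on the image, so \<open>v\<close> is up to a scalar the
    product of the vectors \<open>\<alpha>\<close> and \<open>\<beta>\<close>, the column and the
    row through the nonzero entry \<open>m1\<close>.\<close>
  have quad: "v (i * L + l) * v (i1 * L + l1) = v (i * L + l1) * v (i1 * L + l)" if "l < L" "l1 < L" for i i1 l l1
  proof -
   let ?F = "Var (i * L + l) * Var (i1 * L + l1) - Var (i * L + l1) * Var (i1 * L + l)"
   have "homogeneous (1 + 1) ?F" by (intro homogeneous_diff homogeneous_mult homogeneous_Var)
   moreover have "\<forall>q\<in>Z. ceval (w q) ?F = 0" using widx that by (simp add: ce_simps)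
   ultimately have "ceval v ?F = 0" by (rule vF)
   then show ?thesis by (simp add: ce_simps)
  qed
  obtain m1 where m1: "v m1 \<noteq> 0" using v by blast
  define i1 where "i1 = m1 div L"
  define l1 where "l1 = m1 mod L"
  have l1: "l1 < L" and m1e: "m1 = i1 * L + l1" using L by (simp_all add: l1_def i1_def)
  define \<alpha> where "\<alpha> i = v (i * L + l1)" for i
  define \<beta> where "\<beta> l = v (i1 * L + l)" for l
  have \<alpha>F: "ceval \<alpha> F = 0" if F: "homogeneous d F" "\<forall>q\<in>Z. ceval (a q) F = 0" for d F
  proof -
   have "ceval v (psubst (\<lambda>i. Var (i * L + l1)) F) = 0"
    using F(2) by (intro vF[OF hps[OF F(1)]] ballI) (simp add: ps[OF l1 F(1)])
   then show ?thesis by (simp add: peval_psubst \<alpha>_def[abs_def])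
  qed
  have "\<exists>i. \<alpha> i \<noteq> 0" using m1 m1e by (intro exI[of _ i1]) (simp add: \<alpha>_def)
  moreover have "\<alpha> i = 0" if "i > M" for i
  proof (rule \<alpha>F[of 1 "Var i", simplified])
   show "\<forall>q\<in>Z. a q i = 0" using a_supp that ZP by blast
  qed
  moreover have "ceval \<alpha> F = 0" if "homogeneous d F" "E F = 0" for d F
   using \<alpha>F[OF that(1)] vanish[OF that(1)] that(2) ZP by blast
  ultimately obtain p c where p: "p \<in> Pts" "c \<noteq> 0" "\<alpha> = (\<lambda>i. c * a p i)" using closed[of \<alpha>] by blast
  have "p \<in> Z"
  proof (rule ccontr)
   assume "p \<notin> Z"
   then obtain d F where F: "homogeneous d F" "ceval (a p) F \<noteq> 0" "\<forall>q\<in>Z. ceval (a q) F = 0"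
    using Z p unfolding zcl_def by blast
   then show False using \<alpha>F[OF F(1,3)] p(2) peval_scale[OF rhom_id F(1), of c "a p"] unfolding p(3) by simp
  qed
  obtain l0 where l0: "b p l0 \<noteq> 0" using bex[OF p(1)] by blast
  have l0L: "l0 < L" using bL[OF p(1) l0] .
  \<comment> \<open>On the graph the second factor is a function of the first: near \<open>p\<close>
    the ratio \<open>u l / u l0\<close> is a quotient \<open>G / H\<close> of forms, and the
    resulting relation is a form vanishing at all image points.\<close>
  have \<beta>: "\<beta> l = \<beta> l0 / b p l0 * b p l" if l: "l < L" for l
  proof -
   have "u l / u l0 = (u l * B p) / (u l0 * B p)" using cart_nz[OF cB p(1)] by simp
   moreover have "\<dots> \<in> Ov p" "val p \<dots> = b p l / b p l0"
    using u(1)[OF p(1), of l] isu_inverse[OF p(1) bu[OF p(1) l0]] p(1)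
    by (simp_all add: divide_inverse Ov_simps(6) isu_def val_ops b_def)
   ultimately have r: "u l / u l0 \<in> Ov p" "val p (u l / u l0) = b p l / b p l0" by simp_all
   then obtain d G H where G: "homogeneous d G" "homogeneous d H" "ceval (a p) H \<noteq> 0" "u l / u l0 = E G / E H" "E H \<noteq> 0"
    by (metis Ov_E[OF p(1)])
   have GH: "ceval (a p) G / ceval (a p) H = b p l / b p l0" using val_frac[OF p(1) G(1-3)] G(4) r(2) by simp
   have u0: "u l0 \<noteq> 0" using isu_nz[OF p(1) bu[OF p(1) l0]] by auto
   have rel: "ceval (a q) H * b q l = ceval (a q) G * b q l0" if q: "q \<in> Pts" for q
   proof -
    have "E H * u l = E G * u l0" using G(4,5) u0 by (simp add: field_simps)
    then have "(E H * D0 q ^ d) * (u l * B q) = (E G * D0 q ^ d) * (u l0 * B q)"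
     by (metis (no_types, opaque_lifting) mult.assoc mult.commute)
    from arg_cong[OF this, of "val q"] show ?thesis
     by (simp add: val_ops(2)[OF q] E_D0[OF q] G u(1)[OF q] b_def)
   qed
   let ?F = "psubst (\<lambda>i. Var (i * L + l1)) H * Var (i1 * L + l) - psubst (\<lambda>i. Var (i * L + l1)) G * Var (i1 * L + l0)"
   have "homogeneous (d + 1) ?F" by (intro homogeneous_diff homogeneous_mult hps G homogeneous_Var)
   moreover have "ceval (w q) ?F = 0" if "q \<in> Z" for q
   proof -
    have "ceval (w q) ?F = b q l1 ^ d * ceval (a q) H * (a q i1 * b q l) - b q l1 ^ d * ceval (a q) G * (a q i1 * b q l0)"
     by (simp add: ce_simps ps[OF l1 G(1)] ps[OF l1 G(2)] widx[OF l] widx[OF l0L])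
    then have "ceval (w q) ?F = b q l1 ^ d * a q i1 * (ceval (a q) H * b q l - ceval (a q) G * b q l0)"
     by (simp add: algebra_simps)
    then show ?thesis using rel[of q] that ZP by auto
   qed
   ultimately have "ceval v ?F = 0" using vF by blast
   then have "ceval \<alpha> H * \<beta> l = ceval \<alpha> G * \<beta> l0"
    by (simp add: ce_simps peval_psubst \<alpha>_def[abs_def] \<beta>_def)
   then have "ceval (a p) H * \<beta> l = ceval (a p) G * \<beta> l0"
    unfolding p(3) peval_scale[OF rhom_id G(1)] peval_scale[OF rhom_id G(2)] using p(2) by simp
   then have "\<beta> l = ceval (a p) G / ceval (a p) H * \<beta> l0" using G(3) by (simp add: field_simps)
   then show ?thesis unfolding GH by simp
  qed
  have vil: "v (i * L + l) = (c * (\<beta> l0 / b p l0) / v m1) * w p (i * L + l)" if "l < L" for i l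
  proof -
   have "v (i * L + l) * v m1 = \<alpha> i * \<beta> l" using quad[OF that l1, of i i1] by (simp add: \<alpha>_def \<beta>_def m1e)
   also have "\<dots> = c * a p i * (\<beta> l0 / b p l0 * b p l)" using \<beta>[OF that] p(3) by simp
   finally show ?thesis unfolding widx[OF that] using m1 l0 by (simp add: field_simps)
  qed
  have "v = (\<lambda>m. (c * (\<beta> l0 / b p l0) / v m1) * w p m)"
  proof
   fix m
   show "v m = (c * (\<beta> l0 / b p l0) / v m1) * w p m"
    using vil[of "m mod L" "m div L"] L by simp
  qed
  moreover have "c * (\<beta> l0 / b p l0) / v m1 \<noteq> 0" using vil[OF l1, of i1] m1 m1e by auto
  ultimately show ?thesis using \<open>p \<in> Z\<close> by blast
 qed
 have tD: "peval sc t F * (D0 p * B p) ^ d \<in> Ov p" "val p (peval sc t F * (D0 p * B p) ^ d) = ceval (w p) F"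
  if p: "p \<in> Pts" and F: "homogeneous d F" for p d F
 proof -
  have "peval sc t F * (D0 p * B p) ^ d = peval sc (\<lambda>m. t m * (D0 p * B p)) F"
   using peval_scale[OF sc F, of "D0 p * B p" t] by (simp add: mult.commute)
  then show "peval sc t F * (D0 p * B p) ^ d \<in> Ov p" "val p (peval sc t F * (D0 p * B p) ^ d) = ceval (w p) F"
   using val_peval[OF p 1(1)[OF p]] by (simp_all add: 1(2)[OF p])
 qed
 \<comment> \<open>A form in the products that separates \<open>p\<close> from \<open>Z\<close>
   yields one in the original coordinates: divided by a power of a product that is nonzero at
   \<open>p\<close> it is a unit near \<open>p\<close>, and \<open>?H\<close> describes such a
   neighbourhood.\<close>
 have 6: "\<exists>e H. homogeneous e H \<and> ceval (a p) H \<noteq> 0 \<and> (\<forall>q\<in>Z. ceval (a q) H = 0)"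
  if Z: "Z \<subseteq> Pts" and p: "p \<in> Pts" and F: "homogeneous d F" "ceval (w p) F \<noteq> 0" "\<forall>q\<in>Z. ceval (w q) F = 0" for Z p d F
 proof -
  obtain i l where il: "a p i \<noteq> 0" "b p l \<noteq> 0" using a_ne[OF p] bex[OF p] by blast
  define f where "f = peval sc t F / (s i * u l) ^ d"
  have fq: "f = (peval sc t F * (D0 q * B q) ^ d) / ((s i * D0 q) * (u l * B q)) ^ d" if "q \<in> Pts" for q
   unfolding f_def using D0_ne[OF that] cart_nz[OF cB that] by (simp add: power_mult_distrib)
  have "isu p (peval sc t F * (D0 p * B p) ^ d)" using tD[OF p F(1)] F(2) by (simp add: isu_def)
  then have "isu p f" unfolding fq[OF p]
   by (rule isu_divide[OF p _ isu_power[OF p isu_mult[OF p isu_sD0[OF p il(1)] bu[OF p il(2)]]]])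
  then obtain d1 H1 where H1: "homogeneous d1 H1" "ceval (a p) H1 \<noteq> 0"
   "\<And>q. q \<in> Pts ==> ceval (a q) H1 \<noteq> 0 ==> isu q f" using isu_open[OF p] by blast
  obtain d2 H2 where H2: "homogeneous d2 H2" "ceval (a p) H2 \<noteq> 0"
   "\<And>q. q \<in> Pts ==> ceval (a q) H2 \<noteq> 0 ==> isu q (u l * B p)" using isu_open[OF p bu[OF p il(2)]] by blast
  obtain d3 H3 where H3: "homogeneous d3 H3" "ceval (a p) H3 \<noteq> 0"
   "\<And>q. q \<in> Pts ==> ceval (a q) H3 \<noteq> 0 ==> isu q (B p / B q)" using cB p unfolding cart_def by blast
  let ?H = "H1 * H2 * H3 * Var i"
  have "homogeneous (d1 + d2 + d3 + 1) ?H" by (intro homogeneous_mult H1 H2 H3 homogeneous_Var)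
  moreover have "ceval (a p) ?H \<noteq> 0" using H1 H2 H3 il by (simp add: ce_simps)
  moreover have "ceval (a q) ?H = 0" if q: "q \<in> Z" for q
  proof (rule ccontr)
   assume "ceval (a q) ?H \<noteq> 0"
   then have n: "ceval (a q) H1 \<noteq> 0" "ceval (a q) H2 \<noteq> 0" "ceval (a q) H3 \<noteq> 0" "a q i \<noteq> 0" by (auto simp: ce_simps)
   have qP: "q \<in> Pts" using q Z by blast
   have uB: "isu q (u l * B q)"
    using isu_divide[OF qP H2(3)[OF qP n(2)] H3(3)[OF qP n(3)]] cart_nz[OF cB p] by simp
   have den: "isu q (((s i * D0 q) * (u l * B q)) ^ d)" by (rule isu_power[OF qP isu_mult[OF qP isu_sD0[OF qP n(4)] uB]])
   have "isu q (f * ((s i * D0 q) * (u l * B q)) ^ d)" by (rule isu_mult[OF qP H1(3)[OF qP n(1)] den])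
   moreover have "f * ((s i * D0 q) * (u l * B q)) ^ d = peval sc t F * (D0 q * B q) ^ d"
    using isu_nz[OF qP den] by (simp add: fq[OF qP])
   ultimately show False using tD(2)[OF qP F(1)] F(3) q by (simp add: isu_def)
  qed
  ultimately show ?thesis by blast
 qed
 have 7: "Ov p = {peval sc t F / peval sc t G | F G. (\<exists>d. homogeneous d F \<and> homogeneous d G) \<and> ceval (w p) G \<noteq> 0}"
  (is "_ = ?R") if p: "p \<in> Pts" for p
 proof
  show "Ov p \<subseteq> ?R"
  proof
   fix f assume "f \<in> Ov p"
   then obtain d A C where AC: "homogeneous d A" "homogeneous d C" "ceval (a p) C \<noteq> 0" "f = E A / E C" "E C \<noteq> 0"
    by (metis Ov_E[OF p])
   obtain l where l: "b p l \<noteq> 0" using bex[OF p] by blast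
   have lL: "l < L" using bL[OF p l] .
   have pt: "peval sc t (psubst (\<lambda>i. Var (i * L + l)) F) = u l ^ d * E F" if "homogeneous d F" for F
    using peval_scale[OF sc that, of "u l" s] by (simp add: peval_psubst sc tidx[OF lL] mult.commute)
   have "u l \<noteq> 0" using isu_nz[OF p bu[OF p l]] by auto
   then have "f = peval sc t (psubst (\<lambda>i. Var (i * L + l)) A) / peval sc t (psubst (\<lambda>i. Var (i * L + l)) C)"
    by (simp add: pt AC)
   moreover have "ceval (w p) (psubst (\<lambda>i. Var (i * L + l)) C) \<noteq> 0" using AC l by (simp add: ps[OF lL AC(2)])
   ultimately show "f \<in> ?R" using hps[OF AC(1)] hps[OF AC(2)] by blast
  qed
  show "?R \<subseteq> Ov p"
  proof
   fix f assume "f \<in> ?R"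
   then obtain d F G where F: "homogeneous d F" "homogeneous d G" "ceval (w p) G \<noteq> 0" "f = peval sc t F / peval sc t G" by blast
   have "isu p (peval sc t G * (D0 p * B p) ^ d)" using tD[OF p F(2)] F(3) by (simp add: isu_def)
   then have "inverse (peval sc t G * (D0 p * B p) ^ d) \<in> Ov p" using isu_inverse(1)[OF p] isu_def by blast
   from Ov_simps(6)[OF p tD(1)[OF p F(1)] this] show "f \<in> Ov p"
    using D0_ne[OF p] cart_nz[OF cB p] by (simp add: F(4) divide_inverse[symmetric] del: inverse_mult_distrib)
  qed
 qed
 show thesis by (rule that[of t w M', OF 1 2 3 4 5 6 7])
qed

end

context
 fixes X :: "'k::field projvar"
 assumes X: "projective_variety X"
begin

interpretation o: model "scalar X" "coord X" "ambient X" "points X" rep "local_ring X"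
 by (rule projvar_model[OF X])

text \<open>The conclusions of \<open>segre\<close> are the defining properties of a closed
  immersion; \<open>zc\<close> translates closed sets back to the given embedding of
  \<open>X\<close>.\<close>

theorem very_ample_segre:
 assumes "pmodel (scalar X) s M (points X) a (local_ring X) D0"
  and zc: "\<And>Z. Z \<subseteq> points X ==> model.zcl (points X) a Z \<longleftrightarrow> o.zcl Z"
  and cB: "model.cart (scalar X) (points X) a (local_ring X) B"
  and gB: "model.gg (scalar X) (points X) (local_ring X) B"
 shows "very_ample X (\<lambda>p. D0 p * B p)"
proof -
 interpret n: pmodel "scalar X" s M "points X" a "local_ring X" D0 by fact
 show ?thesis
 proof (rule n.segre[OF cB gB])
 fix t w M'
 assume 1: "\<And>m p. p \<in> points X ==> t m * (D0 p * B p) \<in> local_ring X p"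
  "\<And>m p. p \<in> points X ==> n.val p (t m * (D0 p * B p)) = w p m"
  and 2: "\<And>m. m > M' ==> t m = 0" and 3: "\<And>p. p \<in> points X ==> \<exists>m\<le>M'. w p m \<noteq> 0"
  and 4: "\<And>p q c. p \<in> points X ==> q \<in> points X ==> c \<noteq> 0 ==> w p = (\<lambda>m. c * w q m) ==> p = q"
  and 5: "\<And>Z v. n.zcl Z ==> \<exists>m. v m \<noteq> 0 ==> (\<And>m. m > M' ==> v m = 0) ==>
    (\<And>d F. homogeneous d F ==> \<forall>q\<in>Z. ceval (w q) F = 0 ==> ceval v F = 0) ==>
    \<exists>p\<in>Z. \<exists>c. c \<noteq> 0 \<and> v = (\<lambda>m. c * w p m)"
  and 6: "\<And>Z p d F. Z \<subseteq> points X ==> p \<in> points X ==> homogeneous d F ==> ceval (w p) F \<noteq> 0 ==>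
    \<forall>q\<in>Z. ceval (w q) F = 0 ==>
    \<exists>e H. homogeneous e H \<and> ceval (a p) H \<noteq> 0 \<and> (\<forall>q\<in>Z. ceval (a q) H = 0)"
  and 7: "\<And>p. p \<in> points X ==> local_ring X p = {peval (scalar X) t F / peval (scalar X) t G | F G.
    (\<exists>d. homogeneous d F \<and> homogeneous d G) \<and> ceval (w p) G \<noteq> 0}"
 let ?D = "\<lambda>p. D0 p * B p"
 have "n.cart ?D" by (rule n.cart_mult[OF n.cart_D0 cB])
 moreover have "n.isu = o.isu" by (intro ext) (simp add: n.isu_def o.isu_def n.val_def o.val_def)
 ultimately have "o.cart ?D" unfolding n.cart_iff o.cart_iff
  using zc by (metis (no_types, lifting) n.zcl_def)
 then have C: "cartier_divisor X ?D" using cartier_divisor_iff[OF X] by blast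
 have vv: "value_at X p (t m * ?D p) = w p m" if "p \<in> points X" for m p
  using 1(2)[OF that, of m] by (simp add: n.val_def value_at_def)
 have sm: "section_map X ?D t p = proj_point (w p)" if "p \<in> points X" for p
  by (simp add: section_map_def vv[OF that])
 have w0: "w p m = 0" if "p \<in> points X" "m > M'" for p m
  using 1(2)[OF that(1), of m] 2[OF that(2)] that(1) by simp
 have ps: "proj_point (w p) \<in> proj_space M'" if "p \<in> points X" for p
  using 3[OF that] w0[OF that] by (intro proj_point_in_proj_space) auto
 have va: "vanishes_at F (section_map X ?D t p) \<longleftrightarrow> ceval (w p) F = 0" if "homogeneous d F" "p \<in> points X" for d F p
  unfolding sm[OF that(2)] by (rule vanishes_at_proj_point[OF that(1)])
 have inj: "inj_on (section_map X ?D t) (points X)"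
 proof (rule inj_onI)
  fix p q assume pq: "p \<in> points X" "q \<in> points X" "section_map X ?D t p = section_map X ?D t q"
  then obtain c where "c \<noteq> 0" "w p = (\<lambda>m. c * w q m)" using proj_point_eq_iff sm by metis
  then show "p = q" using 4 pq by blast
 qed
 show "very_ample X ?D"
  unfolding very_ample_def
 proof (rule conjI[OF C], rule exI[of _ M'], rule exI[of _ t], intro conjI inj allI impI ballI)
  show "t m \<in> sections X ?D" for m unfolding sections_def using 1(1) by blast
  show "t m = 0" if "m > M'" for m using 2 that .
  show "\<exists>m\<le>M'. t m * ?D p \<notin> max_ideal (local_ring X p)" if p: "p \<in> points X" for p
   using 3[OF p] 1(2)[OF p] n.max_ideal_iff[OF p] by metis
  show "germs_along (scalar X) t (section_map X ?D t p) = local_ring X p" if p: "p \<in> points X" for p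
   unfolding 7[OF p] germs_along_def using va[OF _ p] by blast
  fix Z assume Z: "Z \<subseteq> points X"
  have "zariski_closed M' (section_map X ?D t ` Z) \<longleftrightarrow> n.zcl Z"
  proof
   assume c: "zariski_closed M' (section_map X ?D t ` Z)"
   show "n.zcl Z" unfolding n.zcl_def
   proof (intro conjI ballI Z)
    fix p assume p: "p \<in> points X - Z"
    then have "section_map X ?D t p \<notin> section_map X ?D t ` Z" using inj Z unfolding inj_on_def by blast
    moreover have "section_map X ?D t p \<in> proj_space M'" using sm ps p by simp
    ultimately obtain d F where F: "homogeneous d F" "\<not> vanishes_at F (section_map X ?D t p)"
     "\<forall>q\<in>section_map X ?D t ` Z. vanishes_at F q" using c unfolding zariski_closed_iff by blast
    have "\<forall>q\<in>Z. ceval (w q) F = 0" "ceval (w p) F \<noteq> 0" using F(2,3) va[OF F(1)] Z p by blast+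
    then show "\<exists>d F. homogeneous d F \<and> ceval (a p) F \<noteq> 0 \<and> (\<forall>q\<in>Z. ceval (a q) F = 0)"
     using 6[OF Z _ F(1)] p by blast
   qed
  next
   assume c: "n.zcl Z"
   show "zariski_closed M' (section_map X ?D t ` Z)" unfolding zariski_closed_iff
   proof (intro conjI ballI)
    show "section_map X ?D t ` Z \<subseteq> proj_space M'" using ps Z sm by auto
    fix p assume p: "p \<in> proj_space M' - section_map X ?D t ` Z"
    show "\<exists>d F. homogeneous d F \<and> \<not> vanishes_at F p \<and> (\<forall>q\<in>section_map X ?D t ` Z. vanishes_at F q)"
    proof (rule ccontr)
     assume no: "\<not> ?thesis"
     have pp: "p \<in> proj_space M'" using p by blast
     have "\<exists>r\<in>Z. \<exists>c. c \<noteq> 0 \<and> rep p = (\<lambda>m. c * w r m)"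
     proof (rule 5[OF c rep_proj_space(2)[OF pp] rep_proj_space(3)[OF pp]])
      fix d F assume F: "homogeneous d F" "\<forall>q\<in>Z. ceval (w q) F = 0"
      then have "\<forall>q\<in>section_map X ?D t ` Z. vanishes_at F q" using va[OF F(1)] Z by blast
      then have "vanishes_at F p" using no F(1) by blast
      then show "ceval (rep p) F = 0" using vanishes_at_rep[OF pp F(1)] by blast
     qed
     then obtain r c where r: "r \<in> Z" "c \<noteq> 0" "rep p = (\<lambda>m. c * w r m)" by blast
     then have "proj_point (rep p) = proj_point (w r)" using proj_point_scale by simp
     then have "p = section_map X ?D t r" using rep_proj_space(1)[OF pp] sm r(1) Z by auto
     then show False using p r(1) by blast
    qed
   qed
  qed
  then show "zariski_closed (ambient X) Z \<longleftrightarrow> zariski_closed M' (section_map X ?D t ` Z)"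
   using zc[OF Z] zariski_closed_eq_zcl[OF X Z] by blast
 qed
 qed
qed

end

section \<open>Canonical divisors\<close>

lemma pos_less: "pos (i :: 'n::{finite,linorder}) < CARD('n)"
 unfolding pos_def by (rule psubset_card_mono) auto

lemma pos_mono: "i < j ==> pos (i :: 'n::{finite,linorder}) < pos j"
 unfolding pos_def by (rule psubset_card_mono) auto

lemma inj_pos: "inj (pos :: 'n::{finite,linorder} \<Rightarrow> nat)"
 by (rule injI) (metis linorder_neqE pos_mono less_irrefl)

lemma bij_pos: "bij_betw (pos :: 'n::{finite,linorder} \<Rightarrow> nat) UNIV {..<CARD('n)}"
 unfolding bij_betw_def
proof
 show "range (pos :: 'n \<Rightarrow> nat) = {..<CARD('n)}"
  by (rule card_subset_eq) (auto simp: pos_less card_image inj_pos)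
qed (rule inj_pos)

lemma pos_surj: "i < CARD('n::{finite,linorder}) ==> \<exists>j::'n. i = pos j"
 using bij_pos[where 'n = 'n] by (auto simp: bij_betw_def)

lemma sum_indicator:
 fixes f :: "'i \<Rightarrow> 'a::comm_ring_1"
 assumes "finite S" "i \<in> S"
 shows "(\<Sum>l\<in>S. (if l = i then 1 else 0) * f l) = f i"
proof -
 have "(\<Sum>l\<in>S. (if l = i then 1 else 0) * f l) = (\<Sum>l\<in>S. if l = i then f l else 0)"
  by (intro sum.cong) auto
 then show ?thesis using assms by simp
qed

text \<open>Reindexing by \<open>pos\<close> turns \<open>wedge_d\<close> into a determinant over a
  finite type, so that a change of parameters becomes a product of matrices.\<close>

lemma wedge_eq_det:
 fixes x :: "nat \<Rightarrow> 'k::field"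
 shows "wedge_d CARD('n::{finite,linorder}) x \<delta> = det (\<chi> i j. \<delta> (pos i) (x (pos j)) :: (('k, 'n) vec, 'n) vec)"
proof -
 let ?f = "pos :: 'n \<Rightarrow> nat" and ?N = "{..<CARD('n)}"
 let ?g = "inv_into UNIV ?f"
 have g: "bij_betw ?g ?N UNIV" by (rule bij_betw_inv_into[OF bij_pos])
 have gf: "?g (?f i) = i" for i by (rule inv_f_f[OF inj_pos])
 have fg: "?f (?g i) = i" if "i \<in> ?N" for i using bij_betw_inv_into_right[OF bij_pos that] .
 have "(\<Sum>\<sigma> | \<sigma> permutes ?N. of_int (sign \<sigma>) * (\<Prod>i<CARD('n). \<delta> i (x (\<sigma> i)))) =
   (\<Sum>p | p permutes (UNIV::'n set). of_int (sign p) * (\<Prod>i\<in>UNIV. \<delta> (pos i) (x (pos (p i)))))"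
 proof (rule sum.reindex_bij_witness[of _ "map_permutation UNIV ?f" "map_permutation ?N ?g"])
  fix \<sigma> assume "\<sigma> \<in> {\<sigma>. \<sigma> permutes ?N}"
  then have s: "\<sigma> permutes ?N" by simp
  show "map_permutation UNIV ?f (map_permutation ?N ?g \<sigma>) = \<sigma>"
   by (rule map_permutation_compose_inv[OF g s fg])
  show "map_permutation ?N ?g \<sigma> \<in> {p. p permutes UNIV}" using map_permutation_permutes[OF g s] by simp
  have "sign (map_permutation ?N ?g \<sigma>) = sign \<sigma>"
   by (rule sign_map_permutation) (use g s in \<open>auto simp: bij_betw_def\<close>)
  moreover have "(\<Prod>i\<in>UNIV. \<delta> (pos i) (x (pos (map_permutation ?N ?g \<sigma> i)))) = (\<Prod>i<CARD('n). \<delta> i (x (\<sigma> i)))"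
  proof -
   have "pos (map_permutation ?N ?g \<sigma> i) = \<sigma> (pos i)" for i
   proof -
    have "map_permutation ?N ?g \<sigma> (?g (pos i)) = ?g (\<sigma> (pos i))"
     using g by (intro map_permutation_apply) (auto simp: bij_betw_def pos_less)
    moreover have "\<sigma> (pos i) \<in> ?N" using permutes_in_image[OF s, of "pos i"] pos_less[of i] by simp
    ultimately show ?thesis using gf[of i] fg by simp
   qed
   then show ?thesis using prod.reindex_bij_betw[OF bij_pos, of "\<lambda>i. \<delta> i (x (\<sigma> i))"] by simp
  qed
  ultimately show "of_int (sign (map_permutation ?N ?g \<sigma>)) *
    (\<Prod>i\<in>UNIV. \<delta> (pos i) (x (pos (map_permutation ?N ?g \<sigma> i)))) = of_int (sign \<sigma>) * (\<Prod>i<CARD('n). \<delta> i (x (\<sigma> i)))"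
   by simp
 next
  fix p assume "p \<in> {p. p permutes (UNIV::'n set)}"
  then have s: "p permutes UNIV" by simp
  show "map_permutation ?N ?g (map_permutation UNIV ?f p) = p"
   by (rule map_permutation_compose_inv[OF bij_pos s]) (rule gf)
  show "map_permutation UNIV ?f p \<in> {\<sigma>. \<sigma> permutes ?N}" using map_permutation_permutes[OF bij_pos s] by simp
 qed
 then show ?thesis unfolding wedge_d_def det_def by simp
qed

section \<open>Derivations, local parameters and Jacobians\<close>

context model begin

definition submod :: "point \<Rightarrow> 'k set \<Rightarrow> bool" where
 "submod p N \<longleftrightarrow> 0 \<in> N \<and> (\<forall>x\<in>N. \<forall>y\<in>N. x + y \<in> N) \<and> (\<forall>r\<in>Ov p. \<forall>x\<in>N. r * x \<in> N)"

lemma submodD: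
 assumes "submod p N"
 shows "0 \<in> N" "x \<in> N ==> y \<in> N ==> x + y \<in> N" "r \<in> Ov p ==> x \<in> N ==> r * x \<in> N"
  "(\<And>i. i \<in> S ==> f i \<in> N) ==> sum f S \<in> N"
proof -
 show 0: "0 \<in> N" and a: "x \<in> N ==> y \<in> N ==> x + y \<in> N" and "r \<in> Ov p ==> x \<in> N ==> r * x \<in> N" for x y r
  using assms by (auto simp: submod_def)
 show "(\<And>i. i \<in> S ==> f i \<in> N) ==> sum f S \<in> N"
  by (induction S rule: infinite_finite_induct) (auto simp: 0 a)
qed

text \<open>Nakayama's lemma for explicit generators: the last relation is solved for
  \<open>y L\<close>, because \<open>1 - q L L\<close> is a unit, and substituted into the
  others.\<close>

lemma nakayama:
 fixes L :: nat
 assumes p: "p \<in> Pts" and N: "submod p N"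
 shows "(\<And>j. j < L ==> \<exists>n\<in>N. \<exists>q. (\<forall>l. q l \<in> max_ideal (Ov p)) \<and> y j = n + (\<Sum>l<L. q l * y l)) ==>
  j < L ==> y j \<in> N"
proof (induction L arbitrary: j)
 case (Suc L)
 have mO: "q \<in> Ov p" if "q \<in> max_ideal (Ov p)" for q using that max_ideal_iff[OF p] by blast
 have mm: "r * q \<in> max_ideal (Ov p)" if "q \<in> max_ideal (Ov p)" "r \<in> Ov p" for r q
  using that by (auto simp: max_ideal_iff p Ov_simps val_ops)
 have ma: "q + q' \<in> max_ideal (Ov p)" if "q \<in> max_ideal (Ov p)" "q' \<in> max_ideal (Ov p)" for q q'
  using that by (auto simp: max_ideal_iff p Ov_simps val_ops)
 have "\<forall>j\<in>{..L}. \<exists>n q. n \<in> N \<and> (\<forall>l. q l \<in> max_ideal (Ov p)) \<and> y j = n + (\<Sum>l<Suc L. q l * y l)"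
  using Suc.prems(1) by (metis atMost_iff less_Suc_eq_le)
 then obtain n q where nq: "\<And>j. j \<le> L ==> n j \<in> N" "\<And>j l. j \<le> L ==> q j l \<in> max_ideal (Ov p)"
  "\<And>j. j \<le> L ==> y j = n j + (\<Sum>l<Suc L. q j l * y l)" by (metis atMost_iff)
 define u where "u = inverse (1 - q L L)"
 have i1: "isu p (1 - q L L)" using nq(2)[of L L] by (simp add: isu_def max_ideal_iff p Ov_simps val_diff)
 then have u: "u \<in> Ov p" using isu_inverse[OF p] by (simp add: u_def isu_def)
 have yL: "y L = u * n L + (\<Sum>l<L. (u * q L l) * y l)"
 proof -
  have "(1 - q L L) * y L = n L + (\<Sum>l<L. q L l * y l)" using nq(3)[of L] by (simp add: algebra_simps)
  then have "u * ((1 - q L L) * y L) = u * (n L + (\<Sum>l<L. q L l * y l))" by simp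
  moreover have "u * ((1 - q L L) * y L) = y L" using isu_nz[OF p i1] by (simp add: u_def)
  ultimately show ?thesis by (simp add: distrib_left sum_distrib_left mult.assoc)
 qed
 have IH: "y j \<in> N" if j: "j < L" for j
 proof (rule Suc.IH[OF _ j])
  fix j assume j: "j < L"
  let ?n = "n j + q j L * (u * n L)" and ?q = "\<lambda>l. q j l + (q j L * u) * q L l"
  have "y j = n j + (\<Sum>l<L. q j l * y l) + q j L * y L" using nq(3)[of j] j by (simp add: algebra_simps)
  also have "\<dots> = ?n + (\<Sum>l<L. ?q l * y l)"
   by (subst yL) (simp add: algebra_simps sum.distrib sum_distrib_left)
  finally have "y j = ?n + (\<Sum>l<L. ?q l * y l)" .
  moreover have "?n \<in> N" using nq(1,2) j u mO submodD[OF N] by simp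
  moreover have "\<forall>l. ?q l \<in> max_ideal (Ov p)"
  proof
   fix l
   have "q j l \<in> max_ideal (Ov p)" "q j L \<in> Ov p" "q L l \<in> max_ideal (Ov p)"
    using nq(2)[of j] nq(2)[of L] j mO by auto
   then show "?q l \<in> max_ideal (Ov p)" by (intro ma mm Ov_simps(6)[OF p _ u])
  qed
  ultimately show "\<exists>n\<in>N. \<exists>q. (\<forall>l. q l \<in> max_ideal (Ov p)) \<and> y j = n + (\<Sum>l<L. q l * y l)"
   by (intro bexI[of _ ?n] exI[of _ ?q] conjI)
 qed
 have "y L \<in> N"
 proof (subst yL, intro submodD(2)[OF N] submodD(4)[OF N])
  show "u * n L \<in> N" by (rule submodD(3)[OF N u nq(1)]) simp
  fix l assume "l \<in> {..<L}"
  then show "u * q L l * y l \<in> N"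
   using submodD(3)[OF N Ov_simps(6)[OF p u mO[OF nq(2)[OF order.refl]]] IH] by simp
 qed
 then show ?case using IH Suc.prems(2) by (metis less_Suc_eq)
qed simp

definition der :: "('k \<Rightarrow> 'k) \<Rightarrow> bool" where
 "der \<delta> \<longleftrightarrow> (\<forall>c. \<delta> (sc c) = 0) \<and> (\<forall>f g. \<delta> (f + g) = \<delta> f + \<delta> g \<and> \<delta> (f * g) = f * \<delta> g + g * \<delta> f)"

lemma derD:
 assumes "der \<delta>"
 shows "\<delta> (sc c) = 0" "\<delta> (f + g) = \<delta> f + \<delta> g" "\<delta> (f * g) = f * \<delta> g + g * \<delta> f" "\<delta> 0 = 0"
  "\<delta> (- f) = - \<delta> f" "\<delta> (f - g) = \<delta> f - \<delta> g" "\<delta> (sum h S) = (\<Sum>i\<in>S. \<delta> (h i))"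
  "\<delta> 1 = 0" "g \<noteq> 0 ==> \<delta> (f / g) = inverse g * (\<delta> f - (f / g) * \<delta> g)"
proof -
 show s: "\<delta> (sc c) = 0" and a: "\<delta> (f + g) = \<delta> f + \<delta> g" and m: "\<delta> (f * g) = f * \<delta> g + g * \<delta> f" for f g c
  using assms by (auto simp: der_def)
 show z: "\<delta> 0 = 0" using m[of 0 0] by simp
 show n: "\<delta> (- f) = - \<delta> f" for f using a[of f "- f"] z by (simp add: eq_neg_iff_add_eq_0 add.commute)
 show "\<delta> (f - g) = \<delta> f - \<delta> g" using a[of f "- g"] n by simp
 show "\<delta> (sum h S) = (\<Sum>i\<in>S. \<delta> (h i))" by (induction S rule: infinite_finite_induct) (auto simp: z a)
 show "\<delta> 1 = 0" using s[of 1] by (simp add: sc_simps)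
 show "\<delta> (f / g) = inverse g * (\<delta> f - (f / g) * \<delta> g)" if "g \<noteq> 0"
 proof -
  have "\<delta> f = (f / g) * \<delta> g + g * \<delta> (f / g)" using m[of "f / g" g] that by simp
  then show ?thesis using that by (simp add: field_simps)
 qed
qed

lemma der_submod_polynomial:
 assumes p: "p \<in> Pts" and z: "\<And>i. z i \<in> Ov p" and N: "submod p N" and d: "der \<delta>" "\<And>i. \<delta> (z i) \<in> N"
 shows "\<delta> (peval sc z P) \<in> N"
proof (induction P rule: mpoly_induct)
 case (mult F G)
 then show ?case using val_peval(1)[OF p z] submodD[OF N] by (simp add: E_simps derD[OF d(1)])
qed (simp_all add: sc derD[OF d(1)] d(2) E_simps submodD[OF N])

lemma affine_frac:
 assumes p: "p \<in> Pts" and j: "a p j \<noteq> 0" and f: "f \<in> Ov p"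
 shows "\<exists>A C. f = peval sc (\<lambda>i. s i / s j) A / peval sc (\<lambda>i. s i / s j) C \<and> isu p (peval sc (\<lambda>i. s i / s j) C)"
proof -
 obtain d F G where F: "homogeneous d F" "homogeneous d G" "ceval (a p) G \<noteq> 0" "f = E F / E G" "E G \<noteq> 0"
  by (metis Ov_E[OF p f])
 have sj: "s j \<noteq> 0" using s_ne[OF p j] .
 have "ceval (\<lambda>i. a p i / a p j) G \<noteq> 0"
  using peval_scale[OF rhom_id F(2), of "inverse (a p j)" "a p"] j F(3) by (simp add: divide_inverse mult.commute)
 then have "isu p (peval sc (\<lambda>i. s i / s j) G)"
  using val_peval[OF p val_ratio(1)[OF p j], of "\<lambda>i. i" G] by (simp add: isu_def val_ratio[OF p j])
 moreover have "f = peval sc (\<lambda>i. s i / s j) F / peval sc (\<lambda>i. s i / s j) G"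
  using sj unfolding F(4) E_dehom[OF sj F(1)] E_dehom[OF sj F(2)] by simp
 ultimately show ?thesis by blast
qed

lemma der_submod:
 assumes p: "p \<in> Pts" and j: "a p j \<noteq> 0" and N: "submod p N" and d: "der \<delta>" "\<And>i. i \<le> M ==> \<delta> (s i / s j) \<in> N"
  and f: "f \<in> Ov p"
 shows "\<delta> f \<in> N"
proof -
 obtain A C where AC: "f = peval sc (\<lambda>i. s i / s j) A / peval sc (\<lambda>i. s i / s j) C" "isu p (peval sc (\<lambda>i. s i / s j) C)"
  using affine_frac[OF p j f] by blast
 let ?A = "peval sc (\<lambda>i. s i / s j) A" and ?C = "peval sc (\<lambda>i. s i / s j) C"
 have z: "\<delta> (s i / s j) \<in> N" for i using d(2)[of i] s_supp[of i] submodD(1)[OF N] derD(4)[OF d(1)] by (cases "i \<le> M") auto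
 have "\<delta> f = inverse ?C * \<delta> ?A + (- inverse ?C * f) * \<delta> ?C"
  using derD(9)[OF d(1) isu_nz[OF p AC(2)], of ?A] unfolding AC(1)[symmetric] by (simp add: algebra_simps)
 moreover have "inverse ?C \<in> Ov p" using isu_inverse(1)[OF p AC(2)] by (simp add: isu_def)
 moreover have "- inverse ?C * f \<in> Ov p" using calculation(2) f p by (simp add: Ov_simps)
 moreover have "\<delta> ?A \<in> N" "\<delta> ?C \<in> N"
  by (rule der_submod_polynomial[OF p val_ratio(1)[OF p j] N d(1) z])+
 ultimately show ?thesis using submodD(2)[OF N submodD(3)[OF N] submodD(3)[OF N]] by metis
qed

text \<open>A coordinate is its value plus a combination of parameters, so by the product rule the
  \<open>\<delta> (z l)\<close> lie in \<open>N\<close> plus the maximal ideal times their own span;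
  Nakayama's lemma removes the second part.\<close>

lemma der_parameters:
 fixes n :: nat
 assumes p: "p \<in> Pts" and t: "max_ideal (Ov p) = {(\<Sum>i<n. r i * t i) | r. \<forall>i<n. r i \<in> Ov p}"
  and N: "submod p N" and d: "der \<delta>" "\<And>i. i < n ==> \<delta> (t i) \<in> N" and f: "f \<in> Ov p"
 shows "\<delta> f \<in> N"
proof -
 obtain j where j: "a p j \<noteq> 0" using a_ne[OF p] by blast
 define z where "z i = s i / s j" for i
 have tm: "t i \<in> max_ideal (Ov p)" if "i < n" for i
  unfolding t using that p
  by (intro CollectI exI[of _ "\<lambda>l. if l = i then 1 else 0"])
    (simp add: Ov_simps sum_indicator)
 have "\<delta> (z l) \<in> N" if "l < Suc M" for l
 proof (rule nakayama[OF p N _ that])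
  fix l assume "l < Suc M"
  have "z l - sc (val p (z l)) \<in> max_ideal (Ov p)"
   using val_ratio(1)[OF p j, of l] by (simp add: z_def max_ideal_iff p val_diff sc_in_Ov Ov_simps)
  then obtain r where r: "z l - sc (val p (z l)) = (\<Sum>i<n. r i * t i)" "\<forall>i<n. r i \<in> Ov p" unfolding t by blast
  have "\<exists>g. (\<forall>m. g m \<in> Ov p) \<and> \<delta> (r i) = (\<Sum>m<Suc M. g m * \<delta> (z m))" if i: "i < n" for i
  proof -
   \<comment> \<open>The derivative of a coefficient \<open>r i\<close> lies in the span of the
     \<open>\<delta> (z m)\<close>, by \<open>der_submod\<close> applied to this span.\<close>
   let ?N = "{(\<Sum>m<Suc M. g m * \<delta> (z m)) | g. \<forall>m. g m \<in> Ov p}"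
   have "submod p ?N"
    unfolding submod_def
   proof (intro conjI ballI)
    show "0 \<in> ?N" using p by (intro CollectI exI[of _ "\<lambda>_. 0"]) (simp add: Ov_simps)
    fix x assume "x \<in> ?N"
    then obtain g where g: "x = (\<Sum>m<Suc M. g m * \<delta> (z m))" "\<forall>m. g m \<in> Ov p" by blast
    show "c * x \<in> ?N" if "c \<in> Ov p" for c
     using g that p by (intro CollectI exI[of _ "\<lambda>m. c * g m"]) (simp add: Ov_simps sum_distrib_left mult.assoc distrib_left)
    fix y assume "y \<in> ?N"
    then obtain h where h: "y = (\<Sum>m<Suc M. h m * \<delta> (z m))" "\<forall>m. h m \<in> Ov p" by blast
    show "x + y \<in> ?N"
     using g h p by (intro CollectI exI[of _ "\<lambda>m. g m + h m"]) (simp add: Ov_simps sum.distrib distrib_right)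
   qed
   moreover have "\<delta> (s m / s j) \<in> ?N" if "m \<le> M" for m
    using that p
    by (intro CollectI exI[of _ "\<lambda>l. if l = m then 1 else 0"])
     (auto simp: Ov_simps z_def sum_indicator simp del: sum.lessThan_Suc)
   ultimately have "\<delta> (r i) \<in> ?N" using der_submod[OF p j _ d(1)] r(2) i by blast
   then show ?thesis by blast
  qed
  then obtain g where g: "\<And>i m. i < n ==> g i m \<in> Ov p" "\<And>i. i < n ==> \<delta> (r i) = (\<Sum>m<Suc M. g i m * \<delta> (z m))"
   by metis
  have "\<delta> (z l) = \<delta> (z l - sc (val p (z l)))" by (simp add: derD[OF d(1)])
  also have "\<dots> = (\<Sum>i<n. r i * \<delta> (t i)) + (\<Sum>i<n. t i * (\<Sum>m<Suc M. g i m * \<delta> (z m)))"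
   unfolding r(1) using g(2) by (simp add: derD[OF d(1)] sum.distrib)
  also have "(\<Sum>i<n. t i * (\<Sum>m<Suc M. g i m * \<delta> (z m))) = (\<Sum>m<Suc M. (\<Sum>i<n. t i * g i m) * \<delta> (z m))"
   unfolding sum_distrib_left sum_distrib_right mult.assoc by (rule sum.swap)
  finally have "\<delta> (z l) = (\<Sum>i<n. r i * \<delta> (t i)) + (\<Sum>m<Suc M. (\<Sum>i<n. t i * g i m) * \<delta> (z m))" .
  moreover have "(\<Sum>i<n. r i * \<delta> (t i)) \<in> N"
   using r(2) d(2) by (intro submodD(4)[OF N] submodD(3)[OF N]) auto
  moreover have "(\<Sum>i<n. t i * g i m) \<in> max_ideal (Ov p)" for m
  proof -
   have "g i m * t i \<in> mp p (Suc 0)" if "i < n" for i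
    using mp_mult_left[OF p g(1)[OF that], of "t i" "Suc 0"] tm[OF that] by (simp add: mp_1[OF p])
   then have "(\<Sum>i<n. g i m * t i) \<in> mp p (Suc 0)" by (intro mp_sum[OF p]) auto
   then show ?thesis by (simp add: mp_1[OF p] mult.commute)
  qed
  ultimately show "\<exists>n\<in>N. \<exists>q. (\<forall>l. q l \<in> max_ideal (Ov p)) \<and> \<delta> (z l) = n + (\<Sum>m<Suc M. q m * \<delta> (z m))"
   by (intro bexI[of _ "\<Sum>i<n. r i * \<delta> (t i)"] exI[of _ "\<lambda>m. \<Sum>i<n. t i * g i m"] conjI allI)
 qed
 then show ?thesis using der_submod[OF p j N d(1) _ f] by (simp add: z_def less_Suc_eq_le)
qed

lemma der_zero_parameters:
 fixes n :: nat
 assumes p: "p \<in> Pts" and t: "max_ideal (Ov p) = {(\<Sum>i<n. r i * t i) | r. \<forall>i<n. r i \<in> Ov p}"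
  and d: "der \<delta>" "\<And>i. i < n ==> \<delta> (t i) = 0"
 shows "\<delta> f = 0"
proof -
 have z: "\<delta> g = 0" if "g \<in> Ov p" for g
  using der_parameters[OF p t _ d(1) _ that, of "{0}"] d(2) by (auto simp: submod_def)
 obtain e F G where F: "homogeneous e F" "homogeneous e G" "E G \<noteq> 0" "f = E F / E G" using frac by blast
 obtain j where j: "a p j \<noteq> 0" using a_ne[OF p] by blast
 have sj: "s j \<noteq> 0" using s_ne[OF p j] .
 have O: "peval sc (\<lambda>i. s i / s j) P \<in> Ov p" for P by (rule val_peval(1)[OF p val_ratio(1)[OF p j]])
 have "f = peval sc (\<lambda>i. s i / s j) F / peval sc (\<lambda>i. s i / s j) G"
  using sj unfolding F(4) E_dehom[OF sj F(1)] E_dehom[OF sj F(2)] by simp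
 moreover have "peval sc (\<lambda>i. s i / s j) G \<noteq> 0" using F(3) E_dehom[OF sj F(2)] by auto
 ultimately show ?thesis using derD(9)[OF d(1)] z[OF O] by simp
qed

text \<open>Inverting the matrix of the \<open>\<delta>0 i (t j)\<close> gives derivations
  \<open>pd l\<close> dual to the parameters \<open>t\<close>. They preserve the local ring, so the
  Jacobian determinant \<open>c\<close> of \<open>t'\<close> is regular.\<close>

lemma wedge_change:
 fixes t t' :: "nat \<Rightarrow> 'k"
 assumes p: "p \<in> Pts" and t: "max_ideal (Ov p) = {(\<Sum>i<CARD('n::{finite,linorder}). r i * t i) | r. \<forall>i<CARD('n). r i \<in> Ov p}"
  and \<delta>0: "\<And>i. i < CARD('n) ==> der (\<delta>0 i)" "wedge_d CARD('n) t \<delta>0 \<noteq> 0"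
  and t': "\<And>i. i < CARD('n) ==> t' i \<in> Ov p"
 shows "\<exists>c\<in>Ov p. \<forall>\<delta>. (\<forall>i<CARD('n). der (\<delta> i)) \<longrightarrow> wedge_d CARD('n) t' \<delta> = c * wedge_d CARD('n) t \<delta>"
proof -
 define mat' where "mat' x \<delta> = (\<chi> i j. \<delta> (pos i) (x (pos j)) :: (('k, 'n) vec, 'n) vec)" for x and \<delta> :: "nat \<Rightarrow> 'k \<Rightarrow> 'k"
 have wd: "wedge_d CARD('n) x \<delta> = det (mat' x \<delta>)" for x \<delta> by (simp add: mat'_def wedge_eq_det)
 have "invertible (mat' t \<delta>0)" using \<delta>0(2) by (simp add: wd invertible_det_nz)
 then obtain S where S: "S ** mat' t \<delta>0 = mat 1" unfolding invertible_def by blast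
 define pd where "pd l f = (\<Sum>i\<in>UNIV. S $ l $ i * \<delta>0 (pos i) f)" for l f
 have der: "der (pd l)" for l
  unfolding der_def pd_def using \<delta>0(1)[OF pos_less]
  by (auto simp: derD sum.distrib[symmetric] sum_distrib_left distrib_left ac_simps intro!: sum.cong)
 have pdt: "pd l (t (pos j)) = (if l = j then 1 else 0)" for l j
 proof -
  have "pd l (t (pos j)) = (S ** mat' t \<delta>0) $ l $ j" by (simp add: pd_def matrix_matrix_mult_def mat'_def)
  then show ?thesis by (simp add: S mat_def)
 qed
 have pdO: "pd l f \<in> Ov p" if f: "f \<in> Ov p" for l f
 proof (rule der_parameters[OF p t _ der _ f])
  show "submod p (Ov p)" using p by (auto simp: submod_def Ov_simps)
  fix i assume "i < CARD('n)"
  then obtain j :: 'n where "i = pos j" using pos_surj by blast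
  then show "pd l (t i) \<in> Ov p" using pdt[of l j] p by (simp add: Ov_simps)
 qed
 have J: "pd l (t' (pos j)) \<in> Ov p" for l and j :: 'n by (rule pdO[OF t'[OF pos_less]])
 define c where "c = det (\<chi> l j. pd l (t' (pos j)) :: (('k, 'n) vec, 'n) vec)"
 have "c \<in> Ov p"
 proof -
  have "of_int (sign q) \<in> Ov p" for q :: "'n \<Rightarrow> 'n" using p by (simp add: sign_def Ov_simps)
  then show ?thesis unfolding c_def det_def using J p by (intro Ov_simps(8)[OF p] Ov_simps(6)[OF p] Ov_simps(9)[OF p]) simp_all
 qed
 moreover have "wedge_d CARD('n) t' \<delta> = c * wedge_d CARD('n) t \<delta>" if d: "\<forall>i<CARD('n). der (\<delta> i)" for \<delta>
 proof -
  \<comment> \<open>Chain rule: the difference \<open>?\<eta>\<close> is a derivation that kills the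
    parameters, hence zero.\<close>
  have e: "\<delta> (pos i) f = (\<Sum>l\<in>UNIV. \<delta> (pos i) (t (pos l)) * pd l f)" for f and i :: 'n
  proof -
   let ?\<eta> = "\<lambda>f. \<delta> (pos i) f - (\<Sum>l\<in>UNIV. \<delta> (pos i) (t (pos l)) * pd l f)"
   have di: "der (\<delta> (pos i))" using d pos_less by blast
   have "der ?\<eta>"
    unfolding der_def
   proof (intro conjI allI)
    show "?\<eta> (sc c) = 0" for c by (simp add: derD[OF di] derD[OF der])
    show "?\<eta> (f + g) = ?\<eta> f + ?\<eta> g" for f g
     by (simp add: derD[OF di] derD[OF der] distrib_left sum.distrib)
    show "?\<eta> (f * g) = f * ?\<eta> g + g * ?\<eta> f" for f g
     by (simp add: derD[OF di] derD[OF der] distrib_left right_diff_distrib sum.distrib sum_distrib_left mult.left_commute)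
   qed
   moreover have "?\<eta> (t k) = 0" if k': "k < CARD('n)" for k
   proof -
    obtain j :: 'n where k: "k = pos j" using pos_surj[OF k'] by blast
    have "(\<Sum>l\<in>UNIV. \<delta> (pos i) (t (pos l)) * pd l (t k)) =
      (\<Sum>l\<in>UNIV. (if l = j then 1 else 0) * \<delta> (pos i) (t (pos l)))"
     unfolding k pdt by (simp only: mult.commute)
    also have "\<dots> = \<delta> (pos i) (t (pos j))" by (rule sum_indicator) auto
    finally show ?thesis by (simp add: k)
   qed
   ultimately have "?\<eta> f = 0" by (rule der_zero_parameters[OF p t])
   then show ?thesis by simp
  qed
  have "mat' t' \<delta> = mat' t \<delta> ** (\<chi> l j. pd l (t' (pos j)))"
   unfolding vec_eq_iff matrix_matrix_mult_def mat'_def by (simp add: e[of _ "t' _"])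
  then show ?thesis by (simp add: wd det_mul c_def mult.commute)
 qed
 ultimately show ?thesis by blast
qed

end

context
 fixes X :: "'k::field projvar"
 assumes X: "projective_variety X"
begin

interpretation o: model "scalar X" "coord X" "ambient X" "points X" rep "local_ring X"
 by (rule projvar_model[OF X])

text \<open>\<open>h\<close> is the ratio of the two rational forms, evaluated on one frame
  \<open>\<delta>0\<close>. At each point the forms are compared with local parameters, and the
  Jacobians between the two parameter systems are inverse to each other, hence units.\<close>

theorem canonical_unique:
 assumes K: "canonical_divisor CARD('n::{finite,linorder}) X K" and K': "canonical_divisor CARD('n) X K'"
 shows "\<exists>h. h \<noteq> 0 \<and> (\<forall>p\<in>points X. o.isu p (K' p / (h * K p)))"
proof -
 let ?n = "CARD('n)"
 have dd: "derivations X = Collect o.der" by (auto simp: derivations_def o.der_def)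
 have pr: "max_ideal (local_ring X p) = {(\<Sum>i<?n. r i * t i) | r. \<forall>i<?n. r i \<in> local_ring X p}"
  if "local_parameters ?n X p t" for p t using that unfolding local_parameters_def .
 obtain f x \<delta>0 where f: "\<forall>i<?n. o.der (\<delta>0 i)" "f * wedge_d ?n x \<delta>0 \<noteq> 0"
  "\<And>p. p \<in> points X ==> \<exists>t u. local_parameters ?n X p t \<and>
      u \<in> local_ring X p - max_ideal (local_ring X p) \<and>
      (\<forall>\<delta>. (\<forall>i<?n. o.der (\<delta> i)) \<longrightarrow> f * wedge_d ?n x \<delta> = u * K p * wedge_d ?n t \<delta>)"
  using K unfolding canonical_divisor_def dd mem_Collect_eq by metis
 obtain f' x' \<delta>1 where f': "\<forall>i<?n. o.der (\<delta>1 i)" "f' * wedge_d ?n x' \<delta>1 \<noteq> 0"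
  "\<And>p. p \<in> points X ==> \<exists>t u. local_parameters ?n X p t \<and>
      u \<in> local_ring X p - max_ideal (local_ring X p) \<and>
      (\<forall>\<delta>. (\<forall>i<?n. o.der (\<delta> i)) \<longrightarrow> f' * wedge_d ?n x' \<delta> = u * K' p * wedge_d ?n t \<delta>)"
  using K' unfolding canonical_divisor_def dd mem_Collect_eq by metis
 have nz: "K p \<noteq> 0" "K' p \<noteq> 0" if "p \<in> points X" for p
  using K K' that unfolding canonical_divisor_def cartier_divisor_def by blast+
 define h where "h = f' * wedge_d ?n x' \<delta>0 / (f * wedge_d ?n x \<delta>0)"
 have main: "\<exists>w. o.isu p w \<and> K' p * w = h * K p" if p: "p \<in> points X" for p
 proof -
  obtain t u where t: "local_parameters ?n X p t" and u: "u \<in> local_ring X p - max_ideal (local_ring X p)"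
   and fu: "\<And>\<delta>. \<forall>i<?n. o.der (\<delta> i) ==> f * wedge_d ?n x \<delta> = u * K p * wedge_d ?n t \<delta>" using f(3)[OF p] by blast
  obtain t' u' where t': "local_parameters ?n X p t'" and u': "u' \<in> local_ring X p - max_ideal (local_ring X p)"
   and fu': "\<And>\<delta>. \<forall>i<?n. o.der (\<delta> i) ==> f' * wedge_d ?n x' \<delta> = u' * K' p * wedge_d ?n t' \<delta>" using f'(3)[OF p] by blast
  have uu: "o.isu p u" "o.isu p u'" using u u' o.max_ideal_iff[OF p] by (auto simp: o.isu_def)
  have w0: "wedge_d ?n t \<delta>0 \<noteq> 0" using fu[OF f(1)] f(2) by auto
  have w1: "wedge_d ?n t' \<delta>1 \<noteq> 0" using fu'[OF f'(1)] f'(2) by auto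
  have tO: "t i \<in> local_ring X p" if lp: "local_parameters ?n X p t" and i: "i < ?n" for t i
  proof -
   have "t i = (\<Sum>l<?n. (if l = i then 1 else 0) * t l)" using i by (simp add: sum_indicator)
   then have "t i \<in> max_ideal (local_ring X p)"
    unfolding pr[OF lp] using o.Ov_simps(1,2)[OF p] by (intro CollectI exI[of _ "\<lambda>l. if l = i then 1 else 0"]) auto
   then show ?thesis using o.max_ideal_iff[OF p] by blast
  qed
  have d0: "\<And>i. i < ?n ==> o.der (\<delta>0 i)" and d1: "\<And>i. i < ?n ==> o.der (\<delta>1 i)" using f(1) f'(1) by auto
  obtain c where c: "c \<in> local_ring X p" "\<And>\<delta>. \<forall>i<?n. o.der (\<delta> i) ==> wedge_d ?n t' \<delta> = c * wedge_d ?n t \<delta>"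
   using o.wedge_change[OF p pr[OF t], of \<delta>0 t'] d0 w0 tO[OF t'] by blast
  obtain c' where c': "c' \<in> local_ring X p" "\<And>\<delta>. \<forall>i<?n. o.der (\<delta> i) ==> wedge_d ?n t \<delta> = c' * wedge_d ?n t' \<delta>"
   using o.wedge_change[OF p pr[OF t'], of \<delta>1 t] d1 w1 tO[OF t] by blast
  have "c' * c = 1" using c(2)[OF f(1)] c'(2)[OF f(1)] w0 by (auto simp: mult.commute)
  then have "inverse c = c'" "c \<noteq> 0" by (auto intro: inverse_unique simp: mult.commute)
  then have ic: "o.isu p c" using o.isu_iff[OF p] c(1) c'(1) by blast
  have "h * (u * K p * wedge_d ?n t \<delta>0) = u' * K' p * (c * wedge_d ?n t \<delta>0)"
   using f(2) unfolding h_def fu'[OF f(1)] c(2)[OF f(1)] fu[OF f(1)] by simp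
  then have e: "h * u * K p = u' * K' p * c" using w0 by (simp add: ac_simps)
  have "K' p * (u' * c / u) = h * K p" using e o.isu_nz[OF p uu(1)] by (simp add: field_simps)
  moreover have "o.isu p (u' * c / u)" by (rule o.isu_divide[OF p o.isu_mult[OF p uu(2) ic] uu(1)])
  ultimately show ?thesis by blast
 qed
 obtain p where p: "p \<in> points X" using o.ne by blast
 have "h \<noteq> 0" using main[OF p] nz[OF p] o.isu_nz[OF p] by fastforce
 moreover have "o.isu p (K' p / (h * K p))" if p: "p \<in> points X" for p
 proof -
  obtain w where w: "o.isu p w" "K' p * w = h * K p" using main[OF p] by blast
  have "K' p / (h * K p) = inverse w"
   unfolding w(2)[symmetric] using nz[OF p] o.isu_nz[OF p w(1)] by (simp add: field_simps)
  then show ?thesis using o.isu_inverse(1)[OF p w(1)] by simp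
 qed
 ultimately show ?thesis by blast
qed

text \<open>Dividing the sections by \<open>h\<close> multiplies all their values at
  \<open>p\<close> by one nonzero scalar, so neither the map to projective space nor the ratios of
  forms in the sections change.\<close>

lemma very_ample_linear_equivalence:
 assumes B: "very_ample X B" and B': "cartier_divisor X B'" and h: "h \<noteq> 0"
  and u: "\<And>p. p \<in> points X ==> o.isu p (B' p / (h * B p))"
 shows "very_ample X B'"
proof -
 obtain M s where s: "\<And>i. i \<le> M ==> s i \<in> sections X B" "\<And>i. i > M ==> s i = 0"
  "\<And>p. p \<in> points X ==> \<exists>i\<le>M. s i * B p \<notin> max_ideal (local_ring X p)"
  "inj_on (section_map X B s) (points X)"
  "\<And>Z. Z \<subseteq> points X ==> zariski_closed (ambient X) Z \<longleftrightarrow> zariski_closed M (section_map X B s ` Z)"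
  "\<And>p. p \<in> points X ==> germs_along (scalar X) s (section_map X B s p) = local_ring X p"
  and cB: "cartier_divisor X B"
  using B unfolding very_ample_def by metis
 define t where "t i = s i / h" for i
 define w where "w p = B' p / (h * B p)" for p
 have nz: "B p \<noteq> 0" if "p \<in> points X" for p using cB that unfolding cartier_divisor_def by blast
 have tB: "t i * B' p = w p * (s i * B p)" if "p \<in> points X" for i p
  using nz[OF that] h by (simp add: t_def w_def)
 have w: "o.isu p (w p)" if "p \<in> points X" for p using u[OF that] by (simp add: w_def)
 have sO: "s i * B p \<in> local_ring X p" if "p \<in> points X" for i p
  using s(1,2)[of i] that o.Ov_simps(1)[OF that] by (cases "i \<le> M") (auto simp: sections_def)
 have sm: "section_map X B' t p = section_map X B s p" if p: "p \<in> points X" for p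
 proof -
  have "value_at X p (t i * B' p) = o.val p (w p) * value_at X p (s i * B p)" for i
   unfolding tB[OF p] val_eq_value_at[OF X, symmetric] using w[OF p] sO[OF p] by (simp add: o.isu_def o.val_ops p)
  then show ?thesis unfolding section_map_def using w[OF p] by (simp add: proj_point_scale o.isu_def)
 qed
 have im: "section_map X B' t ` Z = section_map X B s ` Z" if "Z \<subseteq> points X" for Z
  using sm that by (intro image_cong) auto
 have g: "germs_along (scalar X) t q = germs_along (scalar X) s q" for q
 proof -
  have "peval (scalar X) t F / peval (scalar X) t G = peval (scalar X) s F / peval (scalar X) s G"
   if "homogeneous d F" "homogeneous d G" for d F G
   using peval_scale[OF o.sc that(1), of "inverse h" s] peval_scale[OF o.sc that(2), of "inverse h" s] h
   by (simp add: t_def[abs_def] divide_inverse mult.commute)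
  then show ?thesis unfolding germs_along_def by (intro Collect_cong) metis
 qed
 have 1: "t i \<in> sections X B'" if "i \<le> M" for i
  unfolding sections_def using tB sO w o.Ov_simps(6) by (auto simp: o.isu_def)
 have 2: "t i = 0" if "i > M" for i using s(2)[OF that] by (simp add: t_def)
 have 3: "\<exists>i\<le>M. t i * B' p \<notin> max_ideal (local_ring X p)" if p: "p \<in> points X" for p
 proof -
  obtain i where i: "i \<le> M" "s i * B p \<notin> max_ideal (local_ring X p)" using s(3)[OF p] by blast
  then show ?thesis using w[OF p] sO[OF p, of i] o.max_ideal_iff[OF p] o.val_ops[OF p]
   by (intro exI[of _ i]) (auto simp: tB[OF p] o.isu_def)
 qed
 have 4: "inj_on (section_map X B' t) (points X)" using s(4) inj_on_cong[of "points X"] sm by metis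
 have 5: "zariski_closed (ambient X) Z \<longleftrightarrow> zariski_closed M (section_map X B' t ` Z)" if "Z \<subseteq> points X" for Z
  using s(5)[OF that] im[OF that] by simp
 have 6: "germs_along (scalar X) t (section_map X B' t p) = local_ring X p" if "p \<in> points X" for p
  using s(6)[OF that] g sm[OF that] by simp
 show ?thesis unfolding very_ample_def
  by (rule conjI[OF B'], rule exI[of _ M], rule exI[of _ t]) (simp add: 1 2 3 4 5 6)
qed

end

section \<open>Multiples of an ample divisor\<close>

lemma ideal_prod_I: "x \<in> I ==> y \<in> J ==> x * y \<in> ideal_prod I J"
 unfolding ideal_prod_def
 by (intro CollectI exI[of _ "1::nat"] exI[of _ "\<lambda>_. x"] exI[of _ "\<lambda>_. y"]) simp

lemma ideal_prod_subset:
 assumes R: "subring1 R" and "I \<subseteq> R" "J \<subseteq> R" shows "ideal_prod I J \<subseteq> R"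
proof
 fix u assume "u \<in> ideal_prod I J"
 then obtain l :: nat and x y where u: "u = (\<Sum>i<l. x i * y i)" "\<forall>i<l. x i \<in> I \<and> y i \<in> J" by (rule ideal_prodE)
 show "u \<in> R" unfolding u(1) using u(2) assms(2,3) by (intro subring1D(8)[OF R] subring1D(6)[OF R]) auto
qed

lemma foldr_ideal_prod_subset:
 assumes R: "subring1 R" shows "(\<And>I. I \<in> set Is ==> I \<subseteq> R) ==> foldr ideal_prod Is R \<subseteq> R"
 by (induction Is) (simp_all add: ideal_prod_subset[OF R])

lemma foldr_ideal_prod_one:
 assumes "1 \<in> R" shows "(\<And>I. I \<in> set Is ==> 1 \<in> I) ==> x \<in> R ==> x \<in> foldr ideal_prod Is R"
proof (induction Is)
 case (Cons I Is)
 then show ?case using ideal_prod_I[of 1 I x "foldr ideal_prod Is R"] by simp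
qed simp

lemma foldr_ideal_prod_nth:
 assumes "1 \<in> R"
 shows "i < length Is ==> (\<And>l. l < length Is ==> l \<noteq> i ==> 1 \<in> Is ! l) ==> x \<in> Is ! i ==> x \<in> foldr ideal_prod Is R"
proof (induction Is arbitrary: i)
 case (Cons I Is)
 show ?case
 proof (cases i)
  case 0
  have "1 \<in> J" if "J \<in> set Is" for J
   using that Cons.prems(2)[of "Suc _"] 0 by (auto simp: in_set_conv_nth)
  then have "1 \<in> foldr ideal_prod Is R" using foldr_ideal_prod_one[OF assms] assms by blast
  then show ?thesis using ideal_prod_I[of x I 1 "foldr ideal_prod Is R"] Cons.prems(3) 0 by simp
 next
  case (Suc n)
  have "x \<in> foldr ideal_prod Is R"
  proof (rule Cons.IH[of n])
   show "1 \<in> Is ! l" if "l < length Is" "l \<noteq> n" for l using Cons.prems(2)[of "Suc l"] that Suc by simp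
  qed (use Cons.prems Suc in auto)
  moreover have "1 \<in> I" using Cons.prems(2)[of 0] Suc by simp
  ultimately show ?thesis using ideal_prod_I[of 1 I x "foldr ideal_prod Is R"] by simp
 qed
qed simp

lemma ideal_pow_unit: assumes "subring1 R" shows "1 \<in> ideal_pow R R e"
proof (induction e)
 case (Suc e)
 then show ?case using ideal_prod_I[of 1 R 1 "ideal_pow R R e"] subring1D(2)[OF assms] by simp
qed (simp add: subring1D(2)[OF assms])

lemma ideal_pow_subset: "subring1 R ==> I \<subseteq> R ==> ideal_pow R I e \<subseteq> R"
 by (induction e) (simp_all add: ideal_prod_subset)

context
 fixes X :: "'k::field projvar" and D :: "'k divisor"
 assumes X: "projective_variety X" and D: "ample X D"
begin

interpretation o: model "scalar X" "coord X" "ambient X" "points X" rep "local_ring X"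
 by (rule projvar_model[OF X])

text \<open>At a point outside \<open>xs\<close> all factors are the unit ideal, and at
  \<open>xs ! i\<close> all but the \<open>i\<close>-th are.\<close>

lemma jet_ideal_bounds:
 assumes q: "q \<in> points X" and ks: "length ks = length xs"
 shows "jet_ideal X xs ks q \<subseteq> local_ring X q"
  "q \<notin> set xs ==> f \<in> local_ring X q ==> f \<in> jet_ideal X xs ks q"
  "distinct xs ==> i < length xs ==> q = xs ! i ==> f \<in> o.mp q (ks ! i) ==> f \<in> jet_ideal X xs ks q"
proof -
 let ?R = "local_ring X q"
 have R: "subring1 ?R" by (rule o.Ov_ring[OF q])
 have mR: "max_ideal ?R \<subseteq> ?R" by (auto simp: max_ideal_def)
 let ?I = "\<lambda>x e. ideal_pow ?R (if q = x then max_ideal ?R else ?R) e"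
 let ?Is = "map2 ?I xs ks"
 have nth: "?Is ! l = ?I (xs ! l) (ks ! l)" if "l < length xs" for l using that ks by simp
 have len: "length ?Is = length xs" using ks by simp
 have sub: "I \<subseteq> ?R" if "I \<in> set ?Is" for I
 proof -
  obtain x e where "I = ?I x e" using \<open>I \<in> set ?Is\<close> by auto
  moreover have "?I x e \<subseteq> ?R" by (rule ideal_pow_subset[OF R]) (use mR in auto)
  ultimately show ?thesis by simp
 qed
 show "jet_ideal X xs ks q \<subseteq> ?R" unfolding jet_ideal_def by (rule foldr_ideal_prod_subset[OF R sub])
 show "f \<in> jet_ideal X xs ks q" if "q \<notin> set xs" "f \<in> ?R"
  unfolding jet_ideal_def
 proof (rule foldr_ideal_prod_one[OF subring1D(2)[OF R] _ that(2)])
  fix I assume "I \<in> set ?Is"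
  then obtain l where "l < length xs" "I = ?Is ! l" using len by (metis in_set_conv_nth)
  moreover have "q \<noteq> xs ! l" using calculation that(1) by auto
  ultimately show "1 \<in> I" using nth ideal_pow_unit[OF R] by simp
 qed
 show "f \<in> jet_ideal X xs ks q" if "distinct xs" and i: "i < length xs" and q: "q = xs ! i" and "f \<in> o.mp q (ks ! i)"
  unfolding jet_ideal_def
 proof (rule foldr_ideal_prod_nth[OF subring1D(2)[OF R]])
  show "i < length ?Is" using i len by simp
  show "1 \<in> ?Is ! l" if "l < length ?Is" "l \<noteq> i" for l
  proof -
   have "l < length xs" using that len by simp
   moreover have "q \<noteq> xs ! l" using calculation that(2) \<open>distinct xs\<close> i q by (simp add: nth_eq_iff_index_eq)
   ultimately show ?thesis using nth ideal_pow_unit[OF R] by simp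
  qed
  show "f \<in> ?Is ! i" unfolding nth[OF i] using \<open>f \<in> o.mp q (ks ! i)\<close> q by (simp add: o.mp_def)
 qed
qed

text \<open>Modulo the jet ideal a section of the quotient sheaf matters only through its germs at
  the points \<open>xs\<close>, and these are the jets prescribed in \<open>jets\<close>.\<close>

lemma jet_ampleI:
 assumes pm: "pmodel (scalar X) s M (points X) a (local_ring X) D0"
  and gB: "model.gg (scalar X) (points X) (local_ring X) B"
  and G: "\<And>q. q \<in> points X ==> G q = D0 q ^ k * B q"
 shows "jet_ample X k G"
proof -
 interpret n: pmodel "scalar X" s M "points X" a "local_ring X" D0 by (rule pm)
 show ?thesis
  unfolding jet_ample_def
 proof (intro allI impI)
  fix xs ks g
  assume A: "distinct xs \<and> set xs \<subseteq> points X \<and> length ks = length xs \<and> (\<forall>e\<in>set ks. 1 \<le> e) \<and> sum_list ks = k + 1"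
   and Q: "quotient_section X G (jet_ideal X xs ks) g"
  have A': "distinct xs" "set xs \<subseteq> points X" "length ks = length xs" "sum_list ks = Suc k" using A by auto
  \<comment> \<open>The chosen germ \<open>g q\<close> is itself regular, because it differs from a
    regular germ by an element of the jet ideal.\<close>
  have gO: "g q * G q \<in> local_ring X q" if q: "q \<in> points X" for q
  proof -
   obtain U h where "open_nbhd X q U" and U: "\<And>r. r \<in> U ==> h * G r \<in> local_ring X r \<and> (h - g r) * G r \<in> jet_ideal X xs ks r"
    using Q q unfolding quotient_section_def by blast
   then have "q \<in> U" by (simp add: open_nbhd_def)
   then have "h * G q \<in> local_ring X q" "(h - g q) * G q \<in> local_ring X q"
    using U jet_ideal_bounds(1)[OF q A'(3)] by blast+
   from o.Ov_simps(5)[OF q this] show ?thesis by (simp add: algebra_simps)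
  qed
  have "xs ! i \<in> points X" if "i < length xs" for i using A'(2) that by auto
  then obtain T where T: "\<And>q. q \<in> points X ==> T * (D0 q ^ k * B q) \<in> local_ring X q"
   "\<And>i. i < length xs ==> T * (D0 (xs ! i) ^ k * B (xs ! i)) - g (xs ! i) * G (xs ! i) \<in> n.mp (xs ! i) (ks ! i)"
   using n.jets[OF gB A', of "\<lambda>i. g (xs ! i) * G (xs ! i)"] gO by blast
  show "\<exists>s\<in>sections X G. \<forall>q\<in>points X. (s - g q) * G q \<in> jet_ideal X xs ks q"
  proof (intro bexI[of _ T] ballI)
   show "T \<in> sections X G" unfolding sections_def using T(1) G by simp
   fix q assume q: "q \<in> points X"
   have e: "(T - g q) * G q = T * (D0 q ^ k * B q) - g q * G q" by (simp add: G[OF q] left_diff_distrib)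
   show "(T - g q) * G q \<in> jet_ideal X xs ks q"
   proof (cases "q \<in> set xs")
    case True
    then obtain i where i: "i < length xs" "q = xs ! i" by (metis in_set_conv_nth)
    have "T * (D0 q ^ k * B q) - g q * G q \<in> o.mp q (ks ! i)"
     using T(2)[OF i(1)] unfolding i(2)[symmetric] .
    then show ?thesis unfolding e by (rule jet_ideal_bounds(3)[OF q A'(3,1) i])
   next
    case False
    then show ?thesis unfolding e
     using jet_ideal_bounds(2)[OF q A'(3) False] o.Ov_simps(5)[OF q T(1)[OF q] gO[OF q]] by blast
   qed
  qed
 qed
qed

text \<open>One \<open>c\<close> serves jet ampleness and all canonical divisors. For jets,
  \<open>k\<close> copies of the very ample \<open>m0 D\<close> supply the forms, and the remainder
  is globally generated.\<close>

theorem ample_consequences: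
 obtains m0 s M a c where "m0 > 0"
  "pmodel (scalar X) s M (points X) a (local_ring X) (\<lambda>p. D p ^ m0)"
  "\<And>k t. t \<ge> m0 * k + c ==> jet_ample X k (div_scale (int t) D)"
  "\<And>m K. m \<ge> c ==> canonical_divisor CARD('n::{finite,linorder}) X K ==>
    ample X (div_minus (div_scale (int m) D) K)"
  "\<And>p. p \<in> points X ==> D p \<noteq> 0"
proof -
 obtain mi where mi: "mi > 0" "very_ample X (div_scale mi D)" and cD: "cartier_divisor X D"
  using D unfolding ample_def by blast
 define m0 where "m0 = nat mi"
 have m0: "m0 > 0" using mi(1) by (simp add: m0_def)
 have ds: "div_scale (int m) D = (\<lambda>p. D p ^ m)" for m by (simp add: div_scale_def)
 have "very_ample X (\<lambda>p. D p ^ m0)" using mi unfolding ds[symmetric] m0_def by simp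
 then obtain s M a where pm: "pmodel (scalar X) s M (points X) a (local_ring X) (\<lambda>p. D p ^ m0)"
  and zc: "\<And>Z. Z \<subseteq> points X ==> model.zcl (points X) a Z \<longleftrightarrow> o.zcl Z"
  using very_ample_pmodel[OF X, of "\<lambda>p. D p ^ m0"] by metis
 interpret n: pmodel "scalar X" s M "points X" a "local_ring X" "\<lambda>p. D p ^ m0" by (rule pm)
 have cart: "n.cart B \<longleftrightarrow> cartier_divisor X B" for B
  unfolding cartier_divisor_iff[OF X] n.cart_iff o.cart_iff
  using zc by (metis (no_types, lifting) n.zcl_def o.zcl_def)
 have nD: "n.cart D" using cD cart by blast
 have cp: "n.cart (\<lambda>p. D p ^ r)" for r using n.cart_powi[OF nD, of "int r"] by simp
 \<comment> \<open>Serre's theorem concerns multiples of \<open>m0 D\<close>; applied to each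
   residue class modulo \<open>m0\<close> it covers all large multiples of \<open>D\<close>.\<close>
 have uniform: "\<exists>c. \<forall>t\<ge>c. n.gg (\<lambda>q. D q ^ t * B q)" if B: "n.cart B" for B
 proof -
  have "\<forall>r. \<exists>N0. \<forall>N\<ge>N0. n.gg (\<lambda>q. (D q ^ m0) ^ N * (D q ^ r * B q))"
   by (intro allI n.serre_gg[OF n.cart_mult[OF cp B]])
  from choice[OF this] obtain N
   where N: "\<forall>r. \<forall>n\<ge>N r. n.gg (\<lambda>q. (D q ^ m0) ^ n * (D q ^ r * B q))" by (rule exE)
  show ?thesis
  proof (intro exI[of _ "m0 * (\<Sum>r<m0. N r)"] allI impI)
   fix t assume t: "m0 * (\<Sum>r<m0. N r) \<le> t"
   have "N (t mod m0) \<le> (\<Sum>r<m0. N r)" using m0 by (intro member_le_sum) auto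
   also have "\<dots> \<le> t div m0" using t m0 by (simp add: less_eq_div_iff_mult_less_eq mult.commute)
   finally have "n.gg (\<lambda>q. (D q ^ m0) ^ (t div m0) * (D q ^ (t mod m0) * B q))" by (rule N[rule_format])
   moreover have "(D q ^ m0) ^ (t div m0) * (D q ^ (t mod m0) * B q) = D q ^ t * B q" for q
    by (simp add: power_mult[symmetric] power_add[symmetric] mult.assoc[symmetric])
   ultimately show "n.gg (\<lambda>q. D q ^ t * B q)" by simp
  qed
 qed
 obtain c1 where c1: "\<And>t. t \<ge> c1 ==> n.gg (\<lambda>q. D q ^ t)"
  using uniform[of "\<lambda>_. 1"] cp[of 0] by auto
 have jet: "jet_ample X k (div_scale (int t) D)" if t: "t \<ge> m0 * k + c1" for k t
 proof (rule jet_ampleI[OF pm c1[of "t - m0 * k"]])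
  show "c1 \<le> t - m0 * k" using t by simp
  show "div_scale (int t) D q = (D q ^ m0) ^ k * D q ^ (t - m0 * k)" for q
   using t by (simp add: ds power_mult[symmetric] power_add[symmetric])
 qed
 have "\<exists>c2. \<forall>m\<ge>c2. \<forall>K. canonical_divisor CARD('n) X K \<longrightarrow> ample X (div_minus (div_scale (int m) D) K)"
 proof (cases "\<exists>K. canonical_divisor CARD('n) X K")
  case True
  then obtain K where K: "canonical_divisor CARD('n) X K" by blast
  have cK: "n.cart K'" if "canonical_divisor CARD('n) X K'" for K' using that cart by (simp add: canonical_divisor_def)
  have ci: "n.cart (\<lambda>p. inverse (K' p))" if "canonical_divisor CARD('n) X K'" for K'
   using n.cart_powi[OF cK[OF that], of "- 1"] by (simp add: power_int_minus)
  obtain c3 where c3: "\<And>t. t \<ge> c3 ==> n.gg (\<lambda>q. D q ^ t * inverse (K q))" using uniform[OF ci[OF K]] by blast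
  \<comment> \<open>For the fixed \<open>K\<close>, \<open>m D - K\<close> is the sum of the very
    ample \<open>m0 D\<close> and the globally generated \<open>(m - m0) D - K\<close>. The bound
    must not depend on \<open>K'\<close>, so \<open>K'\<close> is reached by linear
    equivalence.\<close>
  have "ample X (div_minus (div_scale (int m) D) K')"
   if m: "m \<ge> m0 + c3" and K': "canonical_divisor CARD('n) X K'" for m K'
  proof -
   have va: "very_ample X (\<lambda>p. D p ^ m0 * (D p ^ (m - m0) * inverse (K p)))"
    by (rule very_ample_segre[OF X pm zc n.cart_mult[OF cp ci[OF K]] c3]) (use m in auto)
   have e: "D p ^ m0 * (D p ^ (m - m0) * inverse (K p)) = D p ^ m / K p" for p
    using m by (simp add: power_add[symmetric] mult.assoc[symmetric] divide_inverse)
   have cK': "cartier_divisor X (div_minus (div_scale (int m) D) K')"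
    using n.cart_mult[OF cp ci[OF K'], of m] by (simp add: cart[symmetric] div_minus_def ds divide_inverse)
   obtain h where h: "h \<noteq> 0" "\<And>p. p \<in> points X ==> o.isu p (K' p / (h * K p))"
    using canonical_unique[OF X K K'] by blast
   have "very_ample X (div_minus (div_scale (int m) D) K')"
   proof (rule very_ample_linear_equivalence[OF X va cK'])
    show "inverse h \<noteq> 0" using h by simp
    fix p assume p: "p \<in> points X"
    have "div_minus (div_scale (int m) D) K' p / (inverse h * (D p ^ m0 * (D p ^ (m - m0) * inverse (K p)))) =
     inverse (K' p / (h * K p))"
     unfolding e using n.cart_nz[OF nD p] h(1) by (simp add: div_minus_def ds field_simps)
    then show "o.isu p (div_minus (div_scale (int m) D) K' p / (inverse h * (D p ^ m0 * (D p ^ (m - m0) * inverse (K p)))))"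
     using o.isu_inverse(1)[OF p h(2)[OF p]] by simp
   qed
   then show ?thesis unfolding ample_def using cK' by (intro conjI exI[of _ 1]) (simp_all add: div_scale_def)
  qed
  then show ?thesis by blast
 qed blast
 then obtain c2 where c2: "\<And>m K. m \<ge> c2 ==> canonical_divisor CARD('n) X K ==> ample X (div_minus (div_scale (int m) D) K)" by blast
 show thesis
 proof (rule that[OF m0 pm])
  show "jet_ample X k (div_scale (int t) D)" if "t \<ge> m0 * k + max c1 c2" for k t using jet that by simp
  show "ample X (div_minus (div_scale (int m) D) K)" if "m \<ge> max c1 c2" "canonical_divisor CARD('n) X K" for m K
   using c2 that by simp
  show "D p \<noteq> 0" if "p \<in> points X" for p using n.cart_nz[OF nD that] .
 qed
qed

end

section \<open>Polynomials in lists of variables\<close>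

definition lmon :: "nat list \<Rightarrow> 'a list \<Rightarrow> 'a::comm_ring_1" where
 "lmon \<alpha> ys = prod_list (map2 (\<lambda>e y. y ^ e) \<alpha> ys)"

lemma lmon_simps [simp]: "lmon [] ys = 1" "lmon \<alpha> [] = 1" "lmon (e # \<alpha>) (y # ys) = y ^ e * lmon \<alpha> ys"
 by (simp_all add: lmon_def)

lemma lmon_append: "length \<alpha> = length ys ==> lmon (\<alpha> @ \<beta>) (ys @ zs) = lmon \<alpha> ys * lmon \<beta> zs"
 by (simp add: lmon_def)

text \<open>Exponents are bounded separately in each variable: their number is then a power, and
  induction can split off the first variable.\<close>

definition mbox :: "nat \<Rightarrow> nat \<Rightarrow> nat list set" where
 "mbox n \<tau> = {\<alpha>. set \<alpha> \<subseteq> {..\<tau>} \<and> length \<alpha> = n}"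

lemma mbox_card: "finite (mbox n \<tau>)" "card (mbox n \<tau>) = Suc \<tau> ^ n"
 using finite_lists_length_eq[of "{..\<tau>}" n] card_lists_length_eq[of "{..\<tau>}" n] by (simp_all add: mbox_def)

lemma mbox_0 [simp]: "mbox 0 \<tau> = {[]}"
 by (auto simp: mbox_def)

lemma mbox_Suc_sum: "(\<Sum>\<alpha>\<in>mbox (Suc n) \<tau>. f \<alpha>) = (\<Sum>e\<le>\<tau>. \<Sum>\<alpha>\<in>mbox n \<tau>. f (e # \<alpha>))"
proof -
 have "(\<Sum>e\<le>\<tau>. \<Sum>\<alpha>\<in>mbox n \<tau>. f (e # \<alpha>)) = (\<Sum>(e, \<alpha>)\<in>{..\<tau>} \<times> mbox n \<tau>. f (e # \<alpha>))"
  by (simp add: sum.cartesian_product)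
 also have "\<dots> = (\<Sum>\<alpha>\<in>mbox (Suc n) \<tau>. f \<alpha>)"
  by (rule sum.reindex_bij_witness[of _ "\<lambda>\<alpha>. (hd \<alpha>, tl \<alpha>)" "\<lambda>(e, \<alpha>). e # \<alpha>"])
   (auto simp: mbox_def length_Suc_conv)
 finally show ?thesis by simp
qed

lemma mbox_polynomial_nonzero:
 fixes c :: "nat list \<Rightarrow> complex"
 shows "\<exists>\<alpha>\<in>mbox n \<tau>. c \<alpha> \<noteq> 0 ==> \<exists>ys. length ys = n \<and> (\<Sum>\<alpha>\<in>mbox n \<tau>. c \<alpha> * lmon \<alpha> ys) \<noteq> 0"
proof (induction n arbitrary: c)
 case (Suc n)
 then obtain e \<beta> where e: "e \<le> \<tau>" "\<beta> \<in> mbox n \<tau>" "c (e # \<beta>) \<noteq> 0" by (auto simp: mbox_def length_Suc_conv)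
 then have "\<exists>\<alpha>\<in>mbox n \<tau>. c (e # \<alpha>) \<noteq> 0" by blast
 from Suc.IH[OF this] obtain ys where ys: "length ys = n" "(\<Sum>\<alpha>\<in>mbox n \<tau>. c (e # \<alpha>) * lmon \<alpha> ys) \<noteq> 0" by blast
 define b where "b i = (\<Sum>\<alpha>\<in>mbox n \<tau>. c (i # \<alpha>) * lmon \<alpha> ys)" for i
 have eq: "(\<Sum>\<alpha>\<in>mbox (Suc n) \<tau>. c \<alpha> * lmon \<alpha> (x # ys)) = (\<Sum>i\<le>\<tau>. b i * x ^ i)" for x
  by (simp add: mbox_Suc_sum b_def sum_distrib_left sum_distrib_right ac_simps)
 have "\<not> (\<forall>x. (\<Sum>i\<le>\<tau>. b i * x ^ i) = 0)"
  using polyfun_eq_0[of b \<tau>] e(1) ys(2) unfolding b_def by blast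
 then obtain x where "(\<Sum>i\<le>\<tau>. b i * x ^ i) \<noteq> 0" by blast
 then show ?case using ys(1) eq[of x] by (intro exI[of _ "x # ys"]) simp
qed simp

text \<open>The Hasse derivatives at \<open>P\<close>: the coefficients of the polynomial
  \<open>c\<close> in powers of the variables shifted by \<open>P\<close>, computed one variable at
  a time.\<close>

primrec taylor :: "nat \<Rightarrow> complex list \<Rightarrow> (nat list \<Rightarrow> complex) \<Rightarrow> nat list \<Rightarrow> complex" where
 "taylor \<tau> [] c = c"
| "taylor \<tau> (s # P) c = (\<lambda>\<alpha>. taylor \<tau> P (\<lambda>\<beta>. \<Sum>e\<in>{hd \<alpha>..\<tau>}. of_nat (e choose hd \<alpha>) * s ^ (e - hd \<alpha>) * c (e # \<beta>)) (tl \<alpha>))"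

lemma shift_expansion:
 fixes y s :: "'a::comm_ring_1"
 shows "(\<Sum>e\<le>\<tau>. b e * y ^ e) = (\<Sum>i\<le>\<tau>. (\<Sum>e\<in>{i..\<tau>}. of_nat (e choose i) * s ^ (e - i) * b e) * (y - s) ^ i)"
proof -
 have "y ^ e = (\<Sum>i\<le>e. of_nat (e choose i) * (y - s) ^ i * s ^ (e - i))" for e
  using binomial_ring[of "y - s" s e] by simp
 then have "(\<Sum>e\<le>\<tau>. b e * y ^ e) = (\<Sum>e\<le>\<tau>. \<Sum>i\<le>e. of_nat (e choose i) * s ^ (e - i) * b e * (y - s) ^ i)"
  by (simp add: sum_distrib_left ac_simps)
 also have "\<dots> = (\<Sum>i\<le>\<tau>. \<Sum>e\<in>{i..\<tau>}. of_nat (e choose i) * s ^ (e - i) * b e * (y - s) ^ i)"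
  unfolding sum.Sigma[OF finite_atMost ballI[OF finite_atMost]]
    sum.Sigma[OF finite_atMost ballI[OF finite_atLeastAtMost]]
  by (rule sum.reindex_bij_witness[of _ "\<lambda>(i, j). (j, i)" "\<lambda>(j, i). (i, j)"]) auto
 finally show ?thesis by (simp add: sum_distrib_right)
qed

text \<open>The homomorphism \<open>h\<close> allows complex coefficients with arguments in another
  ring, as in the application to the rational functions \<open>Xs\<close>.\<close>

lemma taylor_expansion:
 assumes h: "rhom h"
 shows "length ys = length P ==> (\<Sum>\<alpha>\<in>mbox (length P) \<tau>. h (c \<alpha>) * lmon \<alpha> ys) =
  (\<Sum>\<alpha>\<in>mbox (length P) \<tau>. h (taylor \<tau> P c \<alpha>) * lmon \<alpha> (map2 (\<lambda>y s. y - h s) ys P))"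
proof (induction P arbitrary: ys c)
 case (Cons s P)
 then obtain y ys' where ys: "ys = y # ys'" "length ys' = length P" by (cases ys) auto
 let ?m = "\<lambda>\<alpha>. lmon \<alpha> ys'" and ?B = "mbox (length P) \<tau>"
 define c' where "c' i \<beta> = (\<Sum>e\<in>{i..\<tau>}. of_nat (e choose i) * s ^ (e - i) * c (e # \<beta>))" for i \<beta>
 have "(\<Sum>\<alpha>\<in>mbox (length (s # P)) \<tau>. h (c \<alpha>) * lmon \<alpha> ys) = (\<Sum>e\<le>\<tau>. (\<Sum>\<beta>\<in>?B. h (c (e # \<beta>)) * ?m \<beta>) * y ^ e)"
  by (simp add: mbox_Suc_sum ys(1) sum_distrib_left ac_simps)
 also have "\<dots> = (\<Sum>i\<le>\<tau>. (\<Sum>\<beta>\<in>?B. h (c' i \<beta>) * ?m \<beta>) * (y - h s) ^ i)"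
  unfolding shift_expansion[of _ y \<tau> "h s"]
 proof (intro sum.cong refl arg_cong2[of _ _ _ _ "(*)"])
  fix i
  have "(\<Sum>e\<in>{i..\<tau>}. \<Sum>\<beta>\<in>?B. of_nat (e choose i) * h s ^ (e - i) * h (c (e # \<beta>)) * ?m \<beta>) =
    (\<Sum>\<beta>\<in>?B. \<Sum>e\<in>{i..\<tau>}. of_nat (e choose i) * h s ^ (e - i) * h (c (e # \<beta>)) * ?m \<beta>)"
   by (rule sum.swap)
  then show "(\<Sum>e\<in>{i..\<tau>}. of_nat (e choose i) * h s ^ (e - i) * (\<Sum>\<beta>\<in>?B. h (c (e # \<beta>)) * ?m \<beta>)) =
    (\<Sum>\<beta>\<in>?B. h (c' i \<beta>) * ?m \<beta>)"
   by (simp add: c'_def rhomD[OF h] sum_distrib_right sum_distrib_left mult.assoc)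
 qed
 also have "\<dots> = (\<Sum>i\<le>\<tau>. (\<Sum>\<beta>\<in>?B. h (taylor \<tau> P (c' i) \<beta>) * lmon \<beta> (map2 (\<lambda>y s. y - h s) ys' P)) * (y - h s) ^ i)"
  by (simp add: Cons.IH[OF ys(2)])
 also have "\<dots> = (\<Sum>\<alpha>\<in>mbox (length (s # P)) \<tau>. h (taylor \<tau> (s # P) c \<alpha>) * lmon \<alpha> (map2 (\<lambda>y s. y - h s) ys (s # P)))"
  by (simp add: mbox_Suc_sum ys(1) sum_distrib_left c'_def[abs_def] ac_simps)
 finally show ?case .
qed simp

section \<open>Multiplicities of polynomials along grids\<close>

text \<open>\<open>tree N n T\<close>: \<open>T\<close> is a set of \<open>N ^ n\<close> points of \<open>n\<close>-space such that \<open>N\<close> values of the first coordinate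
 occur, each with \<open>N\<close> values of the second, and so on.\<close>

primrec tree :: "nat \<Rightarrow> nat \<Rightarrow> complex list set \<Rightarrow> bool" where
 "tree N 0 T \<longleftrightarrow> T = {[]}"
| "tree N (Suc n) T \<longleftrightarrow> (\<exists>S \<tau>. finite S \<and> card S = N \<and> (\<forall>s\<in>S. tree N n (\<tau> s)) \<and>
   T = (\<Union>s\<in>S. (#) s ` \<tau> s))"

lemma tree_card: "tree N n T ==> finite T \<and> card T = N ^ n"
proof (induction n arbitrary: T)
 case (Suc n)
 then obtain S \<tau> where S: "finite S" "card S = N" "\<forall>s\<in>S. tree N n (\<tau> s)" "T = (\<Union>s\<in>S. (#) s ` \<tau> s)" by auto
 have *: "finite ((#) s ` \<tau> s)" "card ((#) s ` \<tau> s) = N ^ n" if "s \<in> S" for s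
  using Suc.IH[of "\<tau> s"] S(3) that by (auto simp: card_image)
 have "card T = (\<Sum>s\<in>S. card ((#) s ` \<tau> s))"
  unfolding S(4) by (rule card_UN_disjoint) (use S(1) * in auto)
 then show ?case using S * by simp
qed auto

text \<open>By the bound on the number of zeros there is a root \<open>s\<close> of the tree such that the polynomial is divisible
 exactly by a power \<open>e\<close> of \<open>x - s\<close> with \<open>N * e \<le> \<tau>\<close>; the quotient restricts to \<open>x = s\<close>.\<close>

theorem schwartz_zippel_multiplicity:
 "\<exists>\<alpha>\<in>mbox n \<tau>. c \<alpha> \<noteq> 0 ==> tree N n T ==>
  (\<And>P \<alpha>. P \<in> T ==> \<alpha> \<in> mbox n \<tau> ==> sum_list \<alpha> < b ==> taylor \<tau> P c \<alpha> = 0) ==> N * b \<le> n * \<tau>"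
proof (induction n arbitrary: c T b)
 case 0
 then show ?case by (cases "b = 0") auto
next
 case (Suc n)
 obtain S \<sigma> where S: "finite S" "card S = N" "\<forall>s\<in>S. tree N n (\<sigma> s)" "T = (\<Union>s\<in>S. (#) s ` \<sigma> s)" using Suc.prems(2) by auto
 \<comment> \<open>\<open>C s i\<close> lists the coefficients of the polynomial in the remaining
   variables that multiplies \<open>(x - s)^i\<close>.\<close>
 define C where "C s i \<beta> = (\<Sum>e\<in>{i..\<tau>}. of_nat (e choose i) * s ^ (e - i) * c (e # \<beta>))" for s i \<beta>
 \<comment> \<open>The polynomial in the first variable that multiplies the monomial
   \<open>\<beta>\<close> in the others. A single nonzero one, \<open>p \<beta>0\<close>, bounds the
   sum of all orders \<open>es s\<close>.\<close>
 define p where "p \<beta> = (\<Sum>e\<le>\<tau>. [:c (e # \<beta>):] * [:0, 1:] ^ e)" for \<beta>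
 have pC: "p \<beta> = (\<Sum>i\<le>\<tau>. [:C s i \<beta>:] * [:- s, 1:] ^ i)" for s \<beta>
 proof -
  have k: "rhom (\<lambda>x :: complex. [:x:])" by (simp add: rhom_def)
  have "[:C s i \<beta>:] = (\<Sum>e\<in>{i..\<tau>}. of_nat (e choose i) * [:s:] ^ (e - i) * [:c (e # \<beta>):])" for i
   unfolding C_def by (simp only: rhomD(4,7,8,10)[OF k])
  then show ?thesis unfolding p_def shift_expansion[of _ "[:0, 1:]" \<tau> "[:s:]"] by simp
 qed
 obtain e0 \<beta>0 where e0: "e0 \<le> \<tau>" "\<beta>0 \<in> mbox n \<tau>" "c (e0 # \<beta>0) \<noteq> 0"
  using Suc.prems(1) by (auto simp: mbox_def length_Suc_conv)
 have cp: "coeff (p \<beta>) e = c (e # \<beta>)" if "e \<le> \<tau>" for e \<beta>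
  using that by (simp add: p_def coeff_sum monom_altdef[symmetric] if_distrib cong: if_cong)
 have p0: "p \<beta>0 \<noteq> 0" using cp[OF e0(1), of \<beta>0] e0(3) by auto
 have dp: "degree (p \<beta>) \<le> \<tau>" for \<beta>
  unfolding p_def by (intro degree_sum_le) (auto simp: monom_altdef[symmetric] intro: degree_monom_le[THEN le_trans])
 define Q where "Q s i \<longleftrightarrow> i \<le> \<tau> \<and> (\<exists>\<beta>\<in>mbox n \<tau>. C s i \<beta> \<noteq> 0)" for s i
 have "\<exists>i. Q s i" for s
 proof (rule ccontr)
  assume "\<not> ?thesis"
  then have "p \<beta>0 = 0" unfolding pC[of _ s] using e0(2) by (intro sum.neutral) (auto simp: Q_def)
  then show False using p0 by simp
 qed
 define es where "es s = (LEAST i. Q s i)" for s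
 have es: "Q s (es s)" for s unfolding es_def by (rule LeastI_ex) fact
 have less: "C s i \<beta>0 = 0" if "i < es s" for s i
  using not_less_Least[of i "Q s"] that es[of s] e0(2) by (force simp: es_def Q_def)
 have "[:- s, 1:] ^ es s dvd p \<beta>0" for s
  unfolding pC[of _ s]
 proof (intro dvd_sum)
  fix i
  show "[:- s, 1:] ^ es s dvd [:C s i \<beta>0:] * [:- s, 1:] ^ i"
   using less[of i s] by (cases "i < es s") (auto intro!: dvd_smult le_imp_power_dvd)
 qed
 then have order: "es s \<le> order s (p \<beta>0)" for s using p0 order_divides by blast
 have "(\<Sum>s\<in>S. es s) \<le> (\<Sum>s\<in>S. order s (p \<beta>0))" by (intro sum_mono order)
 also have "\<dots> = (\<Sum>s\<in>S \<inter> {x. poly (p \<beta>0) x = 0}. order s (p \<beta>0))"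
  using S(1) by (intro sum.mono_neutral_right) (auto simp: order_0I)
 also have "\<dots> \<le> (\<Sum>s | poly (p \<beta>0) s = 0. order s (p \<beta>0))" using poly_roots_finite[OF p0] by (intro sum_mono2) auto
 also have "\<dots> \<le> \<tau>" using sum_order_le_degree[OF p0] dp le_trans by blast
 finally have sum: "(\<Sum>s\<in>S. es s) \<le> \<tau>" .
 show ?case
 proof (cases "N = 0")
  case False
  then have "S \<noteq> {}" using S(2) by auto
  \<comment> \<open>Pigeonhole: the \<open>N\<close> orders \<open>es s\<close> add up to at most
    \<open>\<tau>\<close>.\<close>
  have "\<exists>s\<in>S. N * es s \<le> \<tau>"
  proof (rule ccontr)
   assume "\<not> ?thesis"
   then have "(\<Sum>s\<in>S. \<tau>) < (\<Sum>s\<in>S. N * es s)" using S(1) \<open>S \<noteq> {}\<close> by (intro sum_strict_mono) auto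
   then show False using mult_le_mono2[OF sum, of N] S(2) by (simp add: sum_distrib_left)
  qed
  then obtain s where s: "s \<in> S" "N * es s \<le> \<tau>" by blast
  \<comment> \<open>The Taylor coefficients of order below \<open>b\<close> with first index
    \<open>es s\<close> vanish, which leaves multiplicity \<open>b - es s\<close> for the restricted
    quotient.\<close>
  have "N * (b - es s) \<le> n * \<tau>"
  proof (rule Suc.IH[of "C s (es s)" "\<sigma> s"])
   show "\<exists>\<alpha>\<in>mbox n \<tau>. C s (es s) \<alpha> \<noteq> 0" using es[of s] by (simp add: Q_def)
   show "tree N n (\<sigma> s)" using S(3) s(1) by blast
   fix P \<alpha> assume P: "P \<in> \<sigma> s" "\<alpha> \<in> mbox n \<tau>" "sum_list \<alpha> < b - es s"
   have "taylor \<tau> (s # P) c (es s # \<alpha>) = 0"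
    by (rule Suc.prems(3)) (use P S(4) s(1) es[of s] in \<open>auto simp: mbox_def Q_def\<close>)
   then show "taylor \<tau> P (C s (es s)) \<alpha> = 0" by (simp add: C_def[abs_def])
  qed
  moreover have "N * b \<le> N * (b - es s) + N * es s" unfolding distrib_left[symmetric] by (intro mult_le_mono2) simp
  ultimately show ?thesis using s(2) by simp
 qed simp
qed

section \<open>Simple extensions of subrings of a field\<close>

definition polys :: "'a::field set \<Rightarrow> 'a poly set" where
 "polys A = {p. \<forall>i. coeff p i \<in> A}"

definition adj :: "'a::field set \<Rightarrow> 'a \<Rightarrow> 'a set" where
 "adj A y = (\<lambda>p. poly p y) ` polys A"

definition trans_over :: "'a::field set \<Rightarrow> 'a \<Rightarrow> bool" where
 "trans_over A y \<longleftrightarrow> (\<forall>p\<in>polys A. poly p y = 0 \<longrightarrow> p = 0)"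

lemma polys_closed:
 assumes A: "subring1 A"
 shows "0 \<in> polys A" "p \<in> polys A ==> q \<in> polys A ==> p + q \<in> polys A"
  "p \<in> polys A ==> q \<in> polys A ==> p - q \<in> polys A"
  "p \<in> polys A ==> q \<in> polys A ==> p * q \<in> polys A"
  "c \<in> A ==> p \<in> polys A ==> smult c p \<in> polys A" "c \<in> A ==> monom c n \<in> polys A"
  "c \<in> A ==> [:c:] \<in> polys A" "p \<in> polys A ==> pderiv p \<in> polys A" "[:0, 1:] \<in> polys A"
  "p \<in> polys A ==> coeff p i \<in> A"
 using subring1D[OF A] unfolding polys_def
 by (auto simp: coeff_mult coeff_pderiv coeff_pCons split: nat.split
   simp del: of_nat_Suc intro!: subring1D(8)[OF A] subring1D(6)[OF A])

lemma adj_ring: assumes A: "subring1 A" shows "subring1 (adj A y)"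
 unfolding subring1_def
proof (intro conjI ballI)
 have "1 = poly [:1:] y" by simp
 then show "1 \<in> adj A y" unfolding adj_def using polys_closed(7)[OF A subring1D(2)[OF A]] by blast
 fix u v assume "u \<in> adj A y" "v \<in> adj A y"
 then obtain p q where pq: "u = poly p y" "v = poly q y" "p \<in> polys A" "q \<in> polys A" unfolding adj_def by blast
 have "u - v = poly (p - q) y" "u * v = poly (p * q) y" using pq by simp_all
 then show "u - v \<in> adj A y" "u * v \<in> adj A y"
  unfolding adj_def using polys_closed(3,4)[OF A pq(3,4)] by blast+
qed

lemma adj_base: "subring1 A ==> x \<in> A ==> x \<in> adj A y"
 unfolding adj_def using polys_closed(7)[of A x] by (intro image_eqI[of _ _ "[:x:]"]) auto

lemma adj_gen: "subring1 A ==> y \<in> adj A y"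
 unfolding adj_def using polys_closed(9)[of A] by (intro image_eqI[of _ _ "[:0, 1:]"]) auto

text \<open>Division with remainder over a ring: each step multiplies by the leading coefficient of
  \<open>H\<close> instead of dividing by it.\<close>

lemma pseudo_division:
 assumes A: "subring1 A" and H: "H \<in> polys A" "H \<noteq> 0"
 shows "p \<in> polys A ==> \<exists>k Q R. Q \<in> polys A \<and> R \<in> polys A \<and>
  smult (lead_coeff H ^ k) p = H * Q + R \<and> (R = 0 \<or> degree R < degree H)"
proof (induction "degree p" arbitrary: p rule: less_induct)
 case less
 let ?h = "lead_coeff H"
 have h: "?h \<in> A" "?h \<noteq> 0" using H polys_closed(10)[OF A] by auto
 show ?case
 proof (cases "p = 0 \<or> degree p < degree H")
  case True
  then show ?thesis using less.prems polys_closed(1)[OF A]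
   by (intro exI[of _ 0] exI[of _ "0 :: 'a poly"] exI[of _ p]) auto
 next
  case False
  then have p: "p \<noteq> 0" "degree H \<le> degree p" by auto
  define q where "q = monom (lead_coeff p) (degree p - degree H)"
  define p' where "p' = smult ?h p - H * q"
  have q: "q \<in> polys A" unfolding q_def by (intro polys_closed(6)[OF A] polys_closed(10)[OF A] less.prems)
  have p': "p' \<in> polys A" unfolding p'_def by (intro polys_closed[OF A] h H q less.prems)
  have lq: "lead_coeff q = lead_coeff p" "degree q = degree p - degree H"
   using p(1) by (simp_all add: q_def degree_monom_eq)
  have dHq: "degree (H * q) = degree p" using H p lq by (simp add: degree_mult_eq q_def)
  have "coeff p' (degree p) = 0"
   using lead_coeff_mult[of H q] lq dHq by (simp add: p'_def)
  moreover have "degree p' \<le> degree p" unfolding p'_def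
   by (intro degree_diff_le degree_smult_le[THEN le_trans] order.refl) (simp add: dHq)
  ultimately have d: "p' = 0 \<or> degree p' < degree p" by (metis leading_coeff_0_iff le_neq_implies_less)
  have "\<exists>k Q R. Q \<in> polys A \<and> R \<in> polys A \<and> smult (?h ^ k) p' = H * Q + R \<and> (R = 0 \<or> degree R < degree H)"
  proof (cases "p' = 0")
   case True
   then show ?thesis using polys_closed(1)[OF A] by (intro exI[of _ 0] exI[of _ "0 :: 'a poly"]) auto
  next
   case False
   then show ?thesis using less.hyps[of p'] d p' by blast
  qed
  then obtain k Q R where kQR: "Q \<in> polys A" "R \<in> polys A" "smult (?h ^ k) p' = H * Q + R" "R = 0 \<or> degree R < degree H" by blast
  have "smult (?h ^ Suc k) p = smult (?h ^ k) (p' + H * q)" by (simp add: p'_def mult.commute)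
  also have "\<dots> = H * (Q + smult (?h ^ k) q) + R" by (simp add: smult_add_right kQR(3) algebra_simps)
  finally show ?thesis
   using kQR h by (intro exI[of _ "Suc k"] exI[of _ "Q + smult (?h ^ k) q"] exI[of _ R])
    (auto intro!: polys_closed[OF A] q subring1D(7)[OF A])
 qed
qed

text \<open>\<open>H\<close> plays the part of a minimal polynomial over the fraction field of
  \<open>A\<close>, with denominators cleared. Its leading coefficient may be a nonunit, so powers
  of it accompany every division.\<close>

locale algebraic_over =
 fixes A :: "'a::field set" and y :: 'a and H :: "'a poly"
 assumes A: "subring1 A" and H: "H \<in> polys A" "H \<noteq> 0" "poly H y = 0"
  and min: "\<And>p. p \<in> polys A ==> p \<noteq> 0 ==> poly p y = 0 ==> degree H \<le> degree p"
begin

abbreviation "h \<equiv> lead_coeff H"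

lemma h: "h \<in> A" "h \<noteq> 0"
 using H polys_closed(10)[OF A] by auto

lemma deg: "degree H > 0"
proof (rule ccontr)
 assume "\<not> ?thesis"
 then obtain c where "H = [:c:]" by (metis degree_eq_zeroE not_gr_zero)
 then show False using H by simp
qed

lemma annihilator: assumes p: "p \<in> polys A" "poly p y = 0"
 obtains k Q where "Q \<in> polys A" "smult (h ^ k) p = H * Q"
proof -
 obtain k Q R where kQR: "Q \<in> polys A" "R \<in> polys A" "smult (h ^ k) p = H * Q + R" "R = 0 \<or> degree R < degree H"
  using pseudo_division[OF A H(1,2) p(1)] by blast
 have "poly R y = 0" using arg_cong[OF kQR(3), of "\<lambda>p. poly p y"] p(2) H(3) by simp
 then have "R = 0" using min[OF kQR(2)] kQR(4) by fastforce
 then show thesis using that kQR by simp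
qed

text \<open>In characteristic 0 the derivative is nonzero and of smaller degree, so the minimality
  of \<open>H\<close> forbids that it vanishes at \<open>y\<close>.\<close>

lemma separable: assumes "\<And>n. n > 0 ==> (of_nat n :: 'a) \<noteq> 0" shows "poly (pderiv H) y \<noteq> 0"
proof
 assume z: "poly (pderiv H) y = 0"
 obtain m where m: "degree H = Suc m" using deg gr0_implies_Suc by blast
 have "coeff (pderiv H) m \<noteq> 0" using assms[of "Suc m"] h(2) m by (simp add: coeff_pderiv)
 then have "pderiv H \<noteq> 0" by auto
 then have "degree H \<le> degree (pderiv H)" using min[OF polys_closed(8)[OF A H(1)] _ z] by blast
 moreover have "degree (pderiv H) < degree H"
 proof -
  have "coeff (pderiv H) i = 0" if "i > m" for i using that m by (simp add: coeff_pderiv coeff_eq_0)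
  then have "degree (pderiv H) \<le> m" by (intro degree_le) auto
  then show ?thesis using m by simp
 qed
 ultimately show False by simp
qed

text \<open>Take a polynomial of minimal degree among those whose value at \<open>y\<close> is a nonzero multiple of \<open>g\<close>.\<close>

lemma multiple_in_base:
 assumes g: "g \<in> adj A y" "g \<noteq> 0"
 shows "\<exists>c\<in>A. c \<noteq> 0 \<and> (\<exists>u\<in>adj A y. c = g * u)"
proof -
 let ?P = "\<lambda>q. q \<in> polys A \<and> poly q y \<noteq> 0 \<and> (\<exists>u\<in>adj A y. poly q y = g * u)"
 obtain p where p: "p \<in> polys A" "g = poly p y" using g(1) unfolding adj_def by blast
 note R = subring1D[OF adj_ring[OF A]]
 have p1: "?P p" using p g(2) R(2) by (auto intro!: bexI[of _ 1])
 obtain q where q: "?P q" "\<And>q'. ?P q' ==> degree q \<le> degree q'"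
  using ex_has_least_nat[of ?P p degree] p1 by blast
 then obtain u where u: "q \<in> polys A" "poly q y \<noteq> 0" "u \<in> adj A y" "poly q y = g * u" by blast
 have q0: "q \<noteq> 0" using u(2) by auto
 have "degree q = 0"
 proof (rule ccontr)
  assume dq: "degree q \<noteq> 0"
  obtain k Q S where pd: "Q \<in> polys A" "S \<in> polys A" "smult (h ^ k) q = H * Q + S" "S = 0 \<or> degree S < degree H"
   using pseudo_division[OF A H(1,2) u(1)] by blast
  have "poly S y = h ^ k * poly q y" using arg_cong[OF pd(3), of "\<lambda>p. poly p y"] H(3) by simp
  then have "?P S" using u h pd(2) R adj_base[OF A h(1)]
   by (auto intro!: bexI[of _ "h ^ k * u"])
  then have "degree q < degree H" using q(2)[of S] pd(4) by fastforce
  \<comment> \<open>Dividing \<open>H\<close> by \<open>q\<close> leaves a remainder whose value is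
    again a multiple of \<open>g\<close>, so the minimality of \<open>q\<close> forces it to vanish.
    Then the cofactor \<open>Q\<close> annihilates \<open>y\<close> and has smaller degree than
    \<open>H\<close>, a contradiction.\<close>
  obtain k Q S where pd: "Q \<in> polys A" "S \<in> polys A" "smult (lead_coeff q ^ k) H = q * Q + S" "S = 0 \<or> degree S < degree q"
   using pseudo_division[OF A u(1) q0 H(1)] by blast
  have Qy: "poly Q y \<in> adj A y" using pd(1) unfolding adj_def by blast
  have Sy: "poly S y = g * (- (u * poly Q y))"
   using arg_cong[OF pd(3), of "\<lambda>p. poly p y"] H(3) u(4) by (simp add: eq_neg_iff_add_eq_0 add.commute mult.assoc)
  have "poly S y = 0"
  proof (rule ccontr)
   assume "poly S y \<noteq> 0"
   then have "?P S" using Sy pd(2) R(3)[OF R(6)[OF u(3) Qy]] by blast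
   moreover have "S \<noteq> 0" using \<open>poly S y \<noteq> 0\<close> by auto
   ultimately show False using q(2)[of S] pd(4) by fastforce
  qed
  then have "S = 0" using min[OF pd(2)] pd(4) \<open>degree q < degree H\<close> by fastforce
  then have e: "smult (lead_coeff q ^ k) H = q * Q" using pd(3) by simp
  have nz: "lead_coeff q ^ k \<noteq> 0" using q0 by simp
  then have Q0: "Q \<noteq> 0" using e H(2) by (metis mult_zero_right smult_eq_0_iff)
  have "poly q y * poly Q y = 0" using arg_cong[OF e, of "\<lambda>p. poly p y"] H(3) by simp
  then have "degree H \<le> degree Q" using min[OF pd(1) Q0] u(2) by simp
  moreover have "degree H = degree q + degree Q"
   using arg_cong[OF e, of degree] nz q0 Q0 by (simp add: degree_mult_eq)
  ultimately show False using dq by simp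
 qed
 then obtain c where c: "q = [:c:]" by (metis degree_eq_zeroE)
 have "c \<in> A" using polys_closed(10)[OF A u(1), of 0] c by simp
 moreover have "c \<noteq> 0" "c = g * u" using u(2,4) c by auto
 ultimately show ?thesis using u(3) by blast
qed

end

lemma algebraic_over_exists:
 assumes A: "subring1 A" and y: "\<not> trans_over A y" shows "\<exists>H. algebraic_over A y H"
proof -
 let ?P = "\<lambda>H. H \<in> polys A \<and> H \<noteq> 0 \<and> poly H y = 0"
 obtain p where "?P p" using y unfolding trans_over_def by blast
 then obtain H where "?P H" "\<And>q. ?P q ==> degree H \<le> degree q" using ex_has_least_nat[of ?P p degree] by blast
 then show ?thesis using A by (intro exI[of _ H]) (unfold_locales, auto)
qed

subsection \<open>Extension of derivations\<close>

definition der_on :: "'a::field set \<Rightarrow> ('a \<Rightarrow> 'a) \<Rightarrow> bool" where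
 "der_on A \<delta> \<longleftrightarrow> (\<forall>x\<in>A. \<forall>y\<in>A. \<delta> (x + y) = \<delta> x + \<delta> y \<and> \<delta> (x * y) = x * \<delta> y + y * \<delta> x)"

lemma der_on_facts:
 assumes A: "subring1 A" and d: "der_on A \<delta>"
 shows "\<delta> 0 = 0" "\<delta> 1 = 0" "(\<And>i. i \<in> S ==> f i \<in> A) ==> \<delta> (sum f S) = (\<Sum>i\<in>S. \<delta> (f i))"
  "x \<in> A ==> \<delta> (- x) = - \<delta> x"
proof -
 have a: "\<delta> (x + y) = \<delta> x + \<delta> y" and m: "\<delta> (x * y) = x * \<delta> y + y * \<delta> x" if "x \<in> A" "y \<in> A" for x y
  using d that unfolding der_on_def by auto
 note R = subring1D[OF A]
 show z: "\<delta> 0 = 0" using m[OF R(1) R(1)] by simp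
 have "\<delta> 1 + \<delta> 1 = \<delta> 1 + 0" using m[OF R(2) R(2)] by simp
 then show "\<delta> 1 = 0" by (rule add_left_imp_eq)
 show "\<delta> (sum f S) = (\<Sum>i\<in>S. \<delta> (f i))" if "\<And>i. i \<in> S ==> f i \<in> A"
  using that by (induction S rule: infinite_finite_induct) (simp_all add: z a R(8))
 show "\<delta> (- x) = - \<delta> x" if "x \<in> A" using a[OF that R(3)[OF that]] z by (simp add: eq_neg_iff_add_eq_0 add.commute)
qed

text \<open>The extension must send \<open>p(y)\<close> to \<open>W u p\<close>, the value of the
  differentiated coefficients plus \<open>p'(y) u\<close>. This is well defined if
  \<open>W u\<close> kills the polynomials annihilating \<open>y\<close>: no condition on
  \<open>u\<close> when \<open>y\<close> is transcendental, and otherwise one linear equation,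
  solvable because \<open>H'(y)\<close> is nonzero.\<close>

lemma der_extend:
 assumes A: "subring1 A" and d: "der_on A \<delta>" and char0: "\<And>n. n > 0 ==> (of_nat n :: 'a::field) \<noteq> 0"
 shows "\<exists>\<delta>'. der_on (adj A y) \<delta>' \<and> (\<forall>x\<in>A. \<delta>' x = \<delta> x) \<and> (trans_over A y \<longrightarrow> \<delta>' (y::'a) = u0)"
proof -
 note z = der_on_facts(1)[OF A d]
 have da: "\<delta> (x + w) = \<delta> x + \<delta> w" and dm: "\<delta> (x * w) = x * \<delta> w + w * \<delta> x" if "x \<in> A" "w \<in> A" for x w
  using d that unfolding der_on_def by auto
 have cA: "coeff p i \<in> A" if "p \<in> polys A" for p i using polys_closed(10)[OF A that] .
 have ma: "map_poly \<delta> (p + q) = map_poly \<delta> p + map_poly \<delta> q" if "p \<in> polys A" "q \<in> polys A" for p q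
  by (rule poly_eqI) (simp add: coeff_map_poly z da cA that)
 have mm: "map_poly \<delta> (p * q) = p * map_poly \<delta> q + q * map_poly \<delta> p" if pq: "p \<in> polys A" "q \<in> polys A" for p q
 proof (rule poly_eqI)
  fix n
  have 1: "\<delta> (coeff (p * q) n) = (\<Sum>i\<le>n. \<delta> (coeff p i * coeff q (n - i)))"
   unfolding coeff_mult by (rule der_on_facts(3)[OF A d]) (simp add: subring1D(6)[OF A] cA pq)
  have 2: "(\<Sum>i\<le>n. coeff p i * \<delta> (coeff q (n - i))) = coeff (p * map_poly \<delta> q) n"
   by (simp add: coeff_mult coeff_map_poly z)
  have 3: "(\<Sum>i\<le>n. coeff q (n - i) * \<delta> (coeff p i)) = coeff (q * map_poly \<delta> p) n"
   unfolding mult.commute[of q] coeff_mult by (intro sum.cong refl) (simp add: coeff_map_poly z mult.commute)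
  show "coeff (map_poly \<delta> (p * q)) n = coeff (p * map_poly \<delta> q + q * map_poly \<delta> p) n"
   by (simp add: coeff_map_poly z 1 dm cA pq sum.distrib 2 3)
 qed
 define W where "W u p = poly (map_poly \<delta> p) y + poly (pderiv p) y * u" for u p
 have Wa: "W u (p + q) = W u p + W u q" if "p \<in> polys A" "q \<in> polys A" for u p q
  by (simp add: W_def ma[OF that] pderiv_add algebra_simps)
 have Wm: "W u (p * q) = poly p y * W u q + poly q y * W u p" if "p \<in> polys A" "q \<in> polys A" for u p q
  by (simp add: W_def mm[OF that] pderiv_mult algebra_simps)
 have Wc: "W u [:c:] = \<delta> c" for u c
  by (cases "c = 0") (simp_all add: W_def map_poly_pCons z)
 have Wy: "W u [:0, 1:] = u" for u
  by (simp add: W_def map_poly_pCons z der_on_facts(2)[OF A d] pderiv_pCons)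
 have "\<exists>u. (\<forall>p\<in>polys A. poly p y = 0 \<longrightarrow> W u p = 0) \<and> (trans_over A y \<longrightarrow> u = u0)"
 proof (cases "trans_over A y")
  case True
  then have "W u0 p = 0" if "p \<in> polys A" "poly p y = 0" for p
   using that Wc[of u0 0] z unfolding trans_over_def by auto
  then show ?thesis by blast
 next
  case False
  then obtain H where "algebraic_over A y H" using algebraic_over_exists[OF A] by blast
  then interpret algebraic_over A y H .
  note sep = separable[OF char0]
  define u where "u = - poly (map_poly \<delta> H) y / poly (pderiv H) y"
  have WH: "W u H = 0" using sep by (simp add: W_def u_def)
  have "W u p = 0" if p: "p \<in> polys A" "poly p y = 0" for p
  proof -
   obtain k Q where Q: "Q \<in> polys A" "smult (h ^ k) p = H * Q" using annihilator[OF p] .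
   have hk: "h ^ k \<in> A" by (rule subring1D(7)[OF A h(1)])
   have "W u ([:h ^ k:] * p) = W u (H * Q)" using Q(2) by simp
   then have "h ^ k * W u p = 0"
    unfolding Wm[OF polys_closed(7)[OF A hk] p(1)] Wm[OF H(1) Q(1)] using WH H(3) p(2) by simp
   then show ?thesis using h(2) by simp
  qed
  then show ?thesis using False by blast
 qed
 then obtain u where u: "\<And>p. p \<in> polys A ==> poly p y = 0 ==> W u p = 0" "trans_over A y ==> u = u0" by blast
 define \<delta>' where "\<delta>' x = W u (SOME p. p \<in> polys A \<and> poly p y = x)" for x
 have D: "\<delta>' (poly p y) = W u p" if p: "p \<in> polys A" for p
 proof -
  define q where "q = (SOME q. q \<in> polys A \<and> poly q y = poly p y)"
  have q: "q \<in> polys A \<and> poly q y = poly p y" unfolding q_def by (rule someI[of _ p]) (simp add: p)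
  have pq: "p - q \<in> polys A" using polys_closed(3)[OF A p] q by blast
  have "W u (p - q) = 0" using u(1)[OF pq] q by simp
  moreover have "W u p = W u (p - q) + W u q" using Wa[OF pq, of q u] q by simp
  ultimately show ?thesis by (simp add: \<delta>'_def q_def)
 qed
 have "der_on (adj A y) \<delta>'"
  unfolding der_on_def
 proof (intro ballI)
  fix x w assume "x \<in> adj A y" "w \<in> adj A y"
  then obtain p q where pq: "p \<in> polys A" "q \<in> polys A" "x = poly p y" "w = poly q y" unfolding adj_def by blast
  have "x + w = poly (p + q) y" "x * w = poly (p * q) y" using pq by simp_all
  then show "\<delta>' (x + w) = \<delta>' x + \<delta>' w \<and> \<delta>' (x * w) = x * \<delta>' w + w * \<delta>' x"
   using D[OF polys_closed(2)[OF A pq(1,2)]] D[OF polys_closed(4)[OF A pq(1,2)]] D[OF pq(1)] D[OF pq(2)]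
   by (simp only: Wa[OF pq(1,2)] Wm[OF pq(1,2)] pq(3,4))
 qed
 moreover have "\<delta>' x = \<delta> x" if "x \<in> A" for x using D[OF polys_closed(7)[OF A that]] by (simp add: Wc)
 moreover have "\<delta>' y = u" using D[OF polys_closed(9)[OF A]] by (simp add: Wy)
 ultimately show ?thesis using u(2) by blast
qed

subsection \<open>Extension of homomorphisms\<close>

definition hom_on :: "'a::field set \<Rightarrow> ('a \<Rightarrow> complex) \<Rightarrow> bool" where
 "hom_on A \<phi> \<longleftrightarrow> \<phi> 1 = 1 \<and> (\<forall>x\<in>A. \<forall>y\<in>A. \<phi> (x + y) = \<phi> x + \<phi> y \<and> \<phi> (x * y) = \<phi> x * \<phi> y)"

lemma hom_on_facts:
 assumes A: "subring1 A" and f: "hom_on A \<phi>"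
 shows "\<phi> 0 = 0" "\<phi> 1 = 1" "x \<in> A ==> y \<in> A ==> \<phi> (x + y) = \<phi> x + \<phi> y" "x \<in> A ==> y \<in> A ==> \<phi> (x * y) = \<phi> x * \<phi> y"
  "(\<And>i. i \<in> S ==> f i \<in> A) ==> \<phi> (sum f S) = (\<Sum>i\<in>S. \<phi> (f i))" "x \<in> A ==> \<phi> (x ^ n) = \<phi> x ^ n"
proof -
 show 1: "\<phi> 1 = 1" and a: "x \<in> A ==> y \<in> A ==> \<phi> (x + y) = \<phi> x + \<phi> y"
  and m: "x \<in> A ==> y \<in> A ==> \<phi> (x * y) = \<phi> x * \<phi> y" for x y
  using f unfolding hom_on_def by auto
 note R = subring1D[OF A]
 show z: "\<phi> 0 = 0" using a[OF R(1) R(1)] by simp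
 show "\<phi> (sum f S) = (\<Sum>i\<in>S. \<phi> (f i))" if "\<And>i. i \<in> S ==> f i \<in> A"
  using that by (induction S rule: infinite_finite_induct) (simp_all add: z a R(8))
 show "\<phi> (x ^ n) = \<phi> x ^ n" if "x \<in> A" using that by (induction n) (simp_all add: 1 m R(7))
qed

lemma map_poly_hom:
 assumes A: "subring1 A" and f: "hom_on A \<phi>" and p: "p \<in> polys A" and q: "q \<in> polys A"
 shows "map_poly \<phi> (p + q) = map_poly \<phi> p + map_poly \<phi> q" "map_poly \<phi> (p * q) = map_poly \<phi> p * map_poly \<phi> q"
proof -
 note F = hom_on_facts[OF A f]
 have c: "coeff p i \<in> A" "coeff q i \<in> A" for i using polys_closed(10)[OF A] p q by auto
 show "map_poly \<phi> (p + q) = map_poly \<phi> p + map_poly \<phi> q"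
  by (rule poly_eqI) (simp add: coeff_map_poly F c)
 show "map_poly \<phi> (p * q) = map_poly \<phi> p * map_poly \<phi> q"
 proof (rule poly_eqI)
  fix n
  have "\<phi> (coeff (p * q) n) = (\<Sum>i\<le>n. \<phi> (coeff p i * coeff q (n - i)))"
   unfolding coeff_mult by (rule F(5)) (simp add: subring1D(6)[OF A] c)
  also have "\<dots> = coeff (map_poly \<phi> p * map_poly \<phi> q) n"
   by (simp add: coeff_mult coeff_map_poly F(1) F(4)[OF c])
  finally show "coeff (map_poly \<phi> (p * q)) n = coeff (map_poly \<phi> p * map_poly \<phi> q) n"
   by (simp add: coeff_map_poly F(1))
 qed
qed

text \<open>A polynomial in \<open>y\<close> is sent to the value at \<open>c\<close> of its image
  under \<open>\<phi>\<close>; the condition on \<open>c\<close> makes this independent of the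
  polynomial.\<close>

lemma hom_extend:
 assumes A: "subring1 A" and f: "hom_on A \<phi>"
  and c: "\<And>p. p \<in> polys A ==> poly p y = 0 ==> poly (map_poly \<phi> p) c = 0"
 obtains \<phi>' where "hom_on (adj A y) \<phi>'" "\<And>x. x \<in> A ==> \<phi>' x = \<phi> x" "\<phi>' y = c"
  "\<And>p. p \<in> polys A ==> \<phi>' (poly p y) = poly (map_poly \<phi> p) c"
proof -
 note F = hom_on_facts[OF A f]
 define \<phi>' where "\<phi>' x = poly (map_poly \<phi> (SOME p. p \<in> polys A \<and> poly p y = x)) c" for x
 have D: "\<phi>' (poly p y) = poly (map_poly \<phi> p) c" if p: "p \<in> polys A" for p
 proof -
  define q where "q = (SOME q. q \<in> polys A \<and> poly q y = poly p y)"
  have q: "q \<in> polys A \<and> poly q y = poly p y" unfolding q_def by (rule someI[of _ p]) (simp add: p)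
  have pq: "p - q \<in> polys A" using polys_closed(3)[OF A p] q by blast
  have "poly (map_poly \<phi> (p - q)) c = 0" using c[OF pq] q by simp
  moreover have "map_poly \<phi> p = map_poly \<phi> (p - q) + map_poly \<phi> q" using map_poly_hom(1)[OF A f pq, of q] q by simp
  ultimately show ?thesis by (simp add: \<phi>'_def q_def)
 qed
 have c0: "\<phi>' x = \<phi> x" if "x \<in> A" for x
  using D[OF polys_closed(7)[OF A that]] by (cases "x = 0") (simp_all add: map_poly_pCons F(1))
 show thesis
 proof (rule that[of \<phi>'])
  show "hom_on (adj A y) \<phi>'"
   unfolding hom_on_def
  proof (intro conjI ballI)
   show "\<phi>' 1 = 1" using c0[OF subring1D(2)[OF A]] F(2) by simp
   fix x w assume "x \<in> adj A y" "w \<in> adj A y"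
   then obtain p q where pq: "p \<in> polys A" "q \<in> polys A" "x = poly p y" "w = poly q y" unfolding adj_def by blast
   have e: "x + w = poly (p + q) y" "x * w = poly (p * q) y" using pq by simp_all
   show "\<phi>' (x + w) = \<phi>' x + \<phi>' w" "\<phi>' (x * w) = \<phi>' x * \<phi>' w"
    unfolding e D[OF polys_closed(2)[OF A pq(1,2)]] D[OF polys_closed(4)[OF A pq(1,2)]]
     map_poly_hom[OF A f pq(1,2)] by (simp_all add: pq D)
  qed
  show "\<phi>' y = c" using D[OF polys_closed(9)[OF A]] by (simp add: map_poly_pCons F)
 qed (use c0 D in auto)
qed

text \<open>With \<open>g = p(y)\<close>, the bad values \<open>c\<close> are roots of the image of
  \<open>p\<close>, which is nonzero as soon as the leading coefficient \<open>g'\<close>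
  survives.\<close>

lemma hom_lift_trans:
 assumes A: "subring1 A" and y: "trans_over A y" and g: "g \<in> adj A y" "g \<noteq> 0"
 shows "\<exists>g'\<in>A. g' \<noteq> 0 \<and> (\<forall>\<phi>. hom_on A \<phi> \<and> \<phi> g' \<noteq> 0 \<longrightarrow> finite {c. \<not> (\<exists>\<phi>'. hom_on (adj A y) \<phi>' \<and>
  (\<forall>x\<in>A. \<phi>' x = \<phi> x) \<and> \<phi>' y = c \<and> \<phi>' g \<noteq> 0)})"
proof -
 obtain p where p: "p \<in> polys A" "g = poly p y" using g(1) unfolding adj_def by blast
 then have p0: "p \<noteq> 0" using g(2) by auto
 show ?thesis
 proof (intro bexI[of _ "lead_coeff p"] conjI allI impI)
  show "lead_coeff p \<noteq> 0" using p0 by simp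
  show "lead_coeff p \<in> A" using polys_closed(10)[OF A p(1)] .
  fix \<phi> assume f: "hom_on A \<phi> \<and> \<phi> (lead_coeff p) \<noteq> 0"
  then have fA: "hom_on A \<phi>" by blast
  note F = hom_on_facts[OF A fA]
  have "coeff (map_poly \<phi> p) (degree p) \<noteq> 0" using f by (simp add: coeff_map_poly F(1))
  then have "map_poly \<phi> p \<noteq> 0" by auto
  moreover have "\<exists>\<phi>'. hom_on (adj A y) \<phi>' \<and> (\<forall>x\<in>A. \<phi>' x = \<phi> x) \<and> \<phi>' y = c \<and> \<phi>' g \<noteq> 0"
   if c: "poly (map_poly \<phi> p) c \<noteq> 0" for c
  proof -
   have *: "poly (map_poly \<phi> q) c = 0" if "q \<in> polys A" "poly q y = 0" for q
    using y that unfolding trans_over_def by auto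
   obtain \<phi>' where "hom_on (adj A y) \<phi>'" "\<And>x. x \<in> A ==> \<phi>' x = \<phi> x" "\<phi>' y = c"
    "\<And>p. p \<in> polys A ==> \<phi>' (poly p y) = poly (map_poly \<phi> p) c" using hom_extend[OF A fA *] by metis
   then show ?thesis using p c by auto
  qed
  ultimately show "finite {c. \<not> (\<exists>\<phi>'. hom_on (adj A y) \<phi>' \<and> (\<forall>x\<in>A. \<phi>' x = \<phi> x) \<and> \<phi>' y = c \<and> \<phi>' g \<noteq> 0)}"
   by (intro finite_subset[OF _ poly_roots_finite[of "map_poly \<phi> p"]]) auto
 qed
qed

text \<open>\<open>g' = h * c\<close> with \<open>c\<close> a multiple of \<open>g\<close> in
  \<open>A\<close>. If \<open>h\<close> survives, the image of \<open>H\<close> has a root to which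
  \<open>y\<close> can be sent; if \<open>c\<close> survives, so does its factor
  \<open>g\<close>.\<close>

lemma hom_lift_algebraic:
 assumes A: "subring1 A" and y: "\<not> trans_over A y" and g: "g \<in> adj A y" "g \<noteq> 0"
 shows "\<exists>g'\<in>A. g' \<noteq> 0 \<and> (\<forall>\<phi>. hom_on A \<phi> \<and> \<phi> g' \<noteq> 0 \<longrightarrow> (\<exists>\<phi>'. hom_on (adj A y) \<phi>' \<and>
  (\<forall>x\<in>A. \<phi>' x = \<phi> x) \<and> \<phi>' g \<noteq> 0))"
proof -
 obtain H where "algebraic_over A y H" using algebraic_over_exists[OF A y] by blast
 then interpret algebraic_over A y H .
 obtain c u where c: "c \<in> A" "c \<noteq> 0" "u \<in> adj A y" "c = g * u" using multiple_in_base[OF g] by blast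
 show ?thesis
 proof (intro bexI[of _ "h * c"] conjI allI impI)
  show "h * c \<noteq> 0" using h c by simp
  show "h * c \<in> A" using subring1D(6)[OF A h(1) c(1)] .
  fix \<phi> assume f: "hom_on A \<phi> \<and> \<phi> (h * c) \<noteq> 0"
  then have fA: "hom_on A \<phi>" by blast
  note F = hom_on_facts[OF A fA]
  have fh: "\<phi> h \<noteq> 0" "\<phi> c \<noteq> 0" using f F(4)[OF h(1) c(1)] by auto
  then have "coeff (map_poly \<phi> H) (degree H) \<noteq> 0" by (simp add: coeff_map_poly F(1))
  then have "degree (map_poly \<phi> H) \<noteq> 0" using deg le_degree by fastforce
  then obtain r where r: "poly (map_poly \<phi> H) r = 0"
   using fundamental_theorem_of_algebra[of "map_poly \<phi> H"] by (auto simp: constant_degree)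
  have *: "poly (map_poly \<phi> q) r = 0" if q: "q \<in> polys A" "poly q y = 0" for q
  proof -
   obtain k Q where Q: "Q \<in> polys A" "smult (h ^ k) q = H * Q" using annihilator[OF q] .
   have hk: "h ^ k \<in> A" by (rule subring1D(7)[OF A h(1)])
   have "map_poly \<phi> ([:h ^ k:] * q) = map_poly \<phi> (H * Q)" using Q(2) by simp
   then have "map_poly \<phi> [:h ^ k:] * map_poly \<phi> q = map_poly \<phi> H * map_poly \<phi> Q"
    unfolding map_poly_hom(2)[OF A fA polys_closed(7)[OF A hk] q(1)] map_poly_hom(2)[OF A fA H(1) Q(1)] .
   from arg_cong[OF this, of "\<lambda>p. poly p r"] show ?thesis
    using r fh h by (simp add: map_poly_pCons F(1) F(6)[OF h(1)])
  qed
  obtain \<phi>' where f': "hom_on (adj A y) \<phi>'" "\<And>x. x \<in> A ==> \<phi>' x = \<phi> x" "\<phi>' y = r"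
   "\<And>p. p \<in> polys A ==> \<phi>' (poly p y) = poly (map_poly \<phi> p) r" using hom_extend[OF A fA *] by metis
  have "\<phi>' g * \<phi>' u = \<phi> c"
   using hom_on_facts(4)[OF adj_ring[OF A] f'(1) g(1) c(3)] f'(2)[OF c(1)] c(4) by simp
  then have "\<phi>' g \<noteq> 0" using fh by auto
  then show "\<exists>\<phi>'. hom_on (adj A y) \<phi>' \<and> (\<forall>x\<in>A. \<phi>' x = \<phi> x) \<and> \<phi>' g \<noteq> 0" using f' by blast
 qed
qed

section \<open>The tower of coordinate rings\<close>

locale chart = pmodel sc s M Pts a Ov D0
 for sc :: "complex \<Rightarrow> 'k::field" and s M Pts a Ov D0 +
 fixes j0 :: nat
 assumes sj0: "s j0 \<noteq> 0"
begin

definition z :: "nat \<Rightarrow> 'k" where "z i = s i / s j0"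

text \<open>The affine coordinates are adjoined one at a time, so that derivations and homomorphisms
  extend through simple extensions; \<open>AA (Suc M)\<close> is the coordinate ring of the
  chart.\<close>

primrec AA :: "nat \<Rightarrow> 'k set" where
 "AA 0 = range sc"
| "AA (Suc j) = adj (AA j) (z j)"

text \<open>The indices \<open>i\<close> with \<open>tr i\<close> form a transcendence basis, chosen greedily.\<close>

definition tr :: "nat \<Rightarrow> bool" where "tr i \<longleftrightarrow> trans_over (AA i) (z i)"

definition idx :: "nat list" where "idx = filter tr [0..<Suc M]"

definition Xs :: "'k list" where "Xs = map z idx"

lemma char0: "n > 0 ==> (of_nat n :: 'k) \<noteq> 0"
 using sc_0_iff[of "of_nat n"] sc_simps(10)[of n] by simp

lemma AA_ring: "subring1 (AA j)"
 by (induction j) (simp_all add: adj_ring subfield_subring1 subfield_range sc)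

lemma AA_mono: "i \<le> j ==> x \<in> AA i ==> x \<in> AA j"
 by (induction j rule: dec_induct) (auto simp: adj_base AA_ring)

lemma sc_AA: "sc c \<in> AA j"
 using AA_mono[of 0 j "sc c"] by simp

lemma z_AA: "i < j ==> z i \<in> AA j"
 using AA_mono[of "Suc i" j "z i"] by (simp add: adj_gen AA_ring)

lemma z_supp: "i > M ==> z i = 0"
 by (simp add: z_def s_supp)

lemma peval_AA: "peval sc z P \<in> AA (Suc M)"
proof -
 have z': "z i \<in> AA (Suc M)" for i
  using z_AA[of i "Suc M"] z_supp[of i] subring1D(1)[OF AA_ring] by (cases "i \<le> M") (auto simp del: AA.simps)
 show ?thesis
  using z' by (induction P rule: mpoly_induct)
   (simp_all add: sc E_simps sc_AA subring1D[OF AA_ring] del: AA.simps)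
qed

lemma field_eq_frac_AA: "\<exists>x\<in>AA (Suc M). \<exists>y\<in>AA (Suc M). y \<noteq> 0 \<and> f = x / y"
proof -
 obtain d F G where F: "homogeneous d F" "homogeneous d G" "E G \<noteq> 0" "f = E F / E G" using frac by blast
 have e: "E F = s j0 ^ d * peval sc z F" "E G = s j0 ^ d * peval sc z G"
  using E_dehom[OF sj0 F(1)] E_dehom[OF sj0 F(2)] by (simp_all add: z_def[abs_def])
 then have "peval sc z G \<noteq> 0" "f = peval sc z F / peval sc z G" using F(3,4) sj0 by auto
 then show ?thesis using peval_AA by blast
qed

text \<open>Derivations extend up the tower with free values at the transcendental steps, and then
  by the quotient rule to the whole field.\<close>

lemma der_exists: "\<exists>\<delta>. der \<delta> \<and> (\<forall>i\<le>M. tr i \<longrightarrow> \<delta> (z i) = v i)"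
proof -
 have "\<exists>\<delta>. der_on (AA j) \<delta> \<and> (\<forall>c. \<delta> (sc c) = 0) \<and> (\<forall>i<j. tr i \<longrightarrow> \<delta> (z i) = v i)" for j
 proof (induction j)
  case 0
  show ?case by (intro exI[of _ "\<lambda>_. 0"]) (simp add: der_on_def)
 next
  case (Suc j)
  then obtain \<delta> where d: "der_on (AA j) \<delta>" "\<forall>c. \<delta> (sc c) = 0" "\<forall>i<j. tr i \<longrightarrow> \<delta> (z i) = v i" by blast
  obtain \<delta>' where "der_on (AA (Suc j)) \<delta>'" "\<forall>x\<in>AA j. \<delta>' x = \<delta> x" "tr j \<longrightarrow> \<delta>' (z j) = v j"
   using der_extend[OF AA_ring d(1) char0, of "z j" "v j"] unfolding tr_def by auto
  then show ?case using d(2,3) sc_AA z_AA by (intro exI[of _ \<delta>']) (auto simp: less_Suc_eq)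
 qed
 then obtain \<delta> where d: "der_on (AA (Suc M)) \<delta>" "\<And>c. \<delta> (sc c) = 0" "\<And>i. i < Suc M ==> tr i ==> \<delta> (z i) = v i" by blast
 let ?A = "AA (Suc M)"
 note R = subring1D[OF AA_ring[of "Suc M"]]
 have da: "\<delta> (x + w) = \<delta> x + \<delta> w" and dm: "\<delta> (x * w) = x * \<delta> w + w * \<delta> x" if "x \<in> ?A" "w \<in> ?A" for x w
  using d(1) that unfolding der_on_def by auto
 \<comment> \<open>The quotient rule for \<open>f = (f * y) / y\<close>, with the denominator
   \<open>y\<close> kept as a parameter; \<open>Dw\<close> shows that it does not matter.\<close>
 define D where "D f y = (\<delta> (f * y) - f * \<delta> y) / y" for f y
 define P where "P f y \<longleftrightarrow> y \<in> ?A \<and> y \<noteq> 0 \<and> f * y \<in> ?A" for f y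
 have Pex: "\<exists>y. P f y" for f
  using field_eq_frac_AA[of f] unfolding P_def by (metis nonzero_eq_divide_eq)
 have Dw: "D f y = D f y'" if "P f y" "P f y'" for f y y'
 proof -
  have A: "y \<in> ?A" "y' \<in> ?A" "f * y \<in> ?A" "f * y' \<in> ?A" "y \<noteq> 0" "y' \<noteq> 0" using that by (auto simp: P_def)
  have "\<delta> ((f * y) * y') = \<delta> ((f * y') * y)" by (simp add: ac_simps)
  then have "(f * y) * \<delta> y' + y' * \<delta> (f * y) = (f * y') * \<delta> y + y * \<delta> (f * y')" using dm A by simp
  then have "y' * (\<delta> (f * y) - f * \<delta> y) = y * (\<delta> (f * y') - f * \<delta> y')" by (simp add: algebra_simps)
  then show ?thesis using A(5,6) by (simp add: D_def field_simps)
 qed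
 define \<eta> where "\<eta> f = D f (SOME y. P f y)" for f
 have eta: "\<eta> f = D f y" if "P f y" for f y
  unfolding \<eta>_def by (rule Dw[OF someI_ex[OF Pex] that])
 have etaA: "\<eta> f = \<delta> f" if "f \<in> ?A" for f
  using eta[of f 1] that R(2) der_on_facts(2)[OF AA_ring d(1)] by (simp add: P_def D_def del: AA.simps)
 have "der \<eta>"
  unfolding der_def
 proof (intro conjI allI)
  show "\<eta> (sc c) = 0" for c using etaA[OF sc_AA] d(2) by simp
  fix f g
  obtain y w where yw: "P f y" "P g w" using Pex by blast
  have A: "y \<in> ?A" "w \<in> ?A" "f * y \<in> ?A" "g * w \<in> ?A" "y \<noteq> 0" "w \<noteq> 0" using yw by (auto simp: P_def)
  have yw': "y * w \<in> ?A" "y * w \<noteq> 0" "(f * y) * w \<in> ?A" "(g * w) * y \<in> ?A" "(f * y) * (g * w) \<in> ?A"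
   using A by (auto simp: R(6) simp del: AA.simps)
  have e: "(f + g) * (y * w) = (f * y) * w + (g * w) * y" "(f * g) * (y * w) = (f * y) * (g * w)" by (simp_all add: algebra_simps)
  have P2: "P (f + g) (y * w)" "P (f * g) (y * w)"
   unfolding P_def e using yw' R(4)[OF yw'(3,4)] by (simp_all del: AA.simps)
  have e1: "\<eta> f = (\<delta> (f * y) - f * \<delta> y) / y" "\<eta> g = (\<delta> (g * w) - g * \<delta> w) / w"
   using eta[OF yw(1)] eta[OF yw(2)] by (simp_all add: D_def)
  have "\<eta> (f + g) = ((f * y) * \<delta> w + w * \<delta> (f * y) + ((g * w) * \<delta> y + y * \<delta> (g * w)) - (f + g) * (y * \<delta> w + w * \<delta> y)) / (y * w)"
   unfolding eta[OF P2(1)] D_def e(1) using da[OF yw'(3,4)] dm[OF A(3) A(2)] dm[OF A(4) A(1)] dm[OF A(1,2)] by simp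
  then show "\<eta> (f + g) = \<eta> f + \<eta> g" unfolding e1 using A(5,6) by (simp add: field_simps)
  have "\<eta> (f * g) = ((f * y) * \<delta> (g * w) + (g * w) * \<delta> (f * y) - (f * g) * (y * \<delta> w + w * \<delta> y)) / (y * w)"
   unfolding eta[OF P2(2)] D_def e(2) using dm[OF A(3,4)] dm[OF A(1,2)] by simp
  then show "\<eta> (f * g) = f * \<eta> g + g * \<eta> f" unfolding e1 using A(5,6) by (simp add: field_simps)
 qed
 moreover have "\<eta> (z i) = v i" if "i \<le> M" "tr i" for i
  using etaA[OF z_AA[of i "Suc M"]] d(3)[of i] that by simp
 ultimately show ?thesis by blast
qed

text \<open>The values \<open>\<phi> (z i)\<close> satisfy all relations between the coordinates, so
  \<open>affine_point\<close> applies.\<close>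

lemma hom_point:
 assumes f: "hom_on (AA (Suc M)) \<phi>" and c: "\<And>c. \<phi> (sc c) = c"
 obtains p where "p \<in> Pts" "a p j0 \<noteq> 0" "\<And>x. x \<in> AA (Suc M) ==> x \<in> Ov p \<and> val p x = \<phi> x"
proof -
 note F = hom_on_facts[OF AA_ring f]
 have ev: "\<phi> (peval sc z P) = ceval (\<lambda>i. \<phi> (z i)) P" for P
  by (induction P rule: mpoly_induct) (simp_all add: sc E_simps ce_simps c F(3,4)[OF peval_AA peval_AA])
 obtain p where p: "p \<in> Pts" "a p j0 \<noteq> 0"
  and pG: "\<And>d G. homogeneous d G ==> ceval (a p) G = a p j0 ^ d * ceval (\<lambda>i. \<phi> (z i)) (psubst Var G)"
 proof (rule affine_point[OF sj0, of z Var "\<lambda>i. \<phi> (z i)"])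
  show "peval sc z (Var i) = s i / s j0" for i by (simp add: sc z_def)
  show "ceval (\<lambda>i. \<phi> (z i)) P = 0" if "peval sc z P = 0" for P using ev[of P] that F(1) by simp
 qed blast
 have zO: "z i \<in> Ov p" "val p (z i) = \<phi> (z i)" for i
  using val_ratio[OF p] pG[OF homogeneous_Var(1)[of i]] p(2) by (auto simp: z_def peval_psubst)
 have "x \<in> AA j ==> j \<le> Suc M ==> x \<in> Ov p \<and> val p x = \<phi> x" for j x
 proof (induction j arbitrary: x)
  case 0
  then show ?case using c p by (auto simp: sc_in_Ov)
 next
  case (Suc j)
  then obtain q where q: "q \<in> polys (AA j)" "x = poly q (z j)" by (auto simp: adj_def)
  have co: "coeff q i \<in> AA j" for i using polys_closed(10)[OF AA_ring q(1)] .
  have IH: "coeff q i \<in> Ov p" "val p (coeff q i) = \<phi> (coeff q i)" for i using Suc.IH[OF co] Suc.prems by auto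
  have coM: "coeff q i \<in> AA (Suc M)" for i using AA_mono[OF _ co, of "Suc M"] Suc.prems(2) by (simp del: AA.simps)
  have zM: "z j \<in> AA (Suc M)" using z_AA[of j "Suc M"] Suc.prems(2) by (simp del: AA.simps)
  have t: "coeff q i * z j ^ i \<in> AA (Suc M)" for i
   by (rule subring1D(6)[OF AA_ring coM subring1D(7)[OF AA_ring zM]])
  have tO: "coeff q i * z j ^ i \<in> Ov p" for i by (rule Ov_simps(6)[OF p(1) IH(1) Ov_simps(7)[OF p(1) zO(1)]])
  have "x \<in> Ov p" unfolding q(2) poly_altdef using tO by (intro Ov_simps(8)[OF p(1)])
  moreover have "val p x = \<phi> x"
   unfolding q(2) poly_altdef val_sum[OF p(1) tO] F(5)[OF t]
   by (intro sum.cong refl) (simp add: val_ops(2)[OF p(1) IH(1) Ov_simps(7)[OF p(1) zO(1)]] val_power[OF p(1) zO(1)]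
     IH(2) zO(2) F(4)[OF coM subring1D(7)[OF AA_ring zM]] F(6)[OF zM] del: AA.simps)
  ultimately show ?case by blast
 qed
 then show thesis using that[OF p] by blast
qed

text \<open>\<open>P\<close> lists the values that the extension takes on the members of the
  transcendence basis from index \<open>j\<close> on.\<close>

definition lifts :: "'k \<Rightarrow> nat \<Rightarrow> ('k \<Rightarrow> complex) \<Rightarrow> complex list \<Rightarrow> bool" where
 "lifts g j \<phi> P \<longleftrightarrow> (\<exists>\<phi>'. hom_on (AA (Suc M)) \<phi>' \<and> (\<forall>x\<in>AA j. \<phi>' x = \<phi> x) \<and> \<phi>' g \<noteq> 0 \<and>
  map (\<lambda>i. \<phi>' (z i)) (filter tr [j..<Suc M]) = P)"

lemma lifts_step:
 assumes \<psi>: "lifts g (Suc j) \<psi> P" "\<And>x. x \<in> AA j ==> \<psi> x = \<phi> x" and j: "j < Suc M"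
 shows "lifts g j \<phi> ((if tr j then [\<psi> (z j)] else []) @ P)"
proof -
 obtain \<phi>' where f: "hom_on (AA (Suc M)) \<phi>'" "\<And>x. x \<in> AA (Suc j) ==> \<phi>' x = \<psi> x" "\<phi>' g \<noteq> 0"
  "map (\<lambda>i. \<phi>' (z i)) (filter tr [Suc j..<Suc M]) = P" using \<psi>(1) unfolding lifts_def by blast
 have "\<phi>' (z j) = \<psi> (z j)" using f(2)[OF z_AA[of j "Suc j"]] by simp
 moreover have "\<forall>x\<in>AA j. \<phi>' x = \<phi> x" using f(2) \<psi>(2) AA_mono[of j "Suc j"] by (simp del: AA.simps)
 ultimately show ?thesis
  unfolding lifts_def upt_conv_Cons[OF j] using f(1,3,4) by (intro exI[of _ \<phi>']) simp
qed

text \<open>Downward along the tower. At a transcendental step all but finitely many values are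
  allowed, so \<open>N\<close> of them can branch; at an algebraic step one value is chosen. The
  element \<open>g'\<close> collects the conditions that keep \<open>g\<close> nonzero.\<close>

lemma lift_tree:
 assumes g: "g \<in> AA (Suc M)" "g \<noteq> 0" and j: "j \<le> Suc M"
 shows "\<exists>g'\<in>AA j. g' \<noteq> 0 \<and> (\<forall>\<phi>. hom_on (AA j) \<phi> \<and> \<phi> g' \<noteq> 0 \<longrightarrow>
  (\<exists>T. tree N (length (filter tr [j..<Suc M])) T \<and> (\<forall>P\<in>T. lifts g j \<phi> P)))"
 using j
proof (induction j rule: inc_induct)
 case base
 show ?case using g by (intro bexI[of _ g]) (auto simp: lifts_def)
next
 case (step j)
 let ?t = "\<lambda>j. length (filter tr [j..<Suc M])"
 have j: "j < Suc M" using step.hyps by simp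
 obtain g1 where g1: "g1 \<in> AA (Suc j)" "g1 \<noteq> 0" and IH: "\<And>\<phi>. hom_on (AA (Suc j)) \<phi> ==> \<phi> g1 \<noteq> 0 ==>
   \<exists>T. tree N (?t (Suc j)) T \<and> (\<forall>P\<in>T. lifts g (Suc j) \<phi> P)"
  using step.IH by blast
 have g1': "g1 \<in> adj (AA j) (z j)" using g1(1) by simp
 show ?case
 proof (cases "tr j")
  case True
  then have t: "trans_over (AA j) (z j)" and len: "?t j = Suc (?t (Suc j))"
   using upt_conv_Cons[OF j] by (simp_all add: tr_def del: upt_Suc)
  obtain g' where g': "g' \<in> AA j" "g' \<noteq> 0" "\<And>\<phi>. hom_on (AA j) \<phi> ==> \<phi> g' \<noteq> 0 ==>
    finite {c. \<not> (\<exists>\<phi>'. hom_on (AA (Suc j)) \<phi>' \<and> (\<forall>x\<in>AA j. \<phi>' x = \<phi> x) \<and> \<phi>' (z j) = c \<and> \<phi>' g1 \<noteq> 0)}"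
   using hom_lift_trans[OF AA_ring t g1' g1(2)] by auto
  have "\<exists>T. tree N (?t j) T \<and> (\<forall>P\<in>T. lifts g j \<phi> P)" if f: "hom_on (AA j) \<phi>" "\<phi> g' \<noteq> 0" for \<phi>
  proof -
   define G where "G = {c. \<exists>\<phi>'. hom_on (AA (Suc j)) \<phi>' \<and> (\<forall>x\<in>AA j. \<phi>' x = \<phi> x) \<and> \<phi>' (z j) = c \<and> \<phi>' g1 \<noteq> 0}"
   have "finite (- G)" unfolding G_def Collect_neg_eq[symmetric] by (rule g'(3)[OF f])
   then have "infinite G" using infinite_UNIV_char_0[where 'a = complex] finite_UnI[of G "- G"] by auto
   then obtain S where S: "finite S" "card S = N" "S \<subseteq> G" using infinite_arbitrarily_large by blast
   have "\<exists>T. tree N (?t (Suc j)) T \<and> (\<forall>P\<in>T. lifts g j \<phi> (c # P))" if c: "c \<in> S" for c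
   proof -
    obtain \<psi> where psi: "hom_on (AA (Suc j)) \<psi>" "\<And>x. x \<in> AA j ==> \<psi> x = \<phi> x" "\<psi> (z j) = c" "\<psi> g1 \<noteq> 0"
     using S(3) c unfolding G_def by blast
    obtain T where T: "tree N (?t (Suc j)) T" "\<forall>P\<in>T. lifts g (Suc j) \<psi> P" using IH[OF psi(1,4)] by blast
    have "lifts g j \<phi> (c # P)" if PT: "P \<in> T" for P
     using lifts_step[of g j \<psi> P \<phi>, OF bspec[OF T(2) PT] psi(2) j] psi(3) True by simp
    then show ?thesis using T(1) by blast
   qed
   then have "\<forall>c\<in>S. \<exists>T. tree N (?t (Suc j)) T \<and> (\<forall>P\<in>T. lifts g j \<phi> (c # P))" by blast
   from bchoice[OF this] obtain \<tau> where \<tau>: "\<forall>c\<in>S. tree N (?t (Suc j)) (\<tau> c) \<and> (\<forall>P\<in>\<tau> c. lifts g j \<phi> (c # P))"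
    by (rule exE)
   have "tree N (?t j) (\<Union>c\<in>S. (#) c ` \<tau> c)"
    unfolding len tree.simps(2) using S \<tau> by (intro exI[of _ S] exI[of _ \<tau>] conjI ballI) auto
   moreover have "\<forall>P\<in>(\<Union>c\<in>S. (#) c ` \<tau> c). lifts g j \<phi> P" using \<tau> by blast
   ultimately show ?thesis by blast
  qed
  then show ?thesis using g'(1,2) by blast
 next
  case False
  then have t: "\<not> trans_over (AA j) (z j)" and len: "?t j = ?t (Suc j)"
   using upt_conv_Cons[OF j] by (simp_all add: tr_def del: upt_Suc)
  obtain g' where g': "g' \<in> AA j" "g' \<noteq> 0" "\<And>\<phi>. hom_on (AA j) \<phi> ==> \<phi> g' \<noteq> 0 ==>
    \<exists>\<phi>'. hom_on (AA (Suc j)) \<phi>' \<and> (\<forall>x\<in>AA j. \<phi>' x = \<phi> x) \<and> \<phi>' g1 \<noteq> 0"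
   using hom_lift_algebraic[OF AA_ring t g1' g1(2)] by auto
  have "\<exists>T. tree N (?t j) T \<and> (\<forall>P\<in>T. lifts g j \<phi> P)" if f: "hom_on (AA j) \<phi>" "\<phi> g' \<noteq> 0" for \<phi>
  proof -
   obtain \<psi> where psi: "hom_on (AA (Suc j)) \<psi>" "\<And>x. x \<in> AA j ==> \<psi> x = \<phi> x" "\<psi> g1 \<noteq> 0"
    using g'(3)[OF f] by blast
   obtain T where T: "tree N (?t (Suc j)) T" "\<forall>P\<in>T. lifts g (Suc j) \<psi> P" using IH[OF psi(1,3)] by blast
   have "lifts g j \<phi> P" if PT: "P \<in> T" for P
    using lifts_step[of g j \<psi> P \<phi>, OF bspec[OF T(2) PT] psi(2) j] False by simp
   then show ?thesis using T(1) unfolding len by blast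
  qed
  then show ?thesis using g'(1,2) by blast
 qed
qed

text \<open>The homomorphisms from \<open>lift_tree\<close> are closed points by
  \<open>hom_point\<close>. The freely chosen \<open>g\<close> serves to keep the grid away from a
  bad locus.\<close>

lemma grid_of_points:
 assumes g: "g \<in> AA (Suc M)" "g \<noteq> 0"
 obtains T \<pi> where "tree N (length idx) T"
  "\<And>P. P \<in> T ==> \<pi> P \<in> Pts \<and> a (\<pi> P) j0 \<noteq> 0 \<and> val (\<pi> P) g \<noteq> 0 \<and> map (val (\<pi> P)) Xs = P"
proof -
 obtain g' where g': "g' \<in> AA 0" "g' \<noteq> 0" "\<And>\<phi>. hom_on (AA 0) \<phi> ==> \<phi> g' \<noteq> 0 ==>
  \<exists>T. tree N (length (filter tr [0..<Suc M])) T \<and> (\<forall>P\<in>T. lifts g 0 \<phi> P)"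
  using lift_tree[OF g, of 0 N] by blast
 define \<phi> where "\<phi> = inv_into UNIV sc"
 have fs: "\<phi> (sc c) = c" for c unfolding \<phi>_def by (rule inv_f_f) (auto simp: inj_def sc_inj)
 have "\<phi> (sc x + sc y) = x + y" "\<phi> (sc x * sc y) = x * y" for x y
  using fs by (simp_all add: sc_simps[symmetric])
 moreover have "\<phi> 1 = 1" using fs[of 1] by (simp add: sc_simps)
 ultimately have "hom_on (AA 0) \<phi>" unfolding hom_on_def by (auto simp: fs)
 moreover have "\<phi> g' \<noteq> 0" using g'(1,2) fs by auto
 ultimately obtain T where T: "tree N (length (filter tr [0..<Suc M])) T"
  "\<And>P. P \<in> T ==> lifts g 0 \<phi> P" using g'(3) by blast
 have "\<exists>p. p \<in> Pts \<and> a p j0 \<noteq> 0 \<and> val p g \<noteq> 0 \<and> map (val p) Xs = P" if PT: "P \<in> T" for P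
 proof -
  obtain \<phi>' where f': "hom_on (AA (Suc M)) \<phi>'" "\<And>x. x \<in> AA 0 ==> \<phi>' x = \<phi> x" "\<phi>' g \<noteq> 0"
   "map (\<lambda>i. \<phi>' (z i)) (filter tr [0..<Suc M]) = P" using T(2)[OF PT] unfolding lifts_def by blast
  have "\<phi>' (sc c) = c" for c using f'(2)[of "sc c"] fs by simp
  then obtain p where p: "p \<in> Pts" "a p j0 \<noteq> 0" "\<And>x. x \<in> AA (Suc M) ==> x \<in> Ov p \<and> val p x = \<phi>' x"
   using hom_point[OF f'(1)] by metis
  have "val p (z i) = \<phi>' (z i)" if "i \<in> set (filter tr [0..<Suc M])" for i
   using p(3)[OF z_AA[of i "Suc M"]] that by (simp del: upt_Suc AA.simps)
  then have "map (val p) Xs = P" unfolding f'(4)[symmetric] Xs_def idx_def by simp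
  then show ?thesis using p g f'(3) by auto
 qed
 then obtain \<pi> where "\<And>P. P \<in> T ==> \<pi> P \<in> Pts \<and> a (\<pi> P) j0 \<noteq> 0 \<and> val (\<pi> P) g \<noteq> 0 \<and> map (val (\<pi> P)) Xs = P" by metis
 then show thesis using that T(1) unfolding idx_def by blast
qed

end

section \<open>Growth of the spaces of polynomials of bounded degree\<close>

context chart begin

interpretation kv: vector_space "\<lambda>c (x::'k). sc c * x"
 by unfold_locales (simp_all add: sc_simps algebra_simps)

text \<open>\<open>VV j e\<close>: the values of polynomials in \<open>z\<^sub>0, \<dots>, z\<^sub>j\<^sub>-\<^sub>1\<close> of degree at most \<open>e\<close> in every variable.\<close>

primrec VV :: "nat \<Rightarrow> nat \<Rightarrow> 'k set" where
 "VV 0 e = range sc"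
| "VV (Suc j) e = {(\<Sum>i\<le>e. c i * z j ^ i) | c. \<forall>i\<le>e. c i \<in> VV j e}"

lemma VV_add: "x \<in> VV j e ==> y \<in> VV j e ==> x + y \<in> VV j e"
proof (induction j arbitrary: x y)
 case 0
 then obtain u v where "x = sc u" "y = sc v" by auto
 then show ?case by (auto simp: image_iff intro!: exI[of _ "u + v"] simp: sc_simps)
next
 case (Suc j)
 obtain c where c: "x = (\<Sum>i\<le>e. c i * z j ^ i)" "\<forall>i\<le>e. c i \<in> VV j e" using Suc.prems(1) by auto
 obtain d where d: "y = (\<Sum>i\<le>e. d i * z j ^ i)" "\<forall>i\<le>e. d i \<in> VV j e" using Suc.prems(2) by auto
 show ?case using c d Suc.IH
  by (auto intro!: exI[of _ "\<lambda>i. c i + d i"] simp: distrib_right sum.distrib)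
qed

lemma VV_0: "0 \<in> VV j e"
proof (induction j)
 case 0
 show ?case using sc_simps(1) by (auto simp: image_iff intro!: exI[of _ 0])
qed (auto intro!: exI[of _ "\<lambda>_. 0"])

lemma VV_sc: "sc u \<in> VV j e"
proof (induction j)
 case (Suc j)
 have "sc u = (\<Sum>i\<le>e. (if i = 0 then sc u else sc 0) * z j ^ i)"
  by (subst sum.mono_neutral_right[of _ "{0}"]) auto
 then show ?case using Suc VV_0[of j e] by (auto simp: sc_simps intro!: exI[of _ "\<lambda>i. if i = 0 then sc u else sc 0"])
qed auto

lemma VV_mono: "x \<in> VV j e ==> e \<le> e' ==> x \<in> VV j e'"
proof (induction j arbitrary: x)
 case (Suc j)
 obtain c where c: "x = (\<Sum>i\<le>e. c i * z j ^ i)" "\<forall>i\<le>e. c i \<in> VV j e" using Suc.prems(1) by auto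
 have "x = (\<Sum>i\<le>e'. (if i \<le> e then c i else 0) * z j ^ i)"
  unfolding c(1) using Suc.prems(2) by (intro sum.mono_neutral_cong_left) auto
 then show ?case using c(2) Suc.IH Suc.prems(2) VV_0[of j e']
  by (auto intro!: exI[of _ "\<lambda>i. if i \<le> e then c i else 0"])
qed auto

lemma VV_sum: "(\<And>i. i \<in> S ==> f i \<in> VV j e) ==> sum f S \<in> VV j e"
 by (induction S rule: infinite_finite_induct) (auto simp: VV_0 VV_add)

lemma VV_term: "c \<in> VV j e ==> i \<le> e ==> c * z j ^ i \<in> VV (Suc j) e"
proof -
 assume c: "c \<in> VV j e" and i: "i \<le> e"
 have "c * z j ^ i = (\<Sum>l\<le>e. (if l = i then c else 0) * z j ^ l)"
  using i by (subst sum.mono_neutral_right[of _ "{i}"]) auto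
 then show ?thesis using c VV_0[of j e] by (auto intro!: exI[of _ "\<lambda>l. if l = i then c else 0"])
qed

lemma VV_up: "j \<le> l ==> x \<in> VV j e ==> x \<in> VV l e"
proof (induction l rule: dec_induct)
 case (step l)
 then show ?case using VV_term[of x l e 0] by simp
qed simp

lemma VV_mult: "x \<in> VV j e ==> y \<in> VV j e' ==> x * y \<in> VV j (e + e')"
proof (induction j arbitrary: x y)
 case 0
 then obtain u v where "x = sc u" "y = sc v" by auto
 then have "x * y = sc (u * v)" by (simp add: sc_simps)
 then show ?case by simp
next
 case (Suc j)
 obtain c where c: "x = (\<Sum>i\<le>e. c i * z j ^ i)" "\<forall>i\<le>e. c i \<in> VV j e" using Suc.prems(1) by auto
 obtain d where d: "y = (\<Sum>i\<le>e'. d i * z j ^ i)" "\<forall>i\<le>e'. d i \<in> VV j e'" using Suc.prems(2) by auto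
 have "x * y = (\<Sum>i\<le>e. \<Sum>l\<le>e'. (c i * d l) * z j ^ (i + l))"
  unfolding c(1) d(1) sum_product by (simp add: power_add ac_simps)
 also have "\<dots> \<in> VV (Suc j) (e + e')"
  using c(2) d(2) Suc.IH by (intro VV_sum VV_term) auto
 finally show ?case .
qed

lemma VV_uminus: "x \<in> VV j e ==> - x \<in> VV j e"
 using VV_mult[of "sc (- 1)" j 0 x e] VV_sc[of "- 1" j 0] by (simp add: sc_simps)

lemma VV_diff: "x \<in> VV j e ==> y \<in> VV j e ==> x - y \<in> VV j e"
 using VV_add[of x j e "- y"] VV_uminus by simp

lemma AA_VV: "x \<in> AA j ==> \<exists>e. x \<in> VV j e"
proof (induction j arbitrary: x)
 case (Suc j)
 then obtain p where p: "p \<in> polys (AA j)" "x = poly p (z j)" by (auto simp: adj_def)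
 have "\<forall>i. \<exists>e. coeff p i \<in> VV j e" using Suc.IH polys_closed(10)[OF AA_ring p(1)] by blast
 then obtain b where b: "\<And>i. coeff p i \<in> VV j (b i)" by metis
 define e where "e = Max (b ` {..degree p}) + degree p"
 have "coeff p i \<in> VV j e" if "i \<le> degree p" for i
  by (rule VV_mono[OF b]) (use that in \<open>auto simp: e_def intro!: trans_le_add1 Max_ge\<close>)
 then have "x \<in> VV (Suc j) e"
  unfolding p(2) poly_altdef by (intro VV_sum VV_term) (auto simp: e_def)
 then show ?case by blast
qed auto

lemma VV_AA: "x \<in> VV j e ==> x \<in> AA j"
proof (induction j arbitrary: x)
 case (Suc j)
 obtain c where c: "x = (\<Sum>i\<le>e. c i * z j ^ i)" "\<forall>i\<le>e. c i \<in> VV j e" using Suc.prems(1) by auto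
 have "c i \<in> AA (Suc j)" if "i \<le> e" for i using Suc.IH c(2) that AA_mono[of j "Suc j"] by simp
 then show ?case unfolding c(1) using z_AA[of j "Suc j"]
  by (intro subring1D(8)[OF AA_ring] subring1D(6)[OF AA_ring] subring1D(7)[OF AA_ring]) auto
qed auto

lemma span_mult: "x \<in> kv.span B ==> x * y \<in> kv.span ((\<lambda>b. b * y) ` B)"
proof (induction rule: kv.span_induct_alt)
 case base
 then show ?case by (simp add: kv.span_zero)
next
 case (step c b x)
 have "(sc c * b + x) * y = sc c * (b * y) + x * y" by (simp add: algebra_simps)
 then show ?case using step by (auto intro!: kv.span_add kv.span_scale kv.span_base[OF imageI])
qed

text \<open>Rewriting \<open>h * z j ^ degree H\<close> by the lower terms of \<open>H\<close>
  brings the degree in \<open>z j\<close> below \<open>degree H\<close>, at the cost of one factor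
  \<open>h\<close> and of degree \<open>b\<close> in the coefficients for each power.\<close>

lemma power_reduction:
 assumes HH: "algebraic_over (AA j) (z j) H" and b: "\<And>i. coeff H i \<in> VV j b"
 shows "\<exists>c. (\<forall>i. c i \<in> VV j (b * k)) \<and> lead_coeff H ^ k * z j ^ k = (\<Sum>i<degree H. c i * z j ^ i)"
proof -
 interpret algebraic_over "AA j" "z j" H by (rule HH)
 obtain d where d: "degree H = Suc d" using deg gr0_implies_Suc by blast
 have hz: "h * z j ^ Suc d = - (\<Sum>i<Suc d. coeff H i * z j ^ i)"
  using H(3) unfolding poly_altdef d lessThan_Suc_atMost[symmetric] sum.lessThan_Suc[of _ "Suc d"]
  by (simp only: eq_neg_iff_add_eq_0 add.commute)
 show ?thesis
 proof (induction k)
  case 0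
  have "1 = (\<Sum>i<degree H. (if i = 0 then sc 1 else sc 0) * z j ^ i)"
   using deg by (subst sum.mono_neutral_right[of _ "{0}"]) (auto simp: sc_simps)
  then show ?case using VV_sc by (intro exI[of _ "\<lambda>i. if i = 0 then sc 1 else sc 0"]) auto
 next
  case (Suc k)
  then obtain c where c: "\<And>i. c i \<in> VV j (b * k)" "h ^ k * z j ^ k = (\<Sum>i<Suc d. c i * z j ^ i)" unfolding d by blast
  define c' where "c' i = h * (if i = 0 then 0 else c (i - 1)) - c d * coeff H i" for i
  have "h ^ Suc k * z j ^ Suc k = h * z j * (\<Sum>i<Suc d. c i * z j ^ i)" unfolding c(2)[symmetric] by simp
  also have "\<dots> = (\<Sum>i<d. h * c i * z j ^ Suc i) + c d * (h * z j ^ Suc d)"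
   by (simp add: sum_distrib_left algebra_simps)
  also have "(\<Sum>i<d. h * c i * z j ^ Suc i) = (\<Sum>i<Suc d. h * (if i = 0 then 0 else c (i - 1)) * z j ^ i)"
   unfolding sum.lessThan_Suc_shift by simp
  also have "\<dots> + c d * (h * z j ^ Suc d) = (\<Sum>i<Suc d. c' i * z j ^ i)"
   unfolding hz c'_def left_diff_distrib sum_subtractf by (simp only: sum_distrib_left mult_minus_right mult.assoc add_uminus_conv_diff)
  finally have "h ^ Suc k * z j ^ Suc k = (\<Sum>i<degree H. c' i * z j ^ i)" unfolding d .
  moreover have "c' i \<in> VV j (b * Suc k)" for i
  proof -
   have "h * (if i = 0 then 0 else c (i - 1)) \<in> VV j (b + b * k)" using c(1) b VV_0 by (intro VV_mult) auto
   moreover have "c d * coeff H i \<in> VV j (b * k + b)" by (intro VV_mult c b)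
   ultimately show ?thesis unfolding c'_def by (intro VV_diff) (simp_all add: add.commute)
  qed
  ultimately show ?case by blast
 qed
qed

text \<open>The exponent is the number of transcendental steps. An algebraic step multiplies the
  count only by a constant, since high powers of \<open>z j\<close> are reduced.\<close>

lemma hilbert_bound:
 "\<exists>C\<ge>1. \<forall>e. \<exists>B. finite B \<and> card B \<le> C * Suc e ^ length (filter tr [0..<j]) \<and> VV j e \<subseteq> kv.span B"
proof (induction j)
 case 0
 have "VV 0 e \<subseteq> kv.span {1}" for e using kv.span_scale[OF kv.span_base[of 1 "{1}"]] by auto
 then show ?case by (intro exI[of _ 1]) (auto intro!: exI[of _ "{1 :: 'k}"])
next
 case (Suc j)
 then obtain C where C: "C \<ge> 1" "\<And>e. \<exists>B. finite B \<and> card B \<le> C * Suc e ^ length (filter tr [0..<j]) \<and> VV j e \<subseteq> kv.span B" by blast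
 define t where "t = length (filter tr [0..<j])"
 show ?case
 proof (cases "tr j")
  case True
  have "\<exists>B. finite B \<and> card B \<le> C * Suc e ^ Suc t \<and> VV (Suc j) e \<subseteq> kv.span B" for e
  proof -
   obtain B where B: "finite B" "card B \<le> C * Suc e ^ t" "VV j e \<subseteq> kv.span B" using C(2) t_def by blast
   let ?B = "\<Union>i\<le>e. (\<lambda>b. b * z j ^ i) ` B"
   have "card ?B \<le> (\<Sum>i\<le>e. card ((\<lambda>b. b * z j ^ i) ` B))" by (rule card_UN_le) simp
   also have "\<dots> \<le> (\<Sum>i\<le>e. card B)" by (intro sum_mono card_image_le B)
   also have "\<dots> \<le> C * Suc e ^ Suc t" using mult_le_mono2[OF B(2), of "Suc e"] by (simp add: ac_simps)
   finally have "card ?B \<le> C * Suc e ^ Suc t" .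
   moreover have "VV (Suc j) e \<subseteq> kv.span ?B"
   proof
    fix x assume "x \<in> VV (Suc j) e"
    then obtain c where c: "x = (\<Sum>i\<le>e. c i * z j ^ i)" "\<forall>i\<le>e. c i \<in> VV j e" by auto
    have "c i * z j ^ i \<in> kv.span ?B" if "i \<le> e" for i
     by (rule subsetD[OF kv.span_mono span_mult[of "c i" B]]) (use c(2) B(3) that in auto)
    then show "x \<in> kv.span ?B" unfolding c(1) by (intro kv.span_sum) auto
   qed
   ultimately show ?thesis using B(1) by (intro exI[of _ ?B]) auto
  qed
  then show ?thesis using C(1) True by (intro exI[of _ C]) (simp add: t_def)
 next
  case False
  then have "\<not> trans_over (AA j) (z j)" by (simp add: tr_def)
  then obtain H where HH: "algebraic_over (AA j) (z j) H" using algebraic_over_exists[OF AA_ring] by blast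
  interpret algebraic_over "AA j" "z j" H by (rule HH)
  have "\<forall>i. \<exists>e. coeff H i \<in> VV j e" using AA_VV polys_closed(10)[OF AA_ring H(1)] by blast
  then obtain b' where b': "\<And>i. coeff H i \<in> VV j (b' i)" by metis
  define b where "b = Max (b' ` {..degree H})"
  have b: "coeff H i \<in> VV j b" for i
  proof (cases "i \<le> degree H")
   case True
   then show ?thesis by (intro VV_mono[OF b']) (auto simp: b_def intro!: Max_ge)
  qed (simp add: coeff_eq_0 VV_0)
  let ?d = "degree H"
  have "\<exists>B. finite B \<and> card B \<le> (?d * (C * Suc b ^ t)) * Suc e ^ t \<and> VV (Suc j) e \<subseteq> kv.span B" for e
  proof -
   let ?e = "e + b * e"
   obtain B where B: "finite B" "card B \<le> C * Suc ?e ^ t" "VV j ?e \<subseteq> kv.span B" using C(2) t_def by blast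
   \<comment> \<open>The factor \<open>1 / h ^ e\<close> compensates for the powers of
     \<open>h\<close> spent on the reduction; the degree of the coefficients grows to at most
     \<open>e + b * e\<close>.\<close>
   let ?B = "\<Union>i<?d. (\<lambda>x. x * (z j ^ i / h ^ e)) ` B"
   have "card ?B \<le> (\<Sum>i<?d. card ((\<lambda>x. x * (z j ^ i / h ^ e)) ` B))" by (rule card_UN_le) simp
   also have "\<dots> \<le> (\<Sum>i<?d. card B)" by (intro sum_mono card_image_le B)
   also have "\<dots> \<le> ?d * (C * Suc ?e ^ t)" using B(2) by simp
   also have "\<dots> \<le> ?d * (C * (Suc b * Suc e) ^ t)" by (intro mult_le_mono2 power_mono) auto
   also have "\<dots> = (?d * (C * Suc b ^ t)) * Suc e ^ t" by (simp add: power_mult_distrib ac_simps del: mult_Suc mult_Suc_right)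
   finally have card: "card ?B \<le> (?d * (C * Suc b ^ t)) * Suc e ^ t" .
   moreover have "VV (Suc j) e \<subseteq> kv.span ?B"
   proof
    fix x assume "x \<in> VV (Suc j) e"
    then obtain c where c: "x = (\<Sum>i\<le>e. c i * z j ^ i)" "\<forall>i\<le>e. c i \<in> VV j e" by auto
    obtain g where g: "\<And>k i. g k i \<in> VV j (b * k)" "\<And>k. h ^ k * z j ^ k = (\<Sum>i<?d. g k i * z j ^ i)"
     using power_reduction[OF HH b] by metis
    have "x = (\<Sum>k\<le>e. c k * h ^ (e - k) * (h ^ k * z j ^ k)) / h ^ e"
     unfolding c(1) sum_divide_distrib
    proof (intro sum.cong refl)
     fix k assume "k \<in> {..e}"
     then have "h ^ e = h ^ (e - k) * h ^ k" by (simp add: power_add[symmetric])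
     then show "c k * z j ^ k = c k * h ^ (e - k) * (h ^ k * z j ^ k) / h ^ e" using h(2) by (simp add: field_simps)
    qed
    also have "\<dots> = (\<Sum>k\<le>e. \<Sum>i<?d. (c k * h ^ (e - k) * g k i) * (z j ^ i / h ^ e))"
     unfolding g(2) sum_divide_distrib sum_distrib_left by (simp add: mult.assoc)
    also have "\<dots> \<in> kv.span ?B"
    proof (intro kv.span_sum)
     fix k i assume ki: "k \<in> {..e}" "i \<in> {..<?d}"
     have hk: "h ^ l \<in> VV j (b * l)" for l
      by (induction l) (use VV_sc[of 1 j 0] VV_mult[OF b] in \<open>auto simp: sc_simps\<close>)
     have "c k * h ^ (e - k) * g k i \<in> VV j (e + b * (e - k) + b * k)"
      using c(2) ki by (intro VV_mult hk g(1)) auto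
     moreover have "e + b * (e - k) + b * k = ?e" using ki by (simp add: add.assoc distrib_left[symmetric])
     ultimately have "c k * h ^ (e - k) * g k i \<in> kv.span B" using B(3) by auto
     then have "(c k * h ^ (e - k) * g k i) * (z j ^ i / h ^ e) \<in> kv.span ((\<lambda>x. x * (z j ^ i / h ^ e)) ` B)"
      by (rule span_mult)
     then show "(c k * h ^ (e - k) * g k i) * (z j ^ i / h ^ e) \<in> kv.span ?B"
      by (rule subsetD[OF kv.span_mono, rotated]) (use ki in auto)
    qed
    finally show "x \<in> kv.span ?B" .
   qed
   ultimately show ?thesis using B(1) by (intro exI[of _ ?B]) auto
  qed
  moreover have "?d * (C * Suc b ^ t) \<ge> 1" using C(1) deg by simp
  moreover have "length (filter tr [0..<Suc j]) = t" using False by (simp add: t_def)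
  ultimately show ?thesis by metis
 qed
qed

lemma lmon_VV:
 "\<alpha> \<in> mbox (length (filter tr [0..<j])) \<tau> ==> lmon \<alpha> (map z (filter tr [0..<j])) \<in> VV j \<tau>"
proof (induction j arbitrary: \<alpha>)
 case 0
 then show ?case using VV_sc[of 1 0 \<tau>] by (simp add: sc_simps)
next
 case (Suc j)
 show ?case
 proof (cases "tr j")
  case True
  with Suc.prems have "length \<alpha> = Suc (length (filter tr [0..<j]))" by (simp add: mbox_def)
  then obtain \<beta> i where a: "\<alpha> = \<beta> @ [i]" "length \<beta> = length (filter tr [0..<j])"
   by (metis length_append_singleton append_butlast_last_id length_0_conv nat.distinct(1) nat.inject)
  then have "\<beta> \<in> mbox (length (filter tr [0..<j])) \<tau>" "i \<le> \<tau>" using Suc.prems by (auto simp: mbox_def)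
  then show ?thesis using VV_term[OF Suc.IH, of \<beta> i] True a
   by (simp add: lmon_append del: VV.simps)
 next
  case False
  then show ?thesis using VV_up[of j "Suc j", OF _ Suc.IH, of \<alpha>] Suc.prems by simp
 qed
qed

end

section \<open>Sections as forms in the coordinates\<close>

context pmodel begin

text \<open>For each \<open>i\<close> some \<open>S * s i ^ N i\<close> is a form. A monomial of
  degree at least \<open>Suc M * N'\<close> contains some variable at least \<open>N'\<close> times,
  so its product with \<open>S\<close> is again a form.\<close>

lemma section_times_homogeneous:
 assumes S: "\<And>p. p \<in> Pts ==> S * D0 p ^ e \<in> Ov p"
 obtains N where "\<And>d F. homogeneous d F ==> d \<ge> N ==> \<exists>G. homogeneous (d + e) G \<and> S * E F = E G"
proof -
 have "\<exists>N G. homogeneous (N + e) G \<and> S * s i ^ N = E G" for i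
 proof (cases "s i = 0")
  case True
  then show ?thesis by (intro exI[of _ 1] exI[of _ 0]) simp
 next
  case False
  have "S / s i ^ e \<in> Ov q" if q: "q \<in> Pts" "ceval (a q) (Var i) \<noteq> 0" for q
  proof -
   have u: "isu q (s i * D0 q)" using isu_sD0[OF q(1)] q(2) by simp
   have "inverse ((s i * D0 q) ^ e) \<in> Ov q" using isu_inverse[OF q(1) isu_power[OF q(1) u]] by (simp add: isu_def)
   moreover have "S / s i ^ e = (S * D0 q ^ e) * inverse ((s i * D0 q) ^ e)"
    using isu_nz[OF q(1) u] by (simp add: field_simps power_mult_distrib)
   ultimately show ?thesis using Ov_simps(6)[OF q(1) S[OF q(1)]] by simp
  qed
  then obtain N G where G: "homogeneous (N * Suc 0) G" "S / s i ^ e = E G / E (Var i) ^ N"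
   using regular_on_basic_open[of 0 1 "Var i" i "S / s i ^ e"] False by (auto simp: sc)
  have "homogeneous (N + e) (G * Var i ^ e)"
   using homogeneous_mult[OF G(1) homogeneous_power[OF homogeneous_Var(1), of e i]] by simp
  moreover have "S * s i ^ N = E (G * Var i ^ e)" using G(2) False by (simp add: sc E_simps field_simps)
  ultimately show ?thesis by blast
 qed
 then obtain N G where G: "\<And>i. homogeneous (N i + e) (G i)" "\<And>i. S * s i ^ N i = E (G i)" by metis
 define N' where "N' = Max (N ` {..M})"
 have N': "N i \<le> N'" if "i \<le> M" for i unfolding N'_def using that by simp
 show thesis
 proof (rule that[of "Suc M * N'"])
  fix d F assume F: "homogeneous d F" "Suc M * N' \<le> d"
  have "\<exists>H. homogeneous (d + e) H \<and> S * E (Poly_Mapping.single \<mu> c) = E H" if m: "mdeg \<mu> = d" for \<mu> c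
  proof (cases "Poly_Mapping.keys \<mu> \<subseteq> {..M}")
   case False
   then obtain i where i: "i \<in> Poly_Mapping.keys \<mu>" "i > M" by (meson atMost_iff not_le subsetI)
   then have "mon s \<mu> = 0"
    unfolding mon_def using s_supp[OF i(2)] by (intro prod_zero) (auto intro!: bexI[of _ i] simp: in_keys_iff)
   then show ?thesis by (intro exI[of _ 0]) (simp add: peval_single[OF sc])
  next
   case True
   have "\<exists>i\<le>M. N' \<le> Poly_Mapping.lookup \<mu> i"
   proof (rule ccontr)
    assume "\<not> ?thesis"
    then have l: "Poly_Mapping.lookup \<mu> i < N'" if "i \<le> M" for i using that by force
    have "mdeg \<mu> \<le> (\<Sum>i\<le>M. Poly_Mapping.lookup \<mu> i)" unfolding mdeg_def using True by (intro sum_mono2) auto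
    also have "\<dots> < (\<Sum>i\<le>M. N')" using l by (intro sum_strict_mono) auto
    finally show False using F(2) m by simp
   qed
   then obtain i where i: "i \<le> M" "N i \<le> Poly_Mapping.lookup \<mu> i" using N' le_trans by blast
   define \<nu> where "\<nu> = \<mu> - Poly_Mapping.single i (N i)"
   have e: "\<mu> = Poly_Mapping.single i (N i) + \<nu>"
    by (rule poly_mapping_eqI) (use i(2) in \<open>auto simp: \<nu>_def lookup_add lookup_minus lookup_single when_def\<close>)
   have "mdeg (Poly_Mapping.single i (N i)) = N i" by (cases "N i = 0") (simp_all add: mdeg_def)
   then have d: "d = N i + mdeg \<nu>" using m e mdeg_add by metis
   have "mon s (Poly_Mapping.single i (N i)) = s i ^ N i" by (cases "N i = 0") (simp_all add: mon_def)
   then have "S * E (Poly_Mapping.single \<mu> c) = E (G i * Poly_Mapping.single \<nu> c)"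
    by (simp add: E_simps peval_single[OF sc] e mon_add G(2)[symmetric] ac_simps)
   moreover have "homogeneous (mdeg \<nu>) (Poly_Mapping.single \<nu> c)" by (simp add: homogeneous_iff lookup_single when_def)
   then have "homogeneous (d + e) (G i * Poly_Mapping.single \<nu> c)"
    using homogeneous_mult[OF G(1)[of i], of "mdeg \<nu>" "Poly_Mapping.single \<nu> c"] unfolding d by (simp add: ac_simps)
   ultimately show ?thesis by blast
  qed
  then have "\<forall>\<mu>. \<exists>H. mdeg \<mu> = d \<longrightarrow> homogeneous (d + e) H \<and> S * E (Poly_Mapping.single \<mu> (Poly_Mapping.lookup F \<mu>)) = E H" by blast
  then obtain H where H: "\<And>\<mu>. mdeg \<mu> = d ==> homogeneous (d + e) (H \<mu>) \<and> S * E (Poly_Mapping.single \<mu> (Poly_Mapping.lookup F \<mu>)) = E (H \<mu>)" by metis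
  have k: "mdeg \<mu> = d" if "\<mu> \<in> Poly_Mapping.keys F" for \<mu> using F(1) that by (simp add: homogeneous_iff in_keys_iff)
  have "E F = (\<Sum>\<mu>\<in>Poly_Mapping.keys F. E (Poly_Mapping.single \<mu> (Poly_Mapping.lookup F \<mu>)))"
   by (subst mpoly_sum_single) (rule peval_sum[OF sc])
  then have "S * E F = E (\<Sum>\<mu>\<in>Poly_Mapping.keys F. H \<mu>)"
   using H[OF k] by (simp add: sum_distrib_left peval_sum[OF sc])
  moreover have "homogeneous (d + e) (\<Sum>\<mu>\<in>Poly_Mapping.keys F. H \<mu>)" using H[OF k] by (intro homogeneous_sum) auto
  ultimately show "\<exists>G. homogeneous (d + e) G \<and> S * E F = E G" by blast
 qed
qed

end

section \<open>Polynomial relations satisfied by powers of a section\<close>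

context chart begin

interpretation kv: vector_space "\<lambda>c (x::'k). sc c * x"
 by unfold_locales (simp_all add: sc_simps algebra_simps)

text \<open>Once the degree is at least \<open>N\<close>, multiplication by \<open>S\<close> raises
  it by exactly \<open>e\<close>. The excess \<open>N\<close> is paid once and not once for each
  power, which keeps the slope \<open>e\<close> in the count.\<close>

lemma section_powers_VV:
 assumes S: "\<And>p. p \<in> Pts ==> S * D0 p ^ e \<in> Ov p"
 obtains N where "\<And>j. (S / s j0 ^ e) ^ j \<in> VV (Suc M) (N + j * e)"
proof -
 have pV: "peval sc z G \<in> VV (Suc M) d" if G: "homogeneous d G" for d G
 proof -
  have zV: "z i \<in> VV (Suc M) 1" for i
  proof (cases "i \<le> M")
   case True
   have "z i \<in> VV (Suc i) 1" using VV_term[of 1 i 1 1] VV_sc[of 1 i 1] by (simp add: sc_simps)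
   then show ?thesis using VV_up[of "Suc i" "Suc M"] True by (simp del: VV.simps)
  qed (simp add: z_supp VV_0 del: VV.simps)
  have pw: "x ^ l \<in> VV (Suc M) (l * e)" if "x \<in> VV (Suc M) e" for x l e
   by (induction l) (use VV_sc[of 1 "Suc M" 0] VV_mult[OF that] in \<open>auto simp: sc_simps simp del: VV.simps\<close>)
  have pr: "(\<Prod>i\<in>K. z i ^ \<mu> i) \<in> VV (Suc M) (\<Sum>i\<in>K. \<mu> i)" if "finite K" for K and \<mu> :: "nat \<Rightarrow> nat"
   using that by (induction K rule: finite_induct)
    (use VV_sc[of 1 "Suc M" 0] VV_mult[OF pw[OF zV]] in \<open>auto simp: sc_simps simp del: VV.simps\<close>)
  have "mon z \<mu> \<in> VV (Suc M) (mdeg \<mu>)" for \<mu>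
   unfolding mon_def mdeg_def by (rule pr) simp
  then have "sc (Poly_Mapping.lookup G \<mu>) * mon z \<mu> \<in> VV (Suc M) d" if "\<mu> \<in> Poly_Mapping.keys G" for \<mu>
   using VV_mult[OF VV_sc[of "Poly_Mapping.lookup G \<mu>" "Suc M" 0], of "mon z \<mu>" "mdeg \<mu>"] G that
   by (simp add: homogeneous_iff in_keys_iff del: VV.simps)
  then show ?thesis unfolding peval_def mon_def[symmetric] by (rule VV_sum)
 qed
 obtain N where N: "\<And>d F. homogeneous d F ==> d \<ge> N ==> \<exists>G. homogeneous (d + e) G \<and> S * E F = E G"
  using section_times_homogeneous[OF S] by blast
 have "\<exists>G. homogeneous (N + j * e) G \<and> S ^ j * s j0 ^ N = E G" for j
 proof (induction j)
  case 0
  show ?case using homogeneous_power[OF homogeneous_Var(1), of N j0] by (intro exI[of _ "Var j0 ^ N"]) (simp add: sc E_simps)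
 next
  case (Suc j)
  then obtain G where G: "homogeneous (N + j * e) G" "S ^ j * s j0 ^ N = E G" by blast
  obtain H where "homogeneous (N + j * e + e) H" "S * E G = E H" using N[OF G(1)] by auto
  then show ?case using G(2) by (intro exI[of _ H]) (simp add: ac_simps)
 qed
 then have "(S / s j0 ^ e) ^ j \<in> VV (Suc M) (N + j * e)" for j
 proof -
  obtain G where G: "homogeneous (N + j * e) G" "S ^ j * s j0 ^ N = E G"
   using \<open>\<And>j. \<exists>G. homogeneous (N + j * e) G \<and> S ^ j * s j0 ^ N = E G\<close> by blast
  have "E G = s j0 ^ (N + j * e) * peval sc z G" using E_dehom[OF sj0 G(1)] by (simp add: z_def[abs_def])
  then have "(S / s j0 ^ e) ^ j = peval sc z G"
  proof -
   have "s j0 ^ N * S ^ j = s j0 ^ N * (s j0 ^ (j * e) * peval sc z G)"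
    using G(2) \<open>E G = _\<close> by (simp add: power_add ac_simps)
   then have "S ^ j = s j0 ^ (j * e) * peval sc z G" using sj0 by simp
   then show ?thesis using sj0 by (simp add: power_divide power_mult[symmetric] mult.commute[of e j])
  qed
  then show ?thesis using pV[OF G(1)] by simp
 qed
 then show thesis by (rule that)
qed

lemma linear_dependence:
 assumes I: "finite I" and B: "finite B" "card B < card I" and v: "\<And>i. i \<in> I ==> v i \<in> kv.span B"
 obtains c where "\<exists>i\<in>I. c i \<noteq> 0" "(\<Sum>i\<in>I. sc (c i) * v i) = 0"
proof -
 obtain h where h: "bij_betw h {0..<card B} B" using ex_bij_betw_nat_finite[OF B(1)] by blast
 have "\<forall>i\<in>I. \<exists>u. v i = (\<Sum>b\<in>B. sc (u b) * b)" using v unfolding kv.span_finite[OF B(1)] by auto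
 then obtain u where u: "\<And>i. i \<in> I ==> v i = (\<Sum>b\<in>B. sc (u i b) * b)" by metis
 obtain c where c: "\<exists>i\<in>I. c i \<noteq> 0" "\<forall>k<card B. (\<Sum>i\<in>I. c i * u i (h k)) = 0"
  using nontrivial_solution[OF subfield_UNIV I B(2), of "\<lambda>i k. u i (h k)"] by auto
 have z: "(\<Sum>i\<in>I. c i * u i b) = 0" if "b \<in> B" for b
 proof -
  have "b \<in> h ` {0..<card B}" using h that by (simp add: bij_betw_def)
  then show ?thesis using c(2) by auto
 qed
 have "(\<Sum>i\<in>I. sc (c i) * v i) = (\<Sum>i\<in>I. \<Sum>b\<in>B. sc (c i * u i b) * b)"
  by (intro sum.cong refl) (simp only: u sum_distrib_left rhomD(4)[OF sc] mult.assoc)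
 also have "\<dots> = (\<Sum>b\<in>B. \<Sum>i\<in>I. sc (c i * u i b) * b)" by (rule sum.swap)
 also have "\<dots> = (\<Sum>b\<in>B. sc (\<Sum>i\<in>I. c i * u i b) * b)"
  by (simp only: sum_distrib_right rhomD(8)[OF sc])
 also have "\<dots> = 0" using z by (simp add: sc_simps)
 finally show thesis using that c(1) by blast
qed

text \<open>The exponent \<open>k\<close> depends on \<open>S\<close>, but \<open>r\<close> does
  not. This uniformity allows the grid to be fixed before the section is known.\<close>

lemma power_relation:
 "\<exists>r\<ge>1. \<forall>S e. e \<ge> 1 \<and> S \<noteq> 0 \<and> (\<forall>p\<in>Pts. S * D0 p ^ e \<in> Ov p) \<longrightarrow>
  (\<exists>k\<ge>1. \<exists>c. (\<exists>\<alpha>\<in>mbox (length idx) (r * k * e). c \<alpha> \<noteq> 0) \<and>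
   (\<exists>x\<in>AA (Suc M). (\<Sum>\<alpha>\<in>mbox (length idx) (r * k * e). sc (c \<alpha>) * lmon \<alpha> Xs) = (S / s j0 ^ e) ^ k * x))"
proof -
 let ?n = "length idx"
 obtain C where C: "C \<ge> 1" "\<And>e. \<exists>B. finite B \<and> card B \<le> C * Suc e ^ ?n \<and> VV (Suc M) e \<subseteq> kv.span B"
  using hilbert_bound[of "Suc M"] unfolding idx_def[symmetric] by blast
 \<comment> \<open>The 3 absorbs \<open>Suc (N + \<tau> + \<tau>)\<close>, which is at most
   \<open>3 * Suc \<tau>\<close> once \<open>N < \<tau>\<close>. The dimension is then at most
   \<open>r\<close> times the number of monomials, and there are \<open>Suc r\<close>
   powers.\<close>
 define r where "r = C * 3 ^ ?n"
 have r: "r \<ge> 1" using C(1) by (simp add: r_def)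
 show ?thesis
 proof (rule exI[of _ r], intro conjI r allI impI, elim conjE)
  fix S e assume e: "1 \<le> e" and S0: "S \<noteq> 0" and S: "\<forall>p\<in>Pts. S * D0 p ^ e \<in> Ov p"
  define f where "f = S / s j0 ^ e"
  have f0: "f \<noteq> 0" using S0 sj0 by (simp add: f_def)
  obtain N where N: "\<And>j. f ^ j \<in> VV (Suc M) (N + j * e)"
   using section_powers_VV[of S e] S unfolding f_def by metis
  \<comment> \<open>Chosen so that \<open>N < \<tau>\<close>.\<close>
  define k where "k = Suc N"
  define \<tau> where "\<tau> = r * k * e"
  have tau: "Suc N \<le> \<tau>" using mult_le_mono[OF mult_le_mono[OF r order.refl[of k]] e] by (simp add: \<tau>_def k_def)
  obtain B where B: "finite B" "card B \<le> C * Suc (N + \<tau> + \<tau>) ^ ?n" "VV (Suc M) (N + \<tau> + \<tau>) \<subseteq> kv.span B" using C(2) by blast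
  let ?I = "{..r} \<times> mbox ?n \<tau>"
  have "C * Suc (N + \<tau> + \<tau>) ^ ?n \<le> C * (3 * Suc \<tau>) ^ ?n" using tau by (intro mult_le_mono2 power_mono) auto
  also have "\<dots> = r * Suc \<tau> ^ ?n" by (simp add: r_def power_mult_distrib del: mult_Suc_right)
  also have "\<dots> < Suc r * Suc \<tau> ^ ?n" by simp
  also have "\<dots> = card ?I" by (simp add: mbox_card)
  finally have cB: "card B < card ?I" using B(2) by simp
  have lV: "lmon \<alpha> Xs \<in> VV (Suc M) \<tau>" if "\<alpha> \<in> mbox ?n \<tau>" for \<alpha>
   using lmon_VV[of \<alpha> "Suc M" \<tau>] that unfolding Xs_def idx_def by blast
  have v: "lmon (snd x) Xs * f ^ (fst x * k) \<in> kv.span B" if x: "x \<in> ?I" for x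
  proof -
   have "lmon (snd x) Xs * f ^ (fst x * k) \<in> VV (Suc M) (\<tau> + (N + fst x * k * e))"
    using x by (intro VV_mult N lV) auto
   moreover have "fst x * k * e \<le> \<tau>" unfolding \<tau>_def using x by (intro mult_le_mono1) auto
   ultimately have "lmon (snd x) Xs * f ^ (fst x * k) \<in> VV (Suc M) (N + \<tau> + \<tau>)"
    using VV_mono[of _ "Suc M" "\<tau> + (N + fst x * k * e)" "N + \<tau> + \<tau>"] by simp
   then show ?thesis using B(3) by blast
  qed
  have fI: "finite ?I" by (simp add: mbox_card)
  obtain c where c: "\<exists>x\<in>?I. c x \<noteq> 0" "(\<Sum>x\<in>?I. sc (c x) * (lmon (snd x) Xs * f ^ (fst x * k))) = 0"
   by (rule linear_dependence[OF fI B(1) cB v])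
  define P where "P i = (\<Sum>\<alpha>\<in>mbox ?n \<tau>. sc (c (i, \<alpha>)) * lmon \<alpha> Xs)" for i
  have rel: "(\<Sum>i\<le>r. P i * f ^ (i * k)) = 0"
   using c(2) unfolding P_def sum_distrib_right by (simp add: sum.cartesian_product case_prod_beta mult.assoc)
  define Q where "Q i \<longleftrightarrow> i \<le> r \<and> (\<exists>\<alpha>\<in>mbox ?n \<tau>. c (i, \<alpha>) \<noteq> 0)" for i
  have "\<exists>i. Q i" using c(1) unfolding Q_def by fastforce
  \<comment> \<open>All earlier coefficients vanish, so \<open>f ^ (i0 * k)\<close> can be
    cancelled, and every later term keeps a factor \<open>f ^ k\<close>.\<close>
  define i0 where "i0 = (LEAST i. Q i)"
  have i0: "Q i0" unfolding i0_def by (rule LeastI_ex[OF \<open>\<exists>i. Q i\<close>])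
  have less: "\<not> Q i" if "i < i0" for i using not_less_Least that unfolding i0_def by blast
  have Pz: "P i = 0" if "i < i0" for i
   using less[OF that] i0 that unfolding P_def Q_def by (intro sum.neutral) (auto simp: sc_simps)
  define x where "x = - (\<Sum>i\<in>{i0<..r}. P i * f ^ ((i - Suc i0) * k))"
  have "(\<Sum>i\<le>r. P i * f ^ (i * k)) = (\<Sum>i\<in>{i0..r}. P i * f ^ (i * k))"
   using Pz by (intro sum.mono_neutral_right) auto
  also have "\<dots> = P i0 * f ^ (i0 * k) + (\<Sum>i\<in>{i0<..r}. P i * f ^ (i * k))"
   using i0 unfolding Q_def by (subst sum.head) auto
  also have "(\<Sum>i\<in>{i0<..r}. P i * f ^ (i * k)) = (\<Sum>i\<in>{i0<..r}. f ^ (i0 * k) * (f ^ k * (P i * f ^ ((i - Suc i0) * k))))"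
  proof (intro sum.cong refl)
   fix i assume "i \<in> {i0<..r}"
   then have "i = i0 + Suc 0 + (i - Suc i0)" by simp
   then have "i * k = i0 * k + k + (i - Suc i0) * k" by (metis add_mult_distrib mult.commute nat_mult_1_right One_nat_def)
   then show "P i * f ^ (i * k) = f ^ (i0 * k) * (f ^ k * (P i * f ^ ((i - Suc i0) * k)))" by (simp add: power_add)
  qed
  also have "\<dots> = f ^ (i0 * k) * (f ^ k * (- x))" unfolding x_def by (simp add: sum_distrib_left)
  finally have "P i0 * f ^ (i0 * k) + f ^ (i0 * k) * (f ^ k * (- x)) = 0" unfolding rel by (rule sym)
  then have "f ^ (i0 * k) * (P i0 - f ^ k * x) = 0" by (simp add: algebra_simps)
  then have "P i0 = f ^ k * x" using f0 by simp
  moreover have "x \<in> AA (Suc M)"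
  proof -
   have "P i \<in> AA (Suc M)" for i unfolding P_def
    using sc_AA VV_AA[OF lV] by (intro subring1D(8)[OF AA_ring] subring1D(6)[OF AA_ring])
   then show ?thesis unfolding x_def using VV_AA[OF N]
    by (intro subring1D(3)[OF AA_ring] subring1D(8)[OF AA_ring] subring1D(6)[OF AA_ring])
  qed
  ultimately show "\<exists>k\<ge>1. \<exists>c. (\<exists>\<alpha>\<in>mbox ?n (r * k * e). c \<alpha> \<noteq> 0) \<and>
   (\<exists>x\<in>AA (Suc M). (\<Sum>\<alpha>\<in>mbox ?n (r * k * e). sc (c \<alpha>) * lmon \<alpha> Xs) = (S / s j0 ^ e) ^ k * x)"
   using i0 unfolding Q_def P_def \<tau>_def f_def
   by (intro exI[of _ k] exI[of _ "\<lambda>\<alpha>. c (i0, \<alpha>)"] conjI bexI[of _ x]) (auto simp: k_def)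
 qed
qed

end

section \<open>Good points\<close>

lemma poly_in_ring: "subring1 A ==> q \<in> polys A ==> c \<in> A ==> poly q c \<in> A"
 unfolding poly_altdef using polys_closed(10) by (intro subring1D(8) subring1D(6) subring1D(7))

lemma synthetic_div_polys:
 assumes A: "subring1 A" and c: "c \<in> A" shows "q \<in> polys A ==> synthetic_div q c \<in> polys A"
proof (induction q)
 case (pCons b q)
 have q: "q \<in> polys A" unfolding polys_def using polys_closed(10)[OF A pCons.prems, of "Suc i" for i] by simp
 then have "poly q c \<in> A" "synthetic_div q c \<in> polys A" using poly_in_ring[OF A _ c] pCons.IH by auto
 then show ?case unfolding polys_def by (auto simp: coeff_pCons split: nat.split)
qed (simp add: polys_closed[OF A])

context chart begin

abbreviation "nv \<equiv> length idx"

definition tpar :: "point \<Rightarrow> nat \<Rightarrow> 'k" where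
 "tpar p i = Xs ! i - sc (val p (Xs ! i))"

text \<open>The projection of the chart to affine space by the coordinates \<open>Xs\<close> is
  unramified at \<open>p\<close>.\<close>

definition good :: "point \<Rightarrow> bool" where
 "good p \<longleftrightarrow> p \<in> Pts \<and> a p j0 \<noteq> 0 \<and> max_ideal (Ov p) = {(\<Sum>i<nv. r i * tpar p i) | r. \<forall>i<nv. r i \<in> Ov p}"

lemma AA_Ov: assumes p: "p \<in> Pts" "a p j0 \<noteq> 0" shows "x \<in> AA j ==> x \<in> Ov p"
proof (induction j arbitrary: x)
 case 0
 then show ?case using p by (auto simp: sc_in_Ov)
next
 case (Suc j)
 then obtain q where q: "q \<in> polys (AA j)" "x = poly q (z j)" by (auto simp: adj_def)
 have "coeff q i * z j ^ i \<in> Ov p" for i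
  using Suc.IH[OF polys_closed(10)[OF AA_ring q(1)]] val_ratio(1)[OF p, of j] p(1) by (simp add: Ov_simps z_def)
 then show ?case unfolding q(2) poly_altdef by (intro Ov_simps(8)[OF p(1)])
qed

lemma Xs_nth: "i < nv ==> Xs ! i = z (idx ! i)" and idx_nth: "i < nv ==> tr (idx ! i) \<and> idx ! i \<le> M"
 and distinct_idx: "distinct idx"
proof -
 show "distinct idx" unfolding idx_def by (intro distinct_filter distinct_upt)
 show "i < nv ==> Xs ! i = z (idx ! i)" by (simp add: Xs_def)
 show "i < nv ==> tr (idx ! i) \<and> idx ! i \<le> M"
  using nth_mem[of i idx] by (simp add: idx_def less_Suc_eq_le del: upt_Suc)
qed

lemma tpar_max_ideal: "p \<in> Pts ==> a p j0 \<noteq> 0 ==> i < nv ==> tpar p i \<in> max_ideal (Ov p)"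
 using val_ratio(1)[of p j0 "idx ! i"]
 by (simp add: tpar_def Xs_nth z_def max_ideal_iff val_diff sc_in_Ov Ov_simps)

text \<open>Jacobian criterion along the tower: where the derivatives \<open>u j\<close> are
  nonzero, every algebraic coordinate minus its value lies in the ideal generated by the
  transcendental ones.\<close>

lemma good_element:
 obtains g where "g \<in> AA (Suc M)" "g \<noteq> 0" "\<And>p. p \<in> Pts ==> a p j0 \<noteq> 0 ==> val p g \<noteq> 0 ==> good p"
proof -
 have "\<exists>H. tr j \<or> algebraic_over (AA j) (z j) H" for j
  using algebraic_over_exists[OF AA_ring, of j "z j"] by (auto simp: tr_def)
 then obtain H where H: "\<And>j. \<not> tr j ==> algebraic_over (AA j) (z j) (H j)" by metis
 define u where "u j = (if tr j then 1 else poly (pderiv (H j)) (z j))" for j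
 define g where "g = (\<Prod>j\<le>M. u j)"
 have u0: "u j \<noteq> 0" for j
  using algebraic_over.separable[OF H char0] by (simp add: u_def)
 have uA: "u j \<in> AA (Suc M)" if j: "j \<le> M" for j
 proof (cases "tr j")
  case True
  then show ?thesis using subring1D(2)[OF AA_ring] by (simp add: u_def del: AA.simps)
 next
  case False
  have "pderiv (H j) \<in> polys (AA j)" using polys_closed(8)[OF AA_ring] H[OF False] by (simp add: algebraic_over_def)
  then have "u j \<in> AA (Suc j)" using False by (auto simp: u_def adj_def)
  then show ?thesis using AA_mono[of "Suc j" "Suc M"] j by (simp del: AA.simps)
 qed
 have gA: "(\<Prod>j\<in>S. u j) \<in> AA (Suc M)" if "S \<subseteq> {..M}" "finite S" for S
  using that(2,1) by (induction S rule: finite_induct)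
   (use subring1D(2,6)[OF AA_ring] uA in \<open>auto simp del: AA.simps\<close>)
 have "good p" if p: "p \<in> Pts" "a p j0 \<noteq> 0" "val p g \<noteq> 0" for p
 proof -
  note AO = AA_Ov[OF p(1,2)]
  have vu: "val p (u j) \<noteq> 0" if "j \<le> M" for j
  proof -
   have "g = u j * (\<Prod>i\<in>{..M} - {j}. u i)" unfolding g_def using that by (simp add: prod.remove)
   then show ?thesis using p(3) val_ops(2)[OF p(1) AO[OF uA[OF that]] AO[OF gA[of "{..M} - {j}"]]] by auto
  qed
  let ?I = "{(\<Sum>i<nv. r i * tpar p i) | r. \<forall>i<nv. r i \<in> Ov p}"
  have zO: "z i \<in> Ov p" for i using val_ratio(1)[OF p(1,2)] by (simp add: z_def)
  have I0: "0 \<in> ?I" using p by (intro CollectI exI[of _ "\<lambda>_. 0"]) (simp add: Ov_simps)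
  have Iadd: "x + y \<in> ?I" if xy: "x \<in> ?I" "y \<in> ?I" for x y
  proof -
   obtain r q where "x = (\<Sum>i<nv. r i * tpar p i)" "\<forall>i<nv. r i \<in> Ov p"
    "y = (\<Sum>i<nv. q i * tpar p i)" "\<forall>i<nv. q i \<in> Ov p" using xy by blast
   then show ?thesis using p
    by (intro CollectI exI[of _ "\<lambda>i. r i + q i"]) (simp add: Ov_simps distrib_right sum.distrib)
  qed
  have Imult: "c * x \<in> ?I" if cx: "c \<in> Ov p" "x \<in> ?I" for c x
  proof -
   obtain r where "x = (\<Sum>i<nv. r i * tpar p i)" "\<forall>i<nv. r i \<in> Ov p" using cx by blast
   then show ?thesis using p cx
    by (intro CollectI exI[of _ "\<lambda>i. c * r i"]) (simp add: Ov_simps sum_distrib_left mult.assoc)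
  qed
  have Isum: "sum f S \<in> ?I" if "\<And>i. i \<in> S ==> f i \<in> ?I" for f and S :: "nat set"
   using that
  proof (induction S rule: infinite_finite_induct)
   case (insert x F)
   then show ?case using Iadd[of "f x" "sum f F"] by simp
  qed (use I0 in auto)
  have Idiff: "x - y \<in> ?I" if xy: "x \<in> ?I" "y \<in> ?I" for x y
   using Iadd[OF xy(1) Imult[OF _ xy(2), of "- 1"]] p by (simp add: Ov_simps)
  \<comment> \<open>If the generators of \<open>AA j\<close> are constant modulo \<open>?I\<close>,
    so is every element.\<close>
  have step: "x - sc (val p x) \<in> ?I" if "\<And>l. l < j ==> z l - sc (val p (z l)) \<in> ?I" "x \<in> AA j" for x j
   using that
  proof (induction j arbitrary: x)
   case 0
   then show ?case using I0 p by auto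
  next
   case (Suc j)
   obtain q where q: "q \<in> polys (AA j)" "x = poly q (z j)" using Suc.prems(2) by (auto simp: adj_def)
   have c: "coeff q i \<in> AA j" for i using polys_closed(10)[OF AA_ring q(1)] .
   let ?c = "\<lambda>x. x - sc (val p x)"
   have m: "?c (x * y) \<in> ?I" if xy: "x \<in> Ov p" "y \<in> Ov p" "?c x \<in> ?I" "?c y \<in> ?I" for x y
   proof -
    have "?c (x * y) = y * ?c x + sc (val p x) * ?c y"
     using val_ops(2)[OF p(1) xy(1,2)] by (simp add: sc_simps algebra_simps)
    then show ?thesis using Iadd[OF Imult[OF xy(2,3)] Imult[OF sc_in_Ov[OF p(1)] xy(4)]] by simp
   qed
   have zp: "?c (z j ^ i) \<in> ?I" for i
   proof (induction i)
    case 0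
    then show ?case using I0 p(1) by (simp add: sc_simps)
   next
    case (Suc i)
    then show ?case using m[OF zO Ov_simps(7)[OF p(1) zO]] Suc.prems Suc.IH \<open>\<And>l. l < Suc j ==> ?c (z l) \<in> ?I\<close> by simp
   qed
   have t: "?c (coeff q i * z j ^ i) \<in> ?I" for i
    by (rule m[OF AO[OF c] Ov_simps(7)[OF p(1) zO] Suc.IH[OF Suc.prems(1) c] zp]) simp
   have "?c x = (\<Sum>i\<le>degree q. ?c (coeff q i * z j ^ i))"
    unfolding q(2) poly_altdef using p(1) AO[OF c] zO
    by (simp add: val_sum Ov_simps sum_subtractf sc_simps)
   then show ?case using Isum[of "{..degree q}", OF t] by simp
  qed
  have zI: "z j - sc (val p (z j)) \<in> ?I" if "j \<le> M" for j
   using that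
  proof (induction j rule: less_induct)
   case (less j)
   show ?case
   proof (cases "tr j")
    case True
    then have "j \<in> set idx" using less.prems by (auto simp: idx_def simp del: upt_Suc)
    then obtain i where i: "i < nv" "idx ! i = j" by (metis in_set_conv_nth)
    have "z j - sc (val p (z j)) = (\<Sum>l<nv. (if l = i then 1 else 0) * tpar p l)"
     using i by (simp add: sum_indicator tpar_def Xs_nth)
    then show ?thesis using p(1) by (intro CollectI exI[of _ "\<lambda>l. if l = i then 1 else 0"]) (simp add: Ov_simps)
   next
    case False
    interpret h: algebraic_over "AA j" "z j" "H j" by (rule H[OF False])
    let ?y = "z j" and ?c = "sc (val p (z j))"
    define Q where "Q = synthetic_div (H j) ?c"
    \<comment> \<open>Division by \<open>x - c\<close>, where \<open>c\<close> is the value of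
      \<open>z j\<close>. At \<open>z j\<close> the quotient \<open>Q\<close> has the residue of the
      derivative, hence is a unit, while the remainder lies in \<open>AA j\<close> and therefore, by
      induction, in \<open>?I\<close>.\<close>
    have eq: "H j = [:- ?c, 1:] * Q + [:poly (H j) ?c:]"
     unfolding Q_def by (rule synthetic_div_correct'[symmetric])
    have Q: "Q \<in> polys (AA j)" unfolding Q_def by (rule synthetic_div_polys[OF AA_ring sc_AA h.H(1)])
    have in_Ov: "poly q ?y \<in> Ov p" if "q \<in> polys (AA j)" for q
     by (rule AO[of _ "Suc j"]) (use that in \<open>auto simp: adj_def\<close>)
    have y: "?y - ?c \<in> Ov p" "val p (?y - ?c) = 0"
     using zO[of j] p(1) by (simp_all add: Ov_simps sc_in_Ov val_diff)
    have rA: "poly (H j) ?c \<in> AA j" by (rule poly_in_ring[OF AA_ring h.H(1) sc_AA])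
    have r: "(?y - ?c) * poly Q ?y = - poly (H j) ?c"
     using arg_cong[OF eq, of "\<lambda>q. poly q ?y"] h.H(3) by (simp add: eq_neg_iff_add_eq_0 algebra_simps)
    have "val p (poly (H j) ?c) = 0"
     using arg_cong[OF r, of "val p"] p(1) y in_Ov[OF Q] AO[OF rA] by (simp add: val_ops val_uminus)
    then have "poly (H j) ?c \<in> ?I" using step[of j, OF _ rA] less.IH less.prems by (simp add: sc_simps)
    from Idiff[OF I0 this] have I: "poly Q ?y * (?y - ?c) \<in> ?I" using r by (simp add: mult.commute)
    have "pderiv (H j) = Q + [:- ?c, 1:] * pderiv Q"
     by (subst eq) (simp only: pderiv_add pderiv_mult, simp add: pderiv_pCons)
    from arg_cong[OF this, of "\<lambda>q. poly q ?y"] have "u j = poly Q ?y + (?y - ?c) * poly (pderiv Q) ?y" using False by (simp add: u_def algebra_simps)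
    then have "val p (u j) = val p (poly Q ?y)"
     using y in_Ov[OF Q] in_Ov[OF polys_closed(8)[OF AA_ring Q]] p(1) by (simp add: val_ops Ov_simps)
    then have u: "isu p (poly Q ?y)" using vu[OF less.prems] in_Ov[OF Q] by (simp add: isu_def)
    then have "inverse (poly Q ?y) \<in> Ov p" using isu_inverse[OF p(1)] by (simp add: isu_def)
    moreover have "inverse (poly Q ?y) * (poly Q ?y * (?y - ?c)) = ?y - ?c" using isu_nz[OF p(1) u] by simp
    ultimately show ?thesis using Imult[OF _ I, of "inverse (poly Q ?y)"] by (simp only:)
   qed
  qed
  have "max_ideal (Ov p) = ?I"
  proof
   show "max_ideal (Ov p) \<subseteq> ?I"
   proof
    fix f assume "f \<in> max_ideal (Ov p)"
    then obtain r where r: "\<And>i. r i \<in> Ov p" "f = (\<Sum>i\<le>M. r i * (s i / s j0 - sc (a p i / a p j0)))"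
     using max_ideal_generators[OF p(1,2)] by blast
    have "s i / s j0 - sc (a p i / a p j0) = z i - sc (val p (z i))" for i
     using val_ratio(2)[OF p(1,2)] by (simp add: z_def)
    then show "f \<in> ?I" unfolding r(2) using zI r(1) by (intro Isum Imult) auto
   qed
   show "?I \<subseteq> max_ideal (Ov p)"
   proof
    fix f assume "f \<in> ?I"
    then obtain r where r: "\<forall>i<nv. r i \<in> Ov p" "f = (\<Sum>i<nv. r i * tpar p i)" by blast
    show "f \<in> max_ideal (Ov p)" unfolding r(2) mp_1[OF p(1), symmetric]
     using r(1) tpar_max_ideal[OF p(1,2)] mp_1[OF p(1)] by (intro mp_sum[OF p(1)] mp_mult_left[OF p(1)]) auto
   qed
  qed
  then show ?thesis using p unfolding good_def by blast
 qed
 then show thesis using that[of g] gA[of "{..M}"] u0 by (simp add: g_def)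
qed

text \<open>Differentiation with respect to the \<open>i\<close>-th member of the transcendence
  basis, obtained from \<open>der_exists\<close>.\<close>

definition pder :: "nat \<Rightarrow> 'k \<Rightarrow> 'k" where
 "pder i = (SOME \<delta>. der \<delta> \<and> (\<forall>l\<le>M. tr l \<longrightarrow> \<delta> (z l) = (if l = idx ! i then 1 else 0)))"

lemma pder: "der (pder i)" "i < nv ==> l < nv ==> pder i (tpar p l) = (if i = l then 1 else 0)"
proof -
 have *: "der (pder i) \<and> (\<forall>l\<le>M. tr l \<longrightarrow> pder i (z l) = (if l = idx ! i then 1 else 0))"
  unfolding pder_def by (rule someI_ex[OF der_exists[of "\<lambda>l. if l = idx ! i then 1 else 0"]])
 then show "der (pder i)" by blast
 then show "pder i (tpar p l) = (if i = l then 1 else 0)" if "i < nv" "l < nv"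
  using * idx_nth[of l] distinct_idx that by (auto simp: tpar_def Xs_nth derD nth_eq_iff_index_eq)
qed

end

section \<open>Leading forms\<close>

text \<open>The finitely many exponents become lists in a box, which reduces the claim to
  \<open>mbox_polynomial_nonzero\<close>.\<close>

lemma mpoly_zero:
 assumes z: "\<And>w. ceval w P = 0" shows "P = (0 :: mpoly)"
proof (rule ccontr)
 assume "P \<noteq> 0"
 let ?K = "Poly_Mapping.keys P"
 obtain \<mu>0 where m0: "\<mu>0 \<in> ?K" using \<open>P \<noteq> 0\<close> by (metis ex_in_conv keys_eq_empty)
 define n where "n = Suc (Max (\<Union>\<mu>\<in>?K. Poly_Mapping.keys \<mu>))"
 define \<tau> where "\<tau> = Max (\<Union>\<mu>\<in>?K. Poly_Mapping.lookup \<mu> ` {..<n})"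
 have sub: "Poly_Mapping.keys \<mu> \<subseteq> {..<n}" if "\<mu> \<in> ?K" for \<mu>
  unfolding n_def using that by (auto simp: less_Suc_eq_le intro!: Max_ge)
 define L where "L \<mu> = map (Poly_Mapping.lookup \<mu>) [0..<n]" for \<mu> :: "nat \<Rightarrow>\<^sub>0 nat"
 have inj: "\<mu> = \<nu>" if "\<mu> \<in> ?K" "\<nu> \<in> ?K" "L \<mu> = L \<nu>" for \<mu> \<nu>
 proof (rule poly_mapping_eqI)
  fix i
  show "Poly_Mapping.lookup \<mu> i = Poly_Mapping.lookup \<nu> i"
  proof (cases "i < n")
   case True
   then show ?thesis using that(3) by (simp add: L_def)
  next
   case False
   then show ?thesis using sub that(1,2) by (metis in_keys_iff lessThan_iff subsetD)
  qed
 qed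
 have Lb: "L ` ?K \<subseteq> mbox n \<tau>"
  unfolding L_def mbox_def \<tau>_def by (auto intro!: Max_ge) blast
 define c where "c \<alpha> = (\<Sum>\<mu>\<in>{\<mu>\<in>?K. L \<mu> = \<alpha>}. Poly_Mapping.lookup P \<mu>)" for \<alpha>
 have "{\<mu>\<in>?K. L \<mu> = L \<mu>0} = {\<mu>0}" using inj m0 by blast
 then have "c (L \<mu>0) \<noteq> 0" using m0 by (simp add: c_def in_keys_iff)
 then have "\<exists>\<alpha>\<in>mbox n \<tau>. c \<alpha> \<noteq> 0" using Lb m0 by blast
 then obtain ys where ys: "length ys = n" "(\<Sum>\<alpha>\<in>mbox n \<tau>. c \<alpha> * lmon \<alpha> ys) \<noteq> 0"
  using mbox_polynomial_nonzero by blast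
 let ?w = "\<lambda>i. ys ! i"
 have lm: "lmon (map f [0..<length ys]) ys = (\<Prod>i<length ys. ys ! i ^ f i)" for f
 proof (induction ys arbitrary: f)
  case (Cons y ys)
  have "map f [0..<length (y # ys)] = f 0 # map (\<lambda>i. f (Suc i)) [0..<length ys]"
   unfolding length_Cons upt_conv_Cons[OF zero_less_Suc] map_Suc_upt[symmetric] by simp
  then show ?case using Cons.IH[of "\<lambda>i. f (Suc i)"] by (simp add: prod.lessThan_Suc_shift del: upt_Suc prod.lessThan_Suc)
 qed simp
 have lL: "lmon (L \<mu>) ys = mon ?w \<mu>" if "\<mu> \<in> ?K" for \<mu>
  unfolding L_def ys(1)[symmetric] lm using sub[OF that] unfolding mon_def ys(1)[symmetric]
  by (intro prod.mono_neutral_right) (auto simp: in_keys_iff)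
 have "(\<Sum>\<alpha>\<in>mbox n \<tau>. c \<alpha> * lmon \<alpha> ys) = (\<Sum>\<alpha>\<in>mbox n \<tau>. \<Sum>\<mu>\<in>{\<mu>\<in>?K. L \<mu> = \<alpha>}. Poly_Mapping.lookup P \<mu> * mon ?w \<mu>)"
  unfolding c_def sum_distrib_right using lL by (intro sum.cong refl) auto
 also have "\<dots> = (\<Sum>\<mu>\<in>?K. Poly_Mapping.lookup P \<mu> * mon ?w \<mu>)"
  using Lb by (intro sum.group) (auto simp: mbox_card)
 also have "\<dots> = ceval ?w P" by (simp add: peval_def mon_def)
 finally show False using z ys(2) by simp
qed

text \<open>On the line through \<open>w\<close> and \<open>w'\<close> both polynomials restrict to
  nonzero polynomials in one variable. A linear subspace contains its lines, so the common point
  stays inside it.\<close>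

lemma common_nonzero_on_line:
 assumes "ceval w P \<noteq> 0" "ceval w' Q \<noteq> 0"
 obtains x where "ceval (\<lambda>i. w i + x * (w' i - w i)) P \<noteq> 0" "ceval (\<lambda>i. w i + x * (w' i - w i)) Q \<noteq> 0"
proof -
 let ?l = "\<lambda>P. peval (\<lambda>c. [:c:]) (\<lambda>i. [:w i, w' i - w i:]) P"
 have r: "rhom (\<lambda>c :: complex. [:c:])" by (simp add: rhom_def)
 have h: "rhom (\<lambda>p. poly p x)" for x :: complex by (simp add: rhom_def)
 have e: "poly (?l P) x = ceval (\<lambda>i. w i + x * (w' i - w i)) P" for P x
  using rhom_peval_comp[OF r h[of x], of "\<lambda>i. [:w i, w' i - w i:]" P] by simp
 have "poly (?l P) 0 \<noteq> 0" "poly (?l Q) 1 \<noteq> 0" using assms unfolding e by simp_all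
 then have "?l P * ?l Q \<noteq> 0" by auto
 then have "\<not> (UNIV \<subseteq> {x. poly (?l P * ?l Q) x = 0})"
  using poly_roots_finite infinite_UNIV_char_0 finite_subset by blast
 then obtain x where "poly (?l P * ?l Q) x \<noteq> 0" by blast
 then show thesis using that[of x] by (simp add: e)
qed

text \<open>Parameters at \<open>p\<close> with dual derivations, so that leading forms can be
  computed by differentiation.\<close>

locale lparam = model sc s M Pts a Ov
 for sc :: "complex \<Rightarrow> 'k::field" and s M Pts a Ov +
 fixes p :: point and n :: nat and t :: "nat \<Rightarrow> 'k" and \<delta> :: "nat \<Rightarrow> 'k \<Rightarrow> 'k"
 assumes p: "p \<in> Pts"
  and par: "max_ideal (Ov p) = {(\<Sum>i<n. r i * t i) | r. \<forall>i<n. r i \<in> Ov p}"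
  and der: "\<And>i. der (\<delta> i)"
  and dual: "\<And>i l. i < n ==> l < n ==> \<delta> i (t l) = (if i = l then 1 else 0)"
begin

definition dw :: "(nat \<Rightarrow> complex) \<Rightarrow> 'k \<Rightarrow> 'k" where
 "dw w f = (\<Sum>i<n. sc (w i) * \<delta> i f)"

text \<open>\<open>TT w k\<close> is \<open>1 / k!\<close> times the \<open>k\<close>-th iterate of \<open>dw w\<close>.\<close>

primrec TT :: "(nat \<Rightarrow> complex) \<Rightarrow> nat \<Rightarrow> 'k \<Rightarrow> 'k" where
 "TT w 0 f = f"
| "TT w (Suc k) f = sc (1 / of_nat (Suc k)) * dw w (TT w k f)"

text \<open>For \<open>A\<close> in the \<open>D\<close>-th power of the maximal ideal this is the
  leading form of degree \<open>D\<close> as a function of the direction \<open>w\<close>: the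
  \<open>D\<close>-th Taylor coefficient of \<open>A\<close> along \<open>w\<close>.\<close>

definition lf :: "nat \<Rightarrow> 'k \<Rightarrow> (nat \<Rightarrow> complex) \<Rightarrow> complex" where
 "lf D A w = val p (TT w D A)"

lemma t_max: assumes i: "i < n" shows "t i \<in> max_ideal (Ov p)"
 unfolding par using p i
 by (intro CollectI exI[of _ "\<lambda>l. if l = i then 1 else 0"]) (simp add: Ov_simps sum_indicator)

lemma der_dw: "der (dw w)"
 unfolding der_def dw_def
 using derD(1-3)[OF der] by (simp add: sum.distrib sum_distrib_left algebra_simps)

lemma delta_Ov: "i < n ==> f \<in> Ov p ==> \<delta> i f \<in> Ov p"
 by (rule der_parameters[OF p par _ der]) (use p dual in \<open>auto simp: submod_def Ov_simps\<close>)

lemma dw_Ov: "f \<in> Ov p ==> dw w f \<in> Ov p"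
 unfolding dw_def using delta_Ov p by (intro Ov_simps(8)[OF p] Ov_simps(6)[OF p] sc_in_Ov) auto

lemma dw_mp: "f \<in> mp p (Suc e) ==> dw w f \<in> mp p e"
proof (induction e arbitrary: f)
 case 0
 then show ?case using dw_Ov mp_Ov[OF p] by simp
next
 case (Suc e)
 from p Suc.prems show ?case
 proof (induction f rule: mp_induct)
  case (mult x y)
  have "x * dw w y \<in> mp p (Suc e)" using mult(1) Suc.IH[OF mult(2)] by (rule mp_Suc_I)
  moreover have "dw w x * y \<in> mp p (Suc e)"
   using mult p by (intro mp_mult_left[OF p] dw_Ov) (auto simp: max_ideal_iff)
  ultimately show ?case using mp_add[OF p] by (simp add: derD(3)[OF der_dw] mult.commute)
 qed (simp_all add: derD[OF der_dw] mp_zero mp_add p)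
qed

lemma TT_mp: "f \<in> mp p (D + k) ==> TT w k f \<in> mp p D"
 by (induction k arbitrary: D) (auto intro!: mp_mult_left[OF p] sc_in_Ov[OF p] dw_mp)

lemma TT_Ov: "f \<in> Ov p ==> TT w k f \<in> Ov p"
 by (induction k) (auto simp: Ov_simps p sc_in_Ov dw_Ov)

lemma TT_add: "TT w k (f + g) = TT w k f + TT w k g"
 by (induction k) (simp_all add: derD[OF der_dw] algebra_simps)

lemma TT_sc_mult: "TT w k (sc c * f) = sc c * TT w k f"
 by (induction k) (simp_all add: derD[OF der_dw] algebra_simps)

text \<open>Leibniz rule for divided powers: the factor \<open>1 / k!\<close> removes the binomial
  coefficients.\<close>

lemma TT_mult: "TT w m (f * g) = (\<Sum>i\<le>m. TT w i f * TT w (m - i) g)"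
proof (induction m)
 case (Suc m)
 let ?c = "\<lambda>k. sc (of_nat k)"
 have d: "dw w (TT w k f) = ?c (Suc k) * TT w (Suc k) f" for k f
 proof -
  have "?c (Suc k) * (sc (1 / of_nat (Suc k)) * x) = x" for x
   unfolding mult.assoc[symmetric] sc_simps(4)[symmetric] by (simp add: sc_simps del: of_nat_Suc)
  then show ?thesis by (simp only: TT.simps)
 qed
 have "dw w (TT w m (f * g)) = (\<Sum>i\<le>m. TT w i f * (?c (Suc (m - i)) * TT w (Suc (m - i)) g)) +
   (\<Sum>i\<le>m. TT w (m - i) g * (?c (Suc i) * TT w (Suc i) f))"
  unfolding Suc.IH derD(7)[OF der_dw] derD(3)[OF der_dw] d sum.distrib ..
 also have "(\<Sum>i\<le>m. TT w i f * (?c (Suc (m - i)) * TT w (Suc (m - i)) g)) =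
   (\<Sum>i\<le>Suc m. ?c (Suc m - i) * (TT w i f * TT w (Suc m - i) g))"
  by (simp add: Suc_diff_le ac_simps sc_simps(1) del: of_nat_Suc of_nat_diff TT.simps)
 also have "(\<Sum>i\<le>m. TT w (m - i) g * (?c (Suc i) * TT w (Suc i) f)) =
   (\<Sum>i\<le>Suc m. ?c i * (TT w i f * TT w (Suc m - i) g))"
  unfolding sum.atMost_Suc_shift by (simp add: ac_simps sc_simps(1) del: of_nat_Suc TT.simps)
 also have "(\<Sum>i\<le>Suc m. ?c (Suc m - i) * (TT w i f * TT w (Suc m - i) g)) + \<dots> =
   (\<Sum>i\<le>Suc m. ?c (Suc m) * (TT w i f * TT w (Suc m - i) g))"
  unfolding sum.distrib[symmetric] distrib_right[symmetric] sc_simps(3)[symmetric] of_nat_add[symmetric]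
  by (intro sum.cong refl) simp
 finally have "dw w (TT w m (f * g)) = ?c (Suc m) * (\<Sum>i\<le>Suc m. TT w i f * TT w (Suc m - i) g)"
  unfolding sum_distrib_left .
 then have "?c (Suc m) * TT w (Suc m) (f * g) = ?c (Suc m) * (\<Sum>i\<le>Suc m. TT w i f * TT w (Suc m - i) g)"
  unfolding d .
 then show ?case by (simp del: of_nat_Suc TT.simps sum.atMost_Suc)
qed simp

lemma TT_scale: "TT (\<lambda>i. c * w i) k f = sc (c ^ k) * TT w k f"
proof (induction k)
 case (Suc k)
 have "dw (\<lambda>i. c * w i) g = sc c * dw w g" for g
  by (simp add: dw_def sc_simps sum_distrib_left ac_simps)
 moreover have "dw w (sc b * g) = sc b * dw w g" for b g by (simp add: derD[OF der_dw])
 ultimately have "TT (\<lambda>i. c * w i) (Suc k) f = sc (1 / of_nat (Suc k)) * (sc c * (sc (c ^ k) * dw w (TT w k f)))"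
  by (simp only: TT.simps Suc)
 then show ?case by (simp only: TT.simps power_Suc sc_simps(4) ac_simps)
qed (simp add: sc_simps)

lemma lf_add: "A \<in> Ov p ==> B \<in> Ov p ==> lf D (A + B) w = lf D A w + lf D B w"
 by (simp add: lf_def TT_add val_ops p TT_Ov)

lemma lf_sc_mult: "A \<in> Ov p ==> lf D (sc c * A) w = c * lf D A w"
 by (simp add: lf_def TT_sc_mult val_ops p TT_Ov sc_in_Ov)

lemma lf_diff: "A \<in> Ov p ==> B \<in> Ov p ==> lf D (A - B) w = lf D A w - lf D B w"
 using lf_add[of A "sc (- 1) * B" D w] lf_sc_mult[of B D "- 1" w] p by (simp add: sc_simps Ov_simps)

lemma lf_scale: "A \<in> Ov p ==> lf D A (\<lambda>i. c * w i) = c ^ D * lf D A w"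
 by (simp add: lf_def TT_scale val_ops p TT_Ov sc_in_Ov)

lemma lf_zero: "A \<in> mp p (Suc D) ==> lf D A w = 0"
 using TT_mp[of A 1 D w] mp_1[OF p] by (simp add: lf_def max_ideal_iff p)

lemma lf_0: "lf 0 A w = val p A"
 by (simp add: lf_def)

lemma dw_t: "i < n ==> dw w (t i) = sc (w i)"
 unfolding dw_def by (subst sum.remove[of _ i]) (auto simp: dual intro!: sum.neutral)

lemma lf_t: "i < n ==> lf (Suc 0) (t i) w = w i"
 by (simp add: lf_def dw_t sc_simps p)

text \<open>In the Leibniz sum every term but \<open>i = d\<close> has a factor that is
  differentiated too few times and therefore vanishes at \<open>p\<close>.\<close>

lemma lf_mult:
 assumes A: "A \<in> mp p d" and B: "B \<in> mp p e"
 shows "lf (d + e) (A * B) w = lf d A w * lf e B w"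
proof -
 have O: "TT w i A \<in> Ov p" "TT w i B \<in> Ov p" for i using TT_Ov mp_Ov[OF p] A B by auto
 have z: "val p (TT w i A * TT w (d + e - i) B) = 0" if i: "i \<le> d + e" "i \<noteq> d" for i
 proof (cases "i < d")
  case True
  then have "A \<in> mp p (Suc 0 + i)" using mp_mono[OF p _ A, of "Suc 0 + i"] by simp
  from TT_mp[OF this, of w] have "val p (TT w i A) = 0" using mp_1[OF p] by (simp add: max_ideal_iff p)
  then show ?thesis by (simp add: val_ops p O)
 next
  case False
  then have "B \<in> mp p (Suc 0 + (d + e - i))" using i mp_mono[OF p _ B, of "Suc 0 + (d + e - i)"] by simp
  from TT_mp[OF this, of w] have "val p (TT w (d + e - i) B) = 0" using mp_1[OF p] by (simp add: max_ideal_iff p)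
  then show ?thesis by (simp add: val_ops p O)
 qed
 have "lf (d + e) (A * B) w = (\<Sum>i\<le>d + e. val p (TT w i A * TT w (d + e - i) B))"
  unfolding lf_def TT_mult using O p by (intro val_sum) (auto simp: Ov_simps)
 also have "\<dots> = val p (TT w d A * TT w e B)"
  using z by (subst sum.mono_neutral_right[of _ "{d}"]) auto
 finally show ?thesis by (simp add: lf_def val_ops p O)
qed

lemma lf_power: "A \<in> mp p d ==> lf (k * d) (A ^ k) w = lf d A w ^ k"
proof (induction k)
 case (Suc k)
 then show ?case using lf_mult[OF Suc.prems mp_power[OF p Suc.prems]] by simp
qed (simp add: lf_0 p)

abbreviation "trn w \<equiv> (\<lambda>i. if i < n then w i else 0)"

lemma t'_mp: "trn t i \<in> mp p (Suc 0)"
 using t_max p by (simp add: mp_1 max_ideal_iff Ov_simps)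

lemma peval_mp: assumes P: "homogeneous D P"
 shows "peval sc (trn t) P \<in> mp p D" "lf D (peval sc (trn t) P) w = ceval (trn w) P"
proof -
 have pr: "(\<Prod>i\<in>K. trn t i ^ \<mu> i) \<in> mp p (\<Sum>i\<in>K. \<mu> i) \<and>
   lf (\<Sum>i\<in>K. \<mu> i) (\<Prod>i\<in>K. trn t i ^ \<mu> i) w = (\<Prod>i\<in>K. trn w i ^ \<mu> i)" if "finite K" for K and \<mu> :: "nat \<Rightarrow> nat"
  using that
 proof (induction K rule: finite_induct)
  case (insert x F)
  have x: "trn t x ^ \<mu> x \<in> mp p (\<mu> x)" using mp_power[OF p t'_mp] by simp
  have l1: "lf (Suc 0) (trn t x) w = trn w x"
   by (cases "x < n") (simp_all add: lf_def dw_t sc_simps derD[OF der_dw] p)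
  have "lf (\<mu> x) (trn t x ^ \<mu> x) w = trn w x ^ \<mu> x" using lf_power[OF t'_mp, of "\<mu> x" x w] unfolding l1 by simp
  then show ?case using insert lf_mult[OF x, of _ _ w] mp_mult[OF p x] by simp
 qed (simp add: lf_0 p Ov_simps)
 have m: "mon (trn t) \<mu> \<in> mp p (mdeg \<mu>)" "lf (mdeg \<mu>) (mon (trn t) \<mu>) w = mon (trn w) \<mu>" for \<mu>
  using pr[of "Poly_Mapping.keys \<mu>" "Poly_Mapping.lookup \<mu>"] unfolding mon_def mdeg_def by auto
 have d: "mdeg \<mu> = D" if "\<mu> \<in> Poly_Mapping.keys P" for \<mu> using P that by (simp add: homogeneous_iff in_keys_iff)
 have "(\<Sum>\<mu>\<in>S. sc (f \<mu>) * mon (trn t) \<mu>) \<in> mp p D \<and>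
   lf D (\<Sum>\<mu>\<in>S. sc (f \<mu>) * mon (trn t) \<mu>) w = (\<Sum>\<mu>\<in>S. f \<mu> * mon (trn w) \<mu>)"
  if "finite S" "\<And>\<mu>. \<mu> \<in> S ==> mdeg \<mu> = D" for S f
  using that
 proof (induction S rule: finite_induct)
  case empty
  then show ?case using lf_zero[of 0 D w] by (simp add: mp_zero p)
 next
  case (insert \<mu> S)
  have e: "mon (trn t) \<mu> \<in> mp p D" "lf D (mon (trn t) \<mu>) w = mon (trn w) \<mu>" using m[of \<mu>] insert.prems by auto
  then have e': "sc (f \<mu>) * mon (trn t) \<mu> \<in> mp p D" "lf D (sc (f \<mu>) * mon (trn t) \<mu>) w = f \<mu> * mon (trn w) \<mu>"
   using lf_sc_mult[OF mp_Ov[OF p e(1)]] mp_mult_left[OF p sc_in_Ov[OF p]] by auto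
  have IH: "(\<Sum>\<mu>\<in>S. sc (f \<mu>) * mon (trn t) \<mu>) \<in> mp p D"
   "lf D (\<Sum>\<mu>\<in>S. sc (f \<mu>) * mon (trn t) \<mu>) w = (\<Sum>\<mu>\<in>S. f \<mu> * mon (trn w) \<mu>)" using insert by auto
  show ?case
   unfolding sum.insert[OF insert.hyps] using mp_add[OF p e'(1) IH(1)]
    lf_add[OF mp_Ov[OF p e'(1)] mp_Ov[OF p IH(1)], of D w] e'(2) IH(2) by simp
 qed
 from this[OF finite_keys d] show "peval sc (trn t) P \<in> mp p D" "lf D (peval sc (trn t) P) w = ceval (trn w) P"
  unfolding peval_def mon_def[symmetric] by auto
qed

lemma leading_poly: "A \<in> mp p D ==> \<exists>P. homogeneous D P \<and> A - peval sc (trn t) P \<in> mp p (Suc D)"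
proof (induction D arbitrary: A)
 case 0
 then show ?case using p
  by (intro exI[of _ "Const (val p A)"]) (simp add: sc mp_1 max_ideal_iff val_diff sc_in_Ov Ov_simps)
next
 case (Suc D)
 from p Suc.prems show ?case
 proof (induction A rule: mp_induct)
  case zero
  show ?case by (intro exI[of _ 0]) (simp add: mp_zero p)
 next
  case (add u v)
  then obtain P Q where "homogeneous (Suc D) P" "u - peval sc (trn t) P \<in> mp p (Suc (Suc D))"
   "homogeneous (Suc D) Q" "v - peval sc (trn t) Q \<in> mp p (Suc (Suc D))" by blast
  then show ?case using mp_add[OF p, of "u - peval sc (trn t) P" _ "v - peval sc (trn t) Q"]
   by (intro exI[of _ "P + Q"]) (simp add: homogeneous_add E_simps algebra_simps)
 next
  case (mult x y)
  obtain r where r: "x = (\<Sum>i<n. r i * t i)" "\<forall>i<n. r i \<in> Ov p" using mult(1) unfolding par by blast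
  obtain Q where Q: "homogeneous D Q" "y - peval sc (trn t) Q \<in> mp p (Suc D)" using Suc.IH[OF mult(2)] by blast
  define P where "P = (\<Sum>i<n. Const (val p (r i)) * Var i)"
  have P: "homogeneous 1 P" unfolding P_def by (intro homogeneous_sum homogeneous_smult homogeneous_Var)
  have "peval sc (trn t) P = (\<Sum>i<n. sc (val p (r i)) * t i)"
   unfolding P_def peval_sum[OF sc] by (intro sum.cong refl) (simp add: E_simps sc)
  then have "x - peval sc (trn t) P = (\<Sum>i<n. (r i - sc (val p (r i))) * t i)"
   unfolding r(1) by (simp add: left_diff_distrib sum_subtractf)
  also have "\<dots> \<in> mp p (Suc (Suc 0))"
   using r(2) p t_max by (intro mp_sum[OF p] mp_Suc_I) (simp_all add: mp_1 max_ideal_iff val_diff Ov_simps sc_in_Ov)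
  finally have x: "x - peval sc (trn t) P \<in> mp p (Suc (Suc 0))" .
  have "x * y - peval sc (trn t) (P * Q) = (x - peval sc (trn t) P) * y + peval sc (trn t) P * (y - peval sc (trn t) Q)"
   by (simp add: E_simps algebra_simps)
  moreover have "(x - peval sc (trn t) P) * y \<in> mp p (Suc (Suc D))" using mp_mult[OF p x mult(2)] by simp
  moreover have "peval sc (trn t) P * (y - peval sc (trn t) Q) \<in> mp p (Suc (Suc D))"
   using mp_mult[OF p peval_mp(1)[OF P] Q(2)] by simp
  ultimately have "x * y - peval sc (trn t) (P * Q) \<in> mp p (Suc (Suc D))" using mp_add[OF p] by simp
  then show ?case using homogeneous_mult[OF P Q(1)] by auto
 qed
qed

lemma lf_poly:
 assumes A: "A \<in> mp p D"
 obtains P where "\<And>w. lf D A w = ceval (trn w) P" "A - peval sc (trn t) P \<in> mp p (Suc D)"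
proof -
 obtain P where P: "homogeneous D P" "A - peval sc (trn t) P \<in> mp p (Suc D)" using leading_poly[OF A] by blast
 have "lf D A w = ceval (trn w) P" for w
  using lf_zero[OF P(2), of w] lf_diff[of A "peval sc (trn t) P" D w] peval_mp[OF P(1)] mp_Ov[OF p] A by simp
 then show thesis using P(2) that by blast
qed

text \<open>The converse of \<open>lf_zero\<close>: the leading form is a polynomial in
  \<open>w\<close>, and a polynomial vanishing everywhere is zero. Orders at \<open>p\<close> can
  thus be read off from \<open>lf\<close>.\<close>

lemma lf_eq_zero:
 assumes A: "A \<in> mp p D" and z: "\<And>w. lf D A w = 0" shows "A \<in> mp p (Suc D)"
proof -
 obtain P where P: "\<And>w. lf D A w = ceval (trn w) P" "A - peval sc (trn t) P \<in> mp p (Suc D)" using lf_poly[OF A] by blast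
 let ?T = "\<lambda>i. if i < n then Var i else 0"
 have e: "(\<lambda>i. peval c x (?T i)) = trn x" if "rhom c" for c :: "complex \<Rightarrow> 'b::comm_ring_1" and x
  using that by (auto simp: fun_eq_iff)
 have "psubst ?T P = 0"
  by (rule mpoly_zero) (simp only: peval_psubst[OF rhom_id] e[OF rhom_id] P(1)[symmetric] z)
 then have "peval sc (trn t) P = 0" using peval_psubst[OF sc, of t ?T P] unfolding e[OF sc] by simp
 then show ?thesis using P(2) by simp
qed

lemma lf_line:
 assumes A: "A \<in> mp p d" "lf d A w \<noteq> 0" and B: "B \<in> mp p e" "lf e B w' \<noteq> 0"
 obtains x where "lf d A (\<lambda>i. w i + x * (w' i - w i)) \<noteq> 0" "lf e B (\<lambda>i. w i + x * (w' i - w i)) \<noteq> 0"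
proof -
 obtain P where P: "\<And>w. lf d A w = ceval (trn w) P" "A - peval sc (trn t) P \<in> mp p (Suc d)" by (rule lf_poly[OF A(1)]) (rule that)
 obtain Q where Q: "\<And>w. lf e B w = ceval (trn w) Q" "B - peval sc (trn t) Q \<in> mp p (Suc e)" by (rule lf_poly[OF B(1)]) (rule that)
 have "ceval (trn w) P \<noteq> 0" "ceval (trn w') Q \<noteq> 0" using A(2) B(2) unfolding P(1) Q(1) .
 then obtain x where "ceval (\<lambda>i. trn w i + x * (trn w' i - trn w i)) P \<noteq> 0" "ceval (\<lambda>i. trn w i + x * (trn w' i - trn w i)) Q \<noteq> 0"
  by (rule common_nonzero_on_line)
 moreover have "(\<lambda>i. trn w i + x * (trn w' i - trn w i)) = trn (\<lambda>i. w i + x * (w' i - w i))" by auto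
 ultimately show thesis using that[of x] unfolding P(1) Q(1) by simp
qed

end

section \<open>Points of the blow-up\<close>

lemma sum_fun_app: "(sum f S) x = (\<Sum>i\<in>S. f i x)" for f :: "'i \<Rightarrow> 'a \<Rightarrow> complex"
 by (induction S rule: infinite_finite_induct) auto

locale xparam = lparam "scalar X" s M "points X" a "local_ring X" p n t \<delta>
 for X :: "'k::field projvar" and s M a p n t \<delta>
begin

abbreviation "sc \<equiv> scalar X"
abbreviation "Ov \<equiv> local_ring X"

lemma value_at_eq: "value_at X p = val p"
 by (simp add: value_at_def val_def fun_eq_iff)

lemma mp_eq: "ideal_pow (Ov p) (max_ideal (Ov p)) e = mp p e"
 by (simp add: mp_def)

subsection \<open>Tangent vectors\<close>

definition tv :: "(nat \<Rightarrow> complex) \<Rightarrow> 'k \<Rightarrow> complex" where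
 "tv w f = (if f \<in> Ov p then lf (Suc 0) f w else 0)"

definition ev :: "nat \<Rightarrow> nat \<Rightarrow> complex" where
 "ev i = (\<lambda>l. if l = i then 1 else 0)"

lemma tv_t: "i < n ==> tv w (t i) = w i"
 using t_max[of i] by (simp add: tv_def lf_t max_ideal_iff p)

lemma lf_1: "lf (Suc 0) f w = val p (dw w f)"
 by (simp add: lf_def sc_simps)

lemma lf_1_sum: "f \<in> Ov p ==> lf (Suc 0) f w = (\<Sum>i<n. w i * val p (\<delta> i f))"
 unfolding lf_1 dw_def using p delta_Ov[of _ f]
 by (subst val_sum) (auto simp: Ov_simps sc_in_Ov val_ops)

lemma tv_sum: "tv w = (\<Sum>i<n. (\<lambda>f. w i * tv (ev i) f))"
proof
 fix f
 have "val p (\<delta> i f) = lf (Suc 0) f (ev i)" if "i < n" "f \<in> Ov p" for i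
  using that by (simp add: lf_1_sum ev_def sum_indicator)
 then show "tv w f = (\<Sum>i<n. (\<lambda>f. w i * tv (ev i) f)) f"
  unfolding sum_fun_app by (auto simp: tv_def lf_1_sum[of f w] intro!: sum.cong)
qed

lemma tv_scale: "tv (\<lambda>i. c * w i) = (\<lambda>f. c * tv w f)"
 by (auto simp: tv_def fun_eq_iff lf_scale)

lemma tv_eq_0_iff: "tv w = 0 \<longleftrightarrow> (\<forall>i<n. w i = 0)"
proof
 assume z: "tv w = 0"
 show "\<forall>i<n. w i = 0" using tv_t[of _ w] unfolding z by simp
next
 assume "\<forall>i<n. w i = 0"
 then show "tv w = 0" unfolding tv_sum[of w] by (intro sum.neutral) (auto simp: fun_eq_iff)
qed

lemma tangent_space_eq: "tangent_space X p = range tv"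
proof
 show "range tv \<subseteq> tangent_space X p"
 proof
  fix v assume "v \<in> range tv"
  then obtain w where v: "v = tv w" by blast
  have "lf (Suc 0) (f * g) w = val p f * lf (Suc 0) g w + val p g * lf (Suc 0) f w" if "f \<in> Ov p" "g \<in> Ov p" for f g
   using that p by (simp add: lf_1 derD(3)[OF der_dw] val_ops Ov_simps dw_Ov)
  then show "v \<in> tangent_space X p"
   unfolding tangent_space_def v value_at_eq using p
   by (auto simp: tv_def Ov_simps lf_1 derD(1,2)[OF der_dw] val_ops dw_Ov)
 qed
 show "tangent_space X p \<subseteq> range tv"
 proof
  fix v assume "v \<in> tangent_space X p"
  then have out: "\<And>f. f \<notin> Ov p ==> v f = 0" and vs: "\<And>c. v (sc c) = 0"
   and va: "\<And>f g. f \<in> Ov p ==> g \<in> Ov p ==> v (f + g) = v f + v g"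
   and vm: "\<And>f g. f \<in> Ov p ==> g \<in> Ov p ==> v (f * g) = val p f * v g + val p g * v f"
   unfolding tangent_space_def value_at_eq by auto
  have v0: "v 0 = 0" using vs[of 0] by (simp add: sc_simps)
  have vS: "v (sum f S) = (\<Sum>i\<in>S. v (f i))" if "\<And>i. i \<in> S ==> f i \<in> Ov p" for f and S :: "nat set"
   using that by (induction S rule: infinite_finite_induct) (simp_all add: v0 va Ov_simps p)
  have "v f = tv (\<lambda>i. v (t i)) f" for f
  proof (cases "f \<in> Ov p")
   case True
   have "f - sc (val p f) \<in> max_ideal (Ov p)" using True p by (simp add: max_ideal_iff val_diff sc_in_Ov Ov_simps)
   then obtain r where r: "f - sc (val p f) = (\<Sum>i<n. r i * t i)" "\<forall>i<n. r i \<in> Ov p" unfolding par by blast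
   have f: "f = sc (val p f) + (\<Sum>i<n. r i * t i)" using r(1) by (simp add: algebra_simps)
   have tO: "t i \<in> Ov p" "val p (t i) = 0" if "i < n" for i using t_max[OF that] by (simp_all add: max_ideal_iff p)
   have rt: "r i * t i \<in> Ov p" if "i < n" for i using r(2) tO that p by (simp add: Ov_simps)
   have "v f = v (\<Sum>i<n. r i * t i)"
    using va[OF sc_in_Ov[OF p, of "val p f"] Ov_simps(8)[OF p], of "{..<n}" "\<lambda>i. r i * t i"] rt vs
    unfolding f[symmetric] by simp
   also have "\<dots> = (\<Sum>i<n. v (r i * t i))" using rt by (intro vS) auto
   also have "\<dots> = (\<Sum>i<n. val p (r i) * v (t i))" using r(2) tO by (intro sum.cong refl) (simp add: vm)
   finally have "v f = (\<Sum>i<n. val p (r i) * v (t i))" .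
   moreover have "lf (Suc 0) f w = (\<Sum>i<n. val p (r i) * w i)" for w
   proof -
    have "dw w f = (\<Sum>i<n. dw w (r i * t i))" by (subst f) (simp add: derD[OF der_dw])
    moreover have "val p (dw w (r i * t i)) = val p (r i) * w i" if "i < n" for i
     using that r(2) tO p by (simp add: derD[OF der_dw] dw_t val_ops Ov_simps sc_in_Ov dw_Ov)
    moreover have "val p (\<Sum>i<n. dw w (r i * t i)) = (\<Sum>i<n. val p (dw w (r i * t i)))"
     using rt by (intro val_sum[OF p] dw_Ov) auto
    ultimately show ?thesis unfolding lf_1 by simp
   qed
   ultimately show ?thesis using True by (simp add: tv_def)
  qed (simp add: out tv_def)
  then have "v = tv (\<lambda>i. v (t i))" by blast
  then show "v \<in> range tv" by blast
 qed
qed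

text \<open>The tangent vectors \<open>tv w\<close> with \<open>w\<close> in \<open>Ws l\<close>
  form a subspace of codimension \<open>l\<close>; these subspaces are the flag along which
  valuations are computed.\<close>

definition Ws :: "nat \<Rightarrow> (nat \<Rightarrow> complex) set" where "Ws l = {w. \<forall>i<l. w i = 0}"

lemma Ws_span: "l \<le> n ==> tv ` Ws l = cfun.span (tv ` ev ` {l..<n})"
proof
 assume l: "l \<le> n"
 show "tv ` Ws l \<subseteq> cfun.span (tv ` ev ` {l..<n})"
 proof
  fix v assume "v \<in> tv ` Ws l"
  then obtain w where w: "v = tv w" "\<forall>i<l. w i = 0" by (auto simp: Ws_def)
  have "v = (\<Sum>i\<in>{l..<n}. (\<lambda>f. w i * tv (ev i) f))"
   unfolding w(1) tv_sum[of w] using w(2) by (intro sum.mono_neutral_right) (auto simp: fun_eq_iff)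
  also have "\<dots> \<in> cfun.span (tv ` ev ` {l..<n})"
   by (intro cfun.span_sum cfun.span_scale cfun.span_base) auto
  finally show "v \<in> cfun.span (tv ` ev ` {l..<n})" .
 qed
 have add: "tv w + tv w' = tv (\<lambda>i. w i + w' i)" for w w'
  unfolding tv_sum[of w] tv_sum[of w'] tv_sum[of "\<lambda>i. w i + w' i"] sum.distrib[symmetric]
  by (intro sum.cong refl) (auto simp: fun_eq_iff algebra_simps)
 have "cfun.subspace (tv ` Ws l)"
  unfolding cfun.subspace_def
 proof (intro conjI ballI allI)
  show "0 \<in> tv ` Ws l" using tv_eq_0_iff[of "\<lambda>_. 0"] by (auto simp: Ws_def intro!: image_eqI[of _ _ "\<lambda>_. 0"])
  fix v assume "v \<in> tv ` Ws l"
  then obtain w where w: "v = tv w" "w \<in> Ws l" by blast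
  show "(\<lambda>f. c * v f) \<in> tv ` Ws l" for c
   using w(2) unfolding w(1) tv_scale[symmetric] by (auto simp: Ws_def)
  fix v' assume "v' \<in> tv ` Ws l"
  then obtain w' where w': "v' = tv w'" "w' \<in> Ws l" by blast
  show "v + v' \<in> tv ` Ws l" using w(2) w'(2) unfolding w(1) w'(1) add by (auto simp: Ws_def)
 qed
 then show "cfun.span (tv ` ev ` {l..<n}) \<subseteq> tv ` Ws l"
  by (intro cfun.span_minimal) (auto simp: Ws_def ev_def)
qed

lemma independent_tv: "\<not> cfun.dependent (tv ` ev ` {l..<n})" and card_tv: "card (tv ` ev ` {l..<n}) = n - l"
proof -
 have inj: "inj_on (\<lambda>i. tv (ev i)) {l..<n}"
 proof (rule inj_onI)
  fix i j assume ij: "i \<in> {l..<n}" "j \<in> {l..<n}" "tv (ev i) = tv (ev j)"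
  then have "ev i i = ev j i" using tv_t[of i "ev i"] tv_t[of i "ev j"] by simp
  then show "i = j" by (simp add: ev_def split: if_splits)
 qed
 then show "card (tv ` ev ` {l..<n}) = n - l" unfolding image_image by (simp add: card_image)
 show "\<not> cfun.dependent (tv ` ev ` {l..<n})"
 proof
  assume "cfun.dependent (tv ` ev ` {l..<n})"
  then obtain u where u: "\<exists>v\<in>tv ` ev ` {l..<n}. u v \<noteq> 0" "(\<Sum>v\<in>tv ` ev ` {l..<n}. (\<lambda>f. u v * v f)) = 0"
   by (subst (asm) cfun.dependent_finite) auto
  then obtain i where i: "i \<in> {l..<n}" "u (tv (ev i)) \<noteq> 0" by blast
  have "(\<Sum>j\<in>{l..<n}. (\<lambda>f. u (tv (ev j)) * tv (ev j) f)) = 0"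
   using u(2) inj unfolding image_image by (simp add: sum.reindex)
  then have "(\<Sum>j\<in>{l..<n}. (\<lambda>f. u (tv (ev j)) * tv (ev j) f)) (t i) = 0" by simp
  then have "(\<Sum>j\<in>{l..<n}. u (tv (ev j)) * ev j i) = 0" unfolding sum_fun_app using i(1) by (simp add: tv_t)
  then show False using i by (simp add: ev_def sum.delta' if_distrib cong: if_cong)
 qed
qed

lemma dim_Ws: "l \<le> n ==> cfun.dim (tv ` Ws l) = n - l"
 using cfun.dim_span_eq_card_independent[OF independent_tv[of l]] card_tv[of l] by (simp only: Ws_span)

lemma subspace_Ws: "l \<le> n ==> cfun.subspace (tv ` Ws l)"
 by (simp add: Ws_span)

lemma dim_tangent_space: "cfun.dim (tangent_space X p) = n"
 using dim_Ws[of 0] by (simp add: tangent_space_eq Ws_def)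

lemma directions_iff:
 assumes V: "cfun.subspace V"
 shows "l \<in> directions V \<longleftrightarrow> (\<exists>v\<in>V. v \<noteq> 0 \<and> l = cfun.span {v})"
proof
 assume l: "l \<in> directions V"
 then have l': "cfun.subspace l" "l \<subseteq> V" "cfun.dim l = 1" by (auto simp: directions_def)
 obtain B where B: "B \<subseteq> l" "\<not> cfun.dependent B" "l \<subseteq> cfun.span B" "card B = cfun.dim l" by (rule cfun.basis_exists)
 then obtain v where v: "B = {v}" using l'(3) by (metis One_nat_def card_1_singletonE)
 have "l = cfun.span {v}" using B(1,3) v cfun.span_minimal[OF _ l'(1), of B] by auto
 then show "\<exists>v\<in>V. v \<noteq> 0 \<and> l = cfun.span {v}" using B(1,2) v l'(2) by (intro bexI[of _ v]) auto
next
 assume "\<exists>v\<in>V. v \<noteq> 0 \<and> l = cfun.span {v}"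
 then obtain v where v: "v \<in> V" "v \<noteq> 0" "l = cfun.span {v}" by blast
 then show "l \<in> directions V"
  using cfun.span_minimal[OF _ V, of "{v}"] cfun.dim_span_eq_card_independent[of "{v}"] by (simp add: directions_def)
qed

lemma proj_tangent_iff:
 assumes l: "l \<le> n"
 shows "x \<in> proj_tangent p (tv ` Ws l) \<longleftrightarrow> (\<exists>w\<in>Ws l. (\<exists>i<n. w i \<noteq> 0) \<and> x = Direction p (cfun.span {tv w}))"
proof -
 have "x \<in> proj_tangent p (tv ` Ws l) \<longleftrightarrow> (\<exists>w\<in>Ws l. tv w \<noteq> 0 \<and> x = Direction p (cfun.span {tv w}))"
  unfolding proj_tangent_def using directions_iff[OF subspace_Ws[OF l]] by (auto simp del: cfun.span_singleton)
 then show ?thesis unfolding tv_eq_0_iff by simp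
qed

subsection \<open>Local rings of the blow-up\<close>

text \<open>The local ring of the blow-up at the direction \<open>w\<close>, described without
  charts; see \<open>blowup_ring_eq\<close>.\<close>

definition BR :: "(nat \<Rightarrow> complex) \<Rightarrow> 'k set" where
 "BR w = {A / B | A B. \<exists>D. A \<in> mp p D \<and> B \<in> mp p D \<and> lf D B w \<noteq> 0}"

lemma lf_nz: "lf D B w \<noteq> 0 ==> B \<noteq> 0"
 using lf_zero[of 0 D w] by (auto simp: mp_zero p)

text \<open>A point of the chart is determined by its values on the quotients \<open>x / u\<close>
  with \<open>x\<close> in the maximal ideal; multiplicativity of leading forms extends the formula
  to higher powers.\<close>

lemma chart_point_eq:
 assumes \<phi>: "chart_point X p u v \<phi>" and u: "u \<in> max_ideal (Ov p)" "u \<noteq> 0" and v: "v = tv w"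
 shows "b \<in> mp p e ==> \<phi> (b / u ^ e) = lf e b w / v u ^ e"
proof (induction e arbitrary: b)
 case 0
 then show ?case using \<phi> unfolding chart_point_def value_at_eq by (simp add: lf_0)
next
 case (Suc e)
 note C = \<phi>[unfolded chart_point_def blowup_chart_def mp_eq]
 have ch: "x / u ^ d \<in> {a / u ^ d | a d. a \<in> mp p d}" if "x \<in> mp p d" for x d using that by blast
 have fa: "\<phi> (x / u ^ d + y / u ^ e') = \<phi> (x / u ^ d) + \<phi> (y / u ^ e')"
  and fm: "\<phi> (x / u ^ d * (y / u ^ e')) = \<phi> (x / u ^ d) * \<phi> (y / u ^ e')"
  if "x \<in> mp p d" "y \<in> mp p e'" for x y d e' using C ch[OF that(1)] ch[OF that(2)] by blast+
 from p Suc.prems show ?case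
 proof (induction b rule: mp_induct)
  case zero
  have "\<phi> 0 = 0" using C p by (auto simp: value_at_eq Ov_simps)
  then show ?case using lf_zero[of 0 "Suc e" w] by (simp add: mp_zero p)
 next
  case (add x y)
  then show ?case using fa[OF add(1,2)] mp_Ov[OF p] by (simp add: add_divide_distrib lf_add)
 next
  case (mult x y)
  have x: "x \<in> mp p (Suc 0)" "x \<in> Ov p" using mult(1) mp_1[OF p] by (auto simp: max_ideal_iff p)
  have "\<phi> (x / u ^ Suc 0) = v x / v u" using C mult(1) by simp
  then have "\<phi> (x / u ^ Suc 0 * (y / u ^ e)) = lf (Suc 0) x w / v u * (lf e y w / v u ^ e)"
   unfolding fm[OF x(1) mult(2)] Suc.IH[OF mult(2)] using x(2) by (simp add: v tv_def)
  then show ?case using lf_mult[OF x(1) mult(2), of w] by simp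
 qed
qed

lemma blowup_ring_eq:
 assumes w: "i0 < n" "w i0 \<noteq> 0"
 shows "blowup_ring X (Direction p (cfun.span {tv w})) = BR w"
proof
 show "blowup_ring X (Direction p (cfun.span {tv w})) \<subseteq> BR w"
 proof
  fix f assume "f \<in> blowup_ring X (Direction p (cfun.span {tv w}))"
  then obtain u v \<phi> x y where u: "u \<in> max_ideal (Ov p)" "v \<in> cfun.span {tv w}" "v u \<noteq> 0"
   and \<phi>: "chart_point X p u v \<phi>" "x \<in> blowup_chart X p u" "y \<in> blowup_chart X p u" "\<phi> y \<noteq> 0" "f = x / y" by auto
  obtain c where "v = (\<lambda>f. c * tv w f)" using u(2) unfolding cfun.span_singleton by blast
  then have v: "v = tv (\<lambda>i. c * w i)" by (simp add: tv_scale)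
  have uO: "u \<in> Ov p" "u \<in> mp p (Suc 0)" using u(1) mp_1[OF p] by (auto simp: max_ideal_iff p)
  have "u \<noteq> 0" using u(3) lf_zero[of 0 "Suc 0"] by (auto simp: v tv_def mp_zero p split: if_splits)
  obtain A d where A: "x = A / u ^ d" "A \<in> mp p d" using \<phi>(2) unfolding blowup_chart_def mp_eq by blast
  obtain B e where B: "y = B / u ^ e" "B \<in> mp p e" using \<phi>(3) unfolding blowup_chart_def mp_eq by blast
  have "lf e B (\<lambda>i. c * w i) \<noteq> 0" using chart_point_eq[OF \<phi>(1) u(1) \<open>u \<noteq> 0\<close> v B(2)] \<phi>(4) B(1) by auto
  then have b: "lf e B w \<noteq> 0" using lf_scale[OF mp_Ov[OF p B(2)]] by auto
  have "lf (Suc 0) u w \<noteq> 0" using u(3) uO lf_scale[OF uO(1)] by (auto simp: v tv_def)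
  then have "lf (e + d) (B * u ^ d) w \<noteq> 0"
   using lf_mult[OF B(2) mp_power[OF p uO(2)], of d w] lf_power[OF uO(2), of d w] b by simp
  moreover have "B * u ^ d \<in> mp p (e + d)" using mp_mult[OF p B(2) mp_power[OF p uO(2), of d]] by simp
  moreover have "A * u ^ e \<in> mp p (e + d)" using mp_mult[OF p A(2) mp_power[OF p uO(2), of e]] by (simp add: add.commute)
  moreover have "f = A * u ^ e / (B * u ^ d)" using \<open>u \<noteq> 0\<close> \<phi>(5) A(1) B(1) by simp
  ultimately show "f \<in> BR w" unfolding BR_def by blast
 qed
 show "BR w \<subseteq> blowup_ring X (Direction p (cfun.span {tv w}))"
 proof
  fix f assume "f \<in> BR w"
  then obtain A B D where AB: "f = A / B" "A \<in> mp p D" "B \<in> mp p D" "lf D B w \<noteq> 0" unfolding BR_def by blast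
  let ?u = "t i0"
  have um: "?u \<in> max_ideal (Ov p)" using t_max[OF w(1)] .
  have u1: "?u \<in> mp p (Suc 0)" using um mp_1[OF p] by simp
  have lu: "lf (Suc 0) ?u w = w i0" "tv w ?u = w i0" using lf_t tv_t w(1) by auto
  have u0: "?u \<noteq> 0" using lu(1) lf_nz[of "Suc 0" ?u w] w(2) by auto
  \<comment> \<open>The value is independent of the representation of \<open>x\<close>, because
    leading forms are multiplicative; \<open>fe\<close> verifies this.\<close>
  define \<phi> where "\<phi> x = (SOME c. \<exists>b e. b \<in> mp p e \<and> x = b / ?u ^ e \<and> c = lf e b w / w i0 ^ e)" for x
  have fe: "\<phi> (b / ?u ^ e) = lf e b w / w i0 ^ e" if b: "b \<in> mp p e" for b e
  proof -
   have "\<exists>b' e'. b' \<in> mp p e' \<and> b / ?u ^ e = b' / ?u ^ e' \<and> \<phi> (b / ?u ^ e) = lf e' b' w / w i0 ^ e'"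
    unfolding \<phi>_def by (rule someI_ex) (use b in blast)
   then obtain b' e' where b': "b' \<in> mp p e'" "b / ?u ^ e = b' / ?u ^ e'" "\<phi> (b / ?u ^ e) = lf e' b' w / w i0 ^ e'" by blast
   have "b * ?u ^ e' = b' * ?u ^ e" using b'(2) u0 by (simp add: frac_eq_eq)
   then have "lf e b w * w i0 ^ e' = lf e' b' w * w i0 ^ e"
    using lf_mult[OF b mp_power[OF p u1, of e'], of w] lf_mult[OF b'(1) mp_power[OF p u1, of e], of w]
     lf_power[OF u1, of _ w] by (simp add: lu add.commute)
   then show ?thesis unfolding b'(3) using w(2) by (simp add: frac_eq_eq)
  qed
  have "chart_point X p ?u (tv w) \<phi>"
   unfolding chart_point_def blowup_chart_def mp_eq value_at_eq
  proof (intro conjI ballI)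
   fix x y assume "x \<in> {a / ?u ^ d | a d. a \<in> mp p d}" "y \<in> {a / ?u ^ d | a d. a \<in> mp p d}"
   then obtain b d c e where x: "x = b / ?u ^ d" "b \<in> mp p d" and y: "y = c / ?u ^ e" "c \<in> mp p e" by blast
   have m: "b * ?u ^ e \<in> mp p (d + e)" "c * ?u ^ d \<in> mp p (d + e)"
    using mp_mult[OF p x(2) mp_power[OF p u1, of e]] mp_mult[OF p y(2) mp_power[OF p u1, of d]] by (simp_all add: add.commute)
   have l: "lf (d + e) (b * ?u ^ e) w = lf d b w * w i0 ^ e" "lf (d + e) (c * ?u ^ d) w = lf e c w * w i0 ^ d"
    using lf_mult[OF x(2) mp_power[OF p u1, of e], of w] lf_mult[OF y(2) mp_power[OF p u1, of d], of w]
     lf_power[OF u1, of _ w] by (simp_all add: lu add.commute)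
   have "x + y = (b * ?u ^ e + c * ?u ^ d) / ?u ^ (d + e)" using u0 by (simp add: x y power_add add_frac_eq)
   then show "\<phi> (x + y) = \<phi> x + \<phi> y"
    using fe[OF mp_add[OF p m]] fe[OF x(2)] fe[OF y(2)] lf_add[OF mp_Ov[OF p m(1)] mp_Ov[OF p m(2)], of "d + e" w] w(2)
    by (simp add: x y l power_add add_frac_eq)
   have "x * y = (b * c) / ?u ^ (d + e)" by (simp add: x y power_add)
   then show "\<phi> (x * y) = \<phi> x * \<phi> y"
    using fe[OF mp_mult[OF p x(2) y(2)]] fe[OF x(2)] fe[OF y(2)] lf_mult[OF x(2) y(2), of w]
    by (simp add: x y power_add)
  next
   fix f assume "f \<in> Ov p"
   then show "\<phi> f = val p f" using fe[of f 0] by (simp add: lf_0)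
  next
   fix x assume "x \<in> max_ideal (Ov p)"
   then show "\<phi> (x / ?u) = tv w x / tv w ?u"
    using fe[of x "Suc 0"] mp_1[OF p] lu(2) by (simp add: tv_def[of w x] max_ideal_iff p)
  qed
  moreover have "A / ?u ^ D \<in> blowup_chart X p ?u" "B / ?u ^ D \<in> blowup_chart X p ?u"
   unfolding blowup_chart_def mp_eq using AB by blast+
  moreover have "\<phi> (B / ?u ^ D) \<noteq> 0" using fe[OF AB(3)] AB(4) w(2) by simp
  moreover have "f = (A / ?u ^ D) / (B / ?u ^ D)" using u0 AB(1) by simp
  moreover have "tv w \<in> cfun.span {tv w}" by (simp add: cfun.span_base)
  moreover have "tv w ?u \<noteq> 0" using lu w(2) by simp
  ultimately show "f \<in> blowup_ring X (Direction p (cfun.span {tv w}))"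
   unfolding blowup_ring.simps using um
   by (intro CollectI bexI[of _ ?u] bexI[of _ "tv w"] conjI exI[of _ \<phi>] bexI[of _ "A / ?u ^ D"] bexI[of _ "B / ?u ^ D"])
 qed
qed

lemma BR_I: "A \<in> mp p D ==> B \<in> mp p D ==> lf D B w \<noteq> 0 ==> A / B \<in> BR w"
 unfolding BR_def by blast

lemma BR_E:
 assumes "f \<in> BR w" obtains A B D where "f = A / B" "A \<in> mp p D" "B \<in> mp p D" "lf D B w \<noteq> 0" "B \<noteq> 0"
 using assms lf_nz unfolding BR_def by blast

lemma BR_ring: "subring1 (BR w)"
 unfolding subring1_def
proof (intro conjI ballI)
 show "1 \<in> BR w" using BR_I[of 1 0 1 w] p by (simp add: Ov_simps lf_0)
 fix x y assume "x \<in> BR w" "y \<in> BR w"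
 obtain A B D where A: "x = A / B" "A \<in> mp p D" "B \<in> mp p D" "lf D B w \<noteq> 0" "B \<noteq> 0"
  using \<open>x \<in> BR w\<close> by (rule BR_E)
 obtain A' B' D' where A': "y = A' / B'" "A' \<in> mp p D'" "B' \<in> mp p D'" "lf D' B' w \<noteq> 0" "B' \<noteq> 0"
  using \<open>y \<in> BR w\<close> by (rule BR_E)
 note A = A A'
 have B: "B * B' \<in> mp p (D + D')" "lf (D + D') (B * B') w \<noteq> 0" using mp_mult[OF p A(3,8)] lf_mult[OF A(3,8)] A(4,9) by auto
 have "x - y = (A * B' - A' * B) / (B * B')" using A(5,10) by (simp add: A(1,6) diff_frac_eq)
 moreover have "A * B' - A' * B \<in> mp p (D + D')"
  using mp_diff[OF p mp_mult[OF p A(2,8)], of "A' * B"] mp_mult[OF p A(7,3)] by (simp add: add.commute)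
 ultimately show "x - y \<in> BR w" using BR_I[OF _ B] by simp
 have "x * y = (A * A') / (B * B')" by (simp add: A(1,6))
 then show "x * y \<in> BR w" using BR_I[OF mp_mult[OF p A(2,7)] B] by simp
qed

lemma max_ideal_BR_iff:
 assumes A: "A \<in> mp p D" and B: "B \<in> mp p D" "lf D B w \<noteq> 0"
 shows "A / B \<in> max_ideal (BR w) \<longleftrightarrow> lf D A w = 0"
proof
 assume m: "A / B \<in> max_ideal (BR w)"
 show "lf D A w = 0"
 proof (rule ccontr)
  assume l: "lf D A w \<noteq> 0"
  then have "A / B \<noteq> 0" "inverse (A / B) \<in> BR w" using lf_nz[OF l] lf_nz[OF B(2)] BR_I[OF B(1) A l] by auto
  then show False using m by (simp add: max_ideal_def)
 qed
next
 assume l: "lf D A w = 0"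
 have "inverse (A / B) \<notin> BR w" if "A / B \<noteq> 0"
 proof
  assume "inverse (A / B) \<in> BR w"
  then obtain A' B' D' where e: "inverse (A / B) = A' / B'" "A' \<in> mp p D'" "B' \<in> mp p D'" "lf D' B' w \<noteq> 0" "B' \<noteq> 0" by (rule BR_E)
  then have "B * B' = A' * A" using that by (simp add: field_simps)
  then have "lf D B w * lf D' B' w = lf D' A' w * lf D A w"
   using lf_mult[OF B(1) e(3), of w] lf_mult[OF e(2) A, of w] by (simp add: add.commute)
  then show False using l B(2) e(4) by simp
 qed
 then show "A / B \<in> max_ideal (BR w)" using BR_I[OF A B] by (auto simp: max_ideal_def)
qed

lemma Ws_line: "w \<in> Ws l ==> w' \<in> Ws l ==> (\<lambda>i. w i + x * (w' i - w i)) \<in> Ws l"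
 by (simp add: Ws_def)

text \<open>\<open>stalk_ideal\<close> tests only points at which the germ is regular, while the
  right side concerns all directions. Both implications pass to a general direction on a line in
  \<open>Ws l\<close>, at which two given nonzero leading forms are nonzero together.\<close>

lemma stalk_ideal_proj_tangent:
 assumes l: "l \<le> n" and wy: "wy \<in> Ws l" "i0 < n" "wy i0 \<noteq> 0"
  and A: "A \<in> mp p D" and B: "B \<in> mp p D" "lf D B wy \<noteq> 0"
 shows "A / B \<in> stalk_ideal (blowup_ring X) (proj_tangent p (tv ` Ws l)) (Direction p (cfun.span {tv wy})) \<longleftrightarrow>
  (\<forall>w\<in>Ws l. lf D A w = 0)"
proof -
 have 1: "A / B \<in> stalk_ideal (blowup_ring X) (proj_tangent p (tv ` Ws l)) (Direction p (cfun.span {tv wy})) \<longleftrightarrow>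
  (\<forall>w\<in>Ws l. (\<exists>i<n. w i \<noteq> 0) \<longrightarrow> A / B \<in> BR w \<longrightarrow> A / B \<in> max_ideal (BR w))"
 proof
  assume h: "A / B \<in> stalk_ideal (blowup_ring X) (proj_tangent p (tv ` Ws l)) (Direction p (cfun.span {tv wy}))"
  show "\<forall>w\<in>Ws l. (\<exists>i<n. w i \<noteq> 0) \<longrightarrow> A / B \<in> BR w \<longrightarrow> A / B \<in> max_ideal (BR w)"
  proof (intro ballI impI)
   fix w assume w: "w \<in> Ws l" "\<exists>i<n. w i \<noteq> 0" "A / B \<in> BR w"
   then have "Direction p (cfun.span {tv w}) \<in> proj_tangent p (tv ` Ws l)" using proj_tangent_iff[OF l] by blast
   then show "A / B \<in> max_ideal (BR w)" using h w blowup_ring_eq[of _ w] unfolding stalk_ideal_def by (auto simp del: blowup_ring.simps)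
  qed
 next
  assume h: "\<forall>w\<in>Ws l. (\<exists>i<n. w i \<noteq> 0) \<longrightarrow> A / B \<in> BR w \<longrightarrow> A / B \<in> max_ideal (BR w)"
  show "A / B \<in> stalk_ideal (blowup_ring X) (proj_tangent p (tv ` Ws l)) (Direction p (cfun.span {tv wy}))"
   unfolding stalk_ideal_def
  proof (intro CollectI conjI ballI impI)
   show "A / B \<in> blowup_ring X (Direction p (cfun.span {tv wy}))"
    unfolding blowup_ring_eq[of _ wy, OF wy(2,3)] by (rule BR_I[OF A B])
   fix x assume x: "x \<in> proj_tangent p (tv ` Ws l)" "A / B \<in> blowup_ring X x"
   then obtain w i where w: "w \<in> Ws l" "i < n" "w i \<noteq> 0" "x = Direction p (cfun.span {tv w})" using proj_tangent_iff[OF l] by blast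
   show "A / B \<in> max_ideal (blowup_ring X x)"
    using x(2) h w unfolding w(4) blowup_ring_eq[of _ w, OF w(2,3)] by blast
  qed
 qed
 show ?thesis unfolding 1
 proof
  assume h: "\<forall>w\<in>Ws l. (\<exists>i<n. w i \<noteq> 0) \<longrightarrow> A / B \<in> BR w \<longrightarrow> A / B \<in> max_ideal (BR w)"
  show "\<forall>w\<in>Ws l. lf D A w = 0"
  proof (rule ccontr)
   assume "\<not> ?thesis"
   then obtain w1 where w1: "w1 \<in> Ws l" "lf D A w1 \<noteq> 0" by blast
   \<comment> \<open>The factor \<open>t i0\<close> in the denominator keeps the chosen direction
     nonzero.\<close>
   have ti: "t i0 \<in> mp p (Suc 0)" "lf (Suc 0) (t i0) wy \<noteq> 0" using t_max[OF wy(2)] mp_1[OF p] lf_t[OF wy(2)] wy(3) by auto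
   have B': "B * t i0 \<in> mp p (D + Suc 0)" "lf (D + Suc 0) (B * t i0) wy \<noteq> 0"
    using mp_mult[OF p B(1) ti(1)] lf_mult[OF B(1) ti(1), of wy] B(2) ti(2) by auto
   obtain x where x: "lf D A (\<lambda>i. w1 i + x * (wy i - w1 i)) \<noteq> 0" "lf (D + Suc 0) (B * t i0) (\<lambda>i. w1 i + x * (wy i - w1 i)) \<noteq> 0"
    by (rule lf_line[OF A w1(2) B'])
   let ?w = "\<lambda>i. w1 i + x * (wy i - w1 i)"
   have w: "?w \<in> Ws l" by (rule Ws_line[OF w1(1) wy(1)])
   have "lf D B ?w * ?w i0 \<noteq> 0" using x(2) unfolding lf_mult[OF B(1) ti(1)] lf_t[OF wy(2)] .
   from mult_not_zero[OF this] have nz: "lf D B ?w \<noteq> 0" "?w i0 \<noteq> 0" by (rule conjunct1, rule conjunct2)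
   have "\<exists>i<n. ?w i \<noteq> 0" using wy(2) nz(2) by (intro exI[of _ i0] conjI)
   then have "A / B \<in> max_ideal (BR ?w)" by (rule mp[OF mp[OF bspec[OF h w]] BR_I[OF A B(1) nz(1)]])
   then show False using max_ideal_BR_iff[OF A B(1) nz(1)] x(1) by simp
  qed
 next
  assume z: "\<forall>w\<in>Ws l. lf D A w = 0"
  show "\<forall>w\<in>Ws l. (\<exists>i<n. w i \<noteq> 0) \<longrightarrow> A / B \<in> BR w \<longrightarrow> A / B \<in> max_ideal (BR w)"
  proof (intro ballI impI)
   fix w assume w: "w \<in> Ws l" "A / B \<in> BR w"
   obtain A' B' D' where e: "A / B = A' / B'" "A' \<in> mp p D'" "B' \<in> mp p D'" "lf D' B' w \<noteq> 0" "B' \<noteq> 0" using w(2) by (rule BR_E)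
   have "A * B' = A' * B" using e(1,5) lf_nz[OF B(2)] by (simp add: frac_eq_eq)
   then have prod: "lf D' A' u * lf D B u = 0" if "u \<in> Ws l" for u
    using lf_mult[OF A e(3), of u] lf_mult[OF e(2) B(1), of u] z that by (simp add: add.commute)
   have "lf D' A' w = 0"
   proof (rule ccontr)
    assume "lf D' A' w \<noteq> 0"
    then obtain x where "lf D' A' (\<lambda>i. w i + x * (wy i - w i)) \<noteq> 0" "lf D B (\<lambda>i. w i + x * (wy i - w i)) \<noteq> 0"
     by (rule lf_line[OF e(2) _ B])
    then show False using prod[OF Ws_line[OF w(1) wy(1), of x]] by simp
   qed
   then show "A / B \<in> max_ideal (BR w)" unfolding e(1) using max_ideal_BR_iff[OF e(2,3,4)] by simp
  qed
 qed
qed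

end

section \<open>Uniqueness of flag valuations\<close>

definition prime_in :: "'k::field set \<Rightarrow> 'k set \<Rightarrow> bool" where
 "prime_in R I \<longleftrightarrow> 0 \<in> I \<and> I \<subseteq> R \<and> (\<forall>x\<in>I. \<forall>y\<in>I. x + y \<in> I) \<and> (\<forall>r\<in>R. \<forall>x\<in>I. r * x \<in> I) \<and>
  (\<forall>x\<in>R. \<forall>y\<in>R. x * y \<in> I \<longrightarrow> x \<in> I \<or> y \<in> I)"

text \<open>Two local equations differ modulo \<open>P\<close> by a factor \<open>\<gamma>\<close>
  invertible modulo \<open>P\<close>, and \<open>t ^ N\<close> can be cancelled modulo the prime
  ideal \<open>P\<close>. Elements \<open>\<alpha>\<close>, \<open>\<beta>\<close> outside the prime
  ideal \<open>K\<close> of the last point take the place of units.\<close>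

lemma flag_valuation_step:
 fixes P Q K R :: "'k::field set"
 assumes R: "subring1 R"
  and primes: "prime_in R P" "prime_in R Q" "prime_in R K"
  and sub: "P \<subset> Q" "Q \<subseteq> K" "1 \<notin> K"
  and t: "Q = {h + t * a | h a. h \<in> P \<and> a \<in> R}" "Q = {h + t' * a | h a. h \<in> P \<and> a \<in> R}"
  and g: "g1 \<in> R" "g - t ^ N * g1 \<in> P" "g1 \<notin> Q" and g': "g1' \<in> R" "g' - t' ^ N' * g1' \<in> P"
  and \<alpha>: "\<alpha> \<in> R" "\<beta> \<in> R" "\<alpha> \<notin> K" "\<beta> \<notin> K" "\<alpha> * g - \<beta> * g' \<in> P"
  and le: "N \<le> N'"
 shows "N = N' \<and> (\<exists>\<alpha>\<in>R. \<exists>\<beta>\<in>R. \<alpha> \<notin> K \<and> \<beta> \<notin> K \<and> \<alpha> * g1 - \<beta> * g1' \<in> Q)"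
proof -
 note RR = subring1D[OF R]
 have ideals: "x \<in> I ==> y \<in> I ==> x + y \<in> I" "r \<in> R ==> x \<in> I ==> r * x \<in> I"
  "x \<in> R ==> y \<in> R ==> x * y \<in> I ==> x \<in> I \<or> y \<in> I" if "I \<in> {P, Q, K}" for I x y r
  using primes that unfolding prime_in_def by auto
 have sub: "P \<subset> Q" "Q \<subseteq> K" "K \<subseteq> R" "1 \<notin> K" "0 \<in> P" using sub primes by (auto simp: prime_in_def)
 have Pm: "r * x \<in> P" if "r \<in> R" "x \<in> P" for r x using ideals(2) that by simp
 have Pa: "x + y \<in> P" if "x \<in> P" "y \<in> P" for x y using ideals(1) that by simp
 have Pd: "x - y \<in> P" if "x \<in> P" "y \<in> P" for x y
  using Pa[OF that(1) Pm[OF RR(3)[OF RR(2)] that(2)]] by simp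
 have "0 + t * 1 \<in> Q" "0 + t' * 1 \<in> Q" using sub(5) RR(2) t by blast+
 then have tQ: "t \<in> Q" "t' \<in> Q" by simp_all
 then have tR: "t \<in> R" "t' \<in> R" using sub by auto
 have tP: "t \<notin> P"
 proof
  assume "t \<in> P"
  then have "Q \<subseteq> P" unfolding t(1) using Pa Pm by (auto simp: mult.commute[of t])
  then show False using sub(1) by blast
 qed
 obtain h \<gamma> where h: "t' = h + t * \<gamma>" "h \<in> P" "\<gamma> \<in> R" using tQ(2) unfolding t(1) by blast
 obtain h' \<gamma>' where h': "t = h' + t' * \<gamma>'" "h' \<in> P" "\<gamma>' \<in> R" using tQ(1) unfolding t(2) by blast
 have e: "t' - t * \<gamma> = h" "t - t' * \<gamma>' = h'" by (simp add: h(1), simp add: h'(1))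
 have "t * (1 - \<gamma> * \<gamma>') = (t - t' * \<gamma>') + \<gamma>' * (t' - t * \<gamma>)" by (simp add: algebra_simps)
 then have "t * (1 - \<gamma> * \<gamma>') = h' + \<gamma>' * h" unfolding e .
 then have "t * (1 - \<gamma> * \<gamma>') \<in> P" using Pa[OF h'(2) Pm[OF h'(3) h(2)]] by simp
 moreover have "1 - \<gamma> * \<gamma>' \<in> R" by (rule RR(5)[OF RR(2) RR(6)[OF h(3) h'(3)]])
 ultimately have "1 - \<gamma> * \<gamma>' \<in> P" using ideals(3)[of P t "1 - \<gamma> * \<gamma>'"] tP tR by auto
 then have one: "1 - \<gamma> * \<gamma>' \<in> K" using sub by auto
 have \<gamma>: "\<gamma> \<notin> K"
 proof
  assume "\<gamma> \<in> K"
  then have "\<gamma>' * \<gamma> \<in> K" using ideals(2)[of K] h'(3) by simp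
  then have "(1 - \<gamma> * \<gamma>') + \<gamma>' * \<gamma> \<in> K" by (rule ideals(1)[of K, OF _ one, rotated]) simp
  moreover have "(1 - \<gamma> * \<gamma>') + \<gamma>' * \<gamma> = 1" by (simp add: mult.commute)
  ultimately show False using sub(4) by (simp only:)
 qed
 have pw: "t' ^ m - (t * \<gamma>) ^ m \<in> P" for m
 proof (induction m)
  case (Suc m)
  have "t' ^ Suc m - (t * \<gamma>) ^ Suc m = t' * (t' ^ m - (t * \<gamma>) ^ m) + (t * \<gamma>) ^ m * h"
   using h(1) by (simp add: algebra_simps)
  then show ?case using Pa[OF Pm[OF tR(2) Suc] Pm[OF RR(7)[OF RR(6)[OF tR(1) h(3)]] h(2)]] by simp
 qed (simp add: sub)
 define b where "b = \<beta> * \<gamma> ^ N'"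
 have b: "b \<in> R" unfolding b_def by (rule RR(6)[OF \<alpha>(2) RR(7)[OF h(3)]])
 have kp: "\<gamma> ^ m \<notin> K" for m
 proof (induction m)
  case (Suc m)
  then show ?case using ideals(3)[of K \<gamma> "\<gamma> ^ m"] \<gamma> h(3) RR(7)[OF h(3)] by auto
 qed (simp add: sub)
 have bK: "b \<notin> K" unfolding b_def using ideals(3)[of K \<beta> "\<gamma> ^ N'"] kp[of N'] \<alpha>(2,4) RR(7)[OF h(3)] by auto
 \<comment> \<open>\<open>x\<close> turns out to lie in \<open>P\<close>. If \<open>N < N'\<close>,
   its second term lies in \<open>Q\<close>, which would put \<open>g1\<close> into
   \<open>Q\<close>.\<close>
 define x where "x = \<alpha> * g1 - b * (t ^ (N' - N) * g1')"
 have xR: "x \<in> R" unfolding x_def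
  by (rule RR(5)[OF RR(6)[OF \<alpha>(1) g(1)] RR(6)[OF b RR(6)[OF RR(7)[OF tR(1)] g'(1)]]])
 have "t ^ N' = t ^ N * t ^ (N' - N)" using le by (simp add: power_add[symmetric])
 then have "t ^ N * x = (\<alpha> * g - \<beta> * g') - \<alpha> * (g - t ^ N * g1) + \<beta> * (g' - t' ^ N' * g1') + (\<beta> * g1') * (t' ^ N' - (t * \<gamma>) ^ N')"
  by (simp add: x_def b_def algebra_simps power_mult_distrib)
 also have "\<dots> \<in> P"
  by (intro Pa Pd Pm \<alpha> g g' pw RR(6))
 finally have "t ^ N * x \<in> P" .
 moreover have "t ^ m \<notin> P" for m
 proof (induction m)
  case (Suc m)
  then show ?case using ideals(3)[of P t "t ^ m"] tP tR RR(7)[OF tR(1)] by auto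
 qed (use sub in auto)
 ultimately have "x \<in> P" using ideals(3)[of P "t ^ N" x] xR RR(7)[OF tR(1)] by auto
 then have xQ: "x \<in> Q" using sub by auto
 have "N = N'"
 proof (rule ccontr)
  assume "N \<noteq> N'"
  then obtain m where m: "N' - N = Suc m" using le by (metis Suc_diff_Suc le_neq_implies_less)
  have "(b * t ^ m * g1') * t \<in> Q" by (rule ideals(2)[OF _ RR(6)[OF RR(6)[OF b RR(7)[OF tR(1)]] g'(1)] tQ(1)]) simp
  then have "x + (b * t ^ m * g1') * t \<in> Q" using ideals(1)[of Q, OF _ xQ] by simp
  then have "\<alpha> * g1 \<in> Q" by (simp add: x_def m algebra_simps)
  then show False using ideals(3)[of Q \<alpha> g1] \<alpha>(1,3) g(1,3) sub(2) by auto
 qed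
 then have "\<alpha> * g1 - b * g1' \<in> Q" using xQ by (simp add: x_def)
 then show ?thesis using \<open>N = N'\<close> \<alpha>(1,3) b bK by blast
qed

text \<open>The two runs of the recursion produce quotients \<open>g i\<close> and
  \<open>g' i\<close> that agree modulo \<open>P i\<close> up to factors outside the ideal of the
  last point; \<open>flag_valuation_step\<close> propagates this and yields equal orders.\<close>

lemma is_flag_valuation_unique:
 fixes \<nu> \<nu>' :: "(nat, 'n::{finite,linorder}) vec" and R :: "'p \<Rightarrow> 'k::field set" and Y y
 defines "P \<equiv> \<lambda>i. stalk_ideal R (Y i) y"
 assumes R: "subring1 (R y)"
  and prime: "\<And>i. i \<le> CARD('n) ==> prime_in (R y) (P i)"
  and one: "1 \<notin> P CARD('n)" and strict: "\<And>i. i < CARD('n) ==> P i \<subset> P (Suc i)"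
  and v: "is_flag_valuation R Y y f \<nu>" "is_flag_valuation R Y y f \<nu>'"
 shows "\<nu> = \<nu>'"
proof -
 let ?n = "CARD('n)" and ?R = "R y"
 define j where "j i = (SOME j :: 'n. pos j = i)" for i
 have j: "pos (j i) = i" if "i < ?n" for i
  unfolding j_def by (rule someI_ex) (use pos_surj[OF that] in metis)
 have data: "\<exists>t g. g 0 = f \<and> (\<forall>i<?n. P (Suc i) = {h + t i * a | h a. h \<in> P i \<and> a \<in> ?R} \<and> g (Suc i) \<in> ?R \<and>
   g i - t i ^ (\<mu> $ j i) * g (Suc i) \<in> P i \<and> g (Suc i) \<notin> P (Suc i))"
  if \<mu>: "is_flag_valuation R Y y f \<mu>" for \<mu> :: "(nat, 'n) vec"
 proof -
  obtain t g where tg: "g 0 = f" "\<And>j::'n. let i = pos j in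
      local_equation R y (Y i) (Y (Suc i)) (t i) \<and> g (Suc i) \<in> R y \<and>
      g i - t i ^ (\<mu> $ j) * g (Suc i) \<in> stalk_ideal R (Y i) y \<and>
      g (Suc i) \<notin> stalk_ideal R (Y (Suc i)) y"
   using \<mu> unfolding is_flag_valuation_def by blast
  show ?thesis
  proof (rule exI[of _ t], rule exI[of _ g], rule conjI[OF tg(1)], intro allI impI)
   fix i assume "i < ?n"
   from tg(2)[of "j i", unfolded Let_def j[OF this] local_equation_def]
   show "P (Suc i) = {h + t i * a | h a. h \<in> P i \<and> a \<in> ?R} \<and> g (Suc i) \<in> ?R \<and>
    g i - t i ^ (\<mu> $ j i) * g (Suc i) \<in> P i \<and> g (Suc i) \<notin> P (Suc i)" unfolding P_def .
  qed
 qed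
 obtain t g where t: "g 0 = f" "\<And>i. i < ?n ==> P (Suc i) = {h + t i * a | h a. h \<in> P i \<and> a \<in> ?R}"
  "\<And>i. i < ?n ==> g (Suc i) \<in> ?R" "\<And>i. i < ?n ==> g i - t i ^ (\<nu> $ j i) * g (Suc i) \<in> P i"
  "\<And>i. i < ?n ==> g (Suc i) \<notin> P (Suc i)" using data[OF v(1)] by blast
 obtain t' g' where t': "g' 0 = f" "\<And>i. i < ?n ==> P (Suc i) = {h + t' i * a | h a. h \<in> P i \<and> a \<in> ?R}"
  "\<And>i. i < ?n ==> g' (Suc i) \<in> ?R" "\<And>i. i < ?n ==> g' i - t' i ^ (\<nu>' $ j i) * g' (Suc i) \<in> P i"
  "\<And>i. i < ?n ==> g' (Suc i) \<notin> P (Suc i)" using data[OF v(2)] by blast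
 have up: "P (Suc i) \<subseteq> P ?n" if "i < ?n" for i
 proof -
  have "k \<le> ?n ==> Suc i \<le> k ==> P (Suc i) \<subseteq> P k" for k
  proof (induction k)
   case (Suc k)
   then show ?case using strict[of k] by (cases "Suc i = Suc k") auto
  qed simp
  then show ?thesis using that by simp
 qed
 have neg: "- x \<in> P i" if "i \<le> ?n" "x \<in> P i" for i x
 proof -
  have "(- 1) * x \<in> P i"
   using prime[OF that(1)] that(2) subring1D(3)[OF R subring1D(2)[OF R]] unfolding prime_in_def by blast
  then show ?thesis by simp
 qed
 have "(\<exists>\<alpha>\<in>?R. \<exists>\<beta>\<in>?R. \<alpha> \<notin> P ?n \<and> \<beta> \<notin> P ?n \<and> \<alpha> * g i - \<beta> * g' i \<in> P i) \<and> (\<forall>l<i. \<nu> $ j l = \<nu>' $ j l)"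
  if "i \<le> ?n" for i
  using that
 proof (induction i)
  case 0
  show ?case using one prime[of 0] subring1D(2)[OF R] by (intro conjI bexI[of _ 1]) (simp_all add: t(1) t'(1) prime_in_def)
 next
  case (Suc i)
  then have i: "i < ?n" by simp
  obtain \<alpha> \<beta> where ab: "\<alpha> \<in> ?R" "\<beta> \<in> ?R" "\<alpha> \<notin> P ?n" "\<beta> \<notin> P ?n" "\<alpha> * g i - \<beta> * g' i \<in> P i"
   and eq: "\<And>l. l < i ==> \<nu> $ j l = \<nu>' $ j l" using Suc by auto
  note A = flag_valuation_step[OF R prime prime prime strict[OF i] up[OF i] one]
  have "\<nu> $ j i = \<nu>' $ j i \<and> (\<exists>\<alpha>\<in>?R. \<exists>\<beta>\<in>?R. \<alpha> \<notin> P ?n \<and> \<beta> \<notin> P ?n \<and> \<alpha> * g (Suc i) - \<beta> * g' (Suc i) \<in> P (Suc i))"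
  proof (cases "\<nu> $ j i \<le> \<nu>' $ j i")
   case True
   show ?thesis
    by (rule A[OF _ _ _ t(2)[OF i] t'(2)[OF i] t(3)[OF i] t(4)[OF i] t(5)[OF i] t'(3)[OF i] t'(4)[OF i] ab True]) (use i in auto)
  next
   case False
   have ba: "\<beta> * g' i - \<alpha> * g i \<in> P i" using neg[OF _ ab(5)] i by simp
   have "\<nu>' $ j i = \<nu> $ j i \<and> (\<exists>\<alpha>\<in>?R. \<exists>\<beta>\<in>?R. \<alpha> \<notin> P ?n \<and> \<beta> \<notin> P ?n \<and> \<alpha> * g' (Suc i) - \<beta> * g (Suc i) \<in> P (Suc i))"
    by (rule A[OF _ _ _ t'(2)[OF i] t(2)[OF i] t'(3)[OF i] t'(4)[OF i] t'(5)[OF i] t(3)[OF i] t(4)[OF i] ab(2,1,4,3) ba]) (use i False in auto)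
   then show ?thesis using False by simp
  qed
  then show ?case using eq by (auto simp: less_Suc_eq)
 qed
 then have e: "\<nu> $ j l = \<nu>' $ j l" if "l < ?n" for l using that by blast
 have "\<nu> $ i = \<nu>' $ i" for i :: 'n
 proof -
  have "pos (j (pos i)) = pos i" by (rule j[OF pos_less])
  then have "j (pos i) = i" using inj_pos by (auto dest: injD)
  then show ?thesis using e[OF pos_less[of i]] by simp
 qed
 then show ?thesis by (simp add: vec_eq_iff)
qed

section \<open>Valuations along the coordinate flag of tangent subspaces\<close>

context xparam begin

lemma tangent_flag:
 assumes n: "n > 0" and Y: "\<And>i. i < n ==> Y (Suc i) = proj_tangent p (tv ` Ws i)"
 shows "the_elem (Y n) = Direction p (cfun.span {tv (ev (n - 1))})"
proof -
 have "Y n = proj_tangent p (tv ` Ws (n - 1))" using Y[of "n - 1"] n by simp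
 also have "\<dots> = {Direction p (cfun.span {tv (ev (n - 1))})}"
 proof -
  have "cfun.span {tv w} = cfun.span {tv (ev (n - 1))}" if w: "w \<in> Ws (n - 1)" "i < n" "w i \<noteq> 0" for w i
  proof -
   have "\<not> i < n - 1" using w(1,3) by (auto simp: Ws_def)
   then have c: "w (n - 1) \<noteq> 0" using w(2,3) by (metis Suc_diff_1 less_antisym n)
   have e: "tv w = (\<lambda>f. w (n - 1) * tv (ev (n - 1)) f)"
    unfolding tv_sum[of w] using w(1) n
    by (subst sum.mono_neutral_right[of _ "{n - 1}"]) (auto simp: Ws_def fun_eq_iff)
   then have e': "tv (ev (n - 1)) = (\<lambda>f. (1 / w (n - 1)) * tv w f)" using c by (simp add: fun_eq_iff)
   have "tv w \<in> cfun.span {tv (ev (n - 1))}" by (subst e) (intro cfun.span_scale cfun.span_base singletonI)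
   moreover have "tv (ev (n - 1)) \<in> cfun.span {tv w}" by (subst e') (intro cfun.span_scale cfun.span_base singletonI)
   ultimately show ?thesis by (intro equalityI cfun.span_minimal cfun.subspace_span) simp_all
  qed
  moreover have "ev (n - 1) \<in> Ws (n - 1)" "ev (n - 1) (n - 1) \<noteq> 0" by (auto simp: Ws_def ev_def)
  moreover have "n - 1 < n" using n by simp
  ultimately show ?thesis
   unfolding set_eq_iff proj_tangent_iff[of "n - 1", OF diff_le_self] singleton_iff by blast
 qed
 finally show ?thesis by simp
qed

text \<open>A local equation \<open>T 0 = A / B\<close> of the exceptional divisor has a numerator
  of order greater than the order \<open>D\<close> of the denominator. In
  \<open>f = T 0 ^ a * g\<close>, with \<open>a\<close> the first entry of the valuation, comparing
  orders at \<open>p\<close> after clearing denominators gives \<open>f\<close> order at least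
  \<open>a\<close>.\<close>

lemma flag_order:
 fixes \<nu> :: "(nat, 'n::{finite,linorder}) vec"
 assumes n: "n = CARD('n)" and Y0: "Y 0 = blowup_points X Z"
  and Y: "\<And>i. i < n ==> Y (Suc i) = proj_tangent p (tv ` Ws i)"
  and unit: "\<And>h. h \<noteq> 0 ==> \<exists>q\<in>points X - Z. isu q h"
  and f: "f \<in> Ov p" and v: "is_flag_valuation (blowup_ring X) Y (the_elem (Y n)) f \<nu>"
 shows "flag_valuation (blowup_ring X) Y (the_elem (Y n)) f = \<nu>" "pos j = 0 ==> f \<in> mp p (\<nu> $ j)"
proof -
 have n0: "n > 0" using n by simp
 let ?w = "ev (n - 1)" and ?y = "the_elem (Y n)"
 have y: "?y = Direction p (cfun.span {tv ?w})" by (rule tangent_flag[OF n0 Y])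
 have w: "n - 1 < n" "?w (n - 1) \<noteq> 0" "\<And>i. i < n ==> ?w \<in> Ws i" using n0 by (auto simp: ev_def Ws_def)
 have Ry: "blowup_ring X ?y = BR ?w" unfolding y by (rule blowup_ring_eq[of "n - 1" ?w, OF w(1,2)])
 define P where "P i = stalk_ideal (blowup_ring X) (Y i) ?y" for i
 have PR: "P i \<subseteq> BR ?w" for i unfolding P_def stalk_ideal_def Ry by blast
 note RR = subring1D[OF BR_ring[of ?w]]
 \<comment> \<open>A nonzero rational function is a unit at some point outside the centre, so no
   nonzero germ vanishes on the whole blow-up.\<close>
 have P0: "P 0 = {0}"
 proof
  show "P 0 \<subseteq> {0}"
  proof
   fix h assume h: "h \<in> P 0"
   show "h \<in> {0}"
   proof (rule ccontr)
    assume "h \<notin> {0}"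
    then obtain q where q: "q \<in> points X - Z" "isu q h" using unit by blast
    have "Outside q \<in> Y 0" unfolding Y0 blowup_points_def using q(1) by blast
    moreover have "h \<in> blowup_ring X (Outside q)" using q(2) by (simp add: isu_def)
    ultimately have "h \<in> max_ideal (blowup_ring X (Outside q))" using h unfolding P_def stalk_ideal_def by blast
    then show False using q max_ideal_iff[of q h] by (simp add: isu_def)
   qed
  qed
  show "{0} \<subseteq> P 0" using RR(1) by (auto simp: P_def stalk_ideal_def Ry max_ideal_def)
 qed
 have PS: "A / B \<in> P (Suc i) \<longleftrightarrow> (\<forall>u\<in>Ws i. lf D A u = 0)"
  if "i < n" "A \<in> mp p D" "B \<in> mp p D" "lf D B ?w \<noteq> 0" for i A B D
  unfolding P_def y Y[OF that(1)]
  by (rule stalk_ideal_proj_tangent[of i ?w "n - 1", OF less_imp_le[OF that(1)] w(3)[OF that(1)] w(1,2) that(2-4)])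
 have prime_PS: "prime_in (BR ?w) (P (Suc i))" if i: "i < n" for i
  unfolding prime_in_def
 proof (intro conjI ballI impI)
  have one: "1 \<in> mp p 0" "lf 0 1 ?w \<noteq> 0" using p by (simp_all add: Ov_simps lf_0)
  show "0 \<in> P (Suc i)" using PS[OF i mp_zero[OF p] one] lf_zero[OF mp_zero[OF p], of 0] by simp
  show "P (Suc i) \<subseteq> BR ?w" by (rule PR)
  fix x assume x: "x \<in> P (Suc i)"
  obtain A B D where A: "x = A / B" "A \<in> mp p D" "B \<in> mp p D" "lf D B ?w \<noteq> 0" "B \<noteq> 0"
   using subsetD[OF PR x] by (rule BR_E)
  have zA: "lf D A u = 0" if "u \<in> Ws i" for u using x that PS[OF i A(2-4)] unfolding A(1) by blast
  {
   fix x' assume x': "x' \<in> P (Suc i)"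
   obtain A' B' D' where A': "x' = A' / B'" "A' \<in> mp p D'" "B' \<in> mp p D'" "lf D' B' ?w \<noteq> 0" "B' \<noteq> 0"
    using subsetD[OF PR x'] by (rule BR_E)
   have zA': "lf D' A' u = 0" if "u \<in> Ws i" for u using x' that PS[OF i A'(2-4)] unfolding A'(1) by blast
   have m: "A * B' \<in> mp p (D + D')" "B * A' \<in> mp p (D + D')" by (rule mp_mult[OF p A(2) A'(3)], rule mp_mult[OF p A(3) A'(2)])
   have l: "lf (D + D') (B * B') ?w \<noteq> 0" using lf_mult[OF A(3) A'(3)] A(4) A'(4) by simp
   have "lf (D + D') (A * B' + B * A') u = 0" if "u \<in> Ws i" for u
    using lf_add[OF mp_Ov[OF p m(1)] mp_Ov[OF p m(2)]] lf_mult[OF A(2) A'(3)] lf_mult[OF A(3) A'(2)] zA zA' that by simp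
   then have "(A * B' + B * A') / (B * B') \<in> P (Suc i)"
    using PS[OF i mp_add[OF p m] mp_mult[OF p A(3) A'(3)] l] by blast
   then show "x + x' \<in> P (Suc i)" using A(5) A'(5) by (simp add: A(1) A'(1) add_frac_eq mult.commute)
  }
  fix r assume r: "r \<in> BR ?w"
  obtain A' B' D' where A': "r = A' / B'" "A' \<in> mp p D'" "B' \<in> mp p D'" "lf D' B' ?w \<noteq> 0" "B' \<noteq> 0"
   using r by (rule BR_E)
  have l: "lf (D' + D) (B' * B) ?w \<noteq> 0" using lf_mult[OF A'(3) A(3)] A(4) A'(4) by simp
  have "(A' * A) / (B' * B) \<in> P (Suc i)"
   using PS[OF i mp_mult[OF p A'(2) A(2)] mp_mult[OF p A'(3) A(3)] l] lf_mult[OF A'(2) A(2)] zA by simp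
  then show "r * x \<in> P (Suc i)" by (simp add: A(1) A'(1))
 next
  fix x x' assume x: "x \<in> BR ?w" "x' \<in> BR ?w" "x * x' \<in> P (Suc i)"
  obtain A B D where A: "x = A / B" "A \<in> mp p D" "B \<in> mp p D" "lf D B ?w \<noteq> 0" "B \<noteq> 0"
   using x(1) by (rule BR_E)
  obtain A' B' D' where A': "x' = A' / B'" "A' \<in> mp p D'" "B' \<in> mp p D'" "lf D' B' ?w \<noteq> 0" "B' \<noteq> 0"
   using x(2) by (rule BR_E)
  have l: "lf (D + D') (B * B') ?w \<noteq> 0" using lf_mult[OF A(3) A'(3)] A(4) A'(4) by simp
  have "(A * A') / (B * B') \<in> P (Suc i)" using x(3) by (simp add: A(1) A'(1))
  then have prod: "lf D A u * lf D' A' u = 0" if "u \<in> Ws i" for u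
   using PS[OF i mp_mult[OF p A(2) A'(2)] mp_mult[OF p A(3) A'(3)] l] lf_mult[OF A(2) A'(2), of u] that by simp
  show "x \<in> P (Suc i) \<or> x' \<in> P (Suc i)"
  proof (rule ccontr)
   assume "\<not> ?thesis"
   then obtain u u' where u: "u \<in> Ws i" "lf D A u \<noteq> 0" "u' \<in> Ws i" "lf D' A' u' \<noteq> 0"
    using PS[OF i A(2-4)] PS[OF i A'(2-4)] unfolding A(1) A'(1) by blast
   obtain c where "lf D A (\<lambda>i. u i + c * (u' i - u i)) \<noteq> 0" "lf D' A' (\<lambda>i. u i + c * (u' i - u i)) \<noteq> 0"
    by (rule lf_line[OF A(2) u(2) A'(2) u(4)])
   then show False using prod[OF Ws_line[OF u(1,3), of c]] by simp
  qed
 qed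
 have "prime_in (BR ?w) {0}" using RR(1) by (auto simp: prime_in_def)
 then have prime: "prime_in (BR ?w) (P i)" if "i \<le> n" for i
  using that prime_PS P0 by (cases i) auto
 have tn: "t (n - 1) \<in> mp p (Suc 0)" "lf (Suc 0) (t (n - 1)) ?w \<noteq> 0" "t (n - 1) \<noteq> 0"
  using t_max[OF w(1)] mp_1[OF p] lf_t[OF w(1)] w(2) lf_nz[of "Suc 0" "t (n - 1)" ?w] by auto
 \<comment> \<open>Strictness is witnessed by \<open>t (n - 1)\<close> for the exceptional divisor,
   and afterwards by \<open>t l / t (n - 1)\<close>, an affine coordinate of the exceptional
   divisor.\<close>
 have strict: "P i \<subset> P (Suc i)" if i: "i < n" for i
 proof (cases i)
  case 0
  have m: "t (n - 1) * t (n - 1) \<in> mp p (Suc (Suc 0))" using mp_mult[OF p tn(1) tn(1)] by simp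
  have "(t (n - 1) * t (n - 1)) / t (n - 1) \<in> P (Suc i)"
   using PS[OF i mp_dec[OF p m] tn(1,2)] lf_zero[OF m] by blast
  then have "t (n - 1) \<in> P (Suc i)" using tn(3) by simp
  moreover have "0 \<in> P (Suc i)" using prime_PS[OF i] by (simp add: prime_in_def)
  ultimately show ?thesis using tn(3) P0 0 by auto
 next
  case (Suc l)
  then have l: "l < n" using i by simp
  have "P (Suc l) \<subseteq> P (Suc i)"
  proof
   fix x assume x: "x \<in> P (Suc l)"
   obtain A B D where A: "x = A / B" "A \<in> mp p D" "B \<in> mp p D" "lf D B ?w \<noteq> 0" "B \<noteq> 0"
    using subsetD[OF PR x] by (rule BR_E)
   have "Ws i \<subseteq> Ws l" using Suc by (auto simp: Ws_def)
   then show "x \<in> P (Suc i)" using x PS[OF l A(2-4)] PS[OF i A(2-4)] unfolding A(1) by blast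
  qed
  moreover have tl: "t l \<in> mp p (Suc 0)" "lf (Suc 0) (t l) u = u l" for u using t_max[OF l] mp_1[OF p] lf_t[OF l] by auto
  have "t l / t (n - 1) \<in> P (Suc i)" using PS[OF i tl(1) tn(1,2)] Suc by (auto simp: tl(2) Ws_def)
  moreover have "ev l \<in> Ws l" "ev l l \<noteq> 0" by (auto simp: Ws_def ev_def)
  then have "t l / t (n - 1) \<notin> P (Suc l)" using PS[OF l tl(1) tn(1,2)] tl(2) by auto
  ultimately show ?thesis using Suc by blast
 qed
 have one: "1 \<notin> P n"
 proof -
  have "1 \<in> mp p 0" "lf 0 1 u = 1" for u using p by (simp_all add: Ov_simps lf_0)
  then have "1 / 1 \<notin> P (Suc (n - 1))" using PS[OF w(1), of 1 0 1] w(3)[OF w(1)] by auto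
  then show ?thesis using n0 by simp
 qed
 show "flag_valuation (blowup_ring X) Y ?y f = \<nu>"
  unfolding flag_valuation_def
 proof (rule the_equality)
  fix \<nu>' :: "(nat, 'n) vec" assume "is_flag_valuation (blowup_ring X) Y ?y f \<nu>'"
  show "\<nu>' = \<nu>"
  proof (rule is_flag_valuation_unique[where R = "blowup_ring X" and Y = Y and y = ?y and f = f])
   show "subring1 (blowup_ring X ?y)" unfolding Ry by (rule BR_ring)
   show "prime_in (blowup_ring X ?y) (stalk_ideal (blowup_ring X) (Y i) ?y)" if "i \<le> CARD('n)" for i
    unfolding Ry P_def[symmetric] by (rule prime) (use that n in simp)
   show "1 \<notin> stalk_ideal (blowup_ring X) (Y CARD('n)) ?y" unfolding P_def[symmetric] n[symmetric] by (rule one)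
   show "stalk_ideal (blowup_ring X) (Y i) ?y \<subset> stalk_ideal (blowup_ring X) (Y (Suc i)) ?y" if "i < CARD('n)" for i
    unfolding P_def[symmetric] by (rule strict) (use that n in simp)
  qed fact+
 qed (rule v)
 show "f \<in> mp p (\<nu> $ j)" if "pos j = 0"
 proof -
  obtain T g where g0: "g 0 = f" and gj: "\<forall>j::'n. let i = pos j in
      local_equation (blowup_ring X) ?y (Y i) (Y (Suc i)) (T i) \<and> g (Suc i) \<in> blowup_ring X ?y \<and>
      g i - T i ^ (\<nu> $ j) * g (Suc i) \<in> stalk_ideal (blowup_ring X) (Y i) ?y \<and>
      g (Suc i) \<notin> stalk_ideal (blowup_ring X) (Y (Suc i)) ?y"
   using v unfolding is_flag_valuation_def by blast
  have g: "g 0 = f" "local_equation (blowup_ring X) ?y (Y 0) (Y (Suc 0)) (T 0)" "g (Suc 0) \<in> BR ?w"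
   "g 0 - T 0 ^ (\<nu> $ j) * g (Suc 0) \<in> P 0"
   using g0 spec[OF gj, of j] that by (simp_all add: P_def Ry Let_def)
  let ?a = "\<nu> $ j"
  have feq: "f = T 0 ^ ?a * g (Suc 0)" using g(1,4) P0 by simp
  have "0 + T 0 * 1 \<in> P (Suc 0)"
   using g(2) P0 RR(2) unfolding local_equation_def P_def[symmetric] Ry by blast
  then have T: "T 0 \<in> P (Suc 0)" by simp
  obtain A B D where A: "T 0 = A / B" "A \<in> mp p D" "B \<in> mp p D" "lf D B ?w \<noteq> 0" "B \<noteq> 0"
   using subsetD[OF PR T] by (rule BR_E)
  have "lf D A u = 0" for u using T PS[OF n0 A(2-4)] unfolding A(1) by (auto simp: Ws_def)
  then have A': "A \<in> mp p (Suc D)" by (rule lf_eq_zero[OF A(2)])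
  obtain A1 B1 D1 where A1: "g (Suc 0) = A1 / B1" "A1 \<in> mp p D1" "B1 \<in> mp p D1" "lf D1 B1 ?w \<noteq> 0" "B1 \<noteq> 0"
   using g(3) by (rule BR_E)
  \<comment> \<open>The order of this denominator is exactly \<open>a * D + D1\<close>, since its
    leading form is nonzero at \<open>?w\<close>; the order of \<open>f * ?Q\<close> exceeds this by
    at least \<open>a\<close>.\<close>
  let ?Q = "B ^ ?a * B1"
  have Q: "?Q \<in> mp p (?a * D + D1)" by (rule mp_mult[OF p mp_power[OF p A(3)] A1(3)])
  have lQ: "lf (?a * D + D1) ?Q ?w \<noteq> 0"
   unfolding lf_mult[OF mp_power[OF p A(3)] A1(3)] lf_power[OF A(3)] using A(4) A1(4) by simp
  have fQ: "f * ?Q = A ^ ?a * A1" unfolding feq A(1) A1(1) using A(5) A1(5) by (simp add: power_divide)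
  have fQ': "f * ?Q \<in> mp p (?a * Suc D + D1)" unfolding fQ by (rule mp_mult[OF p mp_power[OF p A'] A1(2)])
  have "b \<le> ?a ==> f \<in> mp p b" for b
  proof (induction b)
   case 0
   then show ?case using f by simp
  next
   case (Suc b)
   then have fb: "f \<in> mp p b" by simp
   show ?case
   proof (rule lf_eq_zero[OF fb], rule ccontr)
    fix u assume "lf b f u \<noteq> 0"
    then obtain c where c: "lf b f (\<lambda>i. u i + c * (?w i - u i)) \<noteq> 0" "lf (?a * D + D1) ?Q (\<lambda>i. u i + c * (?w i - u i)) \<noteq> 0"
     by (rule lf_line[OF fb _ Q lQ])
    have "f * ?Q \<in> mp p (Suc (b + (?a * D + D1)))"
     by (rule mp_mono[OF p _ fQ']) (use Suc.prems in simp)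
    from lf_zero[OF this, of "\<lambda>i. u i + c * (?w i - u i)"] show False
     unfolding lf_mult[OF fb Q] using c by simp
   qed
  qed
  then show ?thesis by simp
 qed
qed

end

section \<open>Sections with high multiplicity at many points\<close>

context lparam begin

lemma lf_lmon:
 "length \<alpha> = length us ==> (\<And>u. u \<in> set us ==> u \<in> mp p (Suc 0)) ==>
  lmon \<alpha> us \<in> mp p (sum_list \<alpha>) \<and> lf (sum_list \<alpha>) (lmon \<alpha> us) w = lmon \<alpha> (map (\<lambda>u. lf (Suc 0) u w) us)"
proof (induction \<alpha> arbitrary: us)
 case Nil
 then show ?case using p by (simp add: Ov_simps lf_0)
next
 case (Cons e \<alpha>)
 then obtain u us' where us: "us = u # us'" by (cases us) auto
 have u: "u ^ e \<in> mp p (e * Suc 0)" "lf (e * Suc 0) (u ^ e) w = lf (Suc 0) u w ^ e"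
  using Cons.prems(2) us by (intro mp_power[OF p] lf_power; simp)+
 have IH: "lmon \<alpha> us' \<in> mp p (sum_list \<alpha>)" "lf (sum_list \<alpha>) (lmon \<alpha> us') w = lmon \<alpha> (map (\<lambda>u. lf (Suc 0) u w) us')"
  using Cons.IH[of us'] Cons.prems us by auto
 show ?case using mp_mult[OF p u(1) IH(1)] lf_mult[OF u(1) IH(1), of w] u(2) IH(2) us by simp
qed

text \<open>Otherwise the terms of lowest degree would form a nonzero polynomial that is the leading
  form of an element of higher order. Induction on the degree removes the smaller terms
  first.\<close>

lemma taylor_vanish:
 assumes C: "(\<Sum>\<alpha>\<in>mbox n \<tau>. sc (d \<alpha>) * lmon \<alpha> (map t [0..<n])) \<in> mp p b"
  and \<alpha>: "\<alpha> \<in> mbox n \<tau>" "sum_list \<alpha> < b"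
 shows "d \<alpha> = 0"
 using \<alpha>
proof (induction "sum_list \<alpha>" arbitrary: \<alpha> rule: less_induct)
 case less
 let ?D = "sum_list \<alpha>" and ?ts = "map t [0..<n]"
 define c where "c \<beta> = (if sum_list \<beta> = ?D then d \<beta> else 0)" for \<beta>
 have ts: "u \<in> mp p (Suc 0)" if "u \<in> set ?ts" for u using that t_max mp_1[OF p] by auto
 have lm: "lmon \<beta> ?ts \<in> mp p (sum_list \<beta>)" "lf (sum_list \<beta>) (lmon \<beta> ?ts) w = lmon \<beta> (map w [0..<n])"
  if "\<beta> \<in> mbox n \<tau>" for \<beta> w
 proof -
  have e: "map (\<lambda>u. lf (Suc 0) u w) ?ts = map w [0..<n]" by (simp add: lf_t)
  show "lmon \<beta> ?ts \<in> mp p (sum_list \<beta>)" "lf (sum_list \<beta>) (lmon \<beta> ?ts) w = lmon \<beta> (map w [0..<n])"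
   using lf_lmon[of \<beta> ?ts w, OF _ ts] that unfolding e by (simp_all add: mbox_def)
 qed
 let ?A = "\<Sum>\<beta>\<in>mbox n \<tau>. sc (c \<beta>) * lmon \<beta> ?ts"
 have "(\<Sum>\<beta>\<in>mbox n \<tau>. sc (d \<beta>) * lmon \<beta> ?ts) - ?A = (\<Sum>\<beta>\<in>mbox n \<tau>. sc (d \<beta> - c \<beta>) * lmon \<beta> ?ts)"
  by (simp add: sum_subtractf left_diff_distrib sc_simps)
 also have "\<dots> \<in> mp p (Suc ?D)"
 proof (rule mp_sum[OF p])
  fix \<beta> assume b: "\<beta> \<in> mbox n \<tau>"
  show "sc (d \<beta> - c \<beta>) * lmon \<beta> ?ts \<in> mp p (Suc ?D)"
  proof (cases "sum_list \<beta> \<le> ?D")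
   case True
   then have "d \<beta> - c \<beta> = 0" using less.hyps[of \<beta>] b less.prems by (auto simp: c_def)
   then show ?thesis by (simp add: sc_simps mp_zero p)
  next
   case False
   then show ?thesis using lm(1)[OF b] by (intro mp_mult_left[OF p sc_in_Ov[OF p]] mp_mono[OF p, of "Suc ?D"]) auto
  qed
 qed
 finally have 1: "(\<Sum>\<beta>\<in>mbox n \<tau>. sc (d \<beta>) * lmon \<beta> ?ts) - ?A \<in> mp p (Suc ?D)" .
 have "(\<Sum>\<beta>\<in>mbox n \<tau>. sc (d \<beta>) * lmon \<beta> ?ts) \<in> mp p (Suc ?D)"
  by (rule mp_mono[OF p _ C]) (use less.prems in simp)
 from mp_diff[OF p this 1] have A: "?A \<in> mp p (Suc ?D)" by simp
 have "lf ?D (\<Sum>\<beta>\<in>S. sc (c \<beta>) * lmon \<beta> ?ts) w = (\<Sum>\<beta>\<in>S. c \<beta> * lmon \<beta> (map w [0..<n])) \<and>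
   (\<Sum>\<beta>\<in>S. sc (c \<beta>) * lmon \<beta> ?ts) \<in> Ov p"
  if "finite S" "S \<subseteq> mbox n \<tau>" for S w
  using that
 proof (induction S rule: finite_induct)
  case empty
  then show ?case using lf_zero[of 0 ?D w] p by (simp add: mp_zero Ov_simps)
 next
  case (insert \<beta> S)
  have O: "lmon \<beta> ?ts \<in> Ov p" using mp_Ov[OF p lm(1)] insert.prems by simp
  then have O': "sc (c \<beta>) * lmon \<beta> ?ts \<in> Ov p" using p by (simp add: Ov_simps sc_in_Ov)
  have "lf ?D (sc (c \<beta>) * lmon \<beta> ?ts) w = c \<beta> * lmon \<beta> (map w [0..<n])"
   unfolding lf_sc_mult[OF O] using lm(2)[of \<beta> w] insert.prems by (auto simp: c_def)
  then show ?case using insert O' lf_add[OF O', of "\<Sum>\<beta>\<in>S. sc (c \<beta>) * lmon \<beta> ?ts" ?D w] p by (simp add: Ov_simps)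
 qed
 from this[OF mbox_card(1) order.refl] have z: "(\<Sum>\<beta>\<in>mbox n \<tau>. c \<beta> * lmon \<beta> (map w [0..<n])) = 0" for w
  using lf_zero[OF A, of w] by simp
 have "c \<alpha> = 0"
 proof (rule ccontr)
  assume "c \<alpha> \<noteq> 0"
  then have "\<exists>\<alpha>\<in>mbox n \<tau>. c \<alpha> \<noteq> 0" using less.prems by blast
  then obtain ys where ys: "length ys = n" "(\<Sum>\<beta>\<in>mbox n \<tau>. c \<beta> * lmon \<beta> ys) \<noteq> 0"
   using mbox_polynomial_nonzero by blast
  have "map (nth ys) [0..<n] = ys" using ys(1) map_nth by metis
  then show False using z[of "nth ys"] ys(2) by simp
 qed
 then show ?case by (simp add: c_def)
qed

end

context chart begin

lemma good_lparam: "good p ==> lparam sc s M Pts a Ov p nv (tpar p) pder"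
 by unfold_locales (auto simp: good_def pder)

text \<open>\<open>T\<close> consists of the \<open>Xs\<close> coordinates of the points, so
  membership in \<open>mp (\<pi> P) b\<close> translates into vanishing Taylor coefficients at
  \<open>P\<close>. The exponent \<open>k\<close> of \<open>power_relation\<close> multiplies both
  sides and cancels.\<close>

lemma multiplicity_bound:
 "\<exists>r\<ge>1. \<forall>S e b N T \<pi>. e \<ge> 1 \<and> S \<noteq> 0 \<and> (\<forall>p\<in>Pts. S * D0 p ^ e \<in> Ov p) \<and> tree N nv T \<and>
  (\<forall>P\<in>T. good (\<pi> P) \<and> map (val (\<pi> P)) Xs = P \<and> S * D0 (\<pi> P) ^ e \<in> mp (\<pi> P) b) \<longrightarrow> N * b \<le> nv * r * e"
proof -
 obtain r where r: "r \<ge> 1" and rel: "\<forall>S e. e \<ge> 1 \<and> S \<noteq> 0 \<and> (\<forall>p\<in>Pts. S * D0 p ^ e \<in> Ov p) \<longrightarrow>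
  (\<exists>k\<ge>1. \<exists>c. (\<exists>\<alpha>\<in>mbox nv (r * k * e). c \<alpha> \<noteq> 0) \<and>
   (\<exists>x\<in>AA (Suc M). (\<Sum>\<alpha>\<in>mbox nv (r * k * e). sc (c \<alpha>) * lmon \<alpha> Xs) = (S / s j0 ^ e) ^ k * x))"
  using power_relation by blast
 show ?thesis
 proof (rule exI[of _ r], rule conjI[OF r], intro allI impI, elim conjE)
  fix S :: 'k and e b N :: nat and T \<pi>
  assume e: "1 \<le> e" and S: "S \<noteq> 0" "\<forall>p\<in>Pts. S * D0 p ^ e \<in> Ov p" and T: "tree N nv T"
   and \<pi>: "\<forall>P\<in>T. good (\<pi> P) \<and> map (val (\<pi> P)) Xs = P \<and> S * D0 (\<pi> P) ^ e \<in> mp (\<pi> P) b"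
  obtain k c x where k: "k \<ge> 1" and c: "\<exists>\<alpha>\<in>mbox nv (r * k * e). c \<alpha> \<noteq> 0" and x: "x \<in> AA (Suc M)"
   "(\<Sum>\<alpha>\<in>mbox nv (r * k * e). sc (c \<alpha>) * lmon \<alpha> Xs) = (S / s j0 ^ e) ^ k * x"
   using rel e S by blast
  let ?\<tau> = "r * k * e" and ?f = "S / s j0 ^ e"
  have "taylor ?\<tau> P c \<alpha> = 0" if P: "P \<in> T" and \<alpha>: "\<alpha> \<in> mbox nv ?\<tau>" "sum_list \<alpha> < k * b" for P \<alpha>
  proof -
   let ?p = "\<pi> P"
   have good: "good ?p" and vP: "map (val ?p) Xs = P" and m: "S * D0 ?p ^ e \<in> mp ?p b" using \<pi> P by auto
   have p: "?p \<in> Pts" "a ?p j0 \<noteq> 0" using good by (auto simp: good_def)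
   interpret lp: lparam sc s M Pts a Ov ?p nv "tpar ?p" pder by (rule good_lparam[OF good])
   have u: "isu ?p (s j0 * D0 ?p)" by (rule isu_sD0[OF p])
   have "inverse ((s j0 * D0 ?p) ^ e) \<in> Ov ?p" using isu_inverse[OF p(1) isu_power[OF p(1) u]] by (simp add: isu_def)
   moreover have "?f = inverse ((s j0 * D0 ?p) ^ e) * (S * D0 ?p ^ e)"
    using isu_nz[OF p(1) u] by (simp add: field_simps power_mult_distrib)
   ultimately have "?f \<in> mp ?p b" using mp_mult_left[OF p(1) _ m] by simp
   from mp_mult_left[OF p(1) AA_Ov[OF p x(1)] mp_power[OF p(1) this, of k]]
   have "(\<Sum>\<alpha>\<in>mbox nv ?\<tau>. sc (c \<alpha>) * lmon \<alpha> Xs) \<in> mp ?p (k * b)" unfolding x(2) by (simp add: mult.commute)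
   moreover have lP: "length P = nv" using arg_cong[OF vP, of length] by (simp add: Xs_def)
   have "map2 (\<lambda>y s. y - sc s) Xs P = map (tpar ?p) [0..<nv]"
   proof (rule nth_equalityI)
    show "length (map2 (\<lambda>y s. y - sc s) Xs P) = length (map (tpar ?p) [0..<nv])" using lP by (simp add: Xs_def)
    fix i assume "i < length (map2 (\<lambda>y s. y - sc s) Xs P)"
    then have "i < nv" "length Xs = nv" using lP by (auto simp: Xs_def)
    then show "map2 (\<lambda>y s. y - sc s) Xs P ! i = map (tpar ?p) [0..<nv] ! i"
     using lP arg_cong[OF vP, of "\<lambda>l. l ! i"] by (simp add: tpar_def)
   qed
   then have "(\<Sum>\<alpha>\<in>mbox nv ?\<tau>. sc (c \<alpha>) * lmon \<alpha> Xs) =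
     (\<Sum>\<alpha>\<in>mbox nv ?\<tau>. sc (taylor ?\<tau> P c \<alpha>) * lmon \<alpha> (map (tpar ?p) [0..<nv]))"
    using taylor_expansion[OF sc, where ys = Xs and P = P and \<tau> = ?\<tau> and c = c] lP by (simp add: Xs_def)
   ultimately show ?thesis
    using lp.taylor_vanish[where d = "taylor ?\<tau> P c" and \<tau> = ?\<tau> and b = "k * b" and \<alpha> = \<alpha>] \<alpha> by simp
  qed
  then have "N * (k * b) \<le> nv * ?\<tau>" by (rule schwartz_zippel_multiplicity[OF c T])
  then have "k * (N * b) \<le> k * (nv * r * e)" by (simp add: ac_simps)
  then show "N * b \<le> nv * r * e" using k by simp
 qed
qed

text \<open>There are more grid points than elements of \<open>Z\<close>, and at all of them
  numerator and denominator of \<open>h\<close> are nonzero.\<close>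

lemma unit_avoiding:
 assumes h: "h \<noteq> 0" and Z: "finite Z" and nv: "nv > 0"
 shows "\<exists>q\<in>Pts - Z. isu q h"
proof -
 obtain x y where xy: "x \<in> AA (Suc M)" "y \<in> AA (Suc M)" "y \<noteq> 0" "h = x / y" using field_eq_frac_AA[of h] by blast
 then have "x * y \<in> AA (Suc M)" "x * y \<noteq> 0" using subring1D(6)[OF AA_ring xy(1,2)] h by auto
 then obtain T \<pi> where T: "tree (Suc (card Z)) nv T" and
  \<pi>: "\<And>P. P \<in> T ==> \<pi> P \<in> Pts \<and> a (\<pi> P) j0 \<noteq> 0 \<and> val (\<pi> P) (x * y) \<noteq> 0 \<and> map (val (\<pi> P)) Xs = P"
  by (rule grid_of_points) (rule that)
 have "inj_on \<pi> T" using \<pi> by (metis inj_onI)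
 then have "card (\<pi> ` T) = Suc (card Z) ^ nv" using tree_card[OF T] by (simp add: card_image)
 moreover have "Suc (card Z) ^ 1 \<le> Suc (card Z) ^ nv" using nv by (intro power_increasing) linarith+
 ultimately have "\<not> \<pi> ` T \<subseteq> Z" using card_mono[OF Z, of "\<pi> ` T"] by auto
 then obtain P where P: "P \<in> T" "\<pi> P \<notin> Z" by blast
 let ?q = "\<pi> P"
 have q: "?q \<in> Pts" "a ?q j0 \<noteq> 0" "val ?q (x * y) \<noteq> 0" using \<pi>[OF P(1)] by auto
 have O: "x \<in> Ov ?q" "y \<in> Ov ?q" using AA_Ov[OF q(1,2) xy(1)] AA_Ov[OF q(1,2) xy(2)] .
 then have "isu ?q x" "isu ?q y" using q(3) by (auto simp: isu_def val_ops q(1))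
 then have "isu ?q h" unfolding xy(4) by (rule isu_divide[OF q(1)])
 then show ?thesis using q(1) P(2) by blast
qed

lemma good_grid:
 obtains T \<pi> where "tree N nv T" "\<And>P. P \<in> T ==> good (\<pi> P) \<and> map (val (\<pi> P)) Xs = P"
  "finite (\<pi> ` T)" "card (\<pi> ` T) = N ^ nv"
proof -
 obtain g where g: "g \<in> AA (Suc M)" "g \<noteq> 0" "\<And>p. p \<in> Pts ==> a p j0 \<noteq> 0 ==> val p g \<noteq> 0 ==> good p"
  by (rule good_element) (rule that)
 obtain T \<pi> where T: "tree N nv T" and
  \<pi>: "\<And>P. P \<in> T ==> \<pi> P \<in> Pts \<and> a (\<pi> P) j0 \<noteq> 0 \<and> val (\<pi> P) g \<noteq> 0 \<and> map (val (\<pi> P)) Xs = P"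
  using g(1,2) by (rule grid_of_points) (rule that)
 have "inj_on \<pi> T" using \<pi> by (metis inj_onI)
 then have "card (\<pi> ` T) = N ^ nv" "finite (\<pi> ` T)" using tree_card[OF T] by (simp_all add: card_image)
 then show thesis using that[OF T] \<pi> g(3) by blast
qed

end

locale xchart = chart "scalar X" s M "points X" a "local_ring X" D0 j0
 for X :: "'k::field projvar" and s M a D0 j0
begin

text \<open>Together with smoothness this identifies the transcendence degree \<open>nv\<close> with
  the dimension.\<close>

lemma dim_tangent_space_good: "good p ==> cfun.dim (tangent_space X p) = nv"
proof -
 assume p: "good p"
 interpret lparam "scalar X" s M "points X" a "local_ring X" p nv "tpar p" pder by (rule good_lparam[OF p])
 interpret xparam X s M a p nv "tpar p" pder ..
 show ?thesis by (rule dim_tangent_space)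
qed

text \<open>If the flag valuation of \<open>f\<close> did not exist, its value would be the constant \<open>THE \<nu>. False\<close>.\<close>

definition adapted_flag :: "'n::{finite,linorder} itself \<Rightarrow> point \<Rightarrow> (nat \<Rightarrow> ('k \<Rightarrow> complex) set) \<Rightarrow> bool" where
 "adapted_flag _ p V \<longleftrightarrow> V 0 = tangent_space X p \<and> (\<forall>i<nv. cfun.subspace (V i) \<and> cfun.dim (V i) = nv - i) \<and>
  (\<forall>i. Suc i < nv \<longrightarrow> V (Suc i) \<subseteq> V i) \<and>
  (\<forall>Y Z f. \<forall>j::'n. finite Z \<and> Y 0 = blowup_points X Z \<and> (\<forall>i<nv. Y (Suc i) = proj_tangent p (V i)) \<and>
   f \<in> local_ring X p \<and> pos j = 0 \<longrightarrow>
   flag_valuation (blowup_ring X) Y (the_elem (Y nv)) f = (THE \<nu> :: (nat, 'n) vec. False) \<or>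
   f \<in> mp p ((flag_valuation (blowup_ring X) Y (the_elem (Y nv)) f :: (nat, 'n) vec) $ j))"

lemma good_flag:
 assumes p: "good p" and n: "nv = CARD('n::{finite,linorder})"
 shows "\<exists>V. adapted_flag TYPE('n) p V"
proof -
 interpret lparam "scalar X" s M "points X" a "local_ring X" p nv "tpar p" pder by (rule good_lparam[OF p])
 interpret xparam X s M a p nv "tpar p" pder ..
 show ?thesis
  unfolding adapted_flag_def
 proof (rule exI[of _ "\<lambda>i. tv ` Ws i"], intro conjI allI impI; (elim conjE)?)
  show "tv ` Ws 0 = tangent_space X p" by (simp add: tangent_space_eq Ws_def)
  show "cfun.subspace (tv ` Ws i)" "cfun.dim (tv ` Ws i) = nv - i" if "i < nv" for i
   using that by (simp_all add: subspace_Ws dim_Ws)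
  show "tv ` Ws (Suc i) \<subseteq> tv ` Ws i" for i by (auto simp: Ws_def)
  fix Y Z f and j :: 'n
  assume Z: "finite Z" and Y: "Y 0 = blowup_points X Z" "\<forall>i<nv. Y (Suc i) = proj_tangent p (tv ` Ws i)"
   and f: "f \<in> local_ring X p" and j: "pos j = 0"
  let ?v = "\<lambda>\<nu>. is_flag_valuation (blowup_ring X) Y (the_elem (Y nv)) f (\<nu> :: (nat, 'n) vec)"
  have nv: "nv > 0" unfolding n by simp
  show "flag_valuation (blowup_ring X) Y (the_elem (Y nv)) f = (THE \<nu> :: (nat, 'n) vec. False) \<or>
   f \<in> mp p ((flag_valuation (blowup_ring X) Y (the_elem (Y nv)) f :: (nat, 'n) vec) $ j)"
  proof (cases "\<exists>\<nu>. ?v \<nu>")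
   case True
   then obtain \<nu> where v: "?v \<nu>" by blast
   have "flag_valuation (blowup_ring X) Y (the_elem (Y nv)) f = \<nu>"
    by (rule flag_order(1)[where Y = Y and Z = Z, OF n Y(1) _ _ f v]) (use Y(2) unit_avoiding[OF _ Z nv] in auto)
   moreover have "f \<in> mp p (\<nu> $ j)"
    by (rule flag_order(2)[where Y = Y and Z = Z, OF n Y(1) _ _ f v j]) (use Y(2) unit_avoiding[OF _ Z nv] in auto)
   ultimately show ?thesis by simp
  next
   case False
   then have "?v = (\<lambda>_. False)" by blast
   then show ?thesis unfolding flag_valuation_def by simp
  qed
 qed
qed

end

text \<open>A point of the simplex is approximated whose first coordinate is not close to any fraction with
 denominator at most \<open>Q\<close>.\<close>

lemma body_section:
 fixes j1 :: "'n::{finite,linorder}"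
 assumes sub: "(inverted_simplex (real c + \<epsilon>) :: (real, 'n) vec set) \<subseteq> newton_okounkov_body X N p Y G j"
  and \<epsilon>: "\<epsilon> > 0" and j1: "pos j1 = 0"
 obtains q s where "q > Q" "q \<ge> 1" "s \<in> minimal_sections TYPE('n) X N p Y (div_scale (int q) G) j"
  "(section_valuation X (div_scale (int q) G) (p j) (Y j) s :: (nat, 'n) vec) $ j1 > q * c"
proof -
 \<comment> \<open>No fraction with denominator at most \<open>Q\<close> lies strictly between the
   integer \<open>c\<close> and \<open>c + 1 / fact Q\<close>; this forces
   \<open>q > Q\<close>.\<close>
 define \<eta> where "\<eta> = min \<epsilon> (1 / fact Q)"
 have \<eta>: "0 < \<eta>" "\<eta> \<le> \<epsilon>" "\<eta> \<le> 1 / fact Q" using \<epsilon> by (auto simp: \<eta>_def)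
 let ?\<xi> = "real c + \<epsilon>" and ?x0 = "real c + \<eta> / 2"
 \<comment> \<open>A point on the edge of the simplex from 0 to the vertex on the first
   axis.\<close>
 define x :: "(real, 'n) vec" where "x = (?x0 / ?\<xi>) *\<^sub>R (?\<xi> *\<^sub>R axis j1 1)"
 have \<xi>: "?\<xi> > 0" using \<epsilon> by simp
 have "{..j1} = {j1}"
 proof
  show "{..j1} \<subseteq> {j1}"
  proof
   fix i assume "i \<in> {..j1}"
   moreover have "\<not> i < j1"
   proof
    assume "i < j1"
    then show False using pos_mono[of i j1] j1 by simp
   qed
   ultimately show "i \<in> {j1}" by auto
  qed
 qed simp
 then have v: "?\<xi> *\<^sub>R axis j1 1 \<in> range (\<lambda>i. ?\<xi> *\<^sub>R (\<Sum>j\<le>i. axis j 1 :: (real, 'n) vec))"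
  by (intro range_eqI[of _ _ j1]) simp
 have "x \<in> inverted_simplex ?\<xi>"
 proof -
  have le: "0 \<le> ?x0 / ?\<xi>" "?x0 / ?\<xi> \<le> 1" using \<eta> \<xi> by auto
  have "(1 - ?x0 / ?\<xi>) *\<^sub>R 0 + (?x0 / ?\<xi>) *\<^sub>R (?\<xi> *\<^sub>R axis j1 1) \<in> (inverted_simplex ?\<xi> :: (real, 'n) vec set)"
   unfolding inverted_simplex_def
   by (rule convexD[OF convex_convex_hull]) (use v le in \<open>auto intro!: hull_inc\<close>)
  then show ?thesis by (simp add: x_def)
 qed
 then have "x \<in> newton_okounkov_body X N p Y G j" using sub by blast
 then have "\<forall>e>0. \<exists>z\<in>(\<Union>q\<in>{1::nat..}.
   (\<lambda>s. \<chi> i. real ((section_valuation X (div_scale (int q) G) (p j) (Y j) s :: (nat, 'n) vec) $ i) / real q)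
    ` minimal_sections TYPE('n) X N p Y (div_scale (int q) G) j). dist z x < e"
  unfolding newton_okounkov_body_def closure_approachable .
 from this[rule_format, OF half_gt_zero[OF \<eta>(1)]] obtain z where z: "z \<in> (\<Union>q\<in>{1::nat..}.
   (\<lambda>s. \<chi> i. real ((section_valuation X (div_scale (int q) G) (p j) (Y j) s :: (nat, 'n) vec) $ i) / real q)
    ` minimal_sections TYPE('n) X N p Y (div_scale (int q) G) j)" "dist z x < \<eta> / 2" by (rule bexE)
 from z(1) obtain q s where qs: "q \<ge> 1" "s \<in> minimal_sections TYPE('n) X N p Y (div_scale (int q) G) j"
  and zq: "z = (\<chi> i. real ((section_valuation X (div_scale (int q) G) (p j) (Y j) s :: (nat, 'n) vec) $ i) / real q)"
  by (elim UN_E imageE) simp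
 define b where "b = (section_valuation X (div_scale (int q) G) (p j) (Y j) s :: (nat, 'n) vec) $ j1"
 have "\<bar>z $ j1 - x $ j1\<bar> < \<eta> / 2"
  using dist_vec_nth_le[of z j1 x] z(2) by (simp add: dist_real_def)
 moreover have "x $ j1 = ?x0" "z $ j1 = real b / real q" using \<xi> by (simp_all add: x_def axis_def zq b_def)
 ultimately have b: "real c < real b / real q" "real b / real q < real c + \<eta>" by linarith+
 have "real (q * c) < real b" using b(1) qs(1) by (simp add: field_simps)
 then have bq: "b > q * c" by (simp only: of_nat_less_iff)
 have "q > Q"
 proof (rule ccontr)
  assume "\<not> q > Q"
  then have "q dvd fact Q" using qs(1) by (intro dvd_fact) auto
  then obtain l where l: "fact Q = q * l" by blast
  have l0: "l > 0" using l fact_nonzero[of Q, where 'a = nat] by (cases l) auto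
  have fq: "(fact Q :: real) = real q * real l" using arg_cong[OF l, of real] by simp
  have "real b < real q * real c + real q * \<eta>" using b(2) qs(1) by (simp add: field_simps)
  then have "real l * real b < real l * (real q * real c + real q * \<eta>)" using l0 by simp
  also have "\<dots> = real (l * (q * c)) + fact Q * \<eta>" by (simp add: fq algebra_simps)
  also have "fact Q * \<eta> \<le> 1" using \<eta>(3) by (simp add: field_simps)
  finally have "real (l * b) < real (l * (q * c) + 1)" by simp
  then have "l * b < l * (q * c) + 1" by (simp only: of_nat_less_iff)
  moreover have "l * (q * c) + l \<le> l * b" using mult_le_mono2[OF Suc_leI[OF bq], of l] by simp
  ultimately show False using l0 by simp
 qed
 then show thesis using that qs bq unfolding b_def by blast
qed

text \<open>Passes a large first entry from the point where the valuation is minimal to all other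
  points.\<close>

lemma lex_less_first: "lex_less (\<mu> :: (nat, 'n::{finite,linorder}) vec) \<nu> ==> pos j1 = 0 ==> \<mu> $ j1 \<le> \<nu> $ j1"
proof -
 assume "lex_less \<mu> \<nu>" and j1: "pos j1 = 0"
 then obtain i where i: "\<mu> $ i < \<nu> $ i" "\<forall>j<i. \<mu> $ j = \<nu> $ j" unfolding lex_less_def by blast
 have "\<not> i < j1" using pos_mono[of i j1] j1 by auto
 then have "i = j1 \<or> j1 < i" by auto
 then show ?thesis using i by auto
qed

text \<open>The hypothesis of the theorem for one \<open>\<epsilon>\<close>.\<close>

definition simplex_condition :: "'n::{finite,linorder} itself \<Rightarrow> 'k::field projvar \<Rightarrow> 'k divisor \<Rightarrow> nat \<Rightarrow> nat \<Rightarrow> real \<Rightarrow> bool" where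
 "simplex_condition _ X D k m \<epsilon> \<longleftrightarrow> (\<forall>p Y. inj_on p {..<k + 1} \<and> p ` {..<k + 1} \<subseteq> points X \<and>
  (\<forall>i<k + 1. infinitesimal_flag CARD('n) X (p ` {..<k + 1}) (p i) (Y i)) \<longrightarrow>
  (\<forall>j<k + 1. (inverted_simplex (real CARD('n) + real k + \<epsilon>) :: (real, 'n) vec set)
    \<subseteq> newton_okounkov_body X (k + 1) p Y (div_scale (int m) D) j))"

text \<open>\<open>B\<close> is the number of points of a grid fixed in advance; for
  \<open>k + 1\<close> at least \<open>B\<close> the points in the hypothesis can be chosen to
  contain it.\<close>

lemma simplex_bound:
 fixes X :: "'k::field projvar" and D :: "'k divisor"
 assumes smooth: "smooth_projective_variety CARD('n::{finite,linorder}) X"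
  and pm: "pmodel (scalar X) s M (points X) a (local_ring X) (\<lambda>p. D p ^ m0)" and m0: "m0 > 0"
 obtains B where "\<And>k m \<epsilon>. k + 1 \<ge> B ==> m \<ge> 1 ==> \<epsilon> > 0 ==> simplex_condition TYPE('n) X D k m \<epsilon> ==>
  m0 * (CARD('n) + k) < m"
proof -
 let ?n = "CARD('n)"
 interpret pmodel "scalar X" s M "points X" a "local_ring X" "\<lambda>p. D p ^ m0" by (rule pm)
 obtain p0 where p0: "p0 \<in> points X" using ne by blast
 obtain j0 where "a p0 j0 \<noteq> 0" using a_ne[OF p0] by blast
 then have sj0: "s j0 \<noteq> 0" using s_ne[OF p0] by blast
 interpret chart "scalar X" s M "points X" a "local_ring X" "\<lambda>p. D p ^ m0" j0 by unfold_locales (rule sj0)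
 interpret xchart X s M a "\<lambda>p. D p ^ m0" j0 ..
 have good_pts: "p \<in> points X" if "good p" for p using that by (simp add: good_def)
 have nv: "nv = ?n"
 proof -
  obtain T \<pi> where T: "tree 1 nv T" "\<And>P. P \<in> T ==> good (\<pi> P) \<and> map (val (\<pi> P)) Xs = P"
   "finite (\<pi> ` T)" "card (\<pi> ` T) = 1 ^ nv" by (rule good_grid) (rule that)
  then have "\<pi> ` T \<noteq> {}" by auto
  then obtain P where "P \<in> T" by blast
  then have g: "good (\<pi> P)" using T(2) by blast
  show ?thesis using dim_tangent_space_good[OF g] smooth good_pts[OF g] by (simp add: smooth_projective_variety_def)
 qed
 obtain r where r: "r \<ge> 1" and bound: "\<forall>S e b N T \<pi>. e \<ge> 1 \<and> S \<noteq> 0 \<and> (\<forall>p\<in>points X. S * (D p ^ m0) ^ e \<in> local_ring X p) \<and> tree N nv T \<and>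
  (\<forall>P\<in>T. good (\<pi> P) \<and> map (val (\<pi> P)) Xs = P \<and> S * (D (\<pi> P) ^ m0) ^ e \<in> mp (\<pi> P) b) \<longrightarrow> N * b \<le> nv * r * e"
  using multiplicity_bound by blast
 \<comment> \<open>With this value the factor \<open>n * r\<close> cancels from both sides of the
   multiplicity bound.\<close>
 define N0 where "N0 = ?n * r"
 obtain T0 \<pi>0 where T0: "tree N0 nv T0" "\<And>P. P \<in> T0 ==> good (\<pi>0 P) \<and> map (val (\<pi>0 P)) Xs = P"
  "finite (\<pi>0 ` T0)" "card (\<pi>0 ` T0) = N0 ^ nv" by (rule good_grid) (rule that)
 obtain j1 :: 'n where j1: "pos j1 = 0" using pos_surj[of 0, where 'n = 'n] by auto
 show thesis
 proof (rule that[of "N0 ^ nv"])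
  fix k m and \<epsilon> :: real
  assume k: "N0 ^ nv \<le> k + 1" and m: "1 \<le> m" and \<epsilon>: "0 < \<epsilon>" and hyp: "simplex_condition TYPE('n) X D k m \<epsilon>"
  \<comment> \<open>Supplies further good points, so that a set of exactly \<open>k + 1\<close> good
    points containing the grid exists.\<close>
  obtain T1 \<pi>1 where T1: "tree (k + 1) nv T1" "\<And>P. P \<in> T1 ==> good (\<pi>1 P) \<and> map (val (\<pi>1 P)) Xs = P"
   "finite (\<pi>1 ` T1)" "card (\<pi>1 ` T1) = (k + 1) ^ nv" by (rule good_grid) (rule that)
  have "(k + 1) ^ 1 \<le> (k + 1) ^ nv" unfolding nv by (intro power_increasing) (auto simp: Suc_le_eq)
  then have "k + 1 \<le> card (\<pi>1 ` T1)" using T1(4) by simp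
  also have "\<dots> \<le> card (\<pi>0 ` T0 \<union> \<pi>1 ` T1)" using T0(3) T1(3) by (intro card_mono) auto
  finally obtain Z where Z: "\<pi>0 ` T0 \<subseteq> Z" "Z \<subseteq> \<pi>0 ` T0 \<union> \<pi>1 ` T1" "card Z = k + 1"
   using exists_subset_between[of "\<pi>0 ` T0" "k + 1" "\<pi>0 ` T0 \<union> \<pi>1 ` T1"] T0(3,4) T1(3) k by auto
  have fZ: "finite Z" using Z(3) card.infinite by fastforce
  have gZ: "good p" if "p \<in> Z" for p using that Z(2) T0(2) T1(2) by blast
  obtain pp where pp: "bij_betw pp {..<k + 1} Z" using ex_bij_betw_nat_finite[OF fZ] Z(3) by (auto simp: atLeast0LessThan)
  then have ppZ: "pp ` {..<k + 1} = Z" "inj_on pp {..<k + 1}" by (auto simp: bij_betw_def)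
  have gp: "good (pp i)" if "i < k + 1" for i using gZ ppZ(1) that by blast
  have "\<forall>i. \<exists>V. i < k + 1 \<longrightarrow> adapted_flag TYPE('n) (pp i) V" using good_flag[OF gp nv] by blast
  from choice[OF this] obtain V where V': "\<forall>i. i < k + 1 \<longrightarrow> adapted_flag TYPE('n) (pp i) (V i)" by (rule exE)
  have V: "V i 0 = tangent_space X (pp i) \<and> (\<forall>l<nv. cfun.subspace (V i l) \<and> cfun.dim (V i l) = nv - l)"
   "\<forall>l. Suc l < nv \<longrightarrow> V i (Suc l) \<subseteq> V i l"
   "finite Z' \<and> Y 0 = blowup_points X Z' \<and> (\<forall>l<nv. Y (Suc l) = proj_tangent (pp i) (V i l)) \<and> f \<in> local_ring X (pp i) ==>
    flag_valuation (blowup_ring X) Y (the_elem (Y nv)) f = (THE \<nu> :: (nat, 'n) vec. False) \<or>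
    f \<in> mp (pp i) ((flag_valuation (blowup_ring X) Y (the_elem (Y nv)) f :: (nat, 'n) vec) $ j1)"
   if i: "i < k + 1" for i Y Z' f
  proof -
   note W = mp[OF spec[OF V'] i, unfolded adapted_flag_def]
   show "V i 0 = tangent_space X (pp i) \<and> (\<forall>l<nv. cfun.subspace (V i l) \<and> cfun.dim (V i l) = nv - l)"
    by (rule conjI[OF conjunct1[OF W] conjunct1[OF conjunct2[OF W]]])
   note W' = conjunct2[OF conjunct2[OF W]]
   show "\<forall>l. Suc l < nv \<longrightarrow> V i (Suc l) \<subseteq> V i l" by (rule conjunct1[OF W'])
   show "flag_valuation (blowup_ring X) Y (the_elem (Y nv)) f = (THE \<nu> :: (nat, 'n) vec. False) \<or>
    f \<in> mp (pp i) ((flag_valuation (blowup_ring X) Y (the_elem (Y nv)) f :: (nat, 'n) vec) $ j1)"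
    if "finite Z' \<and> Y 0 = blowup_points X Z' \<and> (\<forall>l<nv. Y (Suc l) = proj_tangent (pp i) (V i l)) \<and> f \<in> local_ring X (pp i)"
    by (rule mp[OF spec[of _ j1, OF spec[of _ f, OF spec[of _ Z', OF spec[of _ Y, OF conjunct2[OF W']]]]]]) (use that j1 in simp)
  qed
  define Y where "Y i l = (case l of 0 \<Rightarrow> blowup_points X Z | Suc l \<Rightarrow> proj_tangent (pp i) (V i l))" for i l
  have Y: "Y i 0 = blowup_points X Z" "Y i (Suc l) = proj_tangent (pp i) (V i l)" for i l by (simp_all add: Y_def)
  have flag: "infinitesimal_flag ?n X Z (pp i) (Y i)" if "i < k + 1" for i
   unfolding infinitesimal_flag_def nv[symmetric] using V(1,2)[OF that] Y by (intro exI[of _ "V i"]) simp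
  have sub: "(inverted_simplex (real (?n + k) + \<epsilon>) :: (real, 'n) vec set) \<subseteq> newton_okounkov_body X (k + 1) pp Y (div_scale (int m) D) 0"
   using hyp[unfolded simplex_condition_def, rule_format, of pp Y 0] ppZ flag gZ good_pts by auto
  \<comment> \<open>The value of \<open>flag_valuation\<close> on germs without a valuation;
    \<open>q\<close> is taken larger than its first entry.\<close>
  let ?u0 = "THE \<nu> :: (nat, 'n) vec. False"
  obtain q x where q: "q > ?u0 $ j1" "q \<ge> 1" and x: "x \<in> minimal_sections TYPE('n) X (k + 1) pp Y (div_scale (int q) (div_scale (int m) D)) 0"
   and first: "(section_valuation X (div_scale (int q) (div_scale (int m) D)) (pp 0) (Y 0) x :: (nat, 'n) vec) $ j1 > q * (?n + k)"
   by (rule body_section[OF sub \<epsilon> j1, of "?u0 $ j1"]) (rule that)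
  let ?G = "div_scale (int q) (div_scale (int m) D)"
  let ?\<nu> = "\<lambda>i. section_valuation X ?G (pp i) (Y i) x :: (nat, 'n) vec"
  have G: "?G p = D p ^ (m * q)" for p by (simp add: div_scale_def power_mult)
  have x0: "x \<noteq> 0" and xO: "x * D p ^ (m * q) \<in> local_ring X p" if "p \<in> points X" for p
   using x that unfolding minimal_sections_def sections_def G by auto
  have \<nu>: "?\<nu> i $ j1 > q * (?n + k)" if i: "i < k + 1" for i
  proof (cases "i = 0")
   case False
   then have "lex_less (?\<nu> 0) (?\<nu> i)" using x i unfolding minimal_sections_def by blast
   from lex_less_first[OF this j1] show ?thesis using first by simp
  qed (use first in simp)
  \<comment> \<open>The successor comes from the strict inequality in \<open>\<nu>\<close> and makes
    the final bound strict.\<close>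
  let ?a = "Suc (q * (?n + k))"
  have mp: "x * D (pp i) ^ (m * q) \<in> mp (pp i) ?a" if i: "i < k + 1" for i
  proof -
   let ?f = "x * D (pp i) ^ (m * q)"
   have p: "pp i \<in> points X" using good_pts gp[OF i] by blast
   have v: "?\<nu> i = flag_valuation (blowup_ring X) (Y i) (the_elem (Y i nv)) ?f"
    by (simp add: section_valuation_def G nv)
   have "?\<nu> i = ?u0 \<or> ?f \<in> mp (pp i) (?\<nu> i $ j1)"
    unfolding v
    by (rule V(3)[OF i, of Z]) (simp add: fZ Y xO[OF p])
   moreover have "?\<nu> i \<noteq> ?u0"
   proof
    assume "?\<nu> i = ?u0"
    then have "q * (?n + k) < ?u0 $ j1" using \<nu>[OF i] by simp
    from less_trans[OF this q(1)] have "q * (?n + k) < q" .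
    moreover have "q * 1 \<le> q * (?n + k)" by (intro mult_le_mono2) (simp add: Suc_le_eq)
    ultimately show False by simp
   qed
   ultimately show ?thesis using mp_mono[OF p, of ?a "?\<nu> i $ j1"] \<nu>[OF i] by auto
  qed
  \<comment> \<open>The \<open>m0\<close>-th power turns a section of \<open>q m D\<close> into a
    section of \<open>m * q\<close> times the hyperplane divisor \<open>m0 D\<close>.\<close>
  have pw: "x ^ m0 * (D p ^ m0) ^ (m * q) = (x * D p ^ (m * q)) ^ m0" for p
   by (simp add: power_mult_distrib power_mult[symmetric] mult.commute)
  have "N0 * (m0 * ?a) \<le> nv * r * (m * q)"
  proof (rule bound[rule_format], intro conjI ballI)
   show "1 \<le> m * q" using m q(2) by simp
   show "x ^ m0 \<noteq> 0" using x0[OF p0] by simp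
   show "x ^ m0 * (D p ^ m0) ^ (m * q) \<in> local_ring X p" if "p \<in> points X" for p
    unfolding pw by (rule Ov_simps(7)[OF that xO[OF that]])
   show "tree N0 nv T0" by (rule T0(1))
   fix P assume P: "P \<in> T0"
   show "good (\<pi>0 P)" "map (val (\<pi>0 P)) Xs = P" using T0(2)[OF P] by auto
   have "\<pi>0 P \<in> Z" using P Z(1) by blast
   then obtain i where i: "i < k + 1" "\<pi>0 P = pp i" using ppZ(1) by force
   show "x ^ m0 * (D (\<pi>0 P) ^ m0) ^ (m * q) \<in> mp (\<pi>0 P) (m0 * ?a)"
    unfolding pw i(2) by (rule mp_power[OF good_pts[OF gp[OF i(1)]] mp[OF i(1)]])
  qed
  then have "(?n * r) * (m0 * ?a) \<le> (?n * r) * (m * q)" by (simp only: N0_def nv)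
  then have "m0 * ?a \<le> m * q" using r by simp
  then have "q * (m0 * (?n + k)) < q * m" using m0 by (simp add: algebra_simps)
  then show "m0 * (?n + k) < m" by simp
 qed
qed

theorem corollary1p3:
  fixes X :: "'k::field projvar" and D :: "'k divisor"
  assumes "smooth_projective_variety CARD('n::{finite,linorder}) X"
    and "ample X D"
  shows "\<exists>mD::int.
    (\<forall>K. canonical_divisor CARD('n) X K \<longrightarrow> ample X (div_minus (div_scale mD D) K)) \<and>
    (\<forall>k m :: nat. m \<ge> 1 \<longrightarrow>
       (\<exists>\<epsilon>::real. \<epsilon> > 0 \<and>
          (\<forall>p Y. inj_on p {..<k + 1} \<and> p ` {..<k + 1} \<subseteq> points X \<and>
             (\<forall>i<k + 1. infinitesimal_flag CARD('n) X (p ` {..<k + 1}) (p i) (Y i)) \<longrightarrow>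
             (\<forall>j<k + 1. (inverted_simplex (real CARD('n) + real k + \<epsilon>) :: (real, 'n) vec set)
                \<subseteq> newton_okounkov_body X (k + 1) p Y (div_scale (int m) D) j))) \<longrightarrow>
       jet_ample X k (div_scale (int m + mD) D))"
proof -
 have X: "projective_variety X" using assms(1) by (simp add: smooth_projective_variety_def)
 obtain m0 s M a c where m0: "m0 > 0"
  and pm: "pmodel (scalar X) s M (points X) a (local_ring X) (\<lambda>p. D p ^ m0)"
  and jets: "\<And>k t. t \<ge> m0 * k + c ==> jet_ample X k (div_scale (int t) D)"
  and canonical: "\<And>m K. m \<ge> c ==> canonical_divisor CARD('n) X K ==> ample X (div_minus (div_scale (int m) D) K)"
  by (rule ample_consequences[OF X assms(2), where 'n = 'n]) (rule that)
 obtain B where B: "\<And>k m \<epsilon>. k + 1 \<ge> B ==> m \<ge> 1 ==> \<epsilon> > 0 ==> simplex_condition TYPE('n) X D k m \<epsilon> ==>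
  m0 * (CARD('n) + k) < m"
  by (rule simplex_bound[OF assms(1) pm m0]) (rule that)
 \<comment> \<open>\<open>c\<close> pays for the jets and the canonical divisors,
   \<open>m0 * B\<close> for the finitely many \<open>k\<close> with
   \<open>k + 1 < B\<close>.\<close>
 let ?mD = "m0 * B + c"
 show ?thesis
  unfolding simplex_condition_def[of "TYPE('n)", symmetric]
 proof (intro exI[of _ "int ?mD"] conjI allI impI)
  show "ample X (div_minus (div_scale (int ?mD) D) K)" if "canonical_divisor CARD('n) X K" for K
   using canonical[OF _ that, of ?mD] by simp
  fix k m :: nat
  assume m: "1 \<le> m" and "\<exists>\<epsilon>>0. simplex_condition TYPE('n) X D k m \<epsilon>"
  then obtain \<epsilon> where \<epsilon>: "\<epsilon> > 0" "simplex_condition TYPE('n) X D k m \<epsilon>" by blast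
  have "m0 * k \<le> m + m0 * B"
  proof (cases "B \<le> k + 1")
   case True
   then have "m0 * (CARD('n) + k) < m" by (rule B[OF _ m \<epsilon>])
   then show ?thesis by (simp add: distrib_left)
  next
   case False
   then have "m0 * k \<le> m0 * B" by (intro mult_le_mono2) simp
   then show ?thesis by (rule trans_le_add2)
  qed
  then have "jet_ample X k (div_scale (int (m + ?mD)) D)" by (intro jets) simp
  then show "jet_ample X k (div_scale (int m + int ?mD) D)" by (simp only: of_nat_add)
 qed
qed

end
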